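(* Let $m\ge 3$ be an integer and suppose that $(S_n)$ satisfies the growth condition of order $m$ and the integrability condition of order $m$ (both defined in the context). Then there are polynomials $H_{j,n}$ ($1\le j\le m-2$, $n\ge1$), with bounded coefficients (which are polynomial functions of $A_n$, $B_n-\sigma_n$ and $\Lambda_n^{(k)}(0)\sigma_n^{k-2}$, $k\ge3$) and degrees not depending on $n$, for which, with $$\Psi_{r,n}(x)=\Phi(x)+\varphi(x)\sum_{j=1}^{r}B_n^{-j}H_{j,n}(x),$$ the non-uniform expansions $|F_n(x)-\Psi_{r,n}(x)|\le C_nB_n^{-r}(1+|x|)^{-m}$ ($x\in\mathbb R$), $C_n\to0$, hold for all $1\le r\le m-2$, and such that the following holds. Let $h:\mathbb R\to\mathbb R$ be an a.e. differentiable function so that $H_m=\int\frac{|h'(x)|}{(1+|x|)^m}dx<\infty$. Then for all $1\le r\le m-2$, $$\left|\mathbb E[h(W_n)]-\int h(x)\,d\Psi_{r,n}(x)\right|\le C_nH_mB_n^{-r},\qquad C_n\to0.$$ In particular, for every $q<m$ we have $$\left|\mathbb E[W_n^q]-\int x^q\,d\Psi_{r,n}(x)\right|\le R_mC_nB_n^{-r},\qquad C_n\to0,$$ and $$\left|\mathbb E[|W_n|^q]-\int |x|^q\,d\Psi_{r,n}(x)\right|\le R_mC_nB_n^{-r},\qquad C_n\to0,$$ where $R_m$ depends only on $m$.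
   Context: $(S_n)_{n\ge1}$ is a sequence of centered real random variables with $\sigma_n=\|S_n\|_{L^2}\to\infty$. $(A_n)$ is a bounded real sequence and $(B_n)$ is a sequence with $B_n=\sigma_n+O(1)$. Put $W_n=(S_n-A_n)/B_n$ and $F_n(x)=\mathbb P(W_n\le x)$. $\varphi(x)=\frac1{\sqrt{2\pi}}e^{-x^2/2}$ and $\Phi(x)=\int_{-\infty}^x\varphi(t)\,dt$. Put $f_n(t)=\mathbb E[e^{itS_n/\sigma_n}]$ and $\Lambda_n(t)=\ln\mathbb E[e^{itS_n/\sigma_n}]+t^2/2$. Growth condition of order $m$: for all $3\le j\le m+1$ there exist constants $C_j,\varepsilon_j>0$ such that for all $n$, $\sup_{t\in[-\varepsilon_j\sigma_n,\varepsilon_j\sigma_n]}|\Lambda_n^{(j)}(t)|\le C_j\sigma_n^{-(j-2)}$. Integrability condition of order $m$: for every $c>0$ (small enough) and $B>0$ (large enough), $\int_{c\sigma_n\le|t|\le B\sigma_n^{m-2}}\left|\frac{f_n^{(m)}(t)}{t}\right|dt=o(\sigma_n^{-(m-2)})$, where $f_n^{(m)}$ is the $m$-th derivative of $f_n$.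
   Formalization: The integrability condition is assumed also for f_n itself (order 0), without which small atoms refute the claim; h is assumed locally absolutely continuous (the integral of h'), since step functions have H_m=0; q is a natural number and bounds are for n with B_n>0. *)

theory Defs
  imports "HOL-Probability.Probability" "HOL-Library.Landau_Symbols"
begin

definition L2_norm :: "'a measure \<Rightarrow> ('a \<Rightarrow> real) \<Rightarrow> real" where
  "L2_norm M X = sqrt (LINT \<omega>|M. (X \<omega>)\<^sup>2)"

definition normalized_char :: "'a measure \<Rightarrow> ('a \<Rightarrow> real) \<Rightarrow> real \<Rightarrow> complex" where
  "normalized_char M X = char (distr M borel (\<lambda>\<omega>. X \<omega> / L2_norm M X))"

(* The branch of the logarithm obtained by continuation from ln 1 = 0 along the segment from 0
   to t.  The principal branch Ln would be wrong here: on the interval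
   [- \<epsilon> \<sigma>, \<epsilon> \<sigma>] the argument of the characteristic function may wind around 0 many times,
   and Ln would then jump.  The lift is unique, so THE is well-defined whenever f is
   continuous and does not vanish on the segment and f 0 = 1. *)
definition continuous_log :: "(real \<Rightarrow> complex) \<Rightarrow> real \<Rightarrow> complex" where
  "continuous_log f t = (THE z. \<exists>g. continuous_on (closed_segment 0 t) g \<and> g 0 = 0 \<and>
     (\<forall>s\<in>closed_segment 0 t. exp (g s) = f s) \<and> g t = z)"

definition log_char_defect :: "'a measure \<Rightarrow> ('a \<Rightarrow> real) \<Rightarrow> real \<Rightarrow> complex" where
  "log_char_defect M X t = continuous_log (normalized_char M X) t + of_real (t\<^sup>2 / 2)"

definition nth_vderiv :: "nat \<Rightarrow> (real \<Rightarrow> complex) \<Rightarrow> real \<Rightarrow> complex" where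
  "nth_vderiv k f = ((\<lambda>g t. vector_derivative g (at t)) ^^ k) f"

(* Since vector_derivative is a choice operator, the existence of the derivatives has to be
   required separately. *)
definition times_differentiable_on :: "nat \<Rightarrow> (real \<Rightarrow> complex) \<Rightarrow> real set \<Rightarrow> bool" where
  "times_differentiable_on k f U \<longleftrightarrow> (\<forall>i<k. \<forall>t\<in>U. nth_vderiv i f differentiable at t)"

(* Non-vanishing of the characteristic function is what makes its logarithm meaningful. *)
definition growth_condition :: "nat \<Rightarrow> 'a measure \<Rightarrow> (nat \<Rightarrow> 'a \<Rightarrow> real) \<Rightarrow> bool" where
  "growth_condition m M S \<longleftrightarrow>
    (\<forall>j\<in>{3..m + 1}. \<exists>C>0. \<exists>\<epsilon>>0. \<forall>n.
       let \<sigma> = L2_norm M (S n); I = {- \<epsilon> * \<sigma>..\<epsilon> * \<sigma>}; \<Lambda> = log_char_defect M (S n)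
       in (\<forall>t\<in>I. normalized_char M (S n) t \<noteq> 0) \<and>
          times_differentiable_on j \<Lambda> I \<and>
          (\<forall>t\<in>I. cmod (nth_vderiv j \<Lambda> t) \<le> C / \<sigma> ^ (j - 2)))"

(* The integrability condition of order m is the instance k = m.  It does not control the
   characteristic function itself at frequencies between c \<sigma> and b \<sigma>^(m - 2), because an atom
   of mass of order 1 / \<sigma> at the origin is killed by differentiation up to terms of size
   \<sigma>^(- m - 1).  Excluding such atoms, as any expansion by continuous functions up to o(1 / \<sigma>)
   must, is the role of the instance k = 0. *)
definition integrability_condition ::
    "nat \<Rightarrow> nat \<Rightarrow> 'a measure \<Rightarrow> (nat \<Rightarrow> 'a \<Rightarrow> real) \<Rightarrow> bool" where
  "integrability_condition k m M S \<longleftrightarrow>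
    (\<forall>n. times_differentiable_on k (normalized_char M (S n)) UNIV) \<and>
    (\<exists>c\<^sub>0>0. \<exists>b\<^sub>0>0. \<forall>c b. 0 < c \<and> c < c\<^sub>0 \<and> b\<^sub>0 < b \<longrightarrow>
       (\<lambda>n. LINT t:{t. c * L2_norm M (S n) \<le> \<bar>t\<bar> \<and> \<bar>t\<bar> \<le> b * L2_norm M (S n) ^ (m - 2)}|lborel.
              cmod (nth_vderiv k (normalized_char M (S n)) t / of_real t))
       \<in> o(\<lambda>n. 1 / L2_norm M (S n) ^ (m - 2)))"

inductive polynomial_fun :: "'i set \<Rightarrow> (('i \<Rightarrow> complex) \<Rightarrow> complex) \<Rightarrow> bool" for V where
  const: "polynomial_fun V (\<lambda>v. c)"
| var: "i \<in> V \<Longrightarrow> polynomial_fun V (\<lambda>v. v i)"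
| add: "polynomial_fun V p \<Longrightarrow> polynomial_fun V q \<Longrightarrow> polynomial_fun V (\<lambda>v. p v + q v)"
| mult: "polynomial_fun V p \<Longrightarrow> polynomial_fun V q \<Longrightarrow> polynomial_fun V (\<lambda>v. p v * q v)"

datatype parameter = Shift | Scale | Cumulant nat

(* Only derivatives of order at most m + 1 are guaranteed to exist by the growth condition. *)
definition parameters :: "nat \<Rightarrow> parameter set" where
  "parameters m = {Shift, Scale} \<union> Cumulant ` {3..m + 1}"

(* Complex valued, since the derivatives at 0 are i^k times real cumulants. *)
fun parameter_value ::
    "'a measure \<Rightarrow> ('a \<Rightarrow> real) \<Rightarrow> real \<Rightarrow> real \<Rightarrow> parameter \<Rightarrow> complex" where
  "parameter_value M X a b Shift = of_real a"
| "parameter_value M X a b Scale = of_real (b - L2_norm M X)"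
| "parameter_value M X a b (Cumulant k) =
     nth_vderiv k (log_char_defect M X) 0 * of_real (L2_norm M X ^ (k - 2))"

definition std_normal_cdf :: "real \<Rightarrow> real" where
  "std_normal_cdf x = (LINT t:{..x}|lborel. std_normal_density t)"

definition edgeworth :: "nat \<Rightarrow> real \<Rightarrow> (nat \<Rightarrow> real poly) \<Rightarrow> real \<Rightarrow> real" where
  "edgeworth r b H x =
     std_normal_cdf x + std_normal_density x * (\<Sum>j = 1..r. poly (H j) x / b ^ j)"

(* The Stieltjes integral of h with respect to G, for G smooth. *)
definition integrable_wrt :: "(real \<Rightarrow> real) \<Rightarrow> (real \<Rightarrow> real) \<Rightarrow> bool" where
  "integrable_wrt G h \<longleftrightarrow> integrable lborel (\<lambda>x. h x * deriv G x)"

definition integral_wrt :: "(real \<Rightarrow> real) \<Rightarrow> (real \<Rightarrow> real) \<Rightarrow> real" where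
  "integral_wrt G h = (LINT x|lborel. h x * deriv G x)"

definition weighted_variation :: "nat \<Rightarrow> (real \<Rightarrow> real) \<Rightarrow> real" where
  "weighted_variation m h = (LINT x|lborel. \<bar>deriv h x\<bar> / (1 + \<bar>x\<bar>) ^ m)"

(* The second conjunct says that h is locally absolutely continuous, in the form of the
   fundamental theorem of calculus.  Differentiability almost everywhere alone is not enough: a
   step function has weighted_variation 0, but its expectation is not given exactly
   by the expansion. *)
definition admissible_test_function :: "nat \<Rightarrow> (real \<Rightarrow> real) \<Rightarrow> bool" where
  "admissible_test_function m h \<longleftrightarrow>
     (AE x in lborel. h differentiable at x) \<and>
     (\<forall>a b. a \<le> b \<longrightarrow> set_integrable lborel {a..b} (deriv h) \<and>
        h b - h a = (LINT x:{a..b}|lborel. deriv h x)) \<and>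
     integrable lborel (\<lambda>x. \<bar>deriv h x\<bar> / (1 + \<bar>x\<bar>) ^ m)"

end

theory Submission
  imports Defs "HOL-Computational_Algebra.Polynomial"
begin

text \<open>The growth condition makes the logarithm of the characteristic function \<open>f\<^sub>n\<close>, on
  \<open>\<bar>t\<bar> \<le> \<epsilon> \<sigma>\<^sub>n\<close>, equal to \<open>- t\<^sup>2 / 2\<close> plus its Taylor polynomial of degree \<open>m\<close> and an error of order
  \<open>\<sigma>\<^sub>n\<^bsup>- (m - 1)\<^esup>\<close>, together with \<open>m + 1\<close> derivatives; it also forces the moments of order \<open>m\<close> to be
  finite. Expanding the exponential in powers of \<open>1 / B\<^sub>n\<close>, with shift and scale included, gives a
  Gaussian times a polynomial, hence through Hermite polynomials a signed density \<open>\<gamma>\<^sub>n\<close>.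

  Let \<open>E\<close> be the difference of the two distribution functions. The Fourier transforms of \<open>E\<close> and of
  \<open>x\<^sup>m E\<close> are, up to constants, \<open>g\<close> and its \<open>m\<close>-th derivative for \<open>g t = u t / t\<close>, where \<open>u\<close> is the
  difference of the characteristic functions. Smoothing with the Fejer kernel at frequency \<open>T\<close>
  bounds \<open>(1 + \<bar>x\<bar>)\<^sup>m \<bar>E x\<bar>\<close> by the integrals of \<open>\<bar>g\<bar>\<close> and \<open>\<bar>g\<^bsup>(m)\<^esup>\<bar>\<close> over \<open>[0, T]\<close> and a term
  \<open>O(1 / T)\<close>: the law is monotone, so \<open>E\<close> cannot drop quickly, and its own size reappears on the
  right only with a small factor. For \<open>T = d \<sigma>\<^sub>n\<^bsup>m - 2\<^esup>\<close> with \<open>d\<close> large the last term is negligible.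
  Near the origin the integrals are \<open>O(\<sigma>\<^sub>n\<^bsup>- (m - 1)\<^esup>)\<close>; beyond it Hardy's inequality replaces \<open>g\<^bsup>(m)\<^esup>\<close> by
  \<open>u\<^bsup>(m)\<^esup> / t\<close>, which the integrability condition controls.

  Finally \<open>\<integral> h dF - \<integral> h d\<Psi> = - \<integral> E h\<^sup>\<prime>\<close>, so the weighted bound on \<open>E\<close> gives all the other
  estimates.\<close>

section \<open>Weighted Fourier transforms and integration by parts\<close>

text \<open>The obstacle is that \<open>x ^ m * E x\<close> is bounded but not known to be
  integrable: finite moments of order \<open>m\<close> give integrability of \<open>E x\<close> only
  against powers below \<open>m\<close>. Hence the transform of order \<open>m\<close> enters only
  as a derivative away from the origin, and one factor \<open>x\<close> is transferred to the Fejer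
  symbol by integration by parts in the frequency. The sup bound is an absorption argument twice
  over: the supremum of the weighted \<open>E\<close> reappears with factor 1 / 3, since the Fejer
  kernel puts three quarters of its mass into a window, and then with a factor of order
  \<open>1 / T\<close>, from comparing powers at neighbouring points. Both need an a priori finite
  supremum, which Markov's inequality supplies. The derivative of order \<open>m + 1\<close> in the
  growth condition pays for the division by \<open>t\<close> at the origin. The comparison is made
  for \<open>S n / \<sigma>\<close>, whose characteristic function the hypotheses describe; the
  expansion, natural for \<open>W\<close>, is transported there by an affine map. Uniformity in
  \<open>n\<close> is carried by a class of function families, closed under products and
  exponentials, in which higher derivatives are never written out.\<close>

definition weighted_ft :: "real measure \<Rightarrow> (real \<Rightarrow> real) \<Rightarrow> nat \<Rightarrow> real \<Rightarrow> complex" where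
  "weighted_ft N w k t = (LINT x|N. of_real (w x * x ^ k) * iexp (t * x))"

lemma abs_power_le_one_plus_power:
  fixes x :: real
  assumes "k \<le> m"
  shows "\<bar>x\<bar> ^ k \<le> (1 + \<bar>x\<bar>) ^ m"
proof -
  have "\<bar>x\<bar> ^ k \<le> (1 + \<bar>x\<bar>) ^ k" by (intro power_mono) auto
  also have "\<dots> \<le> (1 + \<bar>x\<bar>) ^ m" by (intro power_increasing assms) auto
  finally show ?thesis .
qed

text \<open>One setting serves three uses: the law with weight 1, the signed density as a weight on
  Lebesgue measure, and the discrepancy times a power. No sign is imposed on \<open>w\<close>, so
  absolute moments enter through \<open>integrable_abs_moment\<close>.\<close>

locale weighted_measure = sigma_finite_measure N for N :: "real measure" +
  fixes w :: "real \<Rightarrow> real" and m :: nat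
  assumes sets_N [measurable_cong]: "sets N = sets borel"
    and weight_measurable [measurable]: "w \<in> borel_measurable borel"
    and moment_integrable: "integrable N (\<lambda>x. w x * (1 + \<bar>x\<bar>) ^ m)"
begin

lemma integrable_weight_bounded:
  fixes h :: "real \<Rightarrow> 'b :: {banach, second_countable_topology}"
  assumes [measurable]: "h \<in> borel_measurable borel"
    and "\<And>x. norm (h x) \<le> C * (1 + \<bar>x\<bar>) ^ m"
  shows "integrable N (\<lambda>x. w x *\<^sub>R h x)"
proof (rule Bochner_Integration.integrable_bound)
  show "integrable N (\<lambda>x. C * (w x * (1 + \<bar>x\<bar>) ^ m))"
    using moment_integrable by simp
  show "AE x in N. norm (w x *\<^sub>R h x) \<le> norm (C * (w x * (1 + \<bar>x\<bar>) ^ m))"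
  proof (rule AE_I2)
    fix x
    have "norm (w x *\<^sub>R h x) = \<bar>w x\<bar> * norm (h x)" by simp
    also have "\<dots> \<le> \<bar>w x\<bar> * (C * (1 + \<bar>x\<bar>) ^ m)"
      by (intro mult_left_mono assms) auto
    also have "\<dots> \<le> norm (C * (w x * (1 + \<bar>x\<bar>) ^ m))"
      using assms(2)[of x] by (simp add: abs_mult mult_ac abs_of_nonneg mult_right_mono)
    finally show "norm (w x *\<^sub>R h x) \<le> norm (C * (w x * (1 + \<bar>x\<bar>) ^ m))" .
  qed
qed measurable

lemma integrable_weight: "integrable N w"
  using integrable_weight_bounded[of "\<lambda>_. 1::real" 1] by (simp add: one_le_power)

lemma integrable_abs_moment: "integrable N (\<lambda>x. \<bar>w x\<bar> * (1 + \<bar>x\<bar>) ^ m)"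
  using integrable_norm[OF moment_integrable] by (simp add: abs_mult)

lemma integrable_weighted_exp:
  assumes "k \<le> m"
  shows "integrable N (\<lambda>x. of_real (w x * x ^ k) * iexp (t * x))"
proof -
  have "integrable N (\<lambda>x. w x *\<^sub>R (of_real (x ^ k) * iexp (t * x)))"
    using abs_power_le_one_plus_power[OF assms]
    by (intro integrable_weight_bounded[where C = 1]) (auto simp: norm_mult norm_power)
  thus ?thesis by (simp add: scaleR_conv_of_real mult_ac)
qed

lemma integrable_weighted_power:
  assumes "k \<le> m"
  shows "integrable N (\<lambda>x. w x * x ^ k)"
  using integrable_weight_bounded[of "\<lambda>x. x ^ k" 1] abs_power_le_one_plus_power[OF assms]
  by (simp add: power_abs)

lemma weighted_ft_has_vector_derivative:
  assumes "Suc k \<le> m"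
  shows "(weighted_ft N w k has_vector_derivative \<i> * weighted_ft N w (Suc k) t) (at t)"
proof -
  \<comment> \<open>\<open>e h x\<close> is the difference quotient of \<open>iexp\<close> minus its
    limit. The bound linear in \<open>\<bar>x\<bar>\<close> dominates with only one extra moment;
    the quadratic one serves for the pointwise limit.\<close>
  define e where "e h x = (iexp (h * x) - (1 + \<i> * of_real (h * x))) / of_real h" for h x :: real
  have e_le: "cmod (e h x) \<le> 2 * \<bar>x\<bar>" "cmod (e h x) \<le> \<bar>h\<bar> * x\<^sup>2" if "h \<noteq> 0" for h x
    using iexp_approx2[of "h * x" 1] iexp_approx1[of "h * x" 1] that
    by (auto simp: e_def norm_divide divide_simps abs_mult power2_eq_square mult_ac numeral_2_eq_2)
      (smt (verit) norm_ge_zero)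
  have e_tendsto: "((\<lambda>h. e h x) \<longlongrightarrow> 0) (at 0)" for x
  proof (rule Lim_null_comparison)
    show "\<forall>\<^sub>F h in at 0. cmod (e h x) \<le> \<bar>h\<bar> * x\<^sup>2"
      using e_le by (auto simp: eventually_at_filter)
    show "((\<lambda>h. \<bar>h\<bar> * x\<^sup>2) \<longlongrightarrow> 0) (at 0)"
      by (auto intro!: tendsto_eq_intros)
  qed
  define q where "q h = (LINT x|N. of_real (w x * x ^ k) * iexp (t * x) * e h x)" for h
  have e_meas [measurable]: "e h \<in> borel_measurable borel" for h
    unfolding e_def by measurable
  have q_eq: "weighted_ft N w k (t + h) - weighted_ft N w k t
      - h *\<^sub>R (\<i> * weighted_ft N w (Suc k) t) = of_real h * q h" if "h \<noteq> 0" for h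
  proof -
    have "weighted_ft N w k (t + h) - weighted_ft N w k t - h *\<^sub>R (\<i> * weighted_ft N w (Suc k) t)
       = (LINT x|N. of_real (w x * x ^ k) * iexp ((t + h) * x) - of_real (w x * x ^ k) * iexp (t * x)
           - of_real h * \<i> * (of_real (w x * x ^ Suc k) * iexp (t * x)))"
      unfolding weighted_ft_def
      using integrable_weighted_exp[of k "t + h"] integrable_weighted_exp[of k t]
        integrable_weighted_exp[of "Suc k" t] assms
      by (simp add: scaleR_conv_of_real del: power_Suc)
    also have "\<dots> = (LINT x|N. of_real h * (of_real (w x * x ^ k) * iexp (t * x) * e h x))"
    proof (intro Bochner_Integration.integral_cong refl)
      fix x
      have "iexp ((t + h) * x) = iexp (t * x) * iexp (h * x)"
        by (simp add: exp_add[symmetric] algebra_simps)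
      moreover have "of_real h * e h x = iexp (h * x) - (1 + \<i> * of_real (h * x))"
        using that by (simp add: e_def)
      hence "of_real h * (of_real (w x * x ^ k) * iexp (t * x) * e h x)
        = of_real (w x * x ^ k) * iexp (t * x) * (iexp (h * x) - (1 + \<i> * of_real (h * x)))"
        by (subst mult.left_commute) simp
      ultimately show "of_real (w x * x ^ k) * iexp ((t + h) * x) - of_real (w x * x ^ k) * iexp (t * x)
           - of_real h * \<i> * (of_real (w x * x ^ Suc k) * iexp (t * x))
         = of_real h * (of_real (w x * x ^ k) * iexp (t * x) * e h x)"
        by (simp add: algebra_simps)
    qed
    finally show ?thesis by (simp add: q_def)
  qed
  have "(q \<longlongrightarrow> 0) (at 0)"
  proof (unfold tendsto_at_iff_sequentially, intro allI impI)
    fix X :: "nat \<Rightarrow> real"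
    assume X: "\<forall>i. X i \<in> UNIV - {0}" "X \<longlonglongrightarrow> 0"
    hence X': "filterlim X (at 0) sequentially"
      by (auto simp: filterlim_at intro!: always_eventually)
    have "(\<lambda>i. q (X i)) \<longlonglongrightarrow> (LINT x|N. 0)"
      unfolding q_def
    proof (rule integral_dominated_convergence[where w = "\<lambda>x. 2 * \<bar>w x * x ^ Suc k\<bar>"])
      show "integrable N (\<lambda>x. 2 * \<bar>w x * x ^ Suc k\<bar>)"
        using integrable_weighted_power[OF assms] by (simp del: power_Suc)
      show "AE x in N. (\<lambda>i. of_real (w x * x ^ k) * iexp (t * x) * e (X i) x) \<longlonglongrightarrow> 0"
        using filterlim_compose[OF e_tendsto X'] by (auto intro!: AE_I2 tendsto_eq_intros)
      fix i
      show "AE x in N. cmod (of_real (w x * x ^ k) * iexp (t * x) * e (X i) x)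
          \<le> 2 * \<bar>w x * x ^ Suc k\<bar>"
      proof (rule AE_I2)
        fix x
        have "cmod (of_real (w x * x ^ k) * iexp (t * x) * e (X i) x) = \<bar>w x * x ^ k\<bar> * cmod (e (X i) x)"
          by (simp add: norm_mult norm_power abs_mult power_abs)
        also have "\<dots> \<le> \<bar>w x * x ^ k\<bar> * (2 * \<bar>x\<bar>)"
          using X(1) by (intro mult_left_mono e_le) auto
        finally show "cmod (of_real (w x * x ^ k) * iexp (t * x) * e (X i) x) \<le> 2 * \<bar>w x * x ^ Suc k\<bar>"
          by (simp add: abs_mult mult_ac)
      qed
    qed measurable
    thus "(q \<circ> X) \<longlonglongrightarrow> 0" by (simp add: o_def)
  qed
  hence "((\<lambda>h. cmod (q h)) \<longlongrightarrow> 0) (at 0)" by (rule tendsto_norm_zero)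
  hence "((\<lambda>h. cmod (weighted_ft N w k (t + h) - weighted_ft N w k t
      - h *\<^sub>R (\<i> * weighted_ft N w (Suc k) t)) / norm h) \<longlongrightarrow> 0) (at 0)"
    by (rule Lim_transform_eventually)
       (auto simp: eventually_at_filter q_eq norm_mult)
  thus ?thesis
    unfolding has_vector_derivative_def has_derivative_at
    by (simp add: bounded_linear_scaleR_left)
qed

lemma continuous_weighted_ft:
  assumes "k \<le> m"
  shows "continuous_on UNIV (weighted_ft N w k)"
  unfolding continuous_on_sequentially comp_def
proof (intro ballI allI impI; elim conjE)
  fix X :: "nat \<Rightarrow> real" and a assume X: "X \<longlonglongrightarrow> a"
  show "(\<lambda>i. weighted_ft N w k (X i)) \<longlonglongrightarrow> weighted_ft N w k a"
    unfolding weighted_ft_def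
  proof (rule integral_dominated_convergence[where w = "\<lambda>x. \<bar>w x * x ^ k\<bar>"])
    show "integrable N (\<lambda>x. \<bar>w x * x ^ k\<bar>)"
      using integrable_weighted_power[OF assms] by simp
    show "AE x in N. (\<lambda>i. of_real (w x * x ^ k) * iexp (X i * x)) \<longlonglongrightarrow> of_real (w x * x ^ k) * iexp (a * x)"
      using X by (auto intro!: AE_I2 tendsto_intros)
  qed (auto intro!: AE_I2 simp: norm_mult norm_power abs_mult power_abs)
qed

end

section \<open>Integration by parts through tail functions\<close>

definition crossing :: "real \<Rightarrow> real \<Rightarrow> real" where
  "crossing x y = (if 0 \<le> y \<and> y < x then 1 else if x \<le> y \<and> y < 0 then - 1 else 0)"

lemma crossing_measurable [measurable]: "case_prod crossing \<in> borel_measurable (borel \<Otimes>\<^sub>M borel)"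
  unfolding crossing_def by measurable

text \<open>\<open>crossing x y\<close> is the signed indicator of \<open>y\<close> lying between 0
  and \<open>x\<close>. Its endpoints are half-open so that integrating over \<open>x\<close> gives
  exactly the upper tail beyond \<open>y\<close> for \<open>0 \<le> y\<close> and minus the
  distribution function at \<open>y\<close> for \<open>y < 0\<close>. Here, where \<open>y\<close>
  is the variable, the endpoints form a null set.\<close>

lemma integral_crossing:
  fixes h :: "real \<Rightarrow> 'b :: {banach, second_countable_topology}"
  assumes "\<And>a b. a \<le> b \<Longrightarrow> set_integrable lborel {a..b} h' \<and> h b - h a = (LINT x:{a..b}|lborel. h' x)"
  shows "integrable lborel (\<lambda>y. crossing x y *\<^sub>R h' y)"
    and "(LINT y|lborel. crossing x y *\<^sub>R h' y) = h x - h 0"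
proof -
  have AE: "AE y in lborel. y \<noteq> (0::real) \<and> y \<noteq> x"
    using AE_lborel_singleton[of 0] AE_lborel_singleton[of x] by eventually_elim simp
  have "integrable lborel (\<lambda>y. crossing x y *\<^sub>R h' y) \<and> (LINT y|lborel. crossing x y *\<^sub>R h' y) = h x - h 0"
  proof (cases "0 \<le> x")
    case True
    have eq: "crossing x y *\<^sub>R h' y = indicator {0..<x} y *\<^sub>R h' y" for y
      using True by (auto simp: crossing_def indicator_def)
    have int: "set_integrable lborel {0..x} h'" using assms[of 0 x] True by auto
    have "set_integrable lborel {0..<x} h'" by (rule set_integrable_subset[OF int]) auto
    moreover have "(LINT y:{0..<x}|lborel. h' y) = (LINT y:{0..x}|lborel. h' y)"
      using int calculation unfolding set_integrable_def set_lebesgue_integral_def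
      by (intro integral_cong_AE) (use AE in \<open>auto simp: indicator_def\<close>)
    ultimately show ?thesis
      using assms[of 0 x] True by (simp add: eq set_integrable_def set_lebesgue_integral_def)
  next
    case False
    have eq: "crossing x y *\<^sub>R h' y = - (indicator {x..<0} y *\<^sub>R h' y)" for y
      using False by (auto simp: crossing_def indicator_def)
    have int: "set_integrable lborel {x..0} h'" using assms[of x 0] False by auto
    have "set_integrable lborel {x..<0} h'" by (rule set_integrable_subset[OF int]) auto
    moreover have "(LINT y:{x..<0}|lborel. h' y) = (LINT y:{x..0}|lborel. h' y)"
      using int calculation unfolding set_integrable_def set_lebesgue_integral_def
      by (intro integral_cong_AE) (use AE in \<open>auto simp: indicator_def\<close>)
    ultimately show ?thesis
      using assms[of x 0] False by (simp add: eq set_integrable_def set_lebesgue_integral_def algebra_simps)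
  qed
  thus "integrable lborel (\<lambda>y. crossing x y *\<^sub>R h' y)"
    "(LINT y|lborel. crossing x y *\<^sub>R h' y) = h x - h 0" by auto
qed

context weighted_measure
begin

lemma integrable_weight_crossing: "integrable N (\<lambda>x. w x * crossing x y)"
  using integrable_weight_bounded[of "\<lambda>x. crossing x y" 1]
  by (auto simp: crossing_def one_le_power)

text \<open>Fubini's theorem applied to \<open>h x - h 0\<close> written as the integral of
  \<open>crossing x y *\<^sub>R h' y\<close>. Integrability on the product is a hypothesis because
  it is verified in two different ways.\<close>

lemma tail_representation:
  fixes h h' :: "real \<Rightarrow> 'b :: {banach, second_countable_topology}"
  assumes [measurable]: "h' \<in> borel_measurable borel"
    and FTC: "\<And>a b. a \<le> b \<Longrightarrow> set_integrable lborel {a..b} h' \<and> h b - h a = (LINT x:{a..b}|lborel. h' x)"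
    and int: "integrable (N \<Otimes>\<^sub>M lborel) (\<lambda>(x, y). (w x * crossing x y) *\<^sub>R h' y)"
  shows "integrable N (\<lambda>x. w x *\<^sub>R h x)"
    and "integrable lborel (\<lambda>y. (LINT x|N. w x * crossing x y) *\<^sub>R h' y)"
    and "(LINT x|N. w x *\<^sub>R h x) = (LINT x|N. w x) *\<^sub>R h 0 + (LINT y|lborel. (LINT x|N. w x * crossing x y) *\<^sub>R h' y)"
proof -
  interpret pair: pair_sigma_finite N lborel ..
  have "(LINT y|lborel. (w x * crossing x y) *\<^sub>R h' y) = (LINT y|lborel. w x *\<^sub>R (crossing x y *\<^sub>R h' y))" for x
    by simp
  also have "\<dots> x = w x *\<^sub>R (h x - h 0)" for x
    using integral_crossing[of h' h x] FTC by (subst integral_scaleR_right) auto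
  finally have inner: "(LINT y|lborel. (w x * crossing x y) *\<^sub>R h' y) = w x *\<^sub>R (h x - h 0)" for x .
  have i1: "integrable N (\<lambda>x. w x *\<^sub>R (h x - h 0))"
    using pair.integrable_fst'[OF int] by (simp add: inner)
  have i2: "integrable N (\<lambda>x. w x *\<^sub>R h 0)"
    using integrable_weight by simp
  show i3: "integrable N (\<lambda>x. w x *\<^sub>R h x)"
    using Bochner_Integration.integrable_add[OF i1 i2] by (simp add: algebra_simps)
  note wc = integrable_weight_crossing
  have inner': "(LINT x|N. (w x * crossing x y) *\<^sub>R h' y) = (LINT x|N. w x * crossing x y) *\<^sub>R h' y" for y
    using wc by (simp add: integral_scaleR_left)
  have "integrable lborel (\<lambda>y. LINT x|N. (w x * crossing x y) *\<^sub>R h' y)"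
    using pair.integrable_snd[of "\<lambda>x y. (w x * crossing x y) *\<^sub>R h' y"] int by simp
  thus "integrable lborel (\<lambda>y. (LINT x|N. w x * crossing x y) *\<^sub>R h' y)"
    by (simp only: inner')
  have "(LINT y|lborel. (LINT x|N. (w x * crossing x y) *\<^sub>R h' y)) = (LINT x|N. w x *\<^sub>R (h x - h 0))"
    using pair.Fubini_integral[of "\<lambda>x y. (w x * crossing x y) *\<^sub>R h' y"] int by (simp only: inner)
  also have "\<dots> = (LINT x|N. w x *\<^sub>R h x) - (LINT x|N. w x) *\<^sub>R h 0"
    using i3 integrable_weight i2 by (simp add: algebra_simps integral_scaleR_left del: scaleR_left.diff)
  finally show "(LINT x|N. w x *\<^sub>R h x) = (LINT x|N. w x) *\<^sub>R h 0 + (LINT y|lborel. (LINT x|N. w x * crossing x y) *\<^sub>R h' y)"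
    by (simp only: inner') simp
qed

text \<open>Markov's inequality: where the crossing is nonzero,
  \<open>\<bar>y\<bar> \<le> \<bar>x\<bar>\<close>, so the weight at \<open>y\<close> is at most the
  weight at \<open>x\<close>.\<close>

lemma crossing_tail_le:
  "(LINT x|N. norm (w x * crossing x y)) \<le> (LINT x|N. \<bar>w x\<bar> * (1 + \<bar>x\<bar>) ^ m) / (1 + \<bar>y\<bar>) ^ m"
proof -
  have wn: "integrable N (\<lambda>x. norm (w x * crossing x y))"
    by (rule integrable_norm[OF integrable_weight_crossing])
  have "(LINT x|N. norm (w x * crossing x y)) \<le> (LINT x|N. (\<bar>w x\<bar> * (1 + \<bar>x\<bar>) ^ m) / (1 + \<bar>y\<bar>) ^ m)"
  proof (rule integral_mono[OF wn])
    fix x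
    show "norm (w x * crossing x y) \<le> (\<bar>w x\<bar> * (1 + \<bar>x\<bar>) ^ m) / (1 + \<bar>y\<bar>) ^ m"
    proof (cases "crossing x y = 0")
      case False
      hence "\<bar>y\<bar> \<le> \<bar>x\<bar>" by (auto simp: crossing_def split: if_splits)
      hence "(1 + \<bar>y\<bar>) ^ m \<le> (1 + \<bar>x\<bar>) ^ m" by (intro power_mono) auto
      hence "\<bar>w x\<bar> * (1 + \<bar>y\<bar>) ^ m \<le> \<bar>w x\<bar> * (1 + \<bar>x\<bar>) ^ m" by (intro mult_left_mono) auto
      thus ?thesis using False by (auto simp: crossing_def field_simps split: if_splits)
    qed auto
  qed (use integrable_abs_moment in auto)
  thus ?thesis by simp
qed

text \<open>Here the inner integral runs over \<open>N\<close>: the tail decays like the inverse of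
  \<open>(1 + \<bar>y\<bar>) ^ m\<close>, which is exactly the weight in the hypothesis on
  \<open>h'\<close>. Hence the product is taken in the swapped order.\<close>

lemma integrable_crossing_of_variation:
  fixes h' :: "real \<Rightarrow> 'b :: {banach, second_countable_topology}"
  assumes [measurable]: "h' \<in> borel_measurable borel"
    and var: "integrable lborel (\<lambda>y. norm (h' y) / (1 + \<bar>y\<bar>) ^ m)"
  shows "integrable (N \<Otimes>\<^sub>M lborel) (\<lambda>(x, y). (w x * crossing x y) *\<^sub>R h' y)"
proof -
  interpret pair: pair_sigma_finite N lborel ..
  define c where "c = (LINT x|N. \<bar>w x\<bar> * (1 + \<bar>x\<bar>) ^ m)"
  note wc = integrable_weight_crossing
  note wn = integrable_norm[OF wc]
  note tail = crossing_tail_le[folded c_def]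
  have meas [measurable]: "(\<lambda>(x, y). (w x * crossing x y) *\<^sub>R h' y) \<in> borel_measurable (N \<Otimes>\<^sub>M lborel)"
    by measurable
  interpret pair': pair_sigma_finite lborel N ..
  have "integrable (lborel \<Otimes>\<^sub>M N) (\<lambda>(y, x). (w x * crossing x y) *\<^sub>R h' y)"
  proof (rule pair'.Fubini_integrable)
    have "integrable lborel (\<lambda>y. (LINT x|N. norm (w x * crossing x y)) * norm (h' y))"
    proof (rule Bochner_Integration.integrable_bound)
      show "integrable lborel (\<lambda>y. c * (norm (h' y) / (1 + \<bar>y\<bar>) ^ m))"
        using var by (intro integrable_mult_right)
      show "AE y in lborel. norm ((LINT x|N. norm (w x * crossing x y)) * norm (h' y))
          \<le> norm (c * (norm (h' y) / (1 + \<bar>y\<bar>) ^ m))"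
      proof (rule AE_I2)
        fix y
        have "(LINT x|N. norm (w x * crossing x y)) * norm (h' y) \<le> c / (1 + \<bar>y\<bar>) ^ m * norm (h' y)"
          by (intro mult_right_mono tail) auto
        moreover have "0 \<le> (LINT x|N. norm (w x * crossing x y)) * norm (h' y)"
          by (intro mult_nonneg_nonneg) auto
        ultimately show "norm ((LINT x|N. norm (w x * crossing x y)) * norm (h' y))
          \<le> norm (c * (norm (h' y) / (1 + \<bar>y\<bar>) ^ m))"
          using abs_ge_self[of "c / (1 + \<bar>y\<bar>) ^ m * norm (h' y)"]
          by (simp add: abs_mult del: abs_ge_self)
      qed
    qed measurable
    thus "integrable lborel (\<lambda>y. LINT x|N. norm (case (y, x) of (y, x) \<Rightarrow> (w x * crossing x y) *\<^sub>R h' y))"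
      using wn by simp
    show "AE y in lborel. integrable N (\<lambda>x. case (y, x) of (y, x) \<Rightarrow> (w x * crossing x y) *\<^sub>R h' y)"
      using wc by (auto intro!: AE_I2 integrable_scaleR_left)
  qed measurable
  from pair'.integrable_product_swap[OF this] show ?thesis
    by (simp add: case_prod_unfold split_def)
qed

text \<open>For \<open>h'\<close> of growth \<open>m - 1\<close> the quotient by
  \<open>(1 + \<bar>y\<bar>) ^ m\<close> need not be integrable, so the variation criterion is out
  of reach. Integrating over \<open>y\<close> first gives growth \<open>m\<close> in
  \<open>x\<close>, which the moment controls. This covers powers times exponentials.\<close>

lemma integrable_crossing_of_growth:
  fixes h' :: "real \<Rightarrow> 'b :: {banach, second_countable_topology}"
  assumes [measurable]: "h' \<in> borel_measurable borel"
    and "1 \<le> m" and bound: "\<And>y. norm (h' y) \<le> C * (1 + \<bar>y\<bar>) ^ (m - 1)"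
  shows "integrable (N \<Otimes>\<^sub>M lborel) (\<lambda>(x, y). (w x * crossing x y) *\<^sub>R h' y)"
proof -
  interpret pair: pair_sigma_finite N lborel ..
  have C: "0 \<le> C" using order_trans[OF norm_ge_zero bound[of 0]] by simp
  have supp: "integrable lborel (\<lambda>y. crossing x y *\<^sub>R h' y)" 
    and le: "(LINT y|lborel. \<bar>crossing x y\<bar> * norm (h' y)) \<le> C * (1 + \<bar>x\<bar>) ^ m" for x
  proof -
    have ind: "integrable lborel (\<lambda>y. C * (1 + \<bar>x\<bar>) ^ (m - 1) * indicator {min 0 x..max 0 x} y)"
      by simp
    have pw: "\<bar>crossing x y\<bar> * norm (h' y) \<le> C * (1 + \<bar>x\<bar>) ^ (m - 1) * indicator {min 0 x..max 0 x} y" for y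
    proof (cases "crossing x y = 0")
      case False
      hence y: "\<bar>y\<bar> \<le> \<bar>x\<bar>" "y \<in> {min 0 x..max 0 x}" and c: "\<bar>crossing x y\<bar> = 1"
        by (auto simp: crossing_def split: if_splits)
      have "norm (h' y) \<le> C * (1 + \<bar>y\<bar>) ^ (m - 1)" by (rule bound)
      also have "\<dots> \<le> C * (1 + \<bar>x\<bar>) ^ (m - 1)" using y C by (intro mult_left_mono power_mono) auto
      finally show ?thesis using c y by simp
    qed (use C in \<open>auto intro!: mult_nonneg_nonneg\<close>)
    show s: "integrable lborel (\<lambda>y. crossing x y *\<^sub>R h' y)"
      by (rule Bochner_Integration.integrable_bound[OF ind])
         (use pw C in \<open>auto intro!: AE_I2 simp: abs_mult\<close>)
    have "(LINT y|lborel. \<bar>crossing x y\<bar> * norm (h' y)) \<le> (LINT y|lborel. C * (1 + \<bar>x\<bar>) ^ (m - 1) * indicator {min 0 x..max 0 x} y)"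
      using integrable_norm[OF s] by (intro integral_mono ind pw) simp
    also have "\<dots> = C * (1 + \<bar>x\<bar>) ^ (m - 1) * \<bar>x\<bar>"
      by (simp add: min_def max_def)
    also have "\<dots> \<le> C * (1 + \<bar>x\<bar>) ^ (m - 1) * (1 + \<bar>x\<bar>)" using C by (intro mult_left_mono) auto
    also have "\<dots> = C * (1 + \<bar>x\<bar>) ^ m"
      using \<open>1 \<le> m\<close> by (cases m) auto
    finally show "(LINT y|lborel. \<bar>crossing x y\<bar> * norm (h' y)) \<le> C * (1 + \<bar>x\<bar>) ^ m" .
  qed
  show ?thesis
  proof (rule pair.Fubini_integrable)
    have "integrable N (\<lambda>x. \<bar>w x\<bar> * (LINT y|lborel. \<bar>crossing x y\<bar> * norm (h' y)))"
    proof (rule Bochner_Integration.integrable_bound)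
      show "integrable N (\<lambda>x. C * (\<bar>w x\<bar> * (1 + \<bar>x\<bar>) ^ m))" using integrable_abs_moment by simp
      show "AE x in N. norm (\<bar>w x\<bar> * (LINT y|lborel. \<bar>crossing x y\<bar> * norm (h' y))) \<le> norm (C * (\<bar>w x\<bar> * (1 + \<bar>x\<bar>) ^ m))"
      proof (rule AE_I2)
        fix x
        have "0 \<le> (LINT y|lborel. \<bar>crossing x y\<bar> * norm (h' y))" by (intro integral_nonneg_AE AE_I2) auto
        moreover have "\<bar>w x\<bar> * (LINT y|lborel. \<bar>crossing x y\<bar> * norm (h' y)) \<le> \<bar>w x\<bar> * (C * (1 + \<bar>x\<bar>) ^ m)"
          by (intro mult_left_mono le) auto
        ultimately show "norm (\<bar>w x\<bar> * (LINT y|lborel. \<bar>crossing x y\<bar> * norm (h' y))) \<le> norm (C * (\<bar>w x\<bar> * (1 + \<bar>x\<bar>) ^ m))"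
          using C by (simp add: abs_mult mult_ac)
      qed
    qed measurable
    thus "integrable N (\<lambda>x. LINT y|lborel. norm (case (x, y) of (x, y) \<Rightarrow> (w x * crossing x y) *\<^sub>R h' y))"
      by (simp add: abs_mult mult.assoc)
    show "AE x in N. integrable lborel (\<lambda>y. case (x, y) of (x, y) \<Rightarrow> (w x * crossing x y) *\<^sub>R h' y)"
      using supp by (auto intro!: AE_I2 simp flip: scaleR_scaleR)
  qed measurable
qed

end

section \<open>The Fejer kernel\<close>

text \<open>The kernel is left unnormalised. At \<open>u = 0\<close> division by zero gives 0
  instead of the limit \<open>T / 2\<close>, which matters only on a null set.\<close>

definition fejer :: "real \<Rightarrow> real \<Rightarrow> real" where
  "fejer T u = (1 - cos (T * u)) / (T * u\<^sup>2)"

lemma fejer_measurable [measurable]: "fejer T \<in> borel_measurable borel"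
  unfolding fejer_def by measurable

text \<open>\<open>1 - cos u\<close> is at most \<open>u\<^sup>2 / 2\<close> and at most 2.
  Expanding the product with \<open>1 + u\<^sup>2\<close> and using the first bound for 1, the
  second for \<open>u\<^sup>2\<close>, gives \<open>5 / 2 * u\<^sup>2\<close>.\<close>

lemma fejer_bounds:
  shows fejer_nonneg: "0 \<le> fejer 1 u" and fejer_le: "fejer 1 u \<le> 5 / 2 * inverse (1 + u\<^sup>2)"
proof -
  show "0 \<le> fejer 1 u" by (auto simp: fejer_def)
  show "fejer 1 u \<le> 5 / 2 * inverse (1 + u\<^sup>2)"
  proof (cases "u = 0")
    case False
    have "1 - cos u = 2 * (sin (u / 2))\<^sup>2"
      using cos_double_sin[of "u / 2"] by simp
    moreover have "(sin (u / 2))\<^sup>2 \<le> (u / 2)\<^sup>2"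
      by (rule abs_le_square_iff[THEN iffD1]) (rule abs_sin_x_le_abs_x)
    ultimately have "1 - cos u \<le> u\<^sup>2 / 2" by (simp add: power_divide)
    moreover have "1 - cos u \<le> 2" using cos_ge_minus_one[of u] by linarith
    ultimately have "(1 - cos u) * (1 + u\<^sup>2) \<le> u\<^sup>2 / 2 + 2 * u\<^sup>2"
      using mult_right_mono[of "1 - cos u" 2 "u\<^sup>2"] by (simp add: algebra_simps)
    moreover have "u\<^sup>2 > 0" "1 + u\<^sup>2 > 0" using False by (auto simp: add_pos_nonneg)
    ultimately show ?thesis by (simp add: fejer_def field_simps)
  qed (simp add: fejer_def)
qed

lemma integrable_inverse_one_plus_square: "integrable lborel (\<lambda>u :: real. inverse (1 + u\<^sup>2))"
  using integrable_inverse_1_plus_square by (simp add: set_integrable_def)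

lemma integrable_fejer: "integrable lborel (fejer 1)"
proof (rule Bochner_Integration.integrable_bound)
  show "integrable lborel (\<lambda>u :: real. 5 / 2 * inverse (1 + u\<^sup>2))"
    using integrable_inverse_one_plus_square by simp
qed (use fejer_bounds in \<open>auto intro!: AE_I2 simp: abs_of_nonneg\<close>)

lemma integral_fejer_pos: "0 < (LINT u|lborel. fejer 1 u)"
proof -
  have c: "cos 1 < (1 :: real)" using cos_monotone_0_pi[of 0 1] pi_gt3 by simp
  \<comment> \<open>On \<open>{1..2}\<close> the cosine is at most \<open>cos 1\<close> and
    \<open>u\<^sup>2\<close> at most 4, so a positive constant fits under the kernel.\<close>
  have "(LINT u|lborel. (1 - cos 1) / 4 * indicator {1..2::real} u) \<le> (LINT u|lborel. fejer 1 u)"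
  proof (intro integral_mono integrable_fejer)
    fix u :: real
    show "(1 - cos 1) / 4 * indicator {1..2::real} u \<le> fejer 1 u"
    proof (cases "u \<in> {1..2}")
      case True
      hence "cos u \<le> cos 1" using pi_gt3 by (intro cos_monotone_0_pi_le) auto
      moreover have "u\<^sup>2 \<le> 2\<^sup>2" using True by (intro power_mono) auto
      ultimately have "(1 - cos 1) * u\<^sup>2 \<le> (1 - cos u) * 4"
        using c by (intro mult_mono) auto
      thus ?thesis using True by (simp add: fejer_def field_simps)
    qed (simp add: fejer_nonneg)
  qed simp
  thus ?thesis using c by simp
qed

text \<open>The window is to hold three quarters of the mass. The mass outside is then at most
  \<open>p / 3\<close>, which is the source of the factor 1 / 3 in the absorption.\<close>

lemma fejer_concentration:
  obtains A p :: real where "0 < A" "0 < p" "(LBINT u:{- A..A}. fejer 1 u) = p"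
    "(LINT u|lborel. fejer 1 u) \<le> 4 / 3 * p"
proof -
  define P where "P = (LINT u|lborel. fejer 1 u)"
  have P: "0 < P" using integral_fejer_pos by (simp add: P_def)
  have "((\<lambda>n :: real. LBINT u:{- n..n}. fejer 1 u) \<longlongrightarrow> P) at_top"
    unfolding P_def set_lebesgue_integral_def
  proof (rule integral_dominated_convergence_at_top[where w = "fejer 1"])
    show "\<forall>\<^sub>F n in at_top. AE x in lborel. norm (indicator {- n..n} x *\<^sub>R fejer 1 x) \<le> fejer 1 x"
      by (auto intro!: always_eventually simp: indicator_def fejer_nonneg)
    show "AE x in lborel. ((\<lambda>n. indicator {- n..n} x *\<^sub>R fejer 1 x) \<longlongrightarrow> fejer 1 x) at_top"
    proof (rule AE_I2, rule tendsto_eventually)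
      fix x :: real
      show "\<forall>\<^sub>F n in at_top. indicator {- n..n} x *\<^sub>R fejer 1 x = fejer 1 x"
        using eventually_ge_at_top[of "\<bar>x\<bar>"] by eventually_elim (auto simp: indicator_def)
    qed
  qed (auto simp: integrable_fejer)
  moreover have "3 / 4 * P < P" using P by simp
  ultimately have "\<forall>\<^sub>F n in at_top. 3 / 4 * P < (LBINT u:{- n..n}. fejer 1 u)"
    by (rule order_tendstoD(1))
  hence "\<forall>\<^sub>F n in at_top. 3 / 4 * P < (LBINT u:{- n..n}. fejer 1 u) \<and> 0 < n"
    using eventually_gt_at_top[of 0] by eventually_elim auto
  then obtain n where "3 / 4 * P < (LBINT u:{- n..n}. fejer 1 u)" "0 < n"
    using eventually_happens'[OF trivial_limit_at_top_linorder] by blast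
  thus ?thesis using P by (intro that[of n]) (auto simp: P_def)
qed

text \<open>Inside the window \<open>E\<close> is at least \<open>v\<close>, outside at least
  \<open>- s\<close>, so the smoothed value is at least \<open>v * p\<close> minus \<open>s\<close>
  times the outer mass, and that mass is at most \<open>p / 3\<close>. The window bound is
  one-sided, which is all that a monotone distribution function offers.\<close>

lemma smoothing_window:
  fixes E :: "real \<Rightarrow> real"
  assumes [measurable]: "E \<in> borel_measurable borel"
    and E_le: "\<And>y. \<bar>E y\<bar> \<le> s" and "0 < T"
    and p: "(LBINT u:{- A..A}. fejer 1 u) = p" "0 < p" "(LINT u|lborel. fejer 1 u) \<le> 4 / 3 * p"
    and window: "\<And>y. \<bar>y - c\<bar> \<le> A / T \<Longrightarrow> v \<le> E y"
    and J: "(LINT y|lborel. E y * fejer T (c - y)) \<le> I"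
  shows "v \<le> I / p + s / 3"
proof -
  have s: "0 \<le> s" using order_trans[OF abs_ge_zero E_le[of 0]] .
  have scale: "fejer T (u / T) = T * fejer 1 u" for u
    using \<open>0 < T\<close> by (simp add: fejer_def power2_eq_square field_simps)
  have scale': "E (c - u / T) * fejer T (u / T) = T * (E (c - u / T) * fejer 1 u)" for u
    unfolding scale by (rule mult.left_commute)
  have "(LINT y|lborel. E y * fejer T (c - y)) = (LINT u|lborel. E (c - u / T) * fejer 1 u)"
  proof (subst lborel_integral_real_affine[where c = "- 1 / T" and t = c])
    have "c + - 1 / T * u = c - u / T" "c - (c - u / T) = u / T" for u by auto
    moreover have "\<bar>- 1 / T\<bar> *\<^sub>R (T * X) = X" for X :: real
      using \<open>0 < T\<close> by simp
    ultimately show "\<bar>- 1 / T\<bar> *\<^sub>R (LINT u|lborel. E (c + - 1 / T * u) * fejer T (c - (c + - 1 / T * u)))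
        = (LINT u|lborel. E (c - u / T) * fejer 1 u)"
      by (simp only: scale' integral_mult_right_zero)
  qed (use \<open>0 < T\<close> in auto)
  with J have J': "(LINT u|lborel. E (c - u / T) * fejer 1 u) \<le> I" by simp
  have int: "integrable lborel (\<lambda>u. E (c - u / T) * fejer 1 u)"
  proof (rule Bochner_Integration.integrable_bound)
    show "integrable lborel (\<lambda>u. s * fejer 1 u)" using integrable_fejer by simp
    show "AE u in lborel. norm (E (c - u / T) * fejer 1 u) \<le> norm (s * fejer 1 u)"
      using E_le s by (auto intro!: AE_I2 mult_right_mono simp: abs_mult fejer_nonneg)
  qed measurable
  have int': "integrable lborel (\<lambda>u. indicator {- A..A} u * fejer 1 u)"
    using integrable_mult_indicator[of "{-A..A}" lborel "fejer 1"] integrable_fejer by simp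
  have "(LINT u|lborel. (v + s) * (indicator {- A..A} u * fejer 1 u) - s * fejer 1 u)
      \<le> (LINT u|lborel. E (c - u / T) * fejer 1 u)"
  proof (rule integral_mono)
    fix u :: real
    show "(v + s) * (indicator {- A..A} u * fejer 1 u) - s * fejer 1 u \<le> E (c - u / T) * fejer 1 u"
    proof (cases "u \<in> {- A..A}")
      case True
      hence "\<bar>u\<bar> / T \<le> A / T"
        using \<open>0 < T\<close> by (intro divide_right_mono) auto
      hence "v \<le> E (c - u / T)"
        using \<open>0 < T\<close> by (intro window) (simp add: abs_divide)
      from mult_right_mono[OF this fejer_nonneg[of u]] show ?thesis
        using True by (simp add: algebra_simps)
    next
      case False
      have "- s \<le> E (c - u / T)" using E_le[of "c - u / T"] by (simp add: abs_le_iff)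
      from mult_right_mono[OF this fejer_nonneg[of u]] show ?thesis using False by simp
    qed
  qed (use int int' integrable_fejer in auto)
  also note J'
  finally have "(v + s) * p - s * (LINT u|lborel. fejer 1 u) \<le> I"
    using int' integrable_fejer p(1) by (simp add: set_lebesgue_integral_def)
  moreover have "s * (LINT u|lborel. fejer 1 u) \<le> s * (4 / 3 * p)"
    using s p by (intro mult_left_mono) auto
  ultimately have "v * p \<le> I + s / 3 * p" by (simp add: algebra_simps)
  thus ?thesis using p(2) by (simp add: field_simps)
qed

text \<open>The right half of the triangular multiplier whose inverse transform is the Fejer kernel,
  translated to \<open>x\<close>. Integrals run over positive frequencies only; the other half is
  the complex conjugate, so a real part replaces it.\<close>

definition fejer_symbol :: "real \<Rightarrow> real \<Rightarrow> real \<Rightarrow> complex" where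
  "fejer_symbol T x t = of_real (1 - t / T) * iexp (- (t * x))"

lemma continuous_fejer_symbol [continuous_intros]: "continuous_on S (fejer_symbol T x)"
  unfolding fejer_symbol_def divide_inverse by (intro continuous_intros)

lemma fejer_symbol_bound: "0 < T \<Longrightarrow> t \<in> {0..T} \<Longrightarrow> cmod (fejer_symbol T x t) \<le> 1"
proof -
  assume "0 < T" "t \<in> {0..T}"
  hence "\<bar>1 - t / T\<bar> \<le> 1" by (auto simp: field_simps abs_le_iff)
  moreover have "cmod (fejer_symbol T x t) = \<bar>1 - t / T\<bar>"
    unfolding fejer_symbol_def norm_mult norm_of_real norm_exp_i_times
    using norm_exp_i_times[of "- (t * x)"] by simp
  ultimately show ?thesis by simp
qed

definition fejer_symbol_deriv :: "real \<Rightarrow> real \<Rightarrow> real \<Rightarrow> complex" where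
  "fejer_symbol_deriv T x t = - (of_real (1 / T) + \<i> * of_real x * of_real (1 - t / T)) * iexp (- (t * x))"

lemma iexp_has_vector_derivative:
  "((\<lambda>t. iexp (t * x)) has_vector_derivative \<i> * of_real x * iexp (t * x)) (at t within S)"
  by (auto intro!: derivative_eq_intros has_vector_derivative_real_field simp: algebra_simps)

lemma fejer_symbol_has_vector_derivative:
  "(fejer_symbol T x has_vector_derivative fejer_symbol_deriv T x t) (at t within S)"
proof -
  have 1: "((\<lambda>t. complex_of_real (1 - t / T)) has_vector_derivative - of_real (1 / T)) (at t within S)"
    by (auto intro!: derivative_eq_intros has_vector_derivative_of_real simp: has_real_derivative_iff_has_vector_derivative[symmetric])
  show ?thesis
    unfolding fejer_symbol_def fejer_symbol_deriv_def
    using has_vector_derivative_mult[OF 1 iexp_has_vector_derivative[of "- x" t S]]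
    by (simp add: algebra_simps)
qed

lemma continuous_fejer_symbol_deriv [continuous_intros]: "continuous_on S (fejer_symbol_deriv T x)"
  unfolding fejer_symbol_deriv_def divide_inverse by (intro continuous_intros)

text \<open>The point \<open>y = x\<close> is excluded because there \<open>fejer T 0\<close> is the
  default 0, whereas the integral is \<open>T / 2\<close>.\<close>

lemma integral_fejer_symbol:
  assumes "0 < T" "y \<noteq> x"
  shows "Re (LBINT t:{0..T}. fejer_symbol T x t * iexp (t * y)) = fejer T (x - y)"
proof -
  define u where "u = y - x"
  have u: "u \<noteq> 0" using assms by (simp add: u_def)
  have int: "set_integrable lborel {0..T} (\<lambda>t. fejer_symbol T x t * iexp (t * y))"
    by (intro borel_integrable_atLeastAtMost' continuous_intros)
  have "fejer_symbol T x t * iexp (t * y) = of_real (1 - t / T) * iexp (t * u)" for t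
    unfolding fejer_symbol_def u_def
    by (simp add: exp_add[symmetric] algebra_simps)
  hence Re: "Re (fejer_symbol T x t * iexp (t * y)) = (1 - t / T) * cos (t * u)" for t
    by (simp add: Re_exp)
  have "Re (LBINT t:{0..T}. fejer_symbol T x t * iexp (t * y)) = (LBINT t:{0..T}. (1 - t / T) * cos (t * u))"
    unfolding Re[symmetric] using int
    unfolding set_lebesgue_integral_def set_integrable_def
    by (subst integral_Re[symmetric]) (auto simp del: integral_Re)
  also have "\<dots> = ((1 - T / T) * sin (T * u) / u - cos (T * u) / (T * u\<^sup>2))
      - ((1 - 0 / T) * sin (0 * u) / u - cos (0 * u) / (T * u\<^sup>2))"
    unfolding set_lebesgue_integral_def
  proof (rule integral_FTC_atLeastAtMost)
    fix t assume "0 \<le> t" "t \<le> T"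
    show "((\<lambda>t. (1 - t / T) * sin (t * u) / u - cos (t * u) / (T * u\<^sup>2)) has_vector_derivative
       (1 - t / T) * cos (t * u)) (at t within {0..T})"
      unfolding has_real_derivative_iff_has_vector_derivative[symmetric]
      using u \<open>0 < T\<close> by (auto intro!: derivative_eq_intros simp: field_simps power2_eq_square)
  qed (use assms in \<open>auto intro!: continuous_intros\<close>)
  also have "\<dots> = fejer T u" using \<open>0 < T\<close> by (simp add: fejer_def diff_divide_distrib)
  also have "\<dots> = fejer T (x - y)"
    using cos_minus[of "T * u"] by (simp add: fejer_def u_def power2_commute algebra_simps)
  finally show ?thesis .
qed

text \<open>Parseval's identity on a bounded frequency interval: the integrand is dominated by
  \<open>\<bar>w y\<bar>\<close> times \<open>cmod (g t)\<close>, both integrable.\<close>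

lemma (in weighted_measure) integral_fourier_Fubini:
  fixes g :: "real \<Rightarrow> complex"
  assumes "continuous_on {0..T} g"
  shows "integrable N (\<lambda>y. of_real (w y) * (LBINT t:{0..T}. g t * iexp (t * y)))"
    and "(LINT y|N. of_real (w y) * (LBINT t:{0..T}. g t * iexp (t * y))) = (LBINT t:{0..T}. g t * weighted_ft N w 0 t)"
proof -
  interpret pair: pair_sigma_finite N lborel ..
  define g' where "g' t = indicator {0..T} t *\<^sub>R g t" for t
  have g': "integrable lborel g'"
    using borel_integrable_atLeastAtMost'[OF assms] unfolding set_integrable_def g'_def .
  hence [measurable]: "g' \<in> borel_measurable borel" by simp
  have int: "integrable (N \<Otimes>\<^sub>M lborel) (\<lambda>(y, t). of_real (w y) * (g' t * iexp (t * y)))"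
  proof (rule pair.Fubini_integrable)
    have "integrable N (\<lambda>y. \<bar>w y\<bar> * (LINT t|lborel. cmod (g' t)))"
      using integrable_weight by simp
    thus "integrable N (\<lambda>y. LINT t|lborel. norm (case (y, t) of (y, t) \<Rightarrow> of_real (w y) * (g' t * iexp (t * y))))"
      by (simp add: norm_mult)
    show "AE y in N. integrable lborel (\<lambda>t. case (y, t) of (y, t) \<Rightarrow> of_real (w y) * (g' t * iexp (t * y)))"
    proof (rule AE_I2)
      fix y
      have "integrable lborel (\<lambda>t. g' t * iexp (t * y))"
        by (rule Bochner_Integration.integrable_bound[OF g']) (auto simp: norm_mult)
      thus "integrable lborel (\<lambda>t. case (y, t) of (y, t) \<Rightarrow> of_real (w y) * (g' t * iexp (t * y)))"
        by simp
    qed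
  qed measurable
  have inner: "(LINT t|lborel. of_real (w y) * (g' t * iexp (t * y))) = of_real (w y) * (LBINT t:{0..T}. g t * iexp (t * y))" for y
    unfolding set_lebesgue_integral_def g'_def
    by (subst integral_mult_right_zero[symmetric]) (simp add: mult_ac)
  show "integrable N (\<lambda>y. of_real (w y) * (LBINT t:{0..T}. g t * iexp (t * y)))"
    using pair.integrable_fst[OF int] by (simp only: inner)
  have "(LINT y|N. of_real (w y) * (LBINT t:{0..T}. g t * iexp (t * y))) = (LINT t|lborel. (LINT y|N. of_real (w y) * (g' t * iexp (t * y))))"
    using pair.Fubini_integral[OF int] by (simp only: inner)
  also have "\<dots> = (LINT t|lborel. g' t * weighted_ft N w 0 t)"
    unfolding weighted_ft_def
    by (subst integral_mult_right_zero[symmetric]) (simp add: mult_ac)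
  finally show "(LINT y|N. of_real (w y) * (LBINT t:{0..T}. g t * iexp (t * y))) = (LBINT t:{0..T}. g t * weighted_ft N w 0 t)"
    by (simp add: set_lebesgue_integral_def g'_def)
qed

text \<open>Multiplication by \<open>y\<close> is differentiation in the frequency. The symbol
  vanishes at \<open>T\<close> and equals 1 at 0, so the only boundary term is a constant, which
  becomes the leading \<open>\<i>\<close>.\<close>

lemma integral_fejer_symbol_times:
  assumes "0 < T"
  shows "of_real y * (LBINT t:{0..T}. fejer_symbol T x t * iexp (t * y))
     = \<i> + \<i> * (LBINT t:{0..T}. fejer_symbol_deriv T x t * iexp (t * y))"
proof -
  have i1: "set_integrable lborel {0..T} (\<lambda>t. fejer_symbol_deriv T x t * iexp (t * y))"
    and i2: "set_integrable lborel {0..T} (\<lambda>t. fejer_symbol T x t * iexp (t * y))"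
    by (intro borel_integrable_atLeastAtMost' continuous_intros)+
  have "(LBINT t:{0..T}. fejer_symbol_deriv T x t * iexp (t * y) + \<i> * of_real y * (fejer_symbol T x t * iexp (t * y)))
    = fejer_symbol T x T * iexp (T * y) - fejer_symbol T x 0 * iexp (0 * y)"
    unfolding set_lebesgue_integral_def
  proof (rule integral_FTC_atLeastAtMost)
    fix t
    show "((\<lambda>t. fejer_symbol T x t * iexp (t * y)) has_vector_derivative
      fejer_symbol_deriv T x t * iexp (t * y) + \<i> * of_real y * (fejer_symbol T x t * iexp (t * y))) (at t within {0..T})"
      using has_vector_derivative_mult[OF fejer_symbol_has_vector_derivative[of T x t]
          iexp_has_vector_derivative[of y t "{0..T}"]]
      by (simp only: add.commute mult_ac)
  qed (use assms in \<open>auto intro!: continuous_intros\<close>)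
  also have "\<dots> = - 1" using assms by (simp add: fejer_symbol_def)
  also have "(LBINT t:{0..T}. fejer_symbol_deriv T x t * iexp (t * y) + \<i> * of_real y * (fejer_symbol T x t * iexp (t * y)))
    = (LBINT t:{0..T}. fejer_symbol_deriv T x t * iexp (t * y)) + \<i> * of_real y * (LBINT t:{0..T}. fejer_symbol T x t * iexp (t * y))"
    using i1 i2 by (subst set_integral_add) (auto simp: set_integrable_mult_right set_integral_mult_right)
  finally have "\<i> * of_real y * (LBINT t:{0..T}. fejer_symbol T x t * iexp (t * y))
      = - 1 - (LBINT t:{0..T}. fejer_symbol_deriv T x t * iexp (t * y))"
    by (simp add: algebra_simps)
  hence "\<i> * (\<i> * of_real y * (LBINT t:{0..T}. fejer_symbol T x t * iexp (t * y)))
      = \<i> * (- 1 - (LBINT t:{0..T}. fejer_symbol_deriv T x t * iexp (t * y)))" by simp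
  thus ?thesis by (simp add: algebra_simps)
qed

section \<open>A non-uniform smoothing inequality\<close>

text \<open>Taking the supremum on both sides gives \<open>s \<le> \<kappa> + s / 3\<close>. The
  bound by \<open>c\<close> ensures that the supremum is finite; its size does not enter the
  conclusion.\<close>

lemma sup_absorption:
  fixes E :: "real \<Rightarrow> real"
  assumes bounded: "\<And>x. \<bar>E x\<bar> \<le> c"
    and step: "\<And>s x. (\<And>y. \<bar>E y\<bar> \<le> s) \<Longrightarrow> \<bar>E x\<bar> \<le> \<kappa> + s / 3"
  shows "\<bar>E x\<bar> \<le> 3 / 2 * \<kappa>"
proof -
  define s where "s = (SUP y. \<bar>E y\<bar>)"
  have bdd: "bdd_above (range (\<lambda>y. \<bar>E y\<bar>))" using bounded by (auto intro!: bdd_aboveI)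
  have le: "\<bar>E y\<bar> \<le> s" for y unfolding s_def by (intro cSUP_upper bdd) auto
  have "s \<le> \<kappa> + s / 3" unfolding s_def by (intro cSUP_least) (use step[OF le] in \<open>auto simp: s_def\<close>)
  with le[of x] show ?thesis by simp
qed

text \<open>The exponent on \<open>M\<close> is \<open>j\<close> instead of \<open>j - 1\<close>: a
  harmless loss for \<open>1 \<le> M\<close> that keeps the induction free of truncated
  subtraction.\<close>

lemma abs_power_diff_le:
  fixes x y M :: real
  assumes "\<bar>x\<bar> \<le> M" "\<bar>y\<bar> \<le> M" "1 \<le> M"
  shows "\<bar>y ^ j - x ^ j\<bar> \<le> real j * M ^ j * \<bar>y - x\<bar>"
proof (induction j)
  case (Suc j)
  have "y ^ Suc j - x ^ Suc j = y * (y ^ j - x ^ j) + (y - x) * x ^ j" by (simp add: algebra_simps)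
  hence "\<bar>y ^ Suc j - x ^ Suc j\<bar> \<le> \<bar>y\<bar> * \<bar>y ^ j - x ^ j\<bar> + \<bar>y - x\<bar> * \<bar>x\<bar> ^ j"
    using abs_triangle_ineq[of "y * (y ^ j - x ^ j)" "(y - x) * x ^ j"] by (simp add: abs_mult power_abs)
  also have "\<dots> \<le> M * (real j * M ^ j * \<bar>y - x\<bar>) + \<bar>y - x\<bar> * M ^ Suc j"
  proof (intro add_mono mult_mono Suc.IH assms mult_left_mono)
    have "\<bar>x\<bar> ^ j \<le> M ^ j" using assms by (intro power_mono) auto
    also have "\<dots> \<le> M ^ Suc j" using assms by (intro power_increasing) auto
    finally show "\<bar>x\<bar> ^ j \<le> M ^ Suc j" .
  qed (use assms in auto)
  finally show ?case by (simp add: algebra_simps)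
qed simp

text \<open>If \<open>U j = (- \<i>)\<^sup>j f\<^bsup>(j)\<^esup>\<close> for all \<open>j\<close>, this is \<open>(- \<i>)\<^sup>k g\<^bsup>(k)\<^esup>\<close> for \<open>g t = \<i> f t / t\<close>: differentiate
  \<open>t g t = \<i> f t\<close>.\<close>

primrec quotient_deriv :: "(nat \<Rightarrow> real \<Rightarrow> complex) \<Rightarrow> nat \<Rightarrow> real \<Rightarrow> complex" where
  "quotient_deriv U 0 t = \<i> * U 0 t / of_real t"
| "quotient_deriv U (Suc k) t = \<i> * (U (Suc k) t + of_nat (Suc k) * quotient_deriv U k t) / of_real t"

lemma quotient_deriv_has_vector_derivative:
  assumes "\<And>j. j \<le> k \<Longrightarrow> (U j has_vector_derivative \<i> * U (Suc j) t) (at t)" "t \<noteq> 0"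
  shows "(quotient_deriv U k has_vector_derivative \<i> * quotient_deriv U (Suc k) t) (at t)"
proof -
  have div: "((\<lambda>t. f t / of_real t) has_vector_derivative (f' - f t / of_real t) / of_real t) (at t)"
    if "(f has_vector_derivative f') (at t)" for f :: "real \<Rightarrow> complex" and f'
  proof -
    have inv: "((\<lambda>t. complex_of_real (inverse t)) has_vector_derivative complex_of_real (- inverse (t ^ 2))) (at t)"
      using \<open>t \<noteq> 0\<close>
      by (intro has_vector_derivative_of_real)
         (auto intro!: derivative_eq_intros simp: has_real_derivative_iff_has_vector_derivative[symmetric] power2_eq_square)
    have "((\<lambda>t. f t * of_real (inverse t)) has_vector_derivative f t * of_real (- inverse (t ^ 2)) + f' * of_real (inverse t)) (at t)"
      by (rule has_vector_derivative_mult[OF that inv])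
    thus ?thesis using \<open>t \<noteq> 0\<close> by (simp add: divide_inverse power2_eq_square algebra_simps)
  qed
  show ?thesis
    using assms(1)
  proof (induction k)
    case 0
    show ?case
      using div[OF has_vector_derivative_mult_right[OF 0[of 0], of \<i>]] \<open>t \<noteq> 0\<close>
      by (simp add: algebra_simps)
  next
    case (Suc k)
    have "(quotient_deriv U k has_vector_derivative \<i> * quotient_deriv U (Suc k) t) (at t)"
      using Suc by auto
    from div[OF has_vector_derivative_mult_right[OF has_vector_derivative_add[OF Suc.prems[OF order.refl]
        has_vector_derivative_mult_right[OF this, of "of_nat (Suc k)"]], of \<i>]]
    have "((\<lambda>t. \<i> * (U (Suc k) t + of_nat (Suc k) * quotient_deriv U k t) / of_real t) has_vector_derivative
      (\<i> * (\<i> * U (Suc (Suc k)) t + of_nat (Suc k) * (\<i> * quotient_deriv U (Suc k) t)) - quotient_deriv U (Suc k) t) / of_real t) (at t)"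
      by simp
    \<comment> \<open>The quotient rule contributes \<open>- q\<close>, which is
      \<open>\<i> * (\<i> * q)\<close>; this raises the coefficient from \<open>Suc k\<close> to
      \<open>Suc (Suc k)\<close>.\<close>
    moreover have "\<i> * (\<i> * U (Suc (Suc k)) t + of_nat (Suc k) * (\<i> * q)) - q
        = \<i> * (\<i> * (U (Suc (Suc k)) t + of_nat (Suc (Suc k)) * q))" for q :: complex
      by (simp add: algebra_simps)
    ultimately have D: "((\<lambda>t. \<i> * (U (Suc k) t + of_nat (Suc k) * quotient_deriv U k t) / of_real t) has_vector_derivative
      \<i> * (\<i> * (U (Suc (Suc k)) t + of_nat (Suc (Suc k)) * quotient_deriv U (Suc k) t)) / of_real t) (at t)"
      by (simp only:)
    have A: "quotient_deriv U (Suc k) = (\<lambda>t. \<i> * (U (Suc k) t + of_nat (Suc k) * quotient_deriv U k t) / of_real t)"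
      by (rule ext) (rule quotient_deriv.simps)
    have B: "\<i> * quotient_deriv U (Suc (Suc k)) t
      = \<i> * (\<i> * (U (Suc (Suc k)) t + of_nat (Suc (Suc k)) * quotient_deriv U (Suc k) t)) / of_real t"
      by (simp only: quotient_deriv.simps(2)[of U "Suc k"] times_divide_eq_right)
    show ?case unfolding B by (subst A) (rule D)
  qed
qed

section \<open>The discrepancy of distribution functions and its Fourier transform\<close>

locale cdf_approximation =
  law: weighted_measure \<mu> "\<lambda>_. 1" m + dens: weighted_measure lborel \<gamma> m
  for \<mu> :: "real measure" and \<gamma> :: "real \<Rightarrow> real" and m :: nat +
  fixes L :: real
  assumes prob: "prob_space \<mu>"
    and m_pos: "1 \<le> m"
    and density_le: "\<And>x. \<bar>\<gamma> x\<bar> * (1 + \<bar>x\<bar>) ^ m \<le> L"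
    and density_integral: "(LINT x|lborel. \<gamma> x) = 1"
begin

interpretation law_prob: prob_space \<mu> by (rule prob)

definition discrepancy :: "real \<Rightarrow> real" where
  "discrepancy x = measure \<mu> {..x} - (LBINT t:{..x}. \<gamma> t)"

text \<open>For \<open>0 \<le> y\<close> the crossing integral is an upper tail, and the two upper
  tails differ by the negative of the difference of distribution functions because both total masses
  are 1. For \<open>y < 0\<close> it is minus a distribution function directly.\<close>

lemma tail_difference:
  "(LINT x|\<mu>. 1 * crossing x y) - (LINT x|lborel. \<gamma> x * crossing x y) = - discrepancy y"
proof -
  have [simp]: "space \<mu> = UNIV" using sets_eq_imp_space_eq[OF law.sets_N] by simp
  have [simp]: "measure \<mu> UNIV = 1" using law_prob.prob_space by simp
  have [measurable]: "{..y} \<in> sets \<mu>" using law.sets_N by simp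
  have i: "integrable lborel (\<lambda>x. indicator {..y} x * \<gamma> x)"
    using integrable_mult_indicator[of "{..y}" lborel \<gamma>] dens.integrable_weight by simp
  have i': "integrable \<mu> (indicator {..y} :: real \<Rightarrow> real)" by (simp add: law_prob.emeasure_eq_measure)
  show ?thesis
  proof (cases "0 \<le> y")
    case True
    have c: "crossing x y = 1 - indicator {..y} x" for x
      using True by (auto simp: crossing_def indicator_def)
    show ?thesis unfolding c using i i' dens.integrable_weight
      by (simp add: discrepancy_def set_lebesgue_integral_def algebra_simps density_integral law_prob.prob_space)
  next
    case False
    have "crossing x y = - indicator {..y} x" for x
      using False by (auto simp: crossing_def indicator_def)
    thus ?thesis using i i'
      by (simp add: discrepancy_def set_lebesgue_integral_def algebra_simps)
  qed
qed

lemma discrepancy_measurable [measurable]: "discrepancy \<in> borel_measurable borel"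
proof -
  have "discrepancy = (\<lambda>y. - ((LINT x|\<mu>. 1 * crossing x y) - (LINT x|lborel. \<gamma> x * crossing x y)))"
    by (simp only: tail_difference minus_minus)
  also have "\<dots> \<in> borel_measurable borel" by measurable
  finally show ?thesis .
qed

text \<open>Subtracting the two tail representations, the terms with \<open>h 0\<close> cancel since
  both masses are 1. The alternative in \<open>size\<close> covers test functions by their weighted
  variation, and powers times exponentials by their growth.\<close>

lemma expectation_difference:
  fixes h h' :: "real \<Rightarrow> 'b :: {banach, second_countable_topology}"
  assumes h' [measurable]: "h' \<in> borel_measurable borel"
    and FTC: "\<And>a b. a \<le> b \<Longrightarrow> set_integrable lborel {a..b} h' \<and> h b - h a = (LINT x:{a..b}|lborel. h' x)"
    and size: "(\<exists>C. \<forall>y. norm (h' y) \<le> C * (1 + \<bar>y\<bar>) ^ (m - 1)) \<or> integrable lborel (\<lambda>y. norm (h' y) / (1 + \<bar>y\<bar>) ^ m)"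
  shows "integrable \<mu> h"
    and "integrable lborel (\<lambda>x. \<gamma> x *\<^sub>R h x)"
    and "integrable lborel (\<lambda>y. discrepancy y *\<^sub>R h' y)"
    and "(LINT x|\<mu>. h x) - (LINT x|lborel. \<gamma> x *\<^sub>R h x) = - (LINT y|lborel. discrepancy y *\<^sub>R h' y)"
proof -
  have int1: "integrable (\<mu> \<Otimes>\<^sub>M lborel) (\<lambda>(x, y). (1 * crossing x y) *\<^sub>R h' y)"
    using size law.integrable_crossing_of_variation[OF h'] law.integrable_crossing_of_growth[OF h' m_pos] by blast
  have int2: "integrable (lborel \<Otimes>\<^sub>M lborel) (\<lambda>(x, y). (\<gamma> x * crossing x y) *\<^sub>R h' y)"
    using size dens.integrable_crossing_of_variation[OF h'] dens.integrable_crossing_of_growth[OF h' m_pos] by blast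
  note t1 = law.tail_representation[of h' h, OF h' FTC int1]
  note t2 = dens.tail_representation[of h' h, OF h' FTC int2]
  have D: "(LINT x|\<mu>. 1 * crossing x y) *\<^sub>R h' y - (LINT x|lborel. \<gamma> x * crossing x y) *\<^sub>R h' y
      = - (discrepancy y *\<^sub>R h' y)" for y
    by (simp only: scaleR_diff_left[symmetric] tail_difference scaleR_minus_left)
  show "integrable \<mu> h" using t1(1) by simp
  show "integrable lborel (\<lambda>x. \<gamma> x *\<^sub>R h x)" by (rule t2(1))
  have "integrable lborel (\<lambda>y. - (discrepancy y *\<^sub>R h' y))"
    using Bochner_Integration.integrable_diff[OF t1(2) t2(2)] by (simp only: D)
  thus "integrable lborel (\<lambda>y. discrepancy y *\<^sub>R h' y)" by simp
  have "(LINT x|\<mu>. 1 *\<^sub>R h x) - (LINT x|lborel. \<gamma> x *\<^sub>R h x) =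
    (LINT y|lborel. (LINT x|\<mu>. 1 * crossing x y) *\<^sub>R h' y) - (LINT y|lborel. (LINT x|lborel. \<gamma> x * crossing x y) *\<^sub>R h' y)"
    using t1(3) t2(3) by (simp add: density_integral law_prob.prob_space)
  also have "\<dots> = (LINT y|lborel. - (discrepancy y *\<^sub>R h' y))"
    unfolding D[symmetric] using t1(2) t2(2) by (rule Bochner_Integration.integral_diff[symmetric])
  finally show "(LINT x|\<mu>. h x) - (LINT x|lborel. \<gamma> x *\<^sub>R h x) = - (LINT y|lborel. discrepancy y *\<^sub>R h' y)"
    by simp
qed

definition ft_difference :: "nat \<Rightarrow> real \<Rightarrow> complex" where
  "ft_difference k t = weighted_ft \<mu> (\<lambda>_. 1) k t - weighted_ft lborel \<gamma> k t"

lemma ft_difference_has_vector_derivative: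
  assumes "k < m"
  shows "(ft_difference k has_vector_derivative \<i> * ft_difference (Suc k) t) (at t)"
  unfolding ft_difference_def right_diff_distrib
  using assms by (intro has_vector_derivative_diff law.weighted_ft_has_vector_derivative
      dens.weighted_ft_has_vector_derivative) auto

lemma continuous_ft_difference:
  assumes "k \<le> m"
  shows "continuous_on S (ft_difference k)"
  unfolding ft_difference_def
  using continuous_on_subset[OF law.continuous_weighted_ft[OF assms], of S]
    continuous_on_subset[OF dens.continuous_weighted_ft[OF assms], of S]
  by (auto intro!: continuous_on_diff)

text \<open>Taking \<open>y ^ Suc j / real (Suc j)\<close> for \<open>h\<close> makes
  \<open>h'\<close> the power itself, and the growth alternative allows exponents up to
  \<open>m - 1\<close>. The binomial formula then passes to
  \<open>(1 + \<bar>y\<bar>) ^ k\<close>.\<close>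

lemma
  assumes "k < m"
  shows integrable_discrepancy_power: "integrable lborel (\<lambda>y. discrepancy y * (1 + \<bar>y\<bar>) ^ k)"
proof -
  have pw: "integrable lborel (\<lambda>y. discrepancy y * y ^ j)" if "j < m" for j
  proof -
    have "integrable lborel (\<lambda>y. discrepancy y *\<^sub>R y ^ j)"
    proof (rule expectation_difference(3))
      fix a b :: real assume "a \<le> b"
      have "(LBINT x:{a..b}. x ^ j) = b ^ Suc j / real (Suc j) - a ^ Suc j / real (Suc j)"
        unfolding set_lebesgue_integral_def
      proof (rule integral_FTC_atLeastAtMost)
        fix x
        show "((\<lambda>x. x ^ Suc j / real (Suc j)) has_vector_derivative x ^ j) (at x within {a..b})"
          using DERIV_cdivide[OF DERIV_pow[of "Suc j" x "{a..b}"], of "real (Suc j)"]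
          by (simp add: has_real_derivative_iff_has_vector_derivative[symmetric] del: of_nat_Suc power_Suc)
      qed (use \<open>a \<le> b\<close> in \<open>auto intro!: continuous_intros\<close>)
      moreover have "set_integrable lborel {a..b} (\<lambda>x. x ^ j)"
        by (intro borel_integrable_atLeastAtMost' continuous_intros)
      ultimately show "set_integrable lborel {a..b} (\<lambda>x. x ^ j) \<and>
         b ^ Suc j / real (Suc j) - a ^ Suc j / real (Suc j) = (LBINT x:{a..b}. x ^ j)" by simp
    next
      show "(\<exists>C. \<forall>y. norm (y ^ j) \<le> C * (1 + \<bar>y\<bar>) ^ (m - 1)) \<or> integrable lborel (\<lambda>y. norm (y ^ j) / (1 + \<bar>y\<bar>) ^ m)"
        using abs_power_le_one_plus_power[of j "m - 1"] that
        by (intro disjI1 exI[of _ 1]) (simp add: power_abs)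
    qed measurable
    thus ?thesis by simp
  qed
  have "integrable lborel (\<lambda>y. \<Sum>j\<le>k. real (k choose j) * \<bar>discrepancy y * y ^ j\<bar>)"
    using pw assms by (intro Bochner_Integration.integrable_sum integrable_mult_right integrable_abs) auto
  moreover have "(\<Sum>j\<le>k. real (k choose j) * \<bar>discrepancy y * y ^ j\<bar>) = \<bar>discrepancy y\<bar> * (1 + \<bar>y\<bar>) ^ k" for y
    unfolding binomial_ring[of "\<bar>y\<bar>" 1 k, simplified add.commute]
    by (simp add: sum_distrib_left abs_mult power_abs mult_ac)
  ultimately have "integrable lborel (\<lambda>y. \<bar>discrepancy y\<bar> * (1 + \<bar>y\<bar>) ^ k)" by simp
  thus ?thesis
    by (rule Bochner_Integration.integrable_bound) (auto simp: abs_mult)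
qed

lemma discrepancy_weight: "k < m \<Longrightarrow> weighted_measure lborel (\<lambda>y. discrepancy y * y ^ k) (m - 1 - k)"
proof
  assume "k < m"
  show "integrable lborel (\<lambda>y. discrepancy y * y ^ k * (1 + \<bar>y\<bar>) ^ (m - 1 - k))"
  proof (rule Bochner_Integration.integrable_bound)
    show "integrable lborel (\<lambda>y. discrepancy y * (1 + \<bar>y\<bar>) ^ (m - 1))"
      using integrable_discrepancy_power[of "m - 1"] m_pos by simp
    show "AE y in lborel. norm (discrepancy y * y ^ k * (1 + \<bar>y\<bar>) ^ (m - 1 - k)) \<le> norm (discrepancy y * (1 + \<bar>y\<bar>) ^ (m - 1))"
    proof (rule AE_I2)
      fix y :: real
      have "\<bar>y\<bar> ^ k * (1 + \<bar>y\<bar>) ^ (m - 1 - k) \<le> (1 + \<bar>y\<bar>) ^ k * (1 + \<bar>y\<bar>) ^ (m - 1 - k)"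
        by (intro mult_right_mono power_mono) auto
      also have "\<dots> = (1 + \<bar>y\<bar>) ^ (m - 1)" using \<open>k < m\<close> by (simp add: power_add[symmetric])
      finally show "norm (discrepancy y * y ^ k * (1 + \<bar>y\<bar>) ^ (m - 1 - k)) \<le> norm (discrepancy y * (1 + \<bar>y\<bar>) ^ (m - 1))"
        by (simp add: abs_mult power_abs mult.assoc mult_left_mono)
    qed
  qed measurable
qed auto

lemma weighted_ft_discrepancy_power:
  "weighted_ft lborel (\<lambda>y. discrepancy y * y ^ k) 0 = weighted_ft lborel discrepancy k"
  by (simp add: weighted_ft_def fun_eq_iff)

lemma discrepancy_weighted_measure: "weighted_measure lborel discrepancy (m - 1)"
  using discrepancy_weight[of 0] m_pos by simp

text \<open>The test function is \<open>y ^ k * iexp (t * y)\<close>; the two terms of its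
  derivative give the two transforms. For \<open>k = 0\<close> the index \<open>k - 1\<close> is
  truncated to 0, harmlessly since the factor \<open>k\<close> vanishes.\<close>

lemma ft_difference_eq:
  assumes "k < m"
  shows "ft_difference k t = - (of_nat k * weighted_ft lborel discrepancy (k - 1) t
    + \<i> * of_real t * weighted_ft lborel discrepancy k t)"
proof -
  interpret disc: weighted_measure lborel discrepancy "m - 1" by (rule discrepancy_weighted_measure)
  define h where "h y = complex_of_real (y ^ k) * iexp (t * y)" for y
  define h' where "h' y = of_nat k * (of_real (y ^ (k - 1)) * iexp (t * y)) + \<i> * of_real t * (of_real (y ^ k) * iexp (t * y))" for y
  have cont: "continuous_on S h'" for S unfolding h'_def by (intro continuous_intros)
  have deriv: "(h has_vector_derivative h' y) (at y within S)" for y S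
  proof -
    have 1: "((\<lambda>y. complex_of_real (y ^ k)) has_vector_derivative of_real (real k * y ^ (k - 1))) (at y within S)"
      by (intro has_vector_derivative_of_real) (auto intro!: derivative_eq_intros simp: has_real_derivative_iff_has_vector_derivative[symmetric])
    show ?thesis
      unfolding h_def h'_def
      using has_vector_derivative_mult[OF 1 iexp_has_vector_derivative[of t y S]]
      by (simp add: algebra_simps)
  qed
  have [measurable]: "h' \<in> borel_measurable borel"
    using cont[of UNIV] by (rule borel_measurable_continuous_onI)
  have "(LINT x|\<mu>. h x) - (LINT x|lborel. \<gamma> x *\<^sub>R h x) = - (LINT y|lborel. discrepancy y *\<^sub>R h' y)"
  proof (rule expectation_difference(4))
    fix a b :: real assume "a \<le> b"
    have "(LBINT x:{a..b}. h' x) = h b - h a"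
      unfolding set_lebesgue_integral_def
      using \<open>a \<le> b\<close> deriv cont by (intro integral_FTC_atLeastAtMost)
    thus "set_integrable lborel {a..b} h' \<and> h b - h a = (LBINT x:{a..b}. h' x)"
      using cont by (auto intro!: borel_integrable_atLeastAtMost')
  next
    have "norm (h' y) \<le> (real k + \<bar>t\<bar>) * (1 + \<bar>y\<bar>) ^ (m - 1)" for y
    proof -
      have "norm (h' y) \<le> real k * \<bar>y\<bar> ^ (k - 1) + \<bar>t\<bar> * \<bar>y\<bar> ^ k"
        unfolding h'_def by (rule order_trans[OF norm_triangle_ineq]) (simp add: norm_mult norm_power)
      also have "\<dots> \<le> real k * (1 + \<bar>y\<bar>) ^ (m - 1) + \<bar>t\<bar> * (1 + \<bar>y\<bar>) ^ (m - 1)"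
        using assms by (intro add_mono mult_left_mono abs_power_le_one_plus_power) auto
      finally show ?thesis by (simp add: algebra_simps)
    qed
    thus "(\<exists>C. \<forall>y. norm (h' y) \<le> C * (1 + \<bar>y\<bar>) ^ (m - 1)) \<or> integrable lborel (\<lambda>y. norm (h' y) / (1 + \<bar>y\<bar>) ^ m)"
      by blast
  qed measurable
  moreover have "(LINT x|\<mu>. h x) - (LINT x|lborel. \<gamma> x *\<^sub>R h x) = ft_difference k t"
    unfolding ft_difference_def weighted_ft_def h_def by (simp add: scaleR_conv_of_real mult.assoc)
  moreover have "(LINT y|lborel. discrepancy y *\<^sub>R h' y) = of_nat k * weighted_ft lborel discrepancy (k - 1) t
    + \<i> * of_real t * weighted_ft lborel discrepancy k t"
  proof -
    have "discrepancy y *\<^sub>R h' y = of_nat k * (of_real (discrepancy y * y ^ (k - 1)) * iexp (t * y))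
       + \<i> * of_real t * (of_real (discrepancy y * y ^ k) * iexp (t * y))" for y
      unfolding h'_def by (simp add: scaleR_conv_of_real algebra_simps)
    thus ?thesis
      unfolding weighted_ft_def
      using disc.integrable_weighted_exp[of "k - 1" t] disc.integrable_weighted_exp[of k t] assms by simp
  qed
  ultimately show ?thesis by simp
qed

text \<open>Solving the previous relation for the transform of order \<open>k\<close> reproduces the
  recursion of \<open>quotient_deriv\<close>. At \<open>t = 0\<close> the quotient is a default 0
  and carries no information, so later uses discard that point as a null set or stay on positive
  frequencies.\<close>

lemma weighted_ft_discrepancy_eq:
  assumes "k < m" "t \<noteq> 0"
  shows "weighted_ft lborel discrepancy k t = quotient_deriv ft_difference k t"
  using assms(1)
proof (induction k)
  case 0
  thus ?case using ft_difference_eq[of 0 t] \<open>t \<noteq> 0\<close> by simp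
next
  case (Suc k)
  hence "weighted_ft lborel discrepancy k t = quotient_deriv ft_difference k t" by simp
  with ft_difference_eq[OF Suc.prems, of t]
  have "ft_difference (Suc k) t = - (of_nat (Suc k) * quotient_deriv ft_difference k t
      + \<i> * of_real t * weighted_ft lborel discrepancy (Suc k) t)"
    by simp
  moreover have "\<i> * (- (a + \<i> * b * c) + a) = b * c" for a b c :: complex
    by (simp add: algebra_simps)
  ultimately have "\<i> * (ft_difference (Suc k) t + of_nat (Suc k) * quotient_deriv ft_difference k t)
      = of_real t * weighted_ft lborel discrepancy (Suc k) t"
    by (simp only:)
  thus ?case using \<open>t \<noteq> 0\<close> by simp
qed

lemma fejer_integral_eq:
  assumes "0 < T"
    and int: "integrable lborel (\<lambda>y. of_real (E y) * (LBINT t:{0..T}. fejer_symbol T x t * iexp (t * y)))"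
    and [measurable]: "E \<in> borel_measurable borel"
  shows "(LINT y|lborel. E y * fejer T (x - y))
    = Re (LINT y|lborel. of_real (E y) * (LBINT t:{0..T}. fejer_symbol T x t * iexp (t * y)))"
proof -
  have "(LINT y|lborel. E y * fejer T (x - y))
    = (LINT y|lborel. Re (of_real (E y) * (LBINT t:{0..T}. fejer_symbol T x t * iexp (t * y))))"
  proof (rule integral_cong_AE)
    show "AE y in lborel. E y * fejer T (x - y) = Re (of_real (E y) * (LBINT t:{0..T}. fejer_symbol T x t * iexp (t * y)))"
      using AE_lborel_singleton[of x]
    proof eventually_elim
      case (elim y)
      thus ?case using integral_fejer_symbol[OF \<open>0 < T\<close>, of y x] by simp
    qed
    show "(\<lambda>y. Re (of_real (E y) * (LBINT t:{0..T}. fejer_symbol T x t * iexp (t * y)))) \<in> borel_measurable lborel"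
      using borel_measurable_integrable[OF int] by measurable
  qed measurable
  thus ?thesis by (simp only: integral_Re[OF int])
qed

lemma set_integral_symbol_bound:
  fixes Q :: "real \<Rightarrow> complex"
  assumes "0 < T" and Q: "set_integrable lborel {0..T} Q"
  shows "set_integrable lborel {0..T} (\<lambda>t. fejer_symbol T x t * Q t)"
    and "\<bar>Re (LBINT t:{0..T}. fejer_symbol T x t * Q t)\<bar> \<le> (LBINT t:{0..T}. cmod (Q t))"
proof -
  have [measurable]: "fejer_symbol T x \<in> borel_measurable borel"
    by (intro borel_measurable_continuous_onI continuous_intros)
  have le: "cmod (indicator {0..T} t *\<^sub>R (fejer_symbol T x t * Q t)) \<le> indicator {0..T} t *\<^sub>R cmod (Q t)" for t
    using fejer_symbol_bound[OF \<open>0 < T\<close>, of t x] by (auto simp: indicator_def norm_mult mult_left_le_one_le)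
  have eq: "indicator {0..T} t *\<^sub>R (fejer_symbol T x t * Q t) = fejer_symbol T x t * (indicator {0..T} t *\<^sub>R Q t)" for t
    by simp
  have Q': "integrable lborel (\<lambda>t. indicator {0..T} t *\<^sub>R cmod (Q t))"
    using set_integrable_norm[OF Q] by (simp add: set_integrable_def)
  have meas: "(\<lambda>t. indicator {0..T} t *\<^sub>R (fejer_symbol T x t * Q t)) \<in> borel_measurable lborel"
    unfolding eq using borel_measurable_integrable[OF Q[unfolded set_integrable_def]] by measurable
  show int: "set_integrable lborel {0..T} (\<lambda>t. fejer_symbol T x t * Q t)"
    unfolding set_integrable_def
    by (rule Bochner_Integration.integrable_bound[OF Q' meas]) (use le in auto)
  have "\<bar>Re (LBINT t:{0..T}. fejer_symbol T x t * Q t)\<bar> \<le> cmod (LBINT t:{0..T}. fejer_symbol T x t * Q t)"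
    by (rule abs_Re_le_cmod)
  also have "\<dots> \<le> (LINT t|lborel. cmod (indicator {0..T} t *\<^sub>R (fejer_symbol T x t * Q t)))"
    unfolding set_lebesgue_integral_def by (rule integral_norm_bound)
  also have "\<dots> \<le> (LBINT t:{0..T}. cmod (Q t))"
    unfolding set_lebesgue_integral_def
    using int[unfolded set_integrable_def] by (intro integral_mono Q' le integrable_norm)
  finally show "\<bar>Re (LBINT t:{0..T}. fejer_symbol T x t * Q t)\<bar> \<le> (LBINT t:{0..T}. cmod (Q t))" .
qed

text \<open>For exponents below \<open>m\<close> the product \<open>discrepancy y * y ^ k\<close> is
  integrable, so Parseval's identity applies directly.\<close>

lemma smoothed_discrepancy_le:
  assumes "k < m" "0 < T"
  shows "\<bar>LINT y|lborel. (discrepancy y * y ^ k) * fejer T (x - y)\<bar>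
    \<le> (LBINT t:{0..T}. cmod (quotient_deriv ft_difference k t))"
proof -
  interpret disc: weighted_measure lborel discrepancy "m - 1" by (rule discrepancy_weighted_measure)
  interpret disck: weighted_measure lborel "\<lambda>y. discrepancy y * y ^ k" "m - 1 - k"
    by (rule discrepancy_weight[OF assms(1)])
  note F = disck.integral_fourier_Fubini[OF continuous_fejer_symbol[of "{0..T}" T x], unfolded weighted_ft_discrepancy_power]
  have AE: "AE t in lborel. weighted_ft lborel discrepancy k t = quotient_deriv ft_difference k t"
    using AE_lborel_singleton[of 0] by eventually_elim (use weighted_ft_discrepancy_eq[OF assms(1)] in auto)
  have cont: "continuous_on S (weighted_ft lborel discrepancy k)" for S
    using continuous_on_subset[OF disc.continuous_weighted_ft, of k S] assms by simp
  have q: "set_integrable lborel {0..T} (weighted_ft lborel discrepancy k)"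
    by (intro borel_integrable_atLeastAtMost' cont)
  have "(LINT y|lborel. (discrepancy y * y ^ k) * fejer T (x - y))
    = Re (LBINT t:{0..T}. fejer_symbol T x t * weighted_ft lborel discrepancy k t)"
    unfolding F(2)[symmetric] by (rule fejer_integral_eq[OF assms(2) F(1)]) measurable
  hence "\<bar>LINT y|lborel. (discrepancy y * y ^ k) * fejer T (x - y)\<bar> \<le> (LBINT t:{0..T}. cmod (weighted_ft lborel discrepancy k t))"
    using set_integral_symbol_bound(2)[OF assms(2) q, of x] by simp
  also have "\<dots> = (LBINT t:{0..T}. cmod (quotient_deriv ft_difference k t))"
  proof -
    have [measurable]: "ft_difference j \<in> borel_measurable borel" if "j \<le> m" for j
      using continuous_ft_difference[OF that, of UNIV] by (rule borel_measurable_continuous_onI)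
    have [measurable]: "quotient_deriv ft_difference j \<in> borel_measurable borel" if "j \<le> m" for j
      using that
    proof (induction j)
      case 0
      have "quotient_deriv ft_difference 0 = (\<lambda>t. \<i> * ft_difference 0 t / of_real t)" by auto
      then show ?case by simp
    next
      case (Suc j)
      hence [measurable]: "quotient_deriv ft_difference j \<in> borel_measurable borel"
        "ft_difference (Suc j) \<in> borel_measurable borel" by auto
      have "quotient_deriv ft_difference (Suc j) = (\<lambda>t. \<i> * (ft_difference (Suc j) t + of_nat (Suc j) * quotient_deriv ft_difference j t) / of_real t)" by auto
      then show ?case by (simp del: of_nat_Suc)
    qed
    have [measurable]: "weighted_ft lborel discrepancy k \<in> borel_measurable borel"
      by (intro borel_measurable_continuous_onI cont)
    show ?thesis
      unfolding set_lebesgue_integral_def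
      by (intro integral_cong_AE) (use AE assms in auto)
  qed
  finally show ?thesis .
qed

text \<open>For exponent \<open>m\<close> there is no transform to pair with. One factor
  \<open>y\<close> goes to the symbol as its frequency derivative, paired with the transform
  \<open>q\<close> of order \<open>m - 1\<close>; integrating by parts in the frequency then moves
  the derivative onto \<open>q\<close>. The boundary term \<open>- q 0\<close> cancels the constant
  produced by \<open>integral_fejer_symbol_times\<close>.\<close>

lemma smoothed_discrepancy_top_le:
  assumes "0 < T" and Q: "set_integrable lborel {0..T} (quotient_deriv ft_difference m)"
  shows "\<bar>LINT y|lborel. (discrepancy y * y ^ m) * fejer T (x - y)\<bar>
    \<le> (LBINT t:{0..T}. cmod (quotient_deriv ft_difference m t))"
proof -
  define k where "k = m - 1"
  have k: "k < m" "m = Suc k" using m_pos by (auto simp: k_def)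
  interpret disc: weighted_measure lborel discrepancy "m - 1" by (rule discrepancy_weighted_measure)
  interpret disck: weighted_measure lborel "\<lambda>y. discrepancy y * y ^ k" "m - 1 - k"
    by (rule discrepancy_weight[OF k(1)])
  define q where "q = weighted_ft lborel discrepancy k"
  note F = disck.integral_fourier_Fubini[OF continuous_fejer_symbol_deriv[of "{0..T}" T x], unfolded weighted_ft_discrepancy_power, folded q_def]
  have cont: "continuous_on S q" for S
    using continuous_on_subset[OF disc.continuous_weighted_ft, of k S] unfolding q_def k_def by simp
  have q': "(q has_vector_derivative \<i> * quotient_deriv ft_difference m t) (at t)" if "0 < t" for t
  proof (rule has_vector_derivative_transform_within_open)
    show "(quotient_deriv ft_difference k has_vector_derivative \<i> * quotient_deriv ft_difference m t) (at t)"
      unfolding k(2) using that k by (intro quotient_deriv_has_vector_derivative ft_difference_has_vector_derivative) auto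
    show "open {0 :: real<..}" "t \<in> {0<..}" using that by auto
    show "quotient_deriv ft_difference k s = q s" if "s \<in> {0<..}" for s
      using weighted_ft_discrepancy_eq[OF k(1), of s] that by (simp add: q_def)
  qed
  have i1: "set_integrable lborel {0..T} (\<lambda>t. fejer_symbol_deriv T x t * q t)"
    by (intro borel_integrable_atLeastAtMost' continuous_intros cont)
  note i2 = set_integral_symbol_bound(1)[OF assms, of x]
  have i2': "set_integrable lborel {0..T} (\<lambda>t. \<i> * (fejer_symbol T x t * quotient_deriv ft_difference m t))"
    using i2 by simp
  \<comment> \<open>\<open>q\<close> is known to be differentiable only at positive frequencies, but
    it is continuous at 0, so the interior form of the fundamental theorem applies; the assumed
    integrability turns the result into a Lebesgue integral.\<close>
  have "((\<lambda>t. fejer_symbol_deriv T x t * q t + \<i> * (fejer_symbol T x t * quotient_deriv ft_difference m t))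
    has_integral fejer_symbol T x T * q T - fejer_symbol T x 0 * q 0) {0..T}"
  proof (rule fundamental_theorem_of_calculus_interior)
    fix t assume "t \<in> {0<..<T}"
    thus "((\<lambda>t. fejer_symbol T x t * q t) has_vector_derivative
       fejer_symbol_deriv T x t * q t + \<i> * (fejer_symbol T x t * quotient_deriv ft_difference m t)) (at t)"
      using has_vector_derivative_mult[OF fejer_symbol_has_vector_derivative[of T x t UNIV] q'[of t]]
      by (simp add: algebra_simps)
  qed (use assms cont in \<open>auto intro!: continuous_intros\<close>)
  hence "(LBINT t:{0..T}. fejer_symbol_deriv T x t * q t + \<i> * (fejer_symbol T x t * quotient_deriv ft_difference m t))
     = fejer_symbol T x T * q T - fejer_symbol T x 0 * q 0"
    using set_borel_integral_eq_integral(2)[OF set_integral_add(1)[OF i1 i2']] by (simp add: integral_unique)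
  also have "\<dots> = - q 0" using \<open>0 < T\<close> by (simp add: fejer_symbol_def)
  finally have parts: "(LBINT t:{0..T}. fejer_symbol_deriv T x t * q t)
      + \<i> * (LBINT t:{0..T}. fejer_symbol T x t * quotient_deriv ft_difference m t) = - q 0"
    using i1 i2' by (simp add: set_integral_add(2))
  have pt: "of_real (discrepancy y * y ^ m) * (LBINT t:{0..T}. fejer_symbol T x t * iexp (t * y))
     = \<i> * of_real (discrepancy y * y ^ k) + \<i> * (of_real (discrepancy y * y ^ k) * (LBINT t:{0..T}. fejer_symbol_deriv T x t * iexp (t * y)))" for y
  proof -
    have "of_real (discrepancy y * y ^ m) * (LBINT t:{0..T}. fejer_symbol T x t * iexp (t * y))
      = of_real (discrepancy y * y ^ k) * (of_real y * (LBINT t:{0..T}. fejer_symbol T x t * iexp (t * y)))"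
      by (simp add: k(2))
    thus ?thesis unfolding integral_fejer_symbol_times[OF \<open>0 < T\<close>] by (simp add: algebra_simps)
  qed
  have i3: "integrable lborel (\<lambda>y. complex_of_real (discrepancy y * y ^ k))"
    using disck.integrable_weight by (intro integrable_of_real)
  have q0: "q 0 = (LINT y|lborel. of_real (discrepancy y * y ^ k))"
    by (simp add: q_def weighted_ft_def)
  have "(LINT y|lborel. of_real (discrepancy y * y ^ m) * (LBINT t:{0..T}. fejer_symbol T x t * iexp (t * y)))
     = \<i> * q 0 + \<i> * (LBINT t:{0..T}. fejer_symbol_deriv T x t * q t)"
    unfolding pt q0 F(2)[symmetric]
    using i3 F(1) by (subst Bochner_Integration.integral_add) (auto simp del: of_real_mult)
  also have "\<dots> = (LBINT t:{0..T}. fejer_symbol T x t * quotient_deriv ft_difference m t)"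
  proof -
    have "\<i> * c + \<i> * a = b" if "a + \<i> * b = - c" for a b c :: complex
    proof -
      have "\<i> * c + \<i> * a = \<i> * (a - (- c))" by (simp add: algebra_simps)
      also have "\<dots> = b" unfolding that[symmetric] by (simp add: algebra_simps)
      finally show ?thesis .
    qed
    from this[OF parts] show ?thesis .
  qed
  finally have "(LINT y|lborel. (discrepancy y * y ^ m) * fejer T (x - y))
    = Re (LBINT t:{0..T}. fejer_symbol T x t * quotient_deriv ft_difference m t)"
    by (subst fejer_integral_eq[OF \<open>0 < T\<close>])
       (use i3 F(1) in \<open>auto simp: pt simp del: of_real_mult intro!: Bochner_Integration.integrable_add integrable_mult_right\<close>)
  thus ?thesis using set_integral_symbol_bound(2)[OF assms, of x] by simp
qed

end

section \<open>One-sided increments and absorption\<close>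

context cdf_approximation
begin

interpretation law_prob: prob_space \<mu> by (rule prob)

lemma L_nonneg: "0 \<le> L"
  using density_le[of 0] by simp

lemma discrepancy_increment:
  assumes "u \<le> v"
  shows "discrepancy v - discrepancy u = measure \<mu> {u<..v} - (LBINT t:{u<..v}. \<gamma> t)"
proof -
  have [measurable]: "{..u} \<in> sets \<mu>" "{..v} \<in> sets \<mu>" using law.sets_N by auto
  have "{u<..v} = {..v} - {..u}" by auto
  hence "measure \<mu> {u<..v} = measure \<mu> {..v} - measure \<mu> {..u}"
    using assms by (simp add: law_prob.finite_measure_Diff)
  moreover have "(LBINT t:{..v}. \<gamma> t) = (LBINT t:{..u}. \<gamma> t) + (LBINT t:{u<..v}. \<gamma> t)"
  proof -
    have si: "set_integrable lborel S \<gamma>" if "S \<in> sets borel" for S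
      unfolding set_integrable_def using that by (intro integrable_mult_indicator dens.integrable_weight) auto
    have "{..v} = {..u} \<union> {u<..v}" using assms by auto
    moreover have "(LBINT t:{..u} \<union> {u<..v}. \<gamma> t) = (LBINT t:{..u}. \<gamma> t) + (LBINT t:{u<..v}. \<gamma> t)"
      by (rule set_integral_Un) (auto intro: si)
    ultimately show ?thesis by (simp only:)
  qed
  ultimately show ?thesis by (simp add: discrepancy_def)
qed

text \<open>The weight may be evaluated at \<open>z\<close> instead of \<open>t\<close>: on an
  interval of length at most 1, \<open>\<bar>z\<bar> \<le> 1 + \<bar>t\<bar>\<close>. So
  \<open>L\<close> acts as a weighted Lipschitz constant for the primitive of
  \<open>\<gamma>\<close>.\<close>

lemma density_increment:
  assumes "u \<le> z" "z \<le> v" "v - u \<le> 1" "j \<le> m"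
  shows "\<bar>z\<bar> ^ j * \<bar>LBINT t:{u<..v}. \<gamma> t\<bar> \<le> L * (v - u)"
proof -
  have int: "integrable lborel (\<lambda>t. indicator {u<..v} t *\<^sub>R \<gamma> t)"
    by (intro integrable_mult_indicator dens.integrable_weight) auto
  have "\<bar>z\<bar> ^ j * \<bar>LBINT t:{u<..v}. \<gamma> t\<bar> \<le> \<bar>z\<bar> ^ j * (LINT t|lborel. norm (indicator {u<..v} t *\<^sub>R \<gamma> t))"
    unfolding set_lebesgue_integral_def real_norm_def[symmetric]
    by (intro mult_left_mono integral_norm_bound) auto
  also have "\<dots> = (LINT t|lborel. \<bar>z\<bar> ^ j * norm (indicator {u<..v} t *\<^sub>R \<gamma> t))" by simp
  also have "\<dots> \<le> (LINT t|lborel. L * indicator {u<..v} t)"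
  proof (rule integral_mono)
    show "integrable lborel (\<lambda>t. \<bar>z\<bar> ^ j * norm (indicator {u<..v} t *\<^sub>R \<gamma> t))"
      using int by (intro integrable_mult_right integrable_norm)
    fix t
    show "\<bar>z\<bar> ^ j * norm (indicator {u<..v} t *\<^sub>R \<gamma> t) \<le> L * indicator {u<..v} t"
    proof (cases "t \<in> {u<..v}")
      case True
      hence "\<bar>z\<bar> \<le> 1 + \<bar>t\<bar>" using assms by auto
      hence "\<bar>z\<bar> ^ j \<le> (1 + \<bar>t\<bar>) ^ j" by (intro power_mono) auto
      also have "\<dots> \<le> (1 + \<bar>t\<bar>) ^ m" using assms by (intro power_increasing) auto
      finally have "\<bar>z\<bar> ^ j * \<bar>\<gamma> t\<bar> \<le> (1 + \<bar>t\<bar>) ^ m * \<bar>\<gamma> t\<bar>" by (intro mult_right_mono) auto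
      thus ?thesis using density_le[of t] True by (simp add: mult.commute)
    qed auto
  qed (use assms in auto)
  also have "\<dots> = L * (v - u)" using assms by simp
  finally show ?thesis .
qed

text \<open>Moving to the right, monotonicity of the law lets \<open>discrepancy\<close> drop only
  at the rate of the density part. Where the power is negative the same holds for the product when
  moving to the left, which is the alternative in \<open>side\<close>. The sign condition concerns
  only \<open>z\<close>, which may be either of the two points, so the lemma yields lower and upper
  bounds at a fixed point. The change of the power itself is paid for by
  \<open>\<delta>\<close>.\<close>

lemma weighted_discrepancy_increment:
  assumes \<delta>: "\<And>z. (1 + \<bar>z\<bar>) ^ m * \<bar>discrepancy z\<bar> \<le> \<delta>"
    and near: "\<bar>y - x\<bar> \<le> 1" and j: "j \<le> m"
    and z: "(z = x \<and> z' = y) \<or> (z = y \<and> z' = x)"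
    and side: "(x \<le> y \<and> 0 \<le> z ^ j) \<or> (y \<le> x \<and> z ^ j \<le> 0)"
  shows "discrepancy x * x ^ j \<le> discrepancy y * y ^ j + \<bar>y - x\<bar> * (L + real m * \<delta>)"
proof -
  have "z ^ j * (discrepancy y - discrepancy x) \<ge> - (L * \<bar>y - x\<bar>)"
    using side
  proof
    assume a: "x \<le> y \<and> 0 \<le> z ^ j"
    have "z ^ j * (discrepancy y - discrepancy x) \<ge> - (z ^ j * \<bar>LBINT t:{x<..y}. \<gamma> t\<bar>)"
    proof -
      have "- \<bar>LBINT t:{x<..y}. \<gamma> t\<bar> \<le> discrepancy y - discrepancy x"
        using discrepancy_increment[of x y] a measure_nonneg[of \<mu> "{x<..y}"] by linarith
      from mult_left_mono[OF this, of "z ^ j"] a show ?thesis by simp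
    qed
    moreover have "x \<le> z" "z \<le> y" using a z by auto
    hence "z ^ j * \<bar>LBINT t:{x<..y}. \<gamma> t\<bar> \<le> L * (y - x)"
      using density_increment[of x z y j] a z near j by (simp add: power_abs[symmetric])
    ultimately show ?thesis using a by simp
  next
    assume a: "y \<le> x \<and> z ^ j \<le> 0"
    have "z ^ j * (discrepancy y - discrepancy x) \<ge> z ^ j * \<bar>LBINT t:{y<..x}. \<gamma> t\<bar>"
    proof -
      have "discrepancy y - discrepancy x \<le> \<bar>LBINT t:{y<..x}. \<gamma> t\<bar>"
        using discrepancy_increment[of y x] a measure_nonneg[of \<mu> "{y<..x}"] by linarith
      from mult_left_mono_neg[OF this, of "z ^ j"] a show ?thesis by simp
    qed
    moreover have "y \<le> z" "z \<le> x" using a z by auto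
    hence "- (z ^ j) * \<bar>LBINT t:{y<..x}. \<gamma> t\<bar> \<le> L * (x - y)"
      using density_increment[of y z x j] a z near j by (simp add: power_abs[symmetric])
    ultimately show ?thesis using a by simp
  qed
  moreover have "\<bar>(y ^ j - x ^ j) * discrepancy z'\<bar> \<le> \<bar>y - x\<bar> * (real m * \<delta>)"
  proof -
    have "\<bar>y ^ j - x ^ j\<bar> \<le> real j * (1 + \<bar>z'\<bar>) ^ j * \<bar>y - x\<bar>"
      using near z by (intro abs_power_diff_le) auto
    also have "\<dots> \<le> real m * (1 + \<bar>z'\<bar>) ^ m * \<bar>y - x\<bar>"
      using j by (intro mult_right_mono mult_mono power_increasing) auto
    finally have "\<bar>(y ^ j - x ^ j) * discrepancy z'\<bar> \<le> real m * (1 + \<bar>z'\<bar>) ^ m * \<bar>y - x\<bar> * \<bar>discrepancy z'\<bar>"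
      unfolding abs_mult by (intro mult_right_mono) auto
    also have "\<dots> = real m * \<bar>y - x\<bar> * ((1 + \<bar>z'\<bar>) ^ m * \<bar>discrepancy z'\<bar>)" by (simp add: mult_ac)
    also have "\<dots> \<le> real m * \<bar>y - x\<bar> * \<delta>" by (intro mult_left_mono \<delta>) auto
    finally show ?thesis by (simp add: mult_ac)
  qed
  \<comment> \<open>The difference of products is split so that the power sits at \<open>z\<close>
    and the remaining \<open>discrepancy\<close> at the other point \<open>z'\<close>.\<close>
  moreover have "discrepancy y * y ^ j - discrepancy x * x ^ j
      = z ^ j * (discrepancy y - discrepancy x) + (y ^ j - x ^ j) * discrepancy z'"
    using z by (auto simp: algebra_simps)
  moreover have "\<bar>y - x\<bar> * (L + real m * \<delta>) = L * \<bar>y - x\<bar> + \<bar>y - x\<bar> * (real m * \<delta>)"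
    by (simp add: algebra_simps)
  ultimately show ?thesis by linarith
qed

text \<open>The window of half-width \<open>A / T\<close> must lie on the side of \<open>x\<close>
  towards which the weighted discrepancy cannot drop, so its centre is displaced by its own
  half-width; distances then reach \<open>2 * A / T\<close>. The factor 3 / 2 is the price of
  absorbing \<open>s / 3\<close>.\<close>

lemma weighted_discrepancy_le:
  assumes \<delta>: "\<And>z. (1 + \<bar>z\<bar>) ^ m * \<bar>discrepancy z\<bar> \<le> \<delta>"
    and T: "0 < T" "2 * A \<le> T" and j: "j \<le> m"
    and A: "0 < A" and p: "(LBINT u:{- A..A}. fejer 1 u) = p" "0 < p" "(LINT u|lborel. fejer 1 u) \<le> 4 / 3 * p"
    and J: "\<And>x. \<bar>LINT y|lborel. (discrepancy y * y ^ j) * fejer T (x - y)\<bar> \<le> I"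
  shows "\<bar>discrepancy x * x ^ j\<bar> \<le> 3 / 2 * (2 * A / T * (L + real m * \<delta>) + I / p)"
proof (rule sup_absorption[where E = "\<lambda>x. discrepancy x * x ^ j"])
  fix z
  have "\<bar>discrepancy z * z ^ j\<bar> \<le> (1 + \<bar>z\<bar>) ^ m * \<bar>discrepancy z\<bar>"
    using mult_right_mono[OF abs_power_le_one_plus_power[OF j, of z], of "\<bar>discrepancy z\<bar>"]
    by (simp add: abs_mult power_abs mult.commute)
  thus "\<bar>discrepancy z * z ^ j\<bar> \<le> \<delta>" using \<delta>[of z] by linarith
next
  fix s x assume s: "\<And>y. \<bar>discrepancy y * y ^ j\<bar> \<le> s"
  define a where "a = A / T"
  define \<epsilon> where "\<epsilon> = 2 * A / T * (L + real m * \<delta>)"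
  have a: "0 < a" "2 * a \<le> 1" using T A by (auto simp: a_def)
  have \<delta>0: "0 \<le> L + real m * \<delta>"
    using L_nonneg order_trans[OF _ \<delta>[of 0], of 0] by (intro add_nonneg_nonneg mult_nonneg_nonneg) auto
  have small: "\<bar>y - x\<bar> * (L + real m * \<delta>) \<le> \<epsilon>" if "\<bar>y - x\<bar> \<le> 2 * a" for y x
    using mult_right_mono[OF that \<delta>0] by (simp add: \<epsilon>_def a_def)
  have lower: "discrepancy x * x ^ j \<le> \<epsilon> + I / p + s / 3" for x
  proof -
    define c where "c = (if 0 \<le> x ^ j then x + a else x - a)"
    have "discrepancy x * x ^ j - \<epsilon> \<le> I / p + s / 3"
    proof (rule smoothing_window[where E = "\<lambda>x. discrepancy x * x ^ j" and c = c, OF _ s T(1) p])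
      fix y assume y: "\<bar>y - c\<bar> \<le> A / T"
      have y2: "\<bar>y - x\<bar> \<le> 2 * a"
        using y a by (auto simp: c_def a_def[symmetric] abs_le_iff split: if_splits)
      moreover have "(x \<le> y \<and> 0 \<le> x ^ j) \<or> (y \<le> x \<and> x ^ j \<le> 0)"
        using y by (auto simp: c_def a_def[symmetric] abs_le_iff split: if_splits)
      ultimately have "discrepancy x * x ^ j \<le> discrepancy y * y ^ j + \<bar>y - x\<bar> * (L + real m * \<delta>)"
        using a j by (intro weighted_discrepancy_increment[where z = x and z' = y] \<delta>) auto
      with small[OF y2] show "discrepancy x * x ^ j - \<epsilon> \<le> discrepancy y * y ^ j" by linarith
    next
      show "(LINT y|lborel. discrepancy y * y ^ j * fejer T (c - y)) \<le> I" using J[of c] by linarith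
    qed measurable
    thus ?thesis by simp
  qed
  have upper: "- (discrepancy x * x ^ j) \<le> \<epsilon> + I / p + s / 3" for x
  proof -
    \<comment> \<open>For the negated function the admissible side is the opposite one.\<close>
    define c where "c = (if 0 \<le> x ^ j then x - a else x + a)"
    have "- (discrepancy x * x ^ j) - \<epsilon> \<le> I / p + s / 3"
    proof (rule smoothing_window[where E = "\<lambda>x. - (discrepancy x * x ^ j)" and c = c, OF _ _ T(1) p])
      fix y assume y: "\<bar>y - c\<bar> \<le> A / T"
      have y2: "\<bar>x - y\<bar> \<le> 2 * a"
        using y a by (auto simp: c_def a_def[symmetric] abs_le_iff split: if_splits)
      have "(y \<le> x \<and> 0 \<le> x ^ j) \<or> (x \<le> y \<and> x ^ j \<le> 0)"
        using y by (auto simp: c_def a_def[symmetric] abs_le_iff split: if_splits)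
      hence "discrepancy y * y ^ j \<le> discrepancy x * x ^ j + \<bar>x - y\<bar> * (L + real m * \<delta>)"
        using a j y2 by (intro weighted_discrepancy_increment[where z = x and z' = y] \<delta>) auto
      with small[OF y2] show "- (discrepancy x * x ^ j) - \<epsilon> \<le> - (discrepancy y * y ^ j)" by linarith
    next
      show "(LINT y|lborel. - (discrepancy y * y ^ j) * fejer T (c - y)) \<le> I" using J[of c] by simp
    qed (use s in auto)
    thus ?thesis by simp
  qed
  show "\<bar>discrepancy x * x ^ j\<bar> \<le> 2 * A / T * (L + real m * \<delta>) + I / p + s / 3"
    using lower[of x] upper[of x] by (simp add: \<epsilon>_def abs_le_iff)
qed

text \<open>Markov's inequality for both tails; it provides the finite supremum that makes the two
  absorptions legitimate.\<close>

lemma discrepancy_bounded: "\<exists>c. \<forall>x. (1 + \<bar>x\<bar>) ^ m * \<bar>discrepancy x\<bar> \<le> c"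
proof (intro exI allI)
  fix y
  let ?c1 = "LINT x|\<mu>. \<bar>1 :: real\<bar> * (1 + \<bar>x\<bar>) ^ m" and ?c2 = "LINT x|lborel. \<bar>\<gamma> x\<bar> * (1 + \<bar>x\<bar>) ^ m"
  have "\<bar>discrepancy y\<bar> = \<bar>(LINT x|\<mu>. 1 * crossing x y) - (LINT x|lborel. \<gamma> x * crossing x y)\<bar>"
    by (simp only: tail_difference abs_minus_cancel)
  also have "\<dots> \<le> (LINT x|\<mu>. norm (1 * crossing x y)) + (LINT x|lborel. norm (\<gamma> x * crossing x y))"
    using integral_abs_bound[of \<mu> "\<lambda>x. 1 * crossing x y"] integral_abs_bound[of lborel "\<lambda>x. \<gamma> x * crossing x y"]
    by (simp only: real_norm_def add_mono)
  also have "\<dots> \<le> ?c1 / (1 + \<bar>y\<bar>) ^ m + ?c2 / (1 + \<bar>y\<bar>) ^ m"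
    by (intro add_mono law.crossing_tail_le dens.crossing_tail_le)
  finally have "\<bar>discrepancy y\<bar> \<le> (?c1 + ?c2) / (1 + \<bar>y\<bar>) ^ m" by (simp add: add_divide_distrib)
  moreover have "0 < (1 + \<bar>y\<bar>) ^ m" by (intro zero_less_power) linarith
  ultimately show "(1 + \<bar>y\<bar>) ^ m * \<bar>discrepancy y\<bar> \<le> ?c1 + ?c2"
    by (simp add: pos_le_divide_eq mult.commute)
qed

end

text \<open>The constant depends on \<open>m\<close> alone, which makes the bound uniform in
  \<open>n\<close> later. Only the exponents 0 and \<open>m\<close> are smoothed, because
  \<open>(1 + \<bar>x\<bar>) ^ m\<close> is at most
  \<open>2 ^ m * (1 + \<bar>x\<bar> ^ m)\<close>.\<close>

theorem nonuniform_smoothing: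
  fixes m :: nat
  obtains C :: real where "0 < C"
    "\<And>\<mu> \<gamma> L T x. cdf_approximation \<mu> \<gamma> m L \<Longrightarrow> C \<le> T \<Longrightarrow>
      set_integrable lborel {0..T} (quotient_deriv (cdf_approximation.ft_difference \<mu> \<gamma>) m) \<Longrightarrow>
      (1 + \<bar>x\<bar>) ^ m * \<bar>cdf_approximation.discrepancy \<mu> \<gamma> x\<bar> \<le>
        C * ((LBINT t:{0..T}. cmod (quotient_deriv (cdf_approximation.ft_difference \<mu> \<gamma>) 0 t))
           + (LBINT t:{0..T}. cmod (quotient_deriv (cdf_approximation.ft_difference \<mu> \<gamma>) m t)) + L / T)"
proof -
  obtain A p :: real where Ap: "0 < A" "(LBINT u:{- A..A}. fejer 1 u) = p" "0 < p"
    "(LINT u|lborel. fejer 1 u) \<le> 4 / 3 * p"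
    using fejer_concentration by metis
  \<comment> \<open>\<open>c / T\<close> is the coefficient of \<open>L + real m * \<delta>\<close>
    after summing the two exponents. The entries of \<open>C\<close> ensure, in turn, a window of
    width at most 1, a coefficient of \<open>\<delta>\<close> at most 1 / 2, and, after solving for
    \<open>\<delta>\<close>, room for the doubled coefficient of the integrals.\<close>
  define c where "c = 2 ^ m * 3 / 2 * (4 * A)"
  define C where "C = max (2 * A) (max (2 * c * (real m + 1)) (2 ^ m * 3 / p))"
  have c: "0 < c" using Ap by (simp add: c_def)
  have C: "2 * A \<le> C" "2 * c * (real m + 1) \<le> C" "2 ^ m * 3 / p \<le> C" "0 < C"
    using Ap(1) unfolding C_def by (simp_all only: less_max_iff_disj le_max_iff_disj order_refl) auto
  show ?thesis
  proof (rule that[of C])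
    show "0 < C" by (rule C)
    fix \<mu> \<gamma> and L T x :: real
    assume "cdf_approximation \<mu> \<gamma> m L"
    then interpret cdf_approximation \<mu> \<gamma> m L .
    assume T: "C \<le> T" and Q: "set_integrable lborel {0..T} (quotient_deriv ft_difference m)"
    define I0 where "I0 = (LBINT t:{0..T}. cmod (quotient_deriv ft_difference 0 t))"
    define I1 where "I1 = (LBINT t:{0..T}. cmod (quotient_deriv ft_difference m t))"
    have T': "0 < T" "2 * A \<le> T" "2 * c * (real m + 1) \<le> T" using T C by auto
    have I: "0 \<le> I0" "0 \<le> I1" unfolding I0_def I1_def set_lebesgue_integral_def
      by (auto intro!: integral_nonneg_AE AE_I2)
    obtain b where b: "\<And>x. (1 + \<bar>x\<bar>) ^ m * \<bar>discrepancy x\<bar> \<le> b" using discrepancy_bounded by blast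
    define \<delta> where "\<delta> = (SUP x. (1 + \<bar>x\<bar>) ^ m * \<bar>discrepancy x\<bar>)"
    have bdd: "bdd_above (range (\<lambda>x. (1 + \<bar>x\<bar>) ^ m * \<bar>discrepancy x\<bar>))" using b by (auto intro!: bdd_aboveI)
    have \<delta>: "(1 + \<bar>x\<bar>) ^ m * \<bar>discrepancy x\<bar> \<le> \<delta>" for x
      unfolding \<delta>_def by (intro cSUP_upper bdd) auto
    have dbl: "\<delta> \<le> a + \<delta> / 2 + b / 2 \<Longrightarrow> \<delta> \<le> 2 * a + b" for a b
      by linarith
    define K where "K = 2 * A / T * (L + real m * \<delta>)"
    have "\<delta> \<le> 2 ^ m * (3 / 2 * (2 * K + (I0 + I1) / p))"
      unfolding \<delta>_def
    proof (rule cSUP_least)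
      fix x :: real
      note W = weighted_discrepancy_le[OF \<delta> T'(1,2) _ Ap, folded K_def]
      have "(1 + \<bar>x\<bar>) ^ m \<le> 2 ^ m * (1 + \<bar>x\<bar> ^ m)"
      proof -
        have "(1 + \<bar>x\<bar>) ^ m \<le> (2 * max 1 \<bar>x\<bar>) ^ m" by (intro power_mono) auto
        also have "\<dots> = 2 ^ m * (max 1 \<bar>x\<bar>) ^ m" by (simp add: power_mult_distrib)
        also have "(max 1 \<bar>x\<bar>) ^ m \<le> 1 + \<bar>x\<bar> ^ m" by (simp add: max_def)
        finally show ?thesis by simp
      qed
      hence "(1 + \<bar>x\<bar>) ^ m * \<bar>discrepancy x\<bar> \<le> 2 ^ m * (1 + \<bar>x\<bar> ^ m) * \<bar>discrepancy x\<bar>"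
        by (intro mult_right_mono) auto
      also have "\<dots> = 2 ^ m * (\<bar>discrepancy x * x ^ 0\<bar> + \<bar>discrepancy x * x ^ m\<bar>)"
        by (simp add: abs_mult power_abs algebra_simps)
      also have "\<dots> \<le> 2 ^ m * (3 / 2 * (K + I0 / p) + 3 / 2 * (K + I1 / p))"
        using smoothed_discrepancy_le[of 0 T] smoothed_discrepancy_top_le[OF T'(1) Q] m_pos T'
        by (intro mult_left_mono add_mono W) (auto simp: I0_def I1_def)
      also have "\<dots> = 2 ^ m * (3 / 2 * (2 * K + (I0 + I1) / p))"
        by (simp add: algebra_simps add_divide_distrib)
      finally show "(1 + \<bar>x\<bar>) ^ m * \<bar>discrepancy x\<bar> \<le> 2 ^ m * (3 / 2 * (2 * K + (I0 + I1) / p))" .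
    qed auto
    also have "\<dots> = c * L / T + c * real m / T * \<delta> + 2 ^ m * 3 / p / 2 * (I0 + I1)"
    proof -
      have "2 ^ m * (3 / 2 * (2 * K)) = c * L / T + c * real m / T * \<delta>"
        by (simp add: K_def c_def algebra_simps add_divide_distrib)
      thus ?thesis by (simp add: algebra_simps)
    qed
    also have "c * real m / T * \<delta> \<le> \<delta> / 2"
    proof -
      have "c * real m \<le> c * (real m + 1)" using c by (intro mult_left_mono) auto
      also have "\<dots> \<le> 1 / 2 * T" using T'(3) by linarith
      finally have "c * real m / T \<le> 1 / 2" using T'(1) by (simp only: pos_divide_le_eq)
      moreover have "0 \<le> \<delta>" using order_trans[OF _ \<delta>[of 0], of 0] by simp
      ultimately have "c * real m / T * \<delta> \<le> 1 / 2 * \<delta>" by (rule mult_right_mono)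
      thus ?thesis by simp
    qed
    finally have "\<delta> \<le> c * L / T + \<delta> / 2 + 2 ^ m * 3 / p / 2 * (I0 + I1)" by simp
    also have "c * L / T + \<delta> / 2 + 2 ^ m * 3 / p / 2 * (I0 + I1)
        = c * (L / T) + \<delta> / 2 + 2 ^ m * 3 / p * (I0 + I1) / 2"
      by simp
    finally have "\<delta> \<le> 2 * (c * (L / T)) + 2 ^ m * 3 / p * (I0 + I1)"
      using dbl[of "c * (L / T)" "2 ^ m * 3 / p * (I0 + I1)"] by blast
    hence "\<delta> \<le> 2 * c * (L / T) + 2 ^ m * 3 / p * (I0 + I1)" by (simp only: mult.assoc)
    also have "\<dots> \<le> C * (L / T) + C * (I0 + I1)"
    proof (intro add_mono mult_right_mono C)
      have "2 * c * 1 \<le> 2 * c * (real m + 1)" using c by (intro mult_left_mono) auto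
      thus "2 * c \<le> C" using C(2) by simp
    qed (use I L_nonneg T' in auto)
    also have "\<dots> = C * (I0 + I1 + L / T)" by (simp add: algebra_simps)
    finally show "(1 + \<bar>x\<bar>) ^ m * \<bar>discrepancy x\<bar> \<le>
        C * ((LBINT t:{0..T}. cmod (quotient_deriv ft_difference 0 t))
           + (LBINT t:{0..T}. cmod (quotient_deriv ft_difference m t)) + L / T)"
      using \<delta>[of x] by (simp add: I0_def I1_def)
  qed
qed

text \<open>Multiplying by \<open>t ^ Suc k\<close> removes the singularity of
  \<open>quotient_deriv\<close> at 0; this version is a polynomial in \<open>t\<close> and the
  \<open>U j\<close>, so it can be differentiated on intervals that contain the origin.\<close>

primrec cleared_quotient_deriv :: "(nat \<Rightarrow> real \<Rightarrow> complex) \<Rightarrow> nat \<Rightarrow> real \<Rightarrow> complex" where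
  "cleared_quotient_deriv U 0 t = \<i> * U 0 t"
| "cleared_quotient_deriv U (Suc k) t =
     \<i> * (of_real (t ^ Suc k) * U (Suc k) t + of_nat (Suc k) * cleared_quotient_deriv U k t)"

section \<open>Hardy bounds for the derivatives of a quotient by the frequency\<close>

lemma cleared_quotient_deriv_eq:
  assumes "t \<noteq> 0"
  shows "cleared_quotient_deriv U k t = of_real (t ^ Suc k) * quotient_deriv U k t"
proof (induction k)
  case (Suc k)
  have "of_real t * quotient_deriv U (Suc k) t = \<i> * (U (Suc k) t + of_nat (Suc k) * quotient_deriv U k t)"
    using assms by simp
  hence "of_real (t ^ Suc (Suc k)) * quotient_deriv U (Suc k) t
      = of_real (t ^ Suc k) * (\<i> * (U (Suc k) t + of_nat (Suc k) * quotient_deriv U k t))"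
    by (simp only: power_Suc[of t "Suc k"] of_real_mult mult.assoc mult.left_commute[of "of_real t"])
  thus ?case unfolding cleared_quotient_deriv.simps Suc.IH
    by (simp add: algebra_simps)
qed (use assms in simp)

text \<open>Everything telescopes: the term from differentiating \<open>t ^ Suc k\<close> is
  cancelled by \<open>Suc k\<close> times the inductive derivative, as
  \<open>\<i> * \<i> = - 1\<close>. Only the top derivative survives. It is a free value
  \<open>v\<close> because at order \<open>m\<close> it comes from a different source than the lower
  ones.\<close>

lemma cleared_quotient_deriv_has_vector_derivative:
  assumes "\<And>j. j < k \<Longrightarrow> (U j has_vector_derivative \<i> * U (Suc j) t) (at t within S)"
    and "(U k has_vector_derivative v) (at t within S)"
  shows "(cleared_quotient_deriv U k has_vector_derivative \<i> * of_real (t ^ k) * v) (at t within S)"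
  using assms
proof (induction k arbitrary: v)
  case 0
  show ?case using has_vector_derivative_mult_right[OF 0(2), of \<i>] by simp
next
  case (Suc k)
  have pow: "((\<lambda>t. complex_of_real (t ^ Suc k)) has_vector_derivative of_real (real (Suc k) * t ^ k)) (at t within S)"
    using DERIV_pow[of "Suc k" t S]
    by (intro has_vector_derivative_of_real) (simp add: has_real_derivative_iff_has_vector_derivative[symmetric] del: of_nat_Suc)
  have "(cleared_quotient_deriv U k has_vector_derivative \<i> * of_real (t ^ k) * (\<i> * U (Suc k) t)) (at t within S)"
    by (rule Suc.IH) (use Suc.prems in auto)
  from has_vector_derivative_mult_right[OF has_vector_derivative_add[OF has_vector_derivative_mult[OF pow Suc.prems(2)]
      has_vector_derivative_mult_right[OF this, of "of_nat (Suc k)"]], of \<i>]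
  show ?case by (simp add: algebra_simps)
qed

text \<open>The cleared quotient vanishes at 0 and has a derivative of size at most
  \<open>t ^ k * M\<close> on \<open>{0..t}\<close>, so it is at most \<open>t ^ Suc k * M\<close>;
  dividing back loses nothing. One derivative beyond order \<open>k\<close> is spent on the division
  by \<open>t\<close>.\<close>

lemma quotient_deriv_near_zero:
  assumes chain: "\<And>j s. j < k \<Longrightarrow> (U j has_vector_derivative \<i> * U (Suc j) s) (at s)"
    and deriv: "\<And>s. s \<in> {0..1} \<Longrightarrow> (U k has_vector_derivative V s) (at s)"
    and V: "\<And>s. s \<in> {0..1} \<Longrightarrow> cmod (V s) \<le> M"
    and zero: "U 0 0 = 0" and t: "0 < t" "t \<le> 1"
  shows "cmod (quotient_deriv U k t) \<le> M"
proof -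
  let ?Y = "cleared_quotient_deriv U k"
  have Y0: "?Y 0 = 0" by (induction k) (use zero in auto)
  have "norm (?Y t - ?Y 0) \<le> (t ^ k * M) * norm (t - 0)"
  proof (rule differentiable_bound[where S = "{0..t}"])
    fix s assume s: "s \<in> {0..t}"
    have "(?Y has_vector_derivative \<i> * of_real (s ^ k) * V s) (at s within {0..t})"
      using s t by (intro cleared_quotient_deriv_has_vector_derivative has_vector_derivative_at_within[OF chain] has_vector_derivative_at_within[OF deriv]) auto
    thus "(?Y has_derivative (\<lambda>h. h *\<^sub>R (\<i> * of_real (s ^ k) * V s))) (at s within {0..t})"
      by (simp add: has_vector_derivative_def)
    have "cmod (\<i> * of_real (s ^ k) * V s) = s ^ k * cmod (V s)"
      using s by (simp add: norm_mult norm_power)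
    also have "\<dots> \<le> t ^ k * M" using s t V[of s] by (intro mult_mono power_mono) auto
    finally show "onorm (\<lambda>h. h *\<^sub>R (\<i> * of_real (s ^ k) * V s)) \<le> t ^ k * M"
      by (subst onorm_scaleR_left) (auto simp: bounded_linear_ident onorm_id)
  qed (use t in auto)
  hence "t ^ Suc k * cmod (quotient_deriv U k t) \<le> t ^ Suc k * M"
    using t Y0 cleared_quotient_deriv_eq[of t U k] by (simp add: norm_mult norm_power mult_ac)
  thus ?thesis using t by simp
qed

text \<open>For \<open>1 \<le> t\<close> the divisions only help, and
  \<open>1 + Suc k * fact (Suc k) \<le> fact (Suc (Suc k))\<close> accounts for the
  factorial.\<close>

lemma quotient_deriv_le:
  assumes "1 \<le> t" "\<And>j. j \<le> k \<Longrightarrow> cmod (U j t) \<le> u"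
  shows "cmod (quotient_deriv U k t) \<le> fact (Suc k) * u"
  using assms(2)
proof (induction k)
  case 0
  have "cmod (U 0 t) / t \<le> cmod (U 0 t) / 1" using assms(1) by (intro divide_left_mono) auto
  thus ?case using 0[of 0] assms(1) by (simp add: norm_mult norm_divide)
next
  case (Suc k)
  have IH: "cmod (quotient_deriv U k t) \<le> fact (Suc k) * u" using Suc by auto
  have u: "0 \<le> u" using Suc.prems[of 0] order_trans[OF norm_ge_zero] by auto
  have "cmod (quotient_deriv U (Suc k) t) = cmod (U (Suc k) t + of_nat (Suc k) * quotient_deriv U k t) / t"
    using assms(1) by (simp add: norm_mult norm_divide del: of_nat_Suc)
  also have "\<dots> \<le> cmod (U (Suc k) t + of_nat (Suc k) * quotient_deriv U k t) / 1"
    using assms(1) by (intro divide_left_mono) auto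
  also have "\<dots> \<le> cmod (U (Suc k) t) + real (Suc k) * cmod (quotient_deriv U k t)"
    using norm_triangle_ineq[of "U (Suc k) t" "of_nat (Suc k) * quotient_deriv U k t"]
    by (simp add: norm_mult del: of_nat_Suc)
  also have "\<dots> \<le> u + real (Suc k) * (fact (Suc k) * u)"
    using Suc.prems[of "Suc k"] IH by (intro add_mono mult_left_mono) auto
  also have "\<dots> \<le> fact (Suc k) * u + real (Suc k) * (fact (Suc k) * u)"
  proof -
    have "1 * u \<le> fact (Suc k) * u" using u fact_ge_1[of "Suc k"] by (intro mult_right_mono)
    thus ?thesis by simp
  qed
  also have "\<dots> = fact (Suc (Suc k)) * u"
    unfolding fact_Suc[of "Suc k"] by (simp add: algebra_simps)
  finally show ?case .
qed

text \<open>The factor \<open>m t powi (- m - 1)\<close> is the derivative of \<open>- t powi (- m)\<close>, so Hardy's inequality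
  becomes an exact antiderivative.\<close>

lemma integral_quotient_deriv_le:
  assumes chain: "\<And>j s. j \<le> k \<Longrightarrow> (U j has_vector_derivative \<i> * U (Suc j) s) (at s)"
    and cont: "continuous_on UNIV (U (Suc k))"
    and ab: "0 < a" "a \<le> b"
  shows "(LBINT t:{a..b}. cmod (quotient_deriv U (Suc k) t))
     \<le> 2 * (LBINT t:{a..b}. cmod (U (Suc k) t) / t) + cmod (quotient_deriv U k a)"
proof -
  let ?m = "Suc k"
  define Y where "Y = cleared_quotient_deriv U k"
  define f where "f s = cmod (U ?m s) / s" for s
  define g where "g s = s ^ k * cmod (U ?m s)" for s
  have contU: "continuous_on S (U ?m)" for S using cont continuous_on_subset by blast
  have cf: "continuous_on {a..b} f" and cg: "continuous_on {a..b} g"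
    unfolding f_def g_def using ab by (auto intro!: continuous_intros contU)
  define \<Theta> where "\<Theta> t = integral {a..t} g" for t
  define F where "F t = integral {a..t} f" for t
  have Yd: "(Y has_vector_derivative - (of_real (t ^ k) * U ?m t)) (at t within {a..b})" for t
  proof -
    have e: "\<i> * complex_of_real (t ^ k) * (\<i> * U ?m t) = - (of_real (t ^ k) * U ?m t)"
      by (simp add: algebra_simps)
    show ?thesis
    unfolding Y_def e[symmetric] using cleared_quotient_deriv_has_vector_derivative[of k U t "{a..b}", OF has_vector_derivative_at_within[OF chain] has_vector_derivative_at_within[OF chain]]
      by simp
  qed
  have Yle: "cmod (Y t) \<le> cmod (Y a) + \<Theta> t" if "t \<in> {a..b}" for t
  proof -
    have sub: "{a..t} \<subseteq> {a..b}" using that by auto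
    have "((\<lambda>s. - (of_real (s ^ k) * U ?m s)) has_integral Y t - Y a) {a..t}"
      using that by (intro fundamental_theorem_of_calculus has_vector_derivative_within_subset[OF Yd sub]) auto
    hence "Y t - Y a = integral {a..t} (\<lambda>s. - (of_real (s ^ k) * U ?m s))"
      by (rule integral_unique[symmetric])
    also have "cmod \<dots> \<le> \<Theta> t"
      unfolding \<Theta>_def
    proof (rule integral_norm_bound_integral)
      show "(\<lambda>s. - (complex_of_real (s ^ k) * U ?m s)) integrable_on {a..t}"
        by (intro integrable_continuous_real continuous_intros contU)
      show "g integrable_on {a..t}"
        by (intro integrable_continuous_real continuous_on_subset[OF cg sub])
      show "cmod (- (complex_of_real (s ^ k) * U ?m s)) \<le> g s" if "s \<in> {a..t}" for s
        using that ab by (auto simp: g_def norm_mult norm_power)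
    qed
    finally show ?thesis using norm_triangle_sub[of "Y t" "Y a"] by simp
  qed
  \<comment> \<open>\<open>w\<close> majorises the second term of the recursion, by the bound on the
    cleared quotient. It has an antiderivative in closed form: differentiating the quotient in
    \<open>\<Xi>\<close> produces \<open>- f\<close> besides \<open>w\<close>, and \<open>F\<close>
    compensates it.\<close>
  define w where "w t = real ?m / t ^ Suc ?m * (\<Theta> t + cmod (Y a))" for t
  define \<Xi> where "\<Xi> t = F t - (\<Theta> t + cmod (Y a)) / t ^ ?m" for t
  have \<Xi>d: "(\<Xi> has_vector_derivative w t) (at t within {a..b})" if "t \<in> {a..b}" for t
  proof -
    have t: "0 < t" using that ab by auto
    have Fd: "(F has_real_derivative f t) (at t within {a..b})"
      unfolding F_def has_real_derivative_iff_has_vector_derivative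
      by (rule integral_has_vector_derivative[OF cf that])
    have Td: "(\<Theta> has_real_derivative g t) (at t within {a..b})"
      unfolding \<Theta>_def has_real_derivative_iff_has_vector_derivative
      by (rule integral_has_vector_derivative[OF cg that])
    have "(\<Xi> has_real_derivative f t - (g t * t ^ ?m - (\<Theta> t + cmod (Y a)) * (real ?m * t ^ k)) / (t ^ ?m * t ^ ?m)) (at t within {a..b})"
      unfolding \<Xi>_def using t
      by (auto intro!: derivative_eq_intros Fd Td simp del: of_nat_Suc power_Suc)
    moreover have "f t - (g t * t ^ ?m - (\<Theta> t + cmod (Y a)) * (real ?m * t ^ k)) / (t ^ ?m * t ^ ?m) = w t"
      unfolding f_def g_def w_def using t by (simp add: field_simps)
    ultimately show ?thesis by (simp add: has_real_derivative_iff_has_vector_derivative)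
  qed
  hence wint: "(w has_integral \<Xi> b - \<Xi> a) {a..b}"
    using ab by (intro fundamental_theorem_of_calculus) auto
  have fint: "(f has_integral F b) {a..b}"
    unfolding F_def using integrable_continuous_real[OF cf] by (rule integrable_integral)
  have Yeq: "Y t = of_real (t ^ ?m) * quotient_deriv U k t" if "t \<in> {a..b}" for t
    unfolding Y_def using that ab by (intro cleared_quotient_deriv_eq) auto
  have pw: "cmod (quotient_deriv U ?m t) \<le> f t + w t" if "t \<in> {a..b}" for t
  proof -
    have t: "0 < t" using that ab by auto
    have "cmod (quotient_deriv U k t) = cmod (Y t) / t ^ ?m"
      using Yeq[OF that] t by (simp add: norm_mult norm_power)
    also have "\<dots> \<le> (cmod (Y a) + \<Theta> t) / t ^ ?m"
      using t Yle[OF that] by (intro divide_right_mono) auto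
    finally have q: "cmod (quotient_deriv U k t) \<le> (cmod (Y a) + \<Theta> t) / t ^ ?m" .
    have "cmod (quotient_deriv U ?m t) = cmod (U ?m t + of_nat ?m * quotient_deriv U k t) / t"
      using t by (simp add: norm_mult norm_divide del: of_nat_Suc)
    also have "\<dots> \<le> (cmod (U ?m t) + real ?m * cmod (quotient_deriv U k t)) / t"
      using t norm_triangle_ineq[of "U ?m t" "of_nat ?m * quotient_deriv U k t"]
      by (intro divide_right_mono) (simp_all add: norm_mult del: of_nat_Suc)
    also have "\<dots> \<le> (cmod (U ?m t) + real ?m * ((cmod (Y a) + \<Theta> t) / t ^ ?m)) / t"
      using t q by (intro divide_right_mono add_left_mono mult_left_mono) auto
    also have "\<dots> = f t + w t" using t by (simp add: f_def w_def field_simps)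
    finally show ?thesis .
  qed
  have qcont: "continuous_on {a..b} (quotient_deriv U ?m)"
  proof -
    have eq: "quotient_deriv U ?m = (\<lambda>t. \<i> * (U ?m t + of_nat ?m * quotient_deriv U k t) / of_real t)"
      by (rule ext) (rule quotient_deriv.simps)
    have "continuous_on {a..b} (quotient_deriv U k)"
      using ab by (intro continuous_on_vector_derivative[where f' = "\<lambda>t. \<i> * quotient_deriv U ?m t"]
        has_vector_derivative_at_within[OF quotient_deriv_has_vector_derivative] chain) auto
    thus ?thesis unfolding eq using ab by (auto intro!: continuous_intros contU)
  qed
  have i1: "set_integrable lborel {a..b} (\<lambda>t. cmod (quotient_deriv U ?m t))"
    by (intro borel_integrable_atLeastAtMost' continuous_intros qcont)
  have i2: "set_integrable lborel {a..b} f" by (intro borel_integrable_atLeastAtMost' cf)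
  have "(LBINT t:{a..b}. cmod (quotient_deriv U ?m t)) \<le> F b + (\<Xi> b - \<Xi> a)"
    unfolding set_borel_integral_eq_integral(2)[OF i1]
    using has_integral_le[OF integrable_integral[OF set_borel_integral_eq_integral(1)[OF i1]] has_integral_add[OF fint wint]] pw
    by simp
  \<comment> \<open>\<open>F b\<close> occurs twice, once from \<open>f\<close> and once inside
    \<open>\<Xi> b\<close>; this is the factor 2. The other term of \<open>\<Xi> b\<close> has the
    right sign to be dropped, and \<open>\<Xi> a\<close> leaves the boundary value at
    \<open>a\<close>.\<close>
  also have "\<dots> \<le> 2 * F b + cmod (Y a) / a ^ ?m"
  proof -
    have "0 \<le> \<Theta> b" unfolding \<Theta>_def using ab
      by (intro integral_nonneg integrable_continuous_real cg) (auto simp: g_def)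
    hence "0 \<le> (\<Theta> b + cmod (Y a)) / b ^ ?m" using ab by (intro divide_nonneg_nonneg) auto
    moreover have "\<Theta> a = 0" "F a = 0" by (simp_all add: \<Theta>_def F_def)
    ultimately show ?thesis by (simp add: \<Xi>_def)
  qed
  also have "cmod (Y a) / a ^ ?m = cmod (quotient_deriv U k a)"
    using Yeq[of a] ab by (simp add: norm_mult norm_power)
  also have "F b = (LBINT t:{a..b}. f t)"
    unfolding F_def set_borel_integral_eq_integral(2)[OF i2] ..
  finally show ?thesis by (simp add: f_def)
qed

text \<open>Three ranges: on \<open>{0..1}\<close> the division is harmless by the derivative bound,
  on \<open>{1..a}\<close> the decay \<open>1 / t\<^sup>2\<close> has integral at most 1, and the
  rest is passed on. The same \<open>M\<close> serves both bounds, giving the two summands of the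
  constant.\<close>

lemma integral_quotient_deriv_from_zero_le:
  assumes chain: "\<And>j s. j < k \<Longrightarrow> (U j has_vector_derivative \<i> * U (Suc j) s) (at s)"
    and deriv: "\<And>s. s \<in> {0..1} \<Longrightarrow> (U k has_vector_derivative V s) (at s)"
    and V: "\<And>s. s \<in> {0..1} \<Longrightarrow> cmod (V s) \<le> M"
    and zero: "U 0 0 = 0"
    and cont: "\<And>j. j \<le> k \<Longrightarrow> continuous_on UNIV (U j)"
    and aT: "1 \<le> a" "a \<le> T"
    and decay: "\<And>j t. j \<le> k \<Longrightarrow> t \<in> {1..a} \<Longrightarrow> cmod (U j t) \<le> M / t\<^sup>2"
  shows "set_integrable lborel {0..T} (quotient_deriv U k)"
    and "(LBINT t:{0..T}. cmod (quotient_deriv U k t))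
      \<le> (1 + fact (Suc k)) * M + (LBINT t:{a..T}. cmod (quotient_deriv U k t))"
proof -
  have [measurable]: "U j \<in> borel_measurable borel" if "j \<le> k" for j
    using cont[OF that] by (rule borel_measurable_continuous_onI)
  have meas: "quotient_deriv U j \<in> borel_measurable borel" if "j \<le> k" for j
    using that
  proof (induction j)
    case 0
    have "quotient_deriv U 0 = (\<lambda>t. \<i> * U 0 t / of_real t)" by auto
    then show ?case by simp
  next
    case (Suc j)
    hence [measurable]: "quotient_deriv U j \<in> borel_measurable borel" "U (Suc j) \<in> borel_measurable borel" by auto
    have "quotient_deriv U (Suc j) = (\<lambda>t. \<i> * (U (Suc j) t + of_nat (Suc j) * quotient_deriv U j t) / of_real t)" by auto
    then show ?case by (simp del: of_nat_Suc)
  qed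
  hence [measurable]: "quotient_deriv U k \<in> borel_measurable borel" by simp
  have qcont: "continuous_on {0<..} (quotient_deriv U j)" if "j \<le> k" for j
    using that
  proof (induction j)
    case 0
    have "quotient_deriv U 0 = (\<lambda>t. \<i> * U 0 t / of_real t)" by auto
    then show ?case by (auto intro!: continuous_intros continuous_on_subset[OF cont[of 0]])
  next
    case (Suc j)
    have "quotient_deriv U (Suc j) = (\<lambda>t. \<i> * (U (Suc j) t + of_nat (Suc j) * quotient_deriv U j t) / of_real t)" by auto
    with Suc show ?case by (auto intro!: continuous_intros continuous_on_subset[OF cont[of "Suc j"]])
  qed
  have M: "0 \<le> M" using order_trans[OF norm_ge_zero V[of 0]] by simp
  let ?q = "\<lambda>t. cmod (quotient_deriv U k t)"
  define B where "B t = M * indicator {0..1} t + fact (Suc k) * M * (indicator {1..a} t * (1 / t\<^sup>2)) + indicator {a..T} t *\<^sub>R ?q t" for t :: real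
  have iq: "integrable lborel (\<lambda>t. indicator {a..T} t *\<^sub>R ?q t)"
  proof -
    have "{a..T} \<subseteq> {0<..}" using aT by auto
    from borel_integrable_atLeastAtMost'[OF continuous_on_norm[OF continuous_on_subset[OF qcont[OF order.refl] this]]]
    show ?thesis by (simp add: set_integrable_def)
  qed
  have c2: "continuous_on {1..a} (\<lambda>t :: real. 1 / t\<^sup>2)" by (auto intro!: continuous_intros)
  have isq: "integrable lborel (\<lambda>t. indicator {1..a} t * (1 / t\<^sup>2))"
    using borel_integrable_atLeastAtMost'[OF c2] by (simp add: set_integrable_def)
  have B: "integrable lborel B" unfolding B_def using iq isq by (intro Bochner_Integration.integrable_add integrable_mult_right) auto
  have sq: "(LINT t|lborel. indicator {1..a} t * (1 / t\<^sup>2)) \<le> 1"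
  proof -
    have "(LINT t|lborel. indicator {1..a} t *\<^sub>R (1 / t\<^sup>2)) = - (1 / a) - - (1 / 1)"
    proof (rule integral_FTC_atLeastAtMost)
      fix t assume "1 \<le> t" "t \<le> a"
      thus "((\<lambda>t. - (1 / t)) has_vector_derivative 1 / t\<^sup>2) (at t within {1..a})"
        unfolding has_real_derivative_iff_has_vector_derivative[symmetric]
        by (auto intro!: derivative_eq_intros simp: power2_eq_square)
    qed (use aT c2 in auto)
    thus ?thesis using aT by simp
  qed
  have pw: "norm (indicator {0..T} t *\<^sub>R quotient_deriv U k t) \<le> B t" if t0: "t \<noteq> 0" for t
  proof -
    have nn: "0 \<le> M * indicator {0..1} t" "0 \<le> fact (Suc k) * M * (indicator {1..a} t * (1 / t\<^sup>2))" "0 \<le> indicator {a..T} t *\<^sub>R ?q t"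
      using M by (auto intro!: mult_nonneg_nonneg)
    consider "t \<notin> {0..T}" | "t \<in> {0<..1}" | "t \<in> {1..a}" | "t \<in> {a..T}" using t0
      by (cases "t \<in> {0..T}"; cases "t \<le> 1"; cases "t \<le> a") auto
    thus ?thesis
    proof cases
      case 2
      hence "?q t \<le> M" by (intro quotient_deriv_near_zero[OF chain deriv V zero]) auto
      moreover have "norm (indicator {0..T} t *\<^sub>R quotient_deriv U k t) = ?q t" "M * indicator {0..1} t = M"
        using 2 aT by auto
      ultimately show ?thesis using nn unfolding B_def by linarith
    next
      case 3
      hence "?q t \<le> fact (Suc k) * (M / t\<^sup>2)" by (intro quotient_deriv_le decay) auto
      moreover have "norm (indicator {0..T} t *\<^sub>R quotient_deriv U k t) = ?q t"
        "fact (Suc k) * M * (indicator {1..a} t * (1 / t\<^sup>2)) = fact (Suc k) * (M / t\<^sup>2)"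
        using 3 aT by (auto simp del: fact_Suc)
      ultimately show ?thesis using nn unfolding B_def by linarith
    next
      case 4
      hence "norm (indicator {0..T} t *\<^sub>R quotient_deriv U k t) = indicator {a..T} t *\<^sub>R ?q t"
        using aT by auto
      thus ?thesis using nn unfolding B_def by linarith
    next
      case 1
      hence "norm (indicator {0..T} t *\<^sub>R quotient_deriv U k t) = 0" by simp
      thus ?thesis using nn unfolding B_def by linarith
    qed
  qed
  have AE: "AE t in lborel. norm (indicator {0..T} t *\<^sub>R quotient_deriv U k t) \<le> B t"
    using AE_lborel_singleton[of 0] by eventually_elim (rule pw)
  show int: "set_integrable lborel {0..T} (quotient_deriv U k)"
    unfolding set_integrable_def
    by (rule Bochner_Integration.integrable_bound[OF B]) (measurable, use AE in eventually_elim, auto)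
  have "(LBINT t:{0..T}. ?q t) = (LINT t|lborel. norm (indicator {0..T} t *\<^sub>R quotient_deriv U k t))"
    unfolding set_lebesgue_integral_def by simp
  also have "\<dots> \<le> (LINT t|lborel. B t)"
    using AE int[unfolded set_integrable_def] B by (intro integral_mono_AE integrable_norm)
  also have "\<dots> = M + fact (Suc k) * M * (LINT t|lborel. indicator {1..a} t * (1 / t\<^sup>2)) + (LBINT t:{a..T}. ?q t)"
  proof -
    have i1: "integrable lborel (\<lambda>t :: real. M * indicator {0..1} t)" by simp
    have i2: "integrable lborel (\<lambda>t. fact (Suc k) * M * (indicator {1..a} t * (1 / t\<^sup>2)))"
      by (intro integrable_mult_right isq)
    have "(LINT t|lborel. M * indicator {0..1::real} t) = M" by simp
    thus ?thesis
      unfolding B_def set_lebesgue_integral_def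
      by (simp only: Bochner_Integration.integral_add[OF Bochner_Integration.integrable_add[OF i1 i2] iq]
        Bochner_Integration.integral_add[OF i1 i2] integral_mult_right_zero)
  qed
  also have "\<dots> \<le> M + fact (Suc k) * M * 1 + (LBINT t:{a..T}. ?q t)"
    using sq M by (intro add_mono mult_left_mono) auto
  finally show "(LBINT t:{0..T}. ?q t) \<le> (1 + fact (Suc k)) * M + (LBINT t:{a..T}. ?q t)"
    by (simp add: algebra_simps)
qed

section \<open>Growth of functions together with their derivatives\<close>

definition exp_remainder :: "nat \<Rightarrow> complex \<Rightarrow> complex" where
  "exp_remainder p z = exp z - (\<Sum>l<p. z ^ l / fact l)"

text \<open>The exponential series without its first \<open>p\<close> terms is compared with the
  full one through \<open>fact n \<le> fact (n + p)\<close>.\<close>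

lemma exp_remainder_bound: "cmod (exp_remainder p z) \<le> cmod z ^ p * exp (cmod z)"
proof -
  have term_le: "norm (inverse (fact (n + p)) *\<^sub>R z ^ (n + p)) \<le> cmod z ^ p * (inverse (fact n) *\<^sub>R cmod z ^ n)" for n
  proof -
    have "inverse (fact (n + p) :: real) \<le> inverse (fact n)"
      by (intro le_imp_inverse_le fact_mono) auto
    hence "inverse (fact (n + p)) * cmod z ^ (n + p) \<le> inverse (fact n) * cmod z ^ (n + p)"
      by (intro mult_right_mono) auto
    thus ?thesis by (simp add: norm_mult norm_power power_add mult_ac)
  qed
  have sum: "summable (\<lambda>n. cmod z ^ p * (inverse (fact n) *\<^sub>R cmod z ^ n))"
    by (intro summable_mult summable_exp_generic)
  have "exp_remainder p z = (\<Sum>n. inverse (fact (n + p)) *\<^sub>R z ^ (n + p))"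
    using exp_first_terms[of z p] unfolding exp_remainder_def
    by (simp add: scaleR_conv_of_real divide_inverse mult.commute)
  also have "cmod \<dots> \<le> (\<Sum>n. cmod z ^ p * (inverse (fact n) *\<^sub>R cmod z ^ n))"
    by (rule norm_suminf_le[OF term_le sum])
  also have "\<dots> = cmod z ^ p * exp (cmod z)"
    unfolding exp_def by (rule suminf_mult[OF summable_exp_generic])
  finally show ?thesis .
qed

text \<open>Differentiation lowers the index, except at index 0, where the remainder is the
  exponential itself.\<close>

lemma exp_remainder_has_vector_derivative:
  assumes "(M has_vector_derivative M') (at t)"
  shows "((\<lambda>t. exp_remainder (Suc p) (M t)) has_vector_derivative exp_remainder p (M t) * M') (at t)"
    and "((\<lambda>t. exp_remainder 0 (M t)) has_vector_derivative exp_remainder 0 (M t) * M') (at t)"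
proof -
  have exp: "((\<lambda>z. exp z) has_field_derivative exp (M t)) (at (M t))" by (rule DERIV_exp)
  have sum: "((\<lambda>z. \<Sum>l<Suc p. z ^ l / fact l) has_field_derivative (\<Sum>l<p. M t ^ l / fact l)) (at (M t))"
  proof -
    have "((\<lambda>z. z ^ l / fact l) has_field_derivative (case l of 0 \<Rightarrow> 0 | Suc l' \<Rightarrow> M t ^ l' / fact l')) (at (M t))" for l
    proof (cases l)
      case (Suc l')
      have "((\<lambda>z. z ^ l / fact l) has_field_derivative (of_nat l * M t ^ (l - 1)) / fact l) (at (M t))"
        by (auto intro!: derivative_eq_intros)
      moreover have "(of_nat l * M t ^ (l - 1)) / fact l = M t ^ l' / (fact l' :: complex)"
        unfolding Suc fact_Suc by (simp del: of_nat_Suc)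
      ultimately show ?thesis by (simp add: Suc)
    qed auto
    hence "((\<lambda>z. \<Sum>l<Suc p. z ^ l / fact l) has_field_derivative (\<Sum>l<Suc p. (case l of 0 \<Rightarrow> 0 | Suc l' \<Rightarrow> M t ^ l' / fact l'))) (at (M t))"
      by (intro DERIV_sum)
    also have "(\<Sum>l<Suc p. (case l of 0 \<Rightarrow> 0 | Suc l' \<Rightarrow> M t ^ l' / fact l')) = (\<Sum>l<p. M t ^ l / fact l)"
      by (simp only: sum.lessThan_Suc_shift) simp
    finally show ?thesis .
  qed
  have "(exp_remainder (Suc p) has_field_derivative exp_remainder p (M t)) (at (M t))"
    unfolding exp_remainder_def using DERIV_diff[OF exp sum] by simp
  from field_vector_diff_chain_at[OF assms this]
  show "((\<lambda>t. exp_remainder (Suc p) (M t)) has_vector_derivative exp_remainder p (M t) * M') (at t)"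
    by (simp add: o_def mult.commute)
  have "(exp_remainder 0 has_field_derivative exp_remainder 0 (M t)) (at (M t))"
    unfolding exp_remainder_def using exp by simp
  from field_vector_diff_chain_at[OF assms this]
  show "((\<lambda>t. exp_remainder 0 (M t)) has_vector_derivative exp_remainder 0 (M t) * M') (at t)"
    by (simp add: o_def mult.commute)
qed

text \<open>The sets may be empty, so that a statement about large \<open>n\<close> can be made
  without naming a threshold. Starlikeness permits integration from 0.\<close>

locale scaled_family =
  fixes \<sigma> :: "nat \<Rightarrow> real" and I :: "nat \<Rightarrow> real set"
  assumes open_I: "open (I n)"
    and scale_ge_1: "t \<in> I n \<Longrightarrow> 1 \<le> \<sigma> n"
    and starlike: "t \<in> I n \<Longrightarrow> closed_segment 0 t \<subseteq> I n"
begin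

text \<open>Three quantities are kept apart: the order \<open>k\<close> in
  \<open>1 / \<sigma> n\<close>, a power of \<open>1 + \<bar>t\<bar>\<close> that is not tracked,
  and the exponential rate \<open>a\<close>, negative for Gaussian decay. Products add orders and
  rates.\<close>

definition growth :: "real \<Rightarrow> nat \<Rightarrow> (nat \<Rightarrow> real \<Rightarrow> complex) \<Rightarrow> bool" where
  "growth a k u \<longleftrightarrow> (\<exists>K\<ge>0. \<exists>N. \<forall>n. \<forall>t\<in>I n. cmod (u n t) \<le> K / \<sigma> n ^ k * (1 + \<bar>t\<bar>) ^ N * exp (a * t\<^sup>2))"

text \<open>Derivatives are only asserted to exist with a bound of the same order and rate. The
  class is then closed under the operations below by short inductions, with no formula for higher
  derivatives of a composition.\<close>

primrec derivs_growth :: "nat \<Rightarrow> real \<Rightarrow> nat \<Rightarrow> (nat \<Rightarrow> real \<Rightarrow> complex) \<Rightarrow> bool" where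
  "derivs_growth 0 a k u \<longleftrightarrow> growth a k u"
| "derivs_growth (Suc J) a k u \<longleftrightarrow> growth a k u \<and>
     (\<exists>u'. (\<forall>n. \<forall>t\<in>I n. (u n has_vector_derivative u' n t) (at t)) \<and> derivs_growth J a k u')"

lemma growthI:
  assumes "\<And>n t. t \<in> I n \<Longrightarrow> cmod (u n t) \<le> K / \<sigma> n ^ k * (1 + \<bar>t\<bar>) ^ N * exp (a * t\<^sup>2)"
  shows "growth a k u"
  unfolding growth_def
proof (intro exI[of _ "max 0 K"] conjI exI[of _ N] allI ballI)
  fix n t assume t: "t \<in> I n"
  have "K / \<sigma> n ^ k * (1 + \<bar>t\<bar>) ^ N * exp (a * t\<^sup>2) \<le> max 0 K / \<sigma> n ^ k * (1 + \<bar>t\<bar>) ^ N * exp (a * t\<^sup>2)"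
    using scale_ge_1[OF t] by (intro mult_right_mono divide_right_mono) auto
  with assms[OF t] show "cmod (u n t) \<le> max 0 K / \<sigma> n ^ k * (1 + \<bar>t\<bar>) ^ N * exp (a * t\<^sup>2)" by linarith
qed auto

lemma derivs_growth_SucI:
  assumes "growth a k u" "\<And>n t. t \<in> I n \<Longrightarrow> (u n has_vector_derivative u' n t) (at t)" "derivs_growth J a k u'"
  shows "derivs_growth (Suc J) a k u"
  using assms by auto

lemma growth_mono:
  assumes "growth a k u" "a \<le> b" "l \<le> k"
  shows "growth b l u"
proof -
  from assms(1) obtain K N where K: "0 \<le> K" and le [rule_format]: "\<forall>n. \<forall>t\<in>I n. cmod (u n t) \<le> K / \<sigma> n ^ k * (1 + \<bar>t\<bar>) ^ N * exp (a * t\<^sup>2)"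
    unfolding growth_def by blast
  show ?thesis
  proof (rule growthI)
    fix n t assume t: "t \<in> I n"
    note le[OF t]
    also have "K / \<sigma> n ^ k * (1 + \<bar>t\<bar>) ^ N * exp (a * t\<^sup>2) \<le> K / \<sigma> n ^ l * (1 + \<bar>t\<bar>) ^ N * exp (b * t\<^sup>2)"
      using scale_ge_1[OF t] K assms(2,3)
      by (intro mult_mono divide_left_mono power_increasing) (auto intro!: mult_right_mono mult_nonneg_nonneg divide_nonneg_nonneg)
    finally show "cmod (u n t) \<le> K / \<sigma> n ^ l * (1 + \<bar>t\<bar>) ^ N * exp (b * t\<^sup>2)" .
  qed
qed

lemma growth_add:
  assumes "growth a k u" "growth a k v"
  shows "growth a k (\<lambda>n t. u n t + v n t)"
proof -
  from assms(1) obtain K N where K: "0 \<le> K" and le [rule_format]: "\<forall>n. \<forall>t\<in>I n. cmod (u n t) \<le> K / \<sigma> n ^ k * (1 + \<bar>t\<bar>) ^ N * exp (a * t\<^sup>2)"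
    unfolding growth_def by blast
  from assms(2) obtain K' N' where K': "0 \<le> K'" and le' [rule_format]: "\<forall>n. \<forall>t\<in>I n. cmod (v n t) \<le> K' / \<sigma> n ^ k * (1 + \<bar>t\<bar>) ^ N' * exp (a * t\<^sup>2)"
    unfolding growth_def by blast
  show ?thesis
  proof (rule growthI)
    fix n t assume t: "t \<in> I n"
    have "cmod (u n t + v n t) \<le> K / \<sigma> n ^ k * (1 + \<bar>t\<bar>) ^ N * exp (a * t\<^sup>2) + K' / \<sigma> n ^ k * (1 + \<bar>t\<bar>) ^ N' * exp (a * t\<^sup>2)"
      by (rule order_trans[OF norm_triangle_ineq add_mono[OF le[OF t] le'[OF t]]])
    also have "\<dots> \<le> K / \<sigma> n ^ k * (1 + \<bar>t\<bar>) ^ (N + N') * exp (a * t\<^sup>2) + K' / \<sigma> n ^ k * (1 + \<bar>t\<bar>) ^ (N + N') * exp (a * t\<^sup>2)"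
      using scale_ge_1[OF t] K K' by (intro add_mono mult_right_mono mult_left_mono power_increasing divide_nonneg_nonneg) auto
    also have "\<dots> = (K + K') / \<sigma> n ^ k * (1 + \<bar>t\<bar>) ^ (N + N') * exp (a * t\<^sup>2)"
      by (simp add: add_divide_distrib algebra_simps)
    finally show "cmod (u n t + v n t) \<le> (K + K') / \<sigma> n ^ k * (1 + \<bar>t\<bar>) ^ (N + N') * exp (a * t\<^sup>2)" .
  qed
qed

lemma growth_mult:
  assumes "growth a k u" "growth b l v"
  shows "growth (a + b) (k + l) (\<lambda>n t. u n t * v n t)"
proof -
  from assms(1) obtain K N where K: "0 \<le> K" and le [rule_format]: "\<forall>n. \<forall>t\<in>I n. cmod (u n t) \<le> K / \<sigma> n ^ k * (1 + \<bar>t\<bar>) ^ N * exp (a * t\<^sup>2)"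
    unfolding growth_def by blast
  from assms(2) obtain K' N' where K': "0 \<le> K'" and le' [rule_format]: "\<forall>n. \<forall>t\<in>I n. cmod (v n t) \<le> K' / \<sigma> n ^ l * (1 + \<bar>t\<bar>) ^ N' * exp (b * t\<^sup>2)"
    unfolding growth_def by blast
  show ?thesis
  proof (rule growthI)
    fix n t assume t: "t \<in> I n"
    have "cmod (u n t * v n t) \<le> (K / \<sigma> n ^ k * (1 + \<bar>t\<bar>) ^ N * exp (a * t\<^sup>2)) * (K' / \<sigma> n ^ l * (1 + \<bar>t\<bar>) ^ N' * exp (b * t\<^sup>2))"
      unfolding norm_mult using scale_ge_1[OF t] K
      by (intro mult_mono le le' t mult_nonneg_nonneg divide_nonneg_nonneg) auto
    also have "\<dots> = (K * K') / \<sigma> n ^ (k + l) * (1 + \<bar>t\<bar>) ^ (N + N') * exp ((a + b) * t\<^sup>2)"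
      by (simp add: power_add exp_add algebra_simps)
    finally show "cmod (u n t * v n t) \<le> (K * K') / \<sigma> n ^ (k + l) * (1 + \<bar>t\<bar>) ^ (N + N') * exp ((a + b) * t\<^sup>2)" .
  qed
qed

lemma growth_cong:
  assumes "\<And>n t. t \<in> I n \<Longrightarrow> u n t = v n t"
  shows "growth a k u \<longleftrightarrow> growth a k v"
  unfolding growth_def using assms by simp

lemma derivs_growth_cong:
  assumes "\<And>n t. t \<in> I n \<Longrightarrow> u n t = v n t"
  shows "derivs_growth J a k u \<longleftrightarrow> derivs_growth J a k v"
proof (cases J)
  case (Suc J')
  have "(u n has_vector_derivative d) (at t) \<longleftrightarrow> (v n has_vector_derivative d) (at t)" if "t \<in> I n" for n t d
    using assms that open_I[of n]
    by (auto elim!: has_vector_derivative_transform_within_open[where S = "I n"])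
  thus ?thesis unfolding Suc derivs_growth.simps using growth_cong[OF assms] by auto
qed (simp add: growth_cong[OF assms])

lemma derivs_growth_0: "derivs_growth J a k u \<Longrightarrow> growth a k u"
  by (cases J) auto

lemma derivs_growth_Suc_D: "derivs_growth (Suc J) a k u \<Longrightarrow> derivs_growth J a k u"
proof (induction J arbitrary: u)
  case (Suc J)
  then obtain u' where u': "growth a k u" "\<forall>n. \<forall>t\<in>I n. (u n has_vector_derivative u' n t) (at t)" "derivs_growth (Suc J) a k u'"
    by auto
  from Suc.IH[OF u'(3)] u'(1,2) show ?case by auto
qed simp

lemma derivs_growth_mono:
  assumes "derivs_growth J a k u" "a \<le> b" "l \<le> k"
  shows "derivs_growth J b l u"
  using assms(1)
proof (induction J arbitrary: u)
  case (Suc J)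
  thus ?case using growth_mono[OF _ assms(2,3)] by auto
qed (use growth_mono[OF _ assms(2,3)] in auto)

lemma derivs_growth_add:
  assumes "derivs_growth J a k u" "derivs_growth J a k v"
  shows "derivs_growth J a k (\<lambda>n t. u n t + v n t)"
  using assms
proof (induction J arbitrary: u v)
  case (Suc J)
  then obtain u' v' where "\<forall>n. \<forall>t\<in>I n. (u n has_vector_derivative u' n t) (at t)" "derivs_growth J a k u'"
    "\<forall>n. \<forall>t\<in>I n. (v n has_vector_derivative v' n t) (at t)" "derivs_growth J a k v'" by auto
  with Suc.IH[of u' v'] Suc.prems show ?case
    by (auto intro!: growth_add exI[of _ "\<lambda>n t. u' n t + v' n t"] has_vector_derivative_add)
qed (auto intro: growth_add)

lemma derivs_growth_mult:
  assumes "derivs_growth J a k u" "derivs_growth J b l v"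
  shows "derivs_growth J (a + b) (k + l) (\<lambda>n t. u n t * v n t)"
  using assms
proof (induction J arbitrary: u v)
  case (Suc J)
  then obtain u' v' where D: "\<forall>n. \<forall>t\<in>I n. (u n has_vector_derivative u' n t) (at t)" "derivs_growth J a k u'"
    "\<forall>n. \<forall>t\<in>I n. (v n has_vector_derivative v' n t) (at t)" "derivs_growth J b l v'" by auto
  have "derivs_growth J (a + b) (k + l) (\<lambda>n t. u n t * v' n t + u' n t * v n t)"
    using Suc.IH[OF derivs_growth_Suc_D[OF Suc.prems(1)] D(4)] Suc.IH[OF D(2) derivs_growth_Suc_D[OF Suc.prems(2)]]
    by (rule derivs_growth_add)
  moreover have "growth (a + b) (k + l) (\<lambda>n t. u n t * v n t)"
    using Suc.prems by (intro growth_mult) auto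
  moreover have "t \<in> I n \<Longrightarrow> ((\<lambda>t. u n t * v n t) has_vector_derivative u n t * v' n t + u' n t * v n t) (at t)" for n t
    using D by (auto intro!: has_vector_derivative_mult)
  ultimately show ?case by (intro derivs_growth_SucI)
qed (auto intro: growth_mult)

lemma growth_const:
  assumes "\<And>n t. t \<in> I n \<Longrightarrow> cmod (c n) \<le> K / \<sigma> n ^ k"
  shows "growth 0 k (\<lambda>n t. c n)"
  using assms by (intro growthI[where K = K and N = 0]) auto

lemma derivs_growth_zero: "derivs_growth J 0 k (\<lambda>n t. 0)"
proof (induction J)
  case 0
  show ?case using growth_const[of "\<lambda>_. 0" 0 k] by simp
next
  case (Suc J)
  thus ?case using growth_const[of "\<lambda>_. 0" 0 k] by (auto intro!: exI[of _ "\<lambda>n t. 0"])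
qed

lemma derivs_growth_const:
  assumes "\<And>n t. t \<in> I n \<Longrightarrow> cmod (c n) \<le> K / \<sigma> n ^ k"
  shows "derivs_growth J 0 k (\<lambda>n t. c n)"
proof (cases J)
  case 0
  thus ?thesis using growth_const[of c K k] assms by simp
next
  case (Suc J')
  thus ?thesis using growth_const[of c K k] assms derivs_growth_zero[of J' k]
    by (auto intro!: exI[of _ "\<lambda>n t. 0"])
qed

lemma derivs_growth_ident: "derivs_growth J 0 0 (\<lambda>n t. of_real t)"
proof -
  have g: "growth 0 0 (\<lambda>n t. of_real t)"
    by (intro growthI[where K = 1 and N = 1]) auto
  show ?thesis
  proof (cases J)
    case (Suc J')
    have "derivs_growth J' 0 0 (\<lambda>n t. 1)" by (rule derivs_growth_const[where K = 1]) auto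
    thus ?thesis unfolding Suc derivs_growth.simps using g
      by (auto intro!: exI[of _ "\<lambda>n t. 1"] derivative_eq_intros has_vector_derivative_of_real)
  qed (use g in simp)
qed

lemma derivs_growth_power:
  assumes "derivs_growth J 0 k u"
  shows "derivs_growth J 0 (k * l) (\<lambda>n t. u n t ^ l)"
proof (induction l)
  case 0
  show ?case using derivs_growth_const[of "\<lambda>_. 1" 1 0 J] by simp
next
  case (Suc l)
  from derivs_growth_mult[OF assms this] show ?case by (simp add: algebra_simps)
qed

lemma derivs_growth_sum:
  assumes "finite A" "\<And>i. i \<in> A \<Longrightarrow> derivs_growth J 0 k (u i)"
  shows "derivs_growth J 0 k (\<lambda>n t. \<Sum>i\<in>A. u i n t)"
  using assms
proof (induction A)
  case empty
  show ?case using derivs_growth_zero by simp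
next
  case (insert x A)
  thus ?case using derivs_growth_add[of J 0 k "u x" "\<lambda>n t. \<Sum>i\<in>A. u i n t"] by simp
qed

text \<open>Integrating from 0 costs one power of \<open>1 + \<bar>t\<bar>\<close> and no power of
  \<open>\<sigma> n\<close>. The rate is 0, since a decaying exponential bound would be lost by
  integration.\<close>

lemma growth_integrate:
  assumes zero: "\<And>n t. t \<in> I n \<Longrightarrow> u n 0 = 0"
    and deriv: "\<And>n t. t \<in> I n \<Longrightarrow> (u n has_vector_derivative v n t) (at t)"
    and v: "growth 0 k v"
  shows "growth 0 k u"
proof -
  from v obtain K N where K: "0 \<le> K" and le [rule_format]: "\<forall>n. \<forall>t\<in>I n. cmod (v n t) \<le> K / \<sigma> n ^ k * (1 + \<bar>t\<bar>) ^ N * exp (0 * t\<^sup>2)"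
    unfolding growth_def by blast
  show ?thesis
  proof (rule growthI)
    fix n t assume t: "t \<in> I n"
    let ?B = "K / \<sigma> n ^ k * (1 + \<bar>t\<bar>) ^ N"
    have B: "0 \<le> ?B" using K scale_ge_1[OF t] by (intro mult_nonneg_nonneg divide_nonneg_nonneg) auto
    have "norm (u n t - u n 0) \<le> ?B * norm (t - 0)"
    proof (rule differentiable_bound[where S = "closed_segment 0 t"])
      fix s assume "s \<in> closed_segment 0 t"
      hence s: "s \<in> I n" "\<bar>s\<bar> \<le> \<bar>t\<bar>"
        using starlike[OF t] by (auto simp: closed_segment_eq_real_ivl split: if_splits)
      show "(u n has_derivative (\<lambda>h. h *\<^sub>R v n s)) (at s within closed_segment 0 t)"
        using has_vector_derivative_at_within[OF deriv[OF s(1)]] by (simp add: has_vector_derivative_def)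
      have "cmod (v n s) \<le> K / \<sigma> n ^ k * (1 + \<bar>s\<bar>) ^ N" using le[OF s(1)] by simp
      also have "\<dots> \<le> ?B" using s K scale_ge_1[OF t] by (intro mult_left_mono power_mono divide_nonneg_nonneg) auto
      finally show "onorm (\<lambda>h. h *\<^sub>R v n s) \<le> ?B"
        by (subst onorm_scaleR_left) (auto simp: bounded_linear_ident onorm_id)
    qed auto
    also have "\<dots> \<le> ?B * (1 + \<bar>t\<bar>)" using B by (intro mult_left_mono) auto
    finally show "cmod (u n t) \<le> K / \<sigma> n ^ k * (1 + \<bar>t\<bar>) ^ (Suc N) * exp (0 * t\<^sup>2)"
      using zero[OF t] by (simp add: mult_ac)
  qed
qed

lemma derivs_growth_integrate:
  assumes "\<And>n t. t \<in> I n \<Longrightarrow> u n 0 = 0"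
    and "\<And>n t. t \<in> I n \<Longrightarrow> (u n has_vector_derivative v n t) (at t)"
    and "derivs_growth J 0 k v"
  shows "derivs_growth (Suc J) 0 k u"
  by (rule derivs_growth_SucI[OF growth_integrate[OF assms(1,2) derivs_growth_0[OF assms(3)]] assms(2,3)])

lemma derivs_growth_exp_quadratic:
  assumes "\<And>n t. t \<in> I n \<Longrightarrow> \<bar>\<alpha> n\<bar> \<le> K" "\<And>n t. t \<in> I n \<Longrightarrow> \<bar>\<beta> n\<bar> \<le> K" "\<And>n t. t \<in> I n \<Longrightarrow> - \<beta> n / 2 \<le> a"
  shows "derivs_growth J a 0 (\<lambda>n t. exp (\<i> * of_real (\<alpha> n * t) - of_real (\<beta> n * t\<^sup>2 / 2)))"
proof (induction J)
  have "growth a 0 (\<lambda>n t. exp (\<i> * of_real (\<alpha> n * t) - of_real (\<beta> n * t\<^sup>2 / 2)))"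
  proof (rule growthI[where K = 1 and N = 0])
    fix n t assume t: "t \<in> I n"
    have "- (\<beta> n * t\<^sup>2 / 2) \<le> a * t\<^sup>2" using mult_right_mono[OF assms(3)[OF t], of "t\<^sup>2"] by simp
    thus "cmod (exp (\<i> * of_real (\<alpha> n * t) - of_real (\<beta> n * t\<^sup>2 / 2))) \<le> 1 / \<sigma> n ^ 0 * (1 + \<bar>t\<bar>) ^ 0 * exp (a * t\<^sup>2)"
      by (simp add: norm_exp_eq_Re del: of_real_mult of_real_divide)
  qed
  {
    case 0
    show ?case using \<open>growth a 0 _\<close> by simp
  next
    case (Suc J)
    let ?e = "\<lambda>n t. exp (\<i> * of_real (\<alpha> n * t) - of_real (\<beta> n * t\<^sup>2 / 2))"
    let ?p = "\<lambda>n t. \<i> * complex_of_real (\<alpha> n) + - complex_of_real (\<beta> n) * of_real t"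
    have "derivs_growth J 0 0 (\<lambda>n t. - complex_of_real (\<beta> n) * of_real t)"
      using derivs_growth_mult[OF derivs_growth_const[of "\<lambda>n. - complex_of_real (\<beta> n)" K 0] derivs_growth_ident] assms(2)
      by simp
    moreover have "derivs_growth J 0 0 (\<lambda>n t. \<i> * complex_of_real (\<alpha> n))"
      by (rule derivs_growth_const[where K = K]) (use assms(1) in \<open>auto simp: norm_mult\<close>)
    ultimately have "derivs_growth J 0 0 ?p" by (intro derivs_growth_add)
    from derivs_growth_mult[OF this Suc] have "derivs_growth J a 0 (\<lambda>n t. ?p n t * ?e n t)" by simp
    moreover have "(?e n has_vector_derivative ?p n t * ?e n t) (at t)" for n t
    proof -
      have "((\<lambda>z. exp (\<i> * (of_real (\<alpha> n) * z) - of_real (\<beta> n) * z\<^sup>2 / 2)) has_field_derivative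
        (\<i> * of_real (\<alpha> n) + - of_real (\<beta> n) * of_real t) * exp (\<i> * (of_real (\<alpha> n) * of_real t) - of_real (\<beta> n) * (of_real t)\<^sup>2 / 2)) (at (of_real t))"
        by (auto intro!: derivative_eq_intros)
      from has_vector_derivative_real_field[OF this] show ?thesis by simp
    qed
    ultimately show ?case using \<open>growth a 0 _\<close> by (intro derivs_growth_SucI)
  }
qed

text \<open>The remainder of index \<open>p\<close> is at most
  \<open>cmod (M n t) ^ p * exp (cmod (M n t))\<close>: the first factor has order \<open>p\<close>,
  the second the rate \<open>b\<close>. Differentiation lowers the index by one but brings a factor
  of order 1, so the order survives.\<close>

lemma derivs_growth_exp_remainder:
  assumes "derivs_growth J 0 1 M" "\<And>n t. t \<in> I n \<Longrightarrow> cmod (M n t) \<le> K + b * t\<^sup>2"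
  shows "derivs_growth J b p (\<lambda>n t. exp_remainder p (M n t))"
proof -
  have g: "growth b p (\<lambda>n t. exp_remainder p (M n t))" for p
  proof -
    have "growth 0 p (\<lambda>n t. M n t ^ p)"
      using derivs_growth_power[of 0 1 M p] derivs_growth_0[OF assms(1)] by simp
    then obtain C N where C: "0 \<le> C" and le [rule_format]: "\<forall>n. \<forall>t\<in>I n. cmod (M n t ^ p) \<le> C / \<sigma> n ^ p * (1 + \<bar>t\<bar>) ^ N * exp (0 * t\<^sup>2)"
      unfolding growth_def by blast
    show ?thesis
    proof (rule growthI)
      fix n t assume t: "t \<in> I n"
      have "cmod (exp_remainder p (M n t)) \<le> cmod (M n t ^ p) * exp (cmod (M n t))"
        using exp_remainder_bound by (simp add: norm_power)
      also have "\<dots> \<le> (C / \<sigma> n ^ p * (1 + \<bar>t\<bar>) ^ N * exp (0 * t\<^sup>2)) * exp (K + b * t\<^sup>2)"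
        using assms(2)[OF t] C scale_ge_1[OF t] by (intro mult_mono le t) (auto intro!: mult_nonneg_nonneg divide_nonneg_nonneg)
      also have "\<dots> = (C * exp K) / \<sigma> n ^ p * (1 + \<bar>t\<bar>) ^ N * exp (b * t\<^sup>2)" by (simp add: exp_add mult_ac)
      finally show "cmod (exp_remainder p (M n t)) \<le> (C * exp K) / \<sigma> n ^ p * (1 + \<bar>t\<bar>) ^ N * exp (b * t\<^sup>2)" .
    qed
  qed
  show ?thesis
    using assms(1)
  proof (induction J arbitrary: p)
    case (Suc J)
    obtain M' where M': "\<forall>n. \<forall>t\<in>I n. (M n has_vector_derivative M' n t) (at t)" "derivs_growth J 0 1 M'"
      using Suc.prems by auto
    note IH = Suc.IH[OF derivs_growth_Suc_D[OF Suc.prems]]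
    show ?case
    proof (cases p)
      case 0
      have "derivs_growth J b 1 (\<lambda>n t. exp_remainder 0 (M n t) * M' n t)"
        using derivs_growth_mult[OF IH[of 0] M'(2)] by simp
      hence "derivs_growth J b 0 (\<lambda>n t. exp_remainder 0 (M n t) * M' n t)"
        by (rule derivs_growth_mono) auto
      moreover have "t \<in> I n \<Longrightarrow> ((\<lambda>t. exp_remainder 0 (M n t)) has_vector_derivative exp_remainder 0 (M n t) * M' n t) (at t)" for n t
        using M'(1) exp_remainder_has_vector_derivative(2) by blast
      ultimately show ?thesis using g[of 0] unfolding 0 by (intro derivs_growth_SucI)
    next
      case (Suc q)
      have "derivs_growth J b (Suc q) (\<lambda>n t. exp_remainder q (M n t) * M' n t)"
        using derivs_growth_mult[OF IH[of q] M'(2)] by simp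
      moreover have "t \<in> I n \<Longrightarrow> ((\<lambda>t. exp_remainder (Suc q) (M n t)) has_vector_derivative exp_remainder q (M n t) * M' n t) (at t)" for n t
        using M'(1) exp_remainder_has_vector_derivative(1) by blast
      ultimately show ?thesis using g[of "Suc q"] unfolding Suc by (intro derivs_growth_SucI)
    qed
  qed (use g in simp)
qed

lemma derivs_growth_of_chain:
  assumes "\<And>j n t. j < J \<Longrightarrow> t \<in> I n \<Longrightarrow> (U j n has_vector_derivative U (Suc j) n t) (at t)"
    and "\<And>j. j \<le> J \<Longrightarrow> growth a k (U j)"
  shows "derivs_growth J a k (U 0)"
  using assms
proof (induction J arbitrary: U)
  case (Suc J)
  have "derivs_growth J a k (\<lambda>n. U (Suc 0) n)"
    by (rule Suc.IH[of "\<lambda>j. U (Suc j)"]) (use Suc.prems in auto)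
  thus ?case using Suc.prems(1)[of 0] Suc.prems(2)[of 0] by auto
qed auto

text \<open>The anonymous derivatives inside \<open>derivs_growth\<close> are identified with a
  given chain by uniqueness of derivatives, so bounds for concrete transforms can be read
  off.\<close>

lemma derivs_growth_chain:
  assumes "derivs_growth (J + r) a k u"
    and "\<And>n t. t \<in> I n \<Longrightarrow> u n t = U 0 n t"
    and "\<And>j n t. j < J \<Longrightarrow> t \<in> I n \<Longrightarrow> (U j n has_vector_derivative U (Suc j) n t) (at t)"
  shows "derivs_growth r a k (U J)"
  using assms
proof (induction J arbitrary: u U)
  case 0
  thus ?case using derivs_growth_cong[of u "U 0" r a k] by simp
next
  case (Suc J)
  have "derivs_growth (Suc (J + r)) a k (U 0)"
    using Suc.prems(1) derivs_growth_cong[of u "U 0" "Suc (J + r)" a k] Suc.prems(2) by simp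
  then obtain u' where u': "\<And>n t. t \<in> I n \<Longrightarrow> (U 0 n has_vector_derivative u' n t) (at t)" "derivs_growth (J + r) a k u'"
    by auto
  have "u' n t = U (Suc 0) n t" if "t \<in> I n" for n t
    using vector_derivative_unique_at[OF u'(1)[OF that] Suc.prems(3)[of 0, OF _ that]] by simp
  from Suc.IH[OF u'(2), of "\<lambda>j. U (Suc j)"] this Suc.prems(3) show ?case by simp
qed

end

section \<open>The formal symbol of the expansion\<close>

lemma polynomial_fun_sum:
  assumes "\<And>a. a \<in> A \<Longrightarrow> polynomial_fun V (f a)"
  shows "polynomial_fun V (\<lambda>v. \<Sum>a\<in>A. f a v)"
  using assms by (induction A rule: infinite_finite_induct) (auto intro: polynomial_fun.intros)

lemma polynomial_fun_bounded:
  assumes "polynomial_fun V f" "\<And>i. i \<in> V \<Longrightarrow> bounded (range (\<lambda>n :: nat. v n i))"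
  shows "bounded (range (\<lambda>n. f (v n)))"
  using assms
proof (induction rule: polynomial_fun.induct)
  case (add p q)
  then obtain a b where "\<And>n. norm (p (v n)) \<le> a" "\<And>n. norm (q (v n)) \<le> b"
    unfolding bounded_iff by auto
  hence "norm (p (v n) + q (v n)) \<le> a + b" for n by (meson norm_triangle_le add_mono)
  thus ?case unfolding bounded_iff by auto
next
  case (mult p q)
  then obtain a b where ab: "\<And>n. norm (p (v n)) \<le> a" "\<And>n. norm (q (v n)) \<le> b"
    unfolding bounded_iff by auto
  have "norm (p (v n) * q (v n)) \<le> a * b" for n
    unfolding norm_mult using ab order_trans[OF norm_ge_zero ab(1)] by (intro mult_mono) auto
  thus ?case unfolding bounded_iff by auto
qed auto

text \<open>Bivariate polynomials are polynomials in \<open>z\<close> (standing for \<open>1 / B\<close>) whose coefficients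
  are polynomials in \<open>s\<close> (standing for \<open>\<i> * t\<close>).\<close>

definition eval2 :: "complex poly poly \<Rightarrow> complex \<Rightarrow> complex \<Rightarrow> complex" where
  "eval2 p z s = poly (poly p [:z:]) s"

lemma eval2_simps [simp]:
  "eval2 (p + q) z s = eval2 p z s + eval2 q z s"
  "eval2 (p - q) z s = eval2 p z s - eval2 q z s"
  "eval2 (- p) z s = - eval2 p z s"
  "eval2 (p * q) z s = eval2 p z s * eval2 q z s"
  "eval2 (p ^ n) z s = eval2 p z s ^ n"
  "eval2 1 z s = 1" "eval2 [:[:c:]:] z s = c" "eval2 [:0, 1:] z s = z" "eval2 [:[:0, 1:]:] z s = s"
  by (simp_all add: eval2_def)

lemma eval2_sum [simp]: "eval2 (\<Sum>a\<in>A. f a) z s = (\<Sum>a\<in>A. eval2 (f a) z s)"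
  by (simp add: eval2_def poly_sum)

lemma eval2_altdef: "eval2 p z s = (\<Sum>j\<le>degree p. poly (coeff p j) s * z ^ j)"
  by (simp add: eval2_def poly_altdef[of p] poly_sum)

section \<open>Coefficients that are real polynomial functions of the parameters\<close>

definition real_parameters :: "nat \<Rightarrow> (parameter \<Rightarrow> complex) \<Rightarrow> bool" where
  "real_parameters m v \<longleftrightarrow> v Shift \<in> \<real> \<and> v Scale \<in> \<real> \<and> (\<forall>k\<in>{3..m}. v (Cumulant k) * (- \<i>) ^ k \<in> \<real>)"

text \<open>The three conjuncts are what the polynomials of the expansion must inherit: coefficients
  polynomial in the parameters, degrees independent of them, and real values at real parameters. All
  are preserved by sums and products, so they follow from the shape of the phase.\<close>

definition real_poly_family :: "nat \<Rightarrow> ((parameter \<Rightarrow> complex) \<Rightarrow> complex poly poly) \<Rightarrow> bool" where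
  "real_poly_family m E \<longleftrightarrow>
     (\<forall>j i. polynomial_fun (parameters m) (\<lambda>v. coeff (coeff (E v) j) i)) \<and>
     (\<exists>N. \<forall>v. degree (E v) \<le> N \<and> (\<forall>j. degree (coeff (E v) j) \<le> N)) \<and>
     (\<forall>v. real_parameters m v \<longrightarrow> (\<forall>j i. coeff (coeff (E v) j) i \<in> \<real>))"

lemma coeff_coeff_mult:
  fixes p q :: "complex poly poly"
  shows "coeff (coeff (p * q) j) i = (\<Sum>a\<le>j. \<Sum>b\<le>i. coeff (coeff p a) b * coeff (coeff q (j - a)) (i - b))"
  by (simp add: coeff_mult coeff_sum)

lemma real_poly_family_mult:
  assumes "real_poly_family m E" "real_poly_family m F"
  shows "real_poly_family m (\<lambda>v. E v * F v)"
proof -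
  obtain N1 where N1: "degree (E v) \<le> N1" "degree (coeff (E v) j) \<le> N1" for v j
    using assms(1) unfolding real_poly_family_def by blast
  obtain N2 where N2: "degree (F v) \<le> N2" "degree (coeff (F v) j) \<le> N2" for v j
    using assms(2) unfolding real_poly_family_def by blast
  have "degree (E v * F v) \<le> N1 + N2" for v
    using degree_mult_le[of "E v" "F v"] N1(1)[of v] N2(1)[of v] by linarith
  moreover have "degree (coeff (E v * F v) j) \<le> N1 + N2" for v j
    unfolding coeff_mult
  proof (rule degree_sum_le)
    fix a
    show "degree (coeff (E v) a * coeff (F v) (j - a)) \<le> N1 + N2"
      using degree_mult_le[of "coeff (E v) a" "coeff (F v) (j - a)"] N1(2)[of v a] N2(2)[of v "j - a"] by linarith
  qed simp
  moreover have "polynomial_fun (parameters m) (\<lambda>v. coeff (coeff (E v * F v) j) i)" for j i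
    unfolding coeff_coeff_mult
    using assms by (intro polynomial_fun_sum polynomial_fun.mult) (auto simp: real_poly_family_def)
  moreover have "real_parameters m v \<longrightarrow> coeff (coeff (E v * F v) j) i \<in> \<real>" for v j i
    unfolding coeff_coeff_mult
    using assms by (auto simp: real_poly_family_def intro!: sum_in_Reals Reals_mult)
  ultimately show ?thesis unfolding real_poly_family_def by blast
qed

lemma real_poly_family_add:
  assumes "real_poly_family m E" "real_poly_family m F"
  shows "real_poly_family m (\<lambda>v. E v + F v)"
proof -
  obtain N1 where N1: "degree (E v) \<le> N1" "degree (coeff (E v) j) \<le> N1" for v j
    using assms(1) unfolding real_poly_family_def by blast
  obtain N2 where N2: "degree (F v) \<le> N2" "degree (coeff (F v) j) \<le> N2" for v j
    using assms(2) unfolding real_poly_family_def by blast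
  have "degree (E v + F v) \<le> N1 + N2" "degree (coeff (E v + F v) j) \<le> N1 + N2" for v j
    using N1[of v] N2[of v] by (auto intro!: degree_add_le intro: trans_le_add1 trans_le_add2)
  thus ?thesis
    using assms unfolding real_poly_family_def
    by (auto intro!: polynomial_fun.add Reals_add exI[of _ "N1 + N2"])
qed

lemma real_poly_family_scalar:
  assumes "polynomial_fun (parameters m) f" "\<And>v. real_parameters m v \<Longrightarrow> f v \<in> \<real>"
  shows "real_poly_family m (\<lambda>v. [:[:f v:]:])"
proof -
  have "coeff (coeff [:[:f v:]:] j) i = (if j = 0 \<and> i = 0 then f v else 0)" for v j i
    by (auto simp: coeff_pCons split: nat.splits)
  moreover have "degree (coeff [:[:f v:]:] j) \<le> 0" for v j
    by (auto simp: coeff_pCons split: nat.splits)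
  moreover have "polynomial_fun (parameters m) (\<lambda>v. if j = 0 \<and> i = 0 then f v else 0)" for j i :: nat
    using assms(1) by (cases "j = 0 \<and> i = 0") (auto intro: polynomial_fun.const)
  ultimately show ?thesis unfolding real_poly_family_def using assms(2) by auto
qed

lemma real_poly_family_const:
  assumes "\<And>j i. coeff (coeff p j) i \<in> \<real>"
  shows "real_poly_family m (\<lambda>v. p)"
proof -
  have "degree p \<le> degree p + (\<Sum>j\<le>degree p. degree (coeff p j))" by simp
  moreover have "degree (coeff p j) \<le> degree p + (\<Sum>j\<le>degree p. degree (coeff p j))" for j
  proof (cases "j \<le> degree p")
    case True
    hence "degree (coeff p j) \<le> (\<Sum>j\<le>degree p. degree (coeff p j))" by (intro member_le_sum) auto
    thus ?thesis by simp
  qed (simp add: coeff_eq_0)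
  ultimately show ?thesis
    unfolding real_poly_family_def using assms
    by (auto intro: polynomial_fun.const intro!: exI[of _ "degree p + (\<Sum>j\<le>degree p. degree (coeff p j))"])
qed

lemma real_poly_family_sum:
  assumes "\<And>a. a \<in> A \<Longrightarrow> real_poly_family m (f a)"
  shows "real_poly_family m (\<lambda>v. \<Sum>a\<in>A. f a v)"
  using assms
  by (induction A rule: infinite_finite_induct) (auto intro: real_poly_family_add real_poly_family_const)

lemma real_poly_family_power: "real_poly_family m E \<Longrightarrow> real_poly_family m (\<lambda>v. E v ^ n)"
proof (induction n)
  case 0
  have "coeff (coeff (1 :: complex poly poly) j) i \<in> \<real>" for j i
    by (auto simp: one_pCons coeff_pCons split: nat.splits)
  thus ?case by (simp add: real_poly_family_const)
qed (simp add: real_poly_family_mult)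

text \<open>The phase divided by \<open>z * s\<close>. With \<open>z = 1 / B\<close> one has
  \<open>\<sigma> / B = 1 - (B - \<sigma>) * z\<close> and
  \<open>t = - \<i> * s * \<sigma> * z\<close>. Each cumulant term thus becomes
  \<open>s ^ k * z ^ (k - 2)\<close> times the square of \<open>1 - (B - \<sigma>) * z\<close>: the
  factor \<open>\<sigma> ^ (k - 2)\<close> inside the parameter absorbs all but two powers of
  \<open>\<sigma>\<close>.\<close>

definition phase_factor :: "nat \<Rightarrow> (parameter \<Rightarrow> complex) \<Rightarrow> complex poly poly" where
  "phase_factor m v =
     [:[:- v Shift:]:] + [:[:0, 1:]:] * ([:[:- v Scale:]:] + [:[:v Scale * v Scale / 2:]:] * [:0, 1:]) +
     (\<Sum>k\<in>{3..m}. [:[:v (Cumulant k) * (- \<i>) ^ k / fact k:]:] * [:[:0, 1:]:] ^ (k - 1) * [:0, 1:] ^ (k - 3) *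
        (1 + [:[:- v Scale:]:] * [:0, 1:]) ^ 2)"

text \<open>With \<open>z = 1 / B\<close>, \<open>s = \<i> t B / \<sigma>\<close> this is \<open>- \<i> t A / \<sigma> + (t\<^sup>2 / 2) (B\<^sup>2 / \<sigma>\<^sup>2 - 1)\<close> plus the
  Taylor polynomial of \<open>\<Lambda>\<close> of degree \<open>m\<close>.\<close>

definition phase :: "nat \<Rightarrow> (parameter \<Rightarrow> complex) \<Rightarrow> complex poly poly" where
  "phase m v = [:0, 1:] * [:[:0, 1:]:] * phase_factor m v"

text \<open>The phase is divisible by \<open>z\<close>, so its powers from \<open>m - 1\<close> on
  contribute only to \<open>z ^ (m - 1)\<close> and beyond, outside the expansion.\<close>

definition exp_phase :: "nat \<Rightarrow> (parameter \<Rightarrow> complex) \<Rightarrow> complex poly poly" where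
  "exp_phase m v = (\<Sum>l<m - 1. [:[:1 / fact l:]:] * phase m v ^ l)"

lemma real_poly_family_phase: "real_poly_family m (phase m)"
proof -
  have Z: "real_poly_family m (\<lambda>v. [:0, 1:])" and S: "real_poly_family m (\<lambda>v. [:[:0, 1:]:])"
    by (intro real_poly_family_const; auto simp: coeff_pCons split: nat.splits)+
  have one: "real_poly_family m (\<lambda>v. 1)"
    by (intro real_poly_family_const) (auto simp: one_pCons coeff_pCons split: nat.splits)
  have var: "polynomial_fun (parameters m) (\<lambda>v. v Shift)" "polynomial_fun (parameters m) (\<lambda>v. v Scale)"
    and cum: "k \<in> {3..m} \<Longrightarrow> polynomial_fun (parameters m) (\<lambda>v. v (Cumulant k))" for k
    by (intro polynomial_fun.var; force simp: parameters_def)+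
  have neg: "polynomial_fun (parameters m) (\<lambda>v. - f v)" if "polynomial_fun (parameters m) f" for f
    using polynomial_fun.mult[OF polynomial_fun.const[of _ "-1"] that] by simp
  have div: "polynomial_fun (parameters m) (\<lambda>v. f v / c)" if "polynomial_fun (parameters m) f" for f c
    using polynomial_fun.mult[OF that polynomial_fun.const[of _ "1 / c"]] by simp
  have fact: "fact k \<in> (\<real> :: complex set)" for k by (metis Reals_of_real of_real_fact)
  have cumulant: "real_poly_family m (\<lambda>v. [:[:v (Cumulant k) * (- \<i>) ^ k / fact k:]:])" if "k \<in> {3..m}" for k
    using that
    by (intro real_poly_family_scalar div polynomial_fun.mult cum polynomial_fun.const)
       (auto simp: real_parameters_def intro!: fact Reals_divide)
  show ?thesis
    unfolding phase_def[abs_def] phase_factor_def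
    by (intro real_poly_family_mult real_poly_family_add real_poly_family_sum real_poly_family_power Z S one
        cumulant real_poly_family_scalar neg div polynomial_fun.mult var)
       (auto simp: real_parameters_def intro!: Reals_minus Reals_divide Reals_mult)
qed

lemma real_poly_family_exp_phase: "real_poly_family m (exp_phase m)"
proof -
  have "fact k \<in> (\<real> :: complex set)" for k by (metis Reals_of_real of_real_fact)
  thus ?thesis
    unfolding exp_phase_def[abs_def]
    by (intro real_poly_family_sum real_poly_family_mult real_poly_family_power real_poly_family_phase
        real_poly_family_scalar polynomial_fun.const) (auto intro!: Reals_divide)
qed

lemma exp_phase_coeff_0:
  assumes "2 \<le> m"
  shows "coeff (exp_phase m v) 0 = 1"
proof -
  have "coeff (phase m v ^ l) 0 = (if l = 0 then 1 else 0)" for l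
    by (cases l) (auto simp: phase_def coeff_mult_0)
  hence "coeff (exp_phase m v) 0 = (\<Sum>l<m - 1. if l = 0 then 1 else 0)"
    unfolding exp_phase_def coeff_sum coeff_mult_0 by (intro sum.cong) auto
  also have "\<dots> = 1" using assms by (simp add: sum.delta)
  finally show ?thesis .
qed

text \<open>The phase is also divisible by \<open>s\<close>. Hence the corrections carry no total
  mass, and one factor \<open>\<i> * t\<close> can be removed from their symbols to pass from the
  density to the distribution function.\<close>

lemma exp_phase_coeff_coeff_0:
  assumes "0 < j"
  shows "coeff (coeff (exp_phase m v) j) 0 = 0"
proof -
  have "coeff (coeff ([:[:0, 1:]:] * p) i) 0 = 0" for p :: "complex poly poly" and i
    by simp
  hence *: "coeff (coeff (phase m v * p) i) 0 = 0" for p i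
    unfolding phase_def by (metis mult.assoc mult.commute)
  have "coeff (coeff (phase m v ^ l) j) 0 = 0" for l
    using assms * by (cases l) (auto simp: one_pCons coeff_pCons split: nat.splits)
  thus ?thesis
    unfolding exp_phase_def coeff_sum by (intro sum.neutral) auto
qed

lemma eval2_phase:
  assumes "B \<noteq> 0" "\<sigma> \<noteq> 0" and v: "v Shift = of_real A" "v Scale = of_real (B - \<sigma>)"
    and c: "\<And>k. k \<in> {3..m} \<Longrightarrow> v (Cumulant k) = c k * of_real (\<sigma> ^ (k - 2))"
  shows "eval2 (phase m v) (1 / of_real B) (\<i> * of_real (t * B / \<sigma>))
    = - (\<i> * of_real (t * A / \<sigma>)) + of_real (t\<^sup>2 / 2 * (B\<^sup>2 / \<sigma>\<^sup>2 - 1)) + (\<Sum>k\<in>{3..m}. c k * of_real t ^ k / fact k)"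
proof -
  let ?z = "1 / complex_of_real B" and ?s = "\<i> * complex_of_real (t * B / \<sigma>)"
  have 1: "?z * ?s * - of_real A = - (\<i> * of_real (t * A / \<sigma>))" using assms(1,2) by simp
  have 2: "?z * ?s * (?s * (- of_real (B - \<sigma>) + of_real (B - \<sigma>) * of_real (B - \<sigma>) / 2 * ?z))
      = of_real (t\<^sup>2 / 2 * (B\<^sup>2 / \<sigma>\<^sup>2 - 1))"
  proof -
    have ss: "?s * ?s = - of_real ((t * B / \<sigma>)\<^sup>2)"
    proof -
      have "\<i> * x * (\<i> * x) = - (x * x)" for x :: complex by (simp add: algebra_simps)
      thus ?thesis by (simp only: power2_eq_square of_real_mult[symmetric])
    qed
    have "?z * ?s * (?s * X) = ?s * ?s * (?z * X)" for X by (simp only: mult_ac)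
    hence "?z * ?s * (?s * (- of_real (B - \<sigma>) + of_real (B - \<sigma>) * of_real (B - \<sigma>) / 2 * ?z))
       = of_real (- ((t * B / \<sigma>)\<^sup>2) * (1 / B * (- (B - \<sigma>) + (B - \<sigma>) * (B - \<sigma>) / 2 * (1 / B))))"
      unfolding ss by simp
    also have "- ((t * B / \<sigma>)\<^sup>2) * (1 / B * (- (B - \<sigma>) + (B - \<sigma>) * (B - \<sigma>) / 2 * (1 / B)))
        = t\<^sup>2 / 2 * (B\<^sup>2 / \<sigma>\<^sup>2 - 1)"
      using assms(1,2) by (simp add: power2_eq_square field_simps)
    finally show ?thesis .
  qed
  have 3: "?z * ?s * (v (Cumulant k) * (- \<i>) ^ k / fact k * ?s ^ (k - 1) * ?z ^ (k - 3) * (1 + - of_real (B - \<sigma>) * ?z) ^ 2)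
      = c k * of_real t ^ k / fact k" if k: "k \<in> {3..m}" for k
  proof -
    obtain l where l: "k = l + 3" using k le_Suc_ex[of 3 k] by (auto simp: add.commute)
    have sc: "1 + - of_real (B - \<sigma>) * ?z = of_real \<sigma> * ?z" using assms(1) by (simp add: field_simps)
    \<comment> \<open>All factors collect into a single power of \<open>J * S * R * Z\<close>; with
      \<open>J = - \<i>\<close> and \<open>R = \<sigma>\<close> this product is
      \<open>t\<close>.\<close>
    have gen: "Z * S * (C * R ^ Suc l * J ^ (l + 3) / F * S ^ Suc (Suc l) * Z ^ l * (R * Z) ^ 2) = C / F * (J * S * R * Z) ^ (l + 3)"
      for Z S C R J F :: complex
      by (simp add: power_mult_distrib power_add power2_eq_square power3_eq_cube mult_ac)
    have e: "k - 1 = Suc (Suc l)" "k - 3 = l" "k - 2 = Suc l" by (auto simp: l)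
    have "?z * ?s * (v (Cumulant k) * (- \<i>) ^ k / fact k * ?s ^ (k - 1) * ?z ^ (k - 3) * (1 + - of_real (B - \<sigma>) * ?z) ^ 2)
      = c k / fact k * (- \<i> * ?s * of_real \<sigma> * ?z) ^ k"
      unfolding sc c[OF k] e of_real_power
      using gen[of ?z ?s "c k" "of_real \<sigma>" "- \<i>" "fact k"] unfolding l by (simp only:)
    also have "- \<i> * ?s * of_real \<sigma> * ?z = of_real t" using assms(1,2) by simp
    finally show ?thesis by simp
  qed
  show ?thesis
    unfolding phase_def phase_factor_def eval2_simps eval2_sum distrib_left[of "?z * ?s"] v
      sum_distrib_left[of "?z * ?s"] 1 2
    by (intro arg_cong2[of _ _ _ _ "(+)"] refl sum.cong) (use 3 in \<open>simp only: v\<close>)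
qed

section \<open>Polynomials times the Gaussian density\<close>

lemma power_div_fact_le_exp:
  fixes u :: real
  assumes "0 \<le> u"
  shows "u ^ N / fact N \<le> exp u"
proof -
  have "u ^ N / fact N = (\<Sum>n\<in>{N}. inverse (fact n) *\<^sub>R u ^ n)" by (simp add: divide_inverse mult.commute)
  also have "\<dots> \<le> (\<Sum>n. inverse (fact n) *\<^sub>R u ^ n)"
    using assms by (intro sum_le_suminf summable_exp_generic) auto
  finally show ?thesis by (simp add: exp_def)
qed

lemma power_exp_quadratic_bounded:
  fixes a :: real
  assumes "0 < a"
  shows "\<exists>K>0. \<forall>t. (1 + \<bar>t\<bar>) ^ N * exp (- a * t\<^sup>2) \<le> K"
proof (intro exI conjI allI)
  fix t :: real
  have "(1 + \<bar>t\<bar>) ^ N * exp (- a * t\<^sup>2) \<le> (fact N * exp (1 + \<bar>t\<bar>)) * exp (- a * t\<^sup>2)"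
    using power_div_fact_le_exp[of "1 + \<bar>t\<bar>" N] by (intro mult_right_mono) (auto simp: field_simps)
  also have "\<dots> = fact N * exp (1 + \<bar>t\<bar> - a * t\<^sup>2)" by (simp add: exp_add[symmetric] exp_diff exp_minus field_simps)
  \<comment> \<open>Completing the square.\<close>
  also have "1 + \<bar>t\<bar> - a * t\<^sup>2 \<le> 1 + 1 / (4 * a)"
  proof -
    have "0 \<le> (2 * a * \<bar>t\<bar> - 1)\<^sup>2" by simp
    also have "\<dots> = 4 * a * (a * t\<^sup>2 - \<bar>t\<bar>) + 1" by (simp add: power2_eq_square algebra_simps)
    finally have "\<bar>t\<bar> - a * t\<^sup>2 \<le> 1 / (4 * a)" using assms by (simp add: field_simps)
    thus ?thesis by simp
  qed
  finally show "(1 + \<bar>t\<bar>) ^ N * exp (- a * t\<^sup>2) \<le> fact N * exp (1 + 1 / (4 * a))"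
    by simp
qed simp

lemma poly_measurable [measurable]:
  fixes p :: "real poly"
  shows "poly p \<in> borel_measurable borel"
  by (intro borel_measurable_continuous_onI continuous_intros)

lemma abs_poly_le:
  fixes p :: "real poly"
  assumes "degree p \<le> N" "\<And>i. \<bar>coeff p i\<bar> \<le> K"
  shows "\<bar>poly p x\<bar> \<le> real (Suc N) * K * (1 + \<bar>x\<bar>) ^ N"
proof -
  have K: "0 \<le> K" using assms(2)[of 0] by linarith
  have "poly p x = (\<Sum>i\<le>N. coeff p i * x ^ i)"
    unfolding poly_altdef using assms(1) by (intro sum.mono_neutral_left) (auto simp: coeff_eq_0)
  also have "\<bar>\<dots>\<bar> \<le> (\<Sum>i\<le>N. \<bar>coeff p i * x ^ i\<bar>)" by (rule sum_abs)
  also have "\<dots> \<le> (\<Sum>i\<le>N. K * (1 + \<bar>x\<bar>) ^ N)"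
    using assms(2) K abs_power_le_one_plus_power[of _ N x]
    by (intro sum_mono) (auto simp: abs_mult power_abs intro!: mult_mono)
  finally show ?thesis by simp
qed

text \<open>The bound is uniform over all polynomials of bounded degree and coefficients, since the
  polynomials of the expansion vary with \<open>n\<close>.\<close>

lemma gaussian_poly_bounded:
  "\<exists>L>0. \<forall>p. degree p \<le> N \<longrightarrow> (\<forall>i. \<bar>coeff p i\<bar> \<le> K) \<longrightarrow>
     (\<forall>x. \<bar>std_normal_density x * poly p x\<bar> * (1 + \<bar>x\<bar>) ^ k \<le> L)"
proof -
  obtain C where C: "0 < C" "\<And>t :: real. (1 + \<bar>t\<bar>) ^ (N + k) * exp (- (1 / 2) * t\<^sup>2) \<le> C"
    using power_exp_quadratic_bounded[of "1 / 2" "N + k"] by auto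
  show ?thesis
  proof (intro exI[of _ "real (Suc N) * (\<bar>K\<bar> + 1) * C"] conjI allI impI)
    show "0 < real (Suc N) * (\<bar>K\<bar> + 1) * C" using C by simp
    fix p :: "real poly" and x :: real
    assume p: "degree p \<le> N" "\<forall>i. \<bar>coeff p i\<bar> \<le> K"
    have "\<bar>poly p x\<bar> \<le> real (Suc N) * (\<bar>K\<bar> + 1) * (1 + \<bar>x\<bar>) ^ N"
    proof (rule abs_poly_le[OF p(1)])
      fix i show "\<bar>coeff p i\<bar> \<le> \<bar>K\<bar> + 1" using p(2)[rule_format, of i] by linarith
    qed
    moreover have "std_normal_density x \<le> exp (- (1 / 2) * x\<^sup>2)"
    proof -
      have "1 \<le> sqrt (2 * pi)" using pi_gt3 by simp
      hence "1 / sqrt (2 * pi) \<le> 1" by simp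
      hence "1 / sqrt (2 * pi) * exp (- x\<^sup>2 / 2) \<le> 1 * exp (- x\<^sup>2 / 2)" by (intro mult_right_mono) auto
      thus ?thesis by (simp add: std_normal_density_def)
    qed
    ultimately have "std_normal_density x * \<bar>poly p x\<bar> \<le> exp (- (1 / 2) * x\<^sup>2) * (real (Suc N) * (\<bar>K\<bar> + 1) * (1 + \<bar>x\<bar>) ^ N)"
      by (intro mult_mono) auto
    hence "\<bar>std_normal_density x * poly p x\<bar> * (1 + \<bar>x\<bar>) ^ k
      \<le> exp (- (1 / 2) * x\<^sup>2) * (real (Suc N) * (\<bar>K\<bar> + 1) * (1 + \<bar>x\<bar>) ^ N) * (1 + \<bar>x\<bar>) ^ k"
      by (intro mult_right_mono) (auto simp: abs_mult)
    also have "\<dots> = real (Suc N) * (\<bar>K\<bar> + 1) * ((1 + \<bar>x\<bar>) ^ (N + k) * exp (- (1 / 2) * x\<^sup>2))"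
      by (simp add: power_add mult_ac)
    also have "\<dots> \<le> real (Suc N) * (\<bar>K\<bar> + 1) * C"
      by (intro mult_left_mono C) auto
    finally show "\<bar>std_normal_density x * poly p x\<bar> * (1 + \<bar>x\<bar>) ^ k \<le> real (Suc N) * (\<bar>K\<bar> + 1) * C" .
  qed
qed

lemma gaussian_poly_decay:
  "\<exists>L>0. \<forall>x. \<bar>std_normal_density x * poly p x\<bar> * (1 + \<bar>x\<bar>) ^ k \<le> L"
proof -
  have "\<bar>coeff p i\<bar> \<le> (\<Sum>i\<le>degree p. \<bar>coeff p i\<bar>)" for i
  proof (cases "i \<le> degree p")
    case True
    thus ?thesis by (intro member_le_sum) auto
  qed (simp add: coeff_eq_0 sum_nonneg)
  thus ?thesis using gaussian_poly_bounded[of "degree p" "\<Sum>i\<le>degree p. \<bar>coeff p i\<bar>" k] by blast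
qed

lemma inverse_one_plus_abs_square_le: "1 / (1 + \<bar>x :: real\<bar>)\<^sup>2 \<le> inverse (1 + x\<^sup>2)"
proof -
  have "1 + x\<^sup>2 \<le> (1 + \<bar>x\<bar>)\<^sup>2" by (simp add: power2_eq_square algebra_simps)
  thus ?thesis by (simp add: divide_inverse le_imp_inverse_le add_pos_nonneg)
qed

lemma integrable_of_quadratic_decay:
  fixes f :: "real \<Rightarrow> 'b :: {banach, second_countable_topology}"
  assumes [measurable]: "f \<in> borel_measurable borel"
    and "\<And>x. norm (f x) * (1 + \<bar>x\<bar>)\<^sup>2 \<le> L"
  shows "integrable lborel f"
proof (rule Bochner_Integration.integrable_bound)
  show "integrable lborel (\<lambda>x :: real. L * inverse (1 + x\<^sup>2))"
    using integrable_inverse_one_plus_square by simp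
  have L: "0 \<le> L" using order_trans[OF _ assms(2)[of 0], of 0] by simp
  show "AE x in lborel. norm (f x) \<le> norm (L * inverse (1 + x\<^sup>2))"
  proof (rule AE_I2)
    fix x :: real
    have "0 < (1 + \<bar>x\<bar>)\<^sup>2" by (intro zero_less_power) linarith
    hence "norm (f x) \<le> L * (1 / (1 + \<bar>x\<bar>)\<^sup>2)" using assms(2)[of x] by (simp add: field_simps)
    also have "\<dots> \<le> L * inverse (1 + x\<^sup>2)" by (intro mult_left_mono inverse_one_plus_abs_square_le L)
    finally show "norm (f x) \<le> norm (L * inverse (1 + x\<^sup>2))" by simp
  qed
qed measurable

lemma integrable_gaussian_poly_power:
  "integrable lborel (\<lambda>x. std_normal_density x * poly p x * (1 + \<bar>x\<bar>) ^ k)"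
proof -
  obtain L where "\<forall>x. \<bar>std_normal_density x * poly p x\<bar> * (1 + \<bar>x\<bar>) ^ (k + 2) \<le> L"
    using gaussian_poly_decay by blast
  thus ?thesis
    by (intro integrable_of_quadratic_decay[where L = L]) (auto simp: abs_mult power_add power2_eq_square mult_ac)
qed

lemma gaussian_poly_tendsto_0:
  shows "((\<lambda>x. std_normal_density x * poly p x) \<longlongrightarrow> 0) at_top"
    and "((\<lambda>x. std_normal_density x * poly p x) \<longlongrightarrow> 0) at_bot"
proof -
  obtain L where L: "\<And>x. \<bar>std_normal_density x * poly p x\<bar> * (1 + \<bar>x\<bar>) ^ 1 \<le> L"
    using gaussian_poly_decay[of p 1] by blast
  have le: "norm (std_normal_density x * poly p x) \<le> L / (1 + \<bar>x\<bar>)" for x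
  proof -
    have "0 < 1 + \<bar>x\<bar>" by linarith
    thus ?thesis using L[of x] by (simp add: pos_le_divide_eq)
  qed
  have "filterlim (\<lambda>x :: real. 1 + \<bar>x\<bar>) at_top at_top"
    by (intro filterlim_tendsto_add_at_top[OF tendsto_const] filterlim_abs_real)
  moreover have "filterlim (\<lambda>x :: real. 1 + \<bar>x\<bar>) at_top at_bot"
    using calculation by (simp add: filterlim_at_bot_mirror)
  ultimately have "((\<lambda>x. L / (1 + \<bar>x\<bar>)) \<longlongrightarrow> 0) at_top" "((\<lambda>x. L / (1 + \<bar>x\<bar>)) \<longlongrightarrow> 0) at_bot"
    by (auto intro: tendsto_divide_0 filterlim_at_top_imp_at_infinity)
  thus "((\<lambda>x. std_normal_density x * poly p x) \<longlongrightarrow> 0) at_top" "((\<lambda>x. std_normal_density x * poly p x) \<longlongrightarrow> 0) at_bot"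
    by (auto intro: Lim_null_comparison[OF always_eventually] le)
qed

lemma gaussian_poly_has_real_derivative:
  "((\<lambda>x. std_normal_density x * poly p x) has_real_derivative
    std_normal_density x * poly (pderiv p - [:0, 1:] * p) x) (at x within S)"
proof -
  have "((\<lambda>x. std_normal_density x * poly p x) has_real_derivative
    std_normal_density x * poly (pderiv p - [:0, 1:] * p) x) (at x)"
  proof -
    define c where "c = 1 / sqrt (2 * pi)"
    have eq: "std_normal_density = (\<lambda>x. c * exp (- x\<^sup>2 / 2))"
      by (simp add: std_normal_density_def c_def fun_eq_iff)
    show ?thesis unfolding eq
      by (auto intro!: derivative_eq_intros simp: algebra_simps)
  qed
  thus ?thesis by (rule has_field_derivative_at_within)
qed

lemma continuous_std_normal_density [continuous_intros]: "continuous_on S std_normal_density"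
  unfolding std_normal_density_def by (intro continuous_intros) auto

lemma integral_deriv_gaussian_poly:
  "(LBINT t:{..x}. std_normal_density t * poly (pderiv p - [:0, 1:] * p) t) = std_normal_density x * poly p x"
proof -
  let ?f = "\<lambda>t. std_normal_density t * poly (pderiv p - [:0, 1:] * p) t"
  have cont: "continuous_on UNIV ?f" by (intro continuous_intros)
  have int: "integrable lborel ?f" using integrable_gaussian_poly_power[of "pderiv p - [:0, 1:] * p" 0] by simp
  have "(LBINT t=-\<infinity>..ereal x. ?f t) = std_normal_density x * poly p x - 0"
  proof (rule interval_integral_FTC_integrable)
    show "((\<lambda>t. std_normal_density t * poly p t) has_vector_derivative ?f t) (at t)" for t
      using gaussian_poly_has_real_derivative[of p t UNIV] by (simp add: has_real_derivative_iff_has_vector_derivative)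
    show "isCont ?f t" for t using cont by (simp add: continuous_on_eq_continuous_at)
    show "set_integrable lborel (einterval (-\<infinity>) (ereal x)) ?f"
      unfolding set_integrable_def by (intro integrable_mult_indicator int) simp
    show "(((\<lambda>t. std_normal_density t * poly p t) \<circ> real_of_ereal) \<longlongrightarrow> 0) (at_right (- \<infinity>))"
      using gaussian_poly_tendsto_0(2)[of p] by (simp add: ereal_tendsto_simps)
    have "continuous_on UNIV (\<lambda>t. std_normal_density t * poly p t)" by (intro continuous_intros)
    hence "((\<lambda>t. std_normal_density t * poly p t) \<longlongrightarrow> std_normal_density x * poly p x) (at x)"
      by (simp add: continuous_on_def)
    hence "((\<lambda>t. std_normal_density t * poly p t) \<longlongrightarrow> std_normal_density x * poly p x) (at_left x)"
      by (rule filterlim_mono) (auto simp: at_le)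
    thus "(((\<lambda>t. std_normal_density t * poly p t) \<circ> real_of_ereal) \<longlongrightarrow> std_normal_density x * poly p x) (at_left (ereal x))"
      by (simp add: ereal_tendsto_simps)
  qed simp
  also have "(LBINT t=-\<infinity>..ereal x. ?f t) = (LBINT t:{..x}. ?f t)"
  proof -
    have [measurable]: "?f \<in> borel_measurable borel" by measurable
    have "(LINT t|lborel. indicator {..<x} t *\<^sub>R ?f t) = (LINT t|lborel. indicator {..x} t *\<^sub>R ?f t)"
    proof (rule integral_cong_AE)
      show "AE t in lborel. indicator {..<x} t *\<^sub>R ?f t = indicator {..x} t *\<^sub>R ?f t"
        using AE_lborel_singleton[of x] by eventually_elim (simp add: indicator_def)
    qed measurable
    moreover have "einterval (-\<infinity>) (ereal x) = {..<x}" by (auto simp: einterval_def)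
    ultimately show ?thesis
      unfolding interval_lebesgue_integral_def set_lebesgue_integral_def by (simp only: ereal_infty_less_eq(2) MInfty_neq_ereal) simp
  qed
  finally show ?thesis by simp
qed

text \<open>The probabilists' Hermite polynomials, given by the recursion that makes
  \<open>std_normal_density\<close> times \<open>hermite (Suc k)\<close> the negative derivative of
  \<open>std_normal_density\<close> times \<open>hermite k\<close>.\<close>

primrec hermite :: "nat \<Rightarrow> real poly" where
  "hermite 0 = 1"
| "hermite (Suc k) = [:0, 1:] * hermite k - pderiv (hermite k)"

lemma degree_hermite: "degree (hermite k) \<le> k"
proof (induction k)
  case (Suc k)
  have "degree ([:0, 1:] * hermite k) \<le> Suc k"
    using degree_mult_le[of "[:0, 1:]" "hermite k"] Suc by simp
  moreover have "degree (pderiv (hermite k)) \<le> Suc k" using Suc by (simp add: degree_pderiv)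
  ultimately show ?case by (simp add: degree_diff_le)
qed simp

lemma integrable_gaussian_poly_exp:
  "integrable lborel (\<lambda>x. of_real (std_normal_density x * poly p x) * iexp (t * x))"
proof -
  have "integrable lborel (\<lambda>x. std_normal_density x * poly p x)"
    using integrable_gaussian_poly_power[of p 0] by simp
  thus ?thesis by (rule Bochner_Integration.integrable_bound) (auto simp: norm_mult)
qed

text \<open>The case 0 is the characteristic function of the normal law. In the step, the derivative
  of the integrand of order \<open>k\<close> has integral 0 over the line, because that integrand
  vanishes at both ends; the product rule then yields the factor \<open>\<i> * t\<close>.\<close>

lemma fourier_hermite:
  "(LINT x|lborel. of_real (std_normal_density x * poly (hermite k) x) * iexp (t * x))
     = (\<i> * of_real t) ^ k * of_real (exp (- t\<^sup>2 / 2))"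
proof (induction k)
  case 0
  have "char std_normal_distribution t = of_real (exp (- t\<^sup>2 / 2))"
    by (simp add: char_std_normal_distribution)
  moreover have "char std_normal_distribution t = (LINT x|lborel. of_real (std_normal_density x) * iexp (t * x))"
    unfolding char_def by (subst integral_density) (auto simp: scaleR_conv_of_real)
  ultimately show ?case by simp
next
  case (Suc k)
  let ?p = "hermite k"
  let ?F = "\<lambda>x. of_real (std_normal_density x * poly ?p x) * iexp (t * x)"
  let ?f = "\<lambda>x. of_real (std_normal_density x * poly (pderiv ?p - [:0, 1:] * ?p) x) * iexp (t * x) + \<i> * of_real t * ?F x"
  have cont: "continuous_on UNIV ?f" by (intro continuous_intros)
  have i1: "integrable lborel (\<lambda>x. of_real (std_normal_density x * poly (pderiv ?p - [:0, 1:] * ?p) x) * iexp (t * x))"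
    by (rule integrable_gaussian_poly_exp)
  have i2: "integrable lborel (\<lambda>x. \<i> * of_real t * ?F x)"
    by (intro integrable_mult_right integrable_gaussian_poly_exp)
  have int: "integrable lborel ?f" using i1 i2 by (rule Bochner_Integration.integrable_add)
  have norm: "cmod (?F x) = \<bar>std_normal_density x * poly ?p x\<bar>" for x
    by (simp add: norm_mult abs_mult)
  have "(LBINT x=-\<infinity>..\<infinity>. ?f x) = 0 - 0"
  proof (rule interval_integral_FTC_integrable)
    fix x
    have "((\<lambda>x. complex_of_real (std_normal_density x * poly ?p x)) has_vector_derivative
      of_real (std_normal_density x * poly (pderiv ?p - [:0, 1:] * ?p) x)) (at x)"
      by (intro has_vector_derivative_of_real)
         (use gaussian_poly_has_real_derivative[of ?p x UNIV] in \<open>simp add: has_real_derivative_iff_has_vector_derivative\<close>)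
    from has_vector_derivative_mult[OF this iexp_has_vector_derivative[of t x UNIV]]
    show "(?F has_vector_derivative ?f x) (at x)" by (simp add: mult_ac add.commute)
    show "isCont ?f x" using cont by (simp add: continuous_on_eq_continuous_at)
    show "set_integrable lborel (einterval (-\<infinity>) \<infinity>) ?f"
      using int by (simp add: set_integrable_def)
    show "((?F \<circ> real_of_ereal) \<longlongrightarrow> 0) (at_right (- \<infinity>))"
      unfolding ereal_tendsto_simps using gaussian_poly_tendsto_0(2)[of ?p]
      by (subst tendsto_norm_zero_iff[symmetric], subst norm) (rule tendsto_rabs_zero)
    show "((?F \<circ> real_of_ereal) \<longlongrightarrow> 0) (at_left \<infinity>)"
      unfolding ereal_tendsto_simps using gaussian_poly_tendsto_0(1)[of ?p]
      by (subst tendsto_norm_zero_iff[symmetric], subst norm) (rule tendsto_rabs_zero)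
  qed auto
  hence "(LINT x|lborel. ?f x) = 0"
    by (simp add: interval_lebesgue_integral_def set_lebesgue_integral_def)
  also have "(LINT x|lborel. ?f x) = (LINT x|lborel. of_real (std_normal_density x * poly (pderiv ?p - [:0, 1:] * ?p) x) * iexp (t * x))
     + \<i> * of_real t * (LINT x|lborel. ?F x)"
    unfolding Bochner_Integration.integral_add[OF i1 i2] by (simp only: integral_mult_right_zero)
  also have "(LINT x|lborel. of_real (std_normal_density x * poly (pderiv ?p - [:0, 1:] * ?p) x) * iexp (t * x))
     = - (LINT x|lborel. of_real (std_normal_density x * poly (hermite (Suc k)) x) * iexp (t * x))"
    by (subst Bochner_Integration.integral_minus[symmetric]) (simp add: algebra_simps)
  finally show ?case unfolding Suc.IH by (simp add: algebra_simps)
qed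

section \<open>The expansion as a primitive of a Gaussian times a polynomial\<close>

lemma std_normal_cdf_has_real_derivative:
  "(std_normal_cdf has_real_derivative std_normal_density x) (at x)"
proof (rule has_field_derivative_transform_within_open)
  have int: "set_integrable lborel S std_normal_density" if "S \<in> sets borel" for S
    unfolding set_integrable_def using that by (intro integrable_mult_indicator) auto
  \<comment> \<open>The half-line is cut at \<open>x - 1\<close>, so that only a compact piece
    depends on the upper limit near \<open>x\<close>.\<close>
  have "((\<lambda>y. integral {x - 1..y} std_normal_density) has_real_derivative std_normal_density x) (at x within {x - 1..x + 1})"
    by (intro integral_has_real_derivative continuous_intros) auto
  hence "((\<lambda>y. integral {x - 1..y} std_normal_density) has_real_derivative std_normal_density x) (at x)"
    using at_within_Icc_at[of "x - 1" x "x + 1"] by simp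
  thus "((\<lambda>y. (LBINT t:{..<x - 1}. std_normal_density t) + integral {x - 1..y} std_normal_density) has_real_derivative std_normal_density x) (at x)"
    by (auto intro!: derivative_eq_intros)
  show "open {x - 1<..}" "x \<in> {x - 1<..}" by auto
  fix y assume "y \<in> {x - 1<..}"
  hence "{..y} = {..<x - 1} \<union> {x - 1..y}" by auto
  moreover have "(LBINT t:{..<x - 1} \<union> {x - 1..y}. std_normal_density t) = (LBINT t:{..<x - 1}. std_normal_density t) + (LBINT t:{x - 1..y}. std_normal_density t)"
    by (rule set_integral_Un) (auto intro: int)
  ultimately show "(LBINT t:{..<x - 1}. std_normal_density t) + integral {x - 1..y} std_normal_density = std_normal_cdf y"
    unfolding std_normal_cdf_def set_borel_integral_eq_integral(2)[OF int, of "{x - 1..y}", simplified] by simp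
qed

definition edgeworth_correction :: "nat \<Rightarrow> real \<Rightarrow> (nat \<Rightarrow> real poly) \<Rightarrow> real poly" where
  "edgeworth_correction r b H = (\<Sum>j = 1..r. smult (1 / b ^ j) (H j))"

definition edgeworth_density_poly :: "nat \<Rightarrow> real \<Rightarrow> (nat \<Rightarrow> real poly) \<Rightarrow> real poly" where
  "edgeworth_density_poly r b H =
     1 + (pderiv (edgeworth_correction r b H) - [:0, 1:] * edgeworth_correction r b H)"

lemma edgeworth_eq: "edgeworth r b H x = std_normal_cdf x + std_normal_density x * poly (edgeworth_correction r b H) x"
  by (simp add: edgeworth_def edgeworth_correction_def poly_sum)

lemma edgeworth_has_real_derivative:
  "(edgeworth r b H has_real_derivative std_normal_density x * poly (edgeworth_density_poly r b H) x) (at x)"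
  unfolding edgeworth_eq[abs_def]
  using DERIV_add[OF std_normal_cdf_has_real_derivative[of x] gaussian_poly_has_real_derivative[of "edgeworth_correction r b H" x UNIV]]
  by (simp add: edgeworth_density_poly_def algebra_simps)

lemma deriv_edgeworth: "deriv (edgeworth r b H) x = std_normal_density x * poly (edgeworth_density_poly r b H) x"
  using edgeworth_has_real_derivative by (rule DERIV_imp_deriv)

lemma edgeworth_eq_integral:
  "edgeworth r b H x = (LBINT t:{..x}. std_normal_density t * poly (edgeworth_density_poly r b H) t)"
proof -
  let ?P = "edgeworth_correction r b H"
  have int: "set_integrable lborel {..x} (\<lambda>t. std_normal_density t * poly p t)" for p
    unfolding set_integrable_def using integrable_gaussian_poly_power[of p 0]
    by (intro integrable_mult_indicator) auto
  have "(LBINT t:{..x}. std_normal_density t * poly 1 t + std_normal_density t * poly (pderiv ?P - [:0, 1:] * ?P) t)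
    = std_normal_cdf x + std_normal_density x * poly ?P x"
    unfolding set_integral_add(2)[OF int int] integral_deriv_gaussian_poly by (simp add: std_normal_cdf_def)
  thus ?thesis
    unfolding edgeworth_eq edgeworth_density_poly_def by (simp add: algebra_simps)
qed

section \<open>Continuous logarithms\<close>

text \<open>Two continuous logarithms of the same function differ by a continuous function with
  values in the multiples of \<open>2 * pi * \<i>\<close>, a discrete set, hence by a constant on a
  connected set.\<close>

lemma exp_eq_imp_constant:
  fixes g h :: "real \<Rightarrow> complex"
  assumes "connected S" "continuous_on S g" "continuous_on S h"
    and "\<And>s. s \<in> S \<Longrightarrow> exp (g s) = exp (h s)" "a \<in> S" "g a = h a" "t \<in> S"
  shows "g t = h t"
proof -
  have "(\<lambda>s. g s - h s) constant_on S"
  proof (rule continuous_discrete_range_constant[OF assms(1)])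
    show "continuous_on S (\<lambda>s. g s - h s)" by (intro continuous_intros assms)
    fix x assume x: "x \<in> S"
    show "\<exists>e>0. \<forall>y. y \<in> S \<and> g y - h y \<noteq> g x - h x \<longrightarrow> e \<le> norm (g y - h y - (g x - h x))"
    proof (intro exI[of _ "2 * pi"] conjI allI impI)
      fix y assume y: "y \<in> S \<and> g y - h y \<noteq> g x - h x"
      have "exp (g y - h y) = exp (g x - h x)" using assms(4) x y by (simp add: exp_diff)
      then obtain n :: int where n: "g y - h y = g x - h x + (of_int (2 * n) * pi) * \<i>"
        by (auto simp: exp_eq)
      hence "n \<noteq> 0" using y by auto
      hence "1 \<le> \<bar>n\<bar>" by linarith
      hence "1 \<le> \<bar>real_of_int n\<bar>" by (metis of_int_1_le_iff of_int_abs)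
      moreover have "norm (g y - h y - (g x - h x)) = 2 * pi * \<bar>real_of_int n\<bar>"
        by (simp add: n norm_mult)
      ultimately show "2 * pi \<le> norm (g y - h y - (g x - h x))" by simp
    qed simp
  qed
  then obtain c where c: "\<And>s. s \<in> S \<Longrightarrow> g s - h s = c" unfolding constant_on_def by blast
  have "g t - h t = g a - h a" using c[OF assms(5)] c[OF assms(7)] by simp
  thus ?thesis using assms(6) by simp
qed

text \<open>Any continuous logarithm on a symmetric interval identifies the value of the description
  operator; uniqueness is \<open>exp_eq_imp_constant\<close> on the segment.\<close>

lemma continuous_log_eqI:
  assumes "continuous_on {-\<delta>..\<delta>} g" "g 0 = 0" "\<And>s. s \<in> {-\<delta>..\<delta>} \<Longrightarrow> exp (g s) = f s" "t \<in> {-\<delta>..\<delta>}"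
  shows "continuous_log f t = g t"
  unfolding continuous_log_def
proof (rule the_equality)
  have sub: "closed_segment 0 t \<subseteq> {-\<delta>..\<delta>}"
    using assms(4) by (auto simp: closed_segment_eq_real_ivl split: if_splits)
  show "\<exists>g'. continuous_on (closed_segment 0 t) g' \<and> g' 0 = 0 \<and> (\<forall>s\<in>closed_segment 0 t. exp (g' s) = f s) \<and> g' t = g t"
    using assms sub by (intro exI[of _ g]) (auto intro: continuous_on_subset)
  fix z assume "\<exists>g. continuous_on (closed_segment 0 t) g \<and> g 0 = 0 \<and> (\<forall>s\<in>closed_segment 0 t. exp (g s) = f s) \<and> g t = z"
  then obtain g' where g': "continuous_on (closed_segment 0 t) g'" "g' 0 = 0" "\<forall>s\<in>closed_segment 0 t. exp (g' s) = f s" "g' t = z"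
    by blast
  have "g' t = g t"
    using g' sub assms
    by (intro exp_eq_imp_constant[of "closed_segment 0 t" g' g 0 t]) (auto intro: continuous_on_subset simp: subset_iff)
  thus "z = g t" using g' by simp
qed

lemma continuous_log_exists:
  assumes "continuous_on {-\<delta>..\<delta>} f" "\<And>s. s \<in> {-\<delta>..\<delta>} \<Longrightarrow> f s \<noteq> 0" "f 0 = 1" "0 \<le> \<delta>"
  shows "continuous_on {-\<delta>..\<delta>} (continuous_log f)" "continuous_log f 0 = 0"
    "\<And>s. s \<in> {-\<delta>..\<delta>} \<Longrightarrow> exp (continuous_log f s) = f s"
proof -
  \<comment> \<open>On the line a centred ball is a symmetric interval, so a logarithm exists by the
    theorem for balls; subtracting its value at 0 normalises it.\<close>
  have cb: "cball 0 \<delta> = {-\<delta>..\<delta>}" by (simp add: cball_eq_atLeastAtMost)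
  obtain h where h: "continuous_on {-\<delta>..\<delta>} h" "\<And>s. s \<in> {-\<delta>..\<delta>} \<Longrightarrow> f s = exp (h s)"
    using continuous_logarithm_on_cball[of 0 \<delta> f] assms unfolding cb by metis
  define g where "g s = h s - h 0" for s
  have "exp (h 0) = 1" using h(2)[of 0] assms by simp
  hence g: "continuous_on {-\<delta>..\<delta>} g" "g 0 = 0" "\<And>s. s \<in> {-\<delta>..\<delta>} \<Longrightarrow> exp (g s) = f s"
    using h by (auto simp: g_def exp_diff intro!: continuous_intros)
  have eq: "continuous_log f s = g s" if "s \<in> {-\<delta>..\<delta>}" for s
    by (rule continuous_log_eqI[OF g that])
  show "continuous_on {-\<delta>..\<delta>} (continuous_log f)"
    using g(1) eq by (subst continuous_on_cong[OF refl eq]) auto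
  show "continuous_log f 0 = 0" using eq[of 0] g(2) assms(4) by simp
  show "exp (continuous_log f s) = f s" if "s \<in> {-\<delta>..\<delta>}" for s using eq[OF that] g(3)[OF that] by simp
qed

text \<open>Reflection followed by conjugation produces another continuous logarithm of
  \<open>f\<close> vanishing at 0, and there is only one.\<close>

lemma continuous_log_cnj:
  assumes "continuous_on {-\<delta>..\<delta>} f" "\<And>s. s \<in> {-\<delta>..\<delta>} \<Longrightarrow> f s \<noteq> 0" "f 0 = 1" "0 \<le> \<delta>"
    and "\<And>s. f (- s) = cnj (f s)" "t \<in> {-\<delta>..\<delta>}"
  shows "continuous_log f (- t) = cnj (continuous_log f t)"
proof -
  note g = continuous_log_exists[OF assms(1-4)]
  have "continuous_log f (- t) = (\<lambda>s. cnj (continuous_log f (- s))) (- t)"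
  proof (rule continuous_log_eqI)
    show "continuous_on {-\<delta>..\<delta>} (\<lambda>s. cnj (continuous_log f (- s)))"
      by (intro continuous_on_cnj continuous_on_compose2[OF g(1)] continuous_intros) auto
    show "cnj (continuous_log f (- 0)) = 0" using g(2) by simp
    show "exp (cnj (continuous_log f (- s))) = f s" if "s \<in> {-\<delta>..\<delta>}" for s
    proof -
      have "exp (cnj (continuous_log f (- s))) = cnj (f (- s))" using g(3)[of "- s"] that by (simp add: exp_cnj[symmetric])
      thus ?thesis using assms(5)[of s] by simp
    qed
  qed (use assms in auto)
  thus ?thesis by simp
qed

section \<open>Iterated derivatives under conjugation symmetry\<close>

lemma nth_vderiv_0 [simp]: "nth_vderiv 0 f = f"
  by (simp add: nth_vderiv_def)

lemma nth_vderiv_has_vector_derivative: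
  assumes "times_differentiable_on k f U" "j < k" "t \<in> U"
  shows "(nth_vderiv j f has_vector_derivative nth_vderiv (Suc j) f t) (at t)"
  using assms by (simp add: times_differentiable_on_def nth_vderiv_def vector_derivative_works[symmetric])

lemma nth_vderiv_cnj:
  assumes "times_differentiable_on k f {-\<delta><..<\<delta>}" "\<And>t. t \<in> {-\<delta><..<\<delta>} \<Longrightarrow> f (- t) = cnj (f t)"
    and "j \<le> k" "t \<in> {-\<delta><..<\<delta>}"
  shows "nth_vderiv j f (- t) = (- 1) ^ j * cnj (nth_vderiv j f t)"
  using assms(3,4)
proof (induction j arbitrary: t)
  case (Suc j)
  let ?D = "nth_vderiv j f" and ?D' = "nth_vderiv (Suc j) f"
  have mt: "- t \<in> {-\<delta><..<\<delta>}" using Suc.prems by auto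
  have "((\<lambda>s. ?D (- s)) has_vector_derivative (-1) *\<^sub>R ?D' (- t)) (at t)"
  proof (rule vector_diff_chain_at[of uminus "-1" t ?D, unfolded o_def])
    show "(uminus has_vector_derivative - 1) (at t)"
      by (auto intro!: derivative_eq_intros simp: has_real_derivative_iff_has_vector_derivative[symmetric])
    show "(?D has_vector_derivative ?D' (- t)) (at (- t))"
      using Suc.prems mt by (intro nth_vderiv_has_vector_derivative[OF assms(1)]) auto
  qed
  moreover have "((\<lambda>s. ?D (- s)) has_vector_derivative (- 1) ^ j * cnj (?D' t)) (at t)"
  proof (rule has_vector_derivative_transform_within_open)
    show "((\<lambda>s. (- 1) ^ j * cnj (?D s)) has_vector_derivative (- 1) ^ j * cnj (?D' t)) (at t)"
      using Suc.prems
      by (intro has_vector_derivative_mult_right has_vector_derivative_cnj nth_vderiv_has_vector_derivative[OF assms(1)]) auto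
    show "open {-\<delta><..<\<delta>}" "t \<in> {-\<delta><..<\<delta>}" using Suc.prems by auto
    show "(- 1) ^ j * cnj (?D s) = ?D (- s)" if "s \<in> {-\<delta><..<\<delta>}" for s
      using Suc.IH[OF _ that] Suc.prems by simp
  qed
  ultimately have "(-1) *\<^sub>R ?D' (- t) = (- 1) ^ j * cnj (?D' t)" by (rule vector_derivative_unique_at)
  hence "?D' (- t) = - ((- 1) ^ j * cnj (?D' t))"
    by (metis minus_minus scaleR_minus_left scaleR_one)
  thus ?case by simp
qed (use assms in simp)

text \<open>The symmetry equates the derivative at 0 with \<open>(- 1) ^ j\<close> times its
  conjugate, so it is \<open>\<i> ^ j\<close> times a real number.\<close>

lemma nth_vderiv_at_0_real:
  assumes "times_differentiable_on k f {-\<delta><..<\<delta>}" "\<And>t. t \<in> {-\<delta><..<\<delta>} \<Longrightarrow> f (- t) = cnj (f t)"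
    and "j \<le> k" "0 < \<delta>"
  shows "nth_vderiv j f 0 * (- \<i>) ^ j \<in> \<real>"
proof -
  have eq: "nth_vderiv j f 0 = (- 1) ^ j * cnj (nth_vderiv j f 0)"
    using nth_vderiv_cnj[OF assms(1-3), of 0] assms(4) by simp
  hence "cnj (nth_vderiv j f 0 * (- \<i>) ^ j) = ((- 1) ^ j * (- 1) ^ j) * cnj (nth_vderiv j f 0) * (\<i> ^ j)"
    by (simp add: power_mult_distrib[symmetric])
  also have "\<dots> = (- 1) ^ j * ((- 1) ^ j * cnj (nth_vderiv j f 0)) * \<i> ^ j" by (simp only: mult_ac)
  also have "\<dots> = (- 1) ^ j * nth_vderiv j f 0 * \<i> ^ j"
    unfolding eq[symmetric] ..
  also have "\<dots> = nth_vderiv j f 0 * (- \<i>) ^ j"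
    by (simp add: power_minus[of \<i>] mult_ac)
  finally show ?thesis by (simp add: Reals_cnj_iff)
qed

section \<open>Moments from the growth condition\<close>

text \<open>Taylor's formula with cubic remainder gives the lower bound
  \<open>y\<^sup>2 / 2 - \<bar>y\<bar> ^ 3 / 6\<close>, at least \<open>y\<^sup>2 / 3\<close> for
  \<open>\<bar>y\<bar> \<le> 1\<close>; the constant 1 / 4 is a convenient weakening.\<close>

lemma one_minus_cos_ge: "\<bar>y :: real\<bar> \<le> 1 \<Longrightarrow> y\<^sup>2 / 4 \<le> 1 - cos y"
proof -
  assume y: "\<bar>y\<bar> \<le> 1"
  have "(\<Sum>k\<le>2. (\<i> * y) ^ k / fact k) = 1 + \<i> * y - of_real (y\<^sup>2 / 2)"
    by (simp add: numeral_2_eq_2 power2_eq_square algebra_simps)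
  hence "cmod (iexp y - (1 + \<i> * y - of_real (y\<^sup>2 / 2))) \<le> \<bar>y\<bar> ^ 3 / 6"
    using iexp_approx1[of y 2] by (simp add: eval_nat_numeral)
  moreover have "Re (iexp y - (1 + \<i> * y - of_real (y\<^sup>2 / 2))) = cos y - 1 + y\<^sup>2 / 2"
    by (simp add: Re_exp)
  ultimately have "cos y - 1 + y\<^sup>2 / 2 \<le> \<bar>y\<bar> ^ 3 / 6"
    using complex_Re_le_cmod[of "iexp y - (1 + \<i> * y - of_real (y\<^sup>2 / 2))"] by linarith
  moreover have "\<bar>y\<bar> ^ 3 \<le> y\<^sup>2"
    using y mult_right_mono[of "\<bar>y\<bar>" 1 "\<bar>y\<bar>\<^sup>2"] by (simp add: power3_eq_cube power2_eq_square mult.assoc)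
  ultimately show ?thesis using zero_le_power2[of y] by linarith
qed

lemma (in real_distribution) weighted_measure_moment:
  assumes "integrable M (\<lambda>x. (1 + \<bar>x\<bar>) ^ k)"
  shows "weighted_measure M (\<lambda>_. 1) k"
  by unfold_locales (use assms in auto)

lemma one_plus_abs_power_le: "(1 + \<bar>x :: real\<bar>) ^ k \<le> 2 ^ k * (1 + \<bar>x\<bar> ^ k)"
proof -
  have "(1 + \<bar>x\<bar>) ^ k \<le> (2 * max 1 \<bar>x\<bar>) ^ k" by (intro power_mono) auto
  also have "\<dots> = 2 ^ k * (max 1 \<bar>x\<bar>) ^ k" by (simp add: power_mult_distrib)
  also have "(max 1 \<bar>x\<bar>) ^ k \<le> 1 + \<bar>x\<bar> ^ k" by (simp add: max_def)
  finally show ?thesis by simp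
qed

text \<open>The even part of a twice differentiable function with a maximum at \<open>0\<close> deviates from it
  at most quadratically; this bounds truncated moments of the next even order.\<close>

lemma (in real_distribution) next_even_moment:
  assumes mom: "integrable M (\<lambda>x. x ^ (2 * k))"
    and "0 < \<eta>"
    and d1: "\<And>t. \<bar>t\<bar> < \<eta> \<Longrightarrow> ((\<lambda>t. LINT x|M. x ^ (2 * k) * cos (t * x)) has_real_derivative v1 t) (at t)"
    and d2: "(v1 has_real_derivative v2) (at 0)"
  shows "integrable M (\<lambda>x. x ^ (2 * Suc k))"
proof -
  define v where "v t = (LINT x|M. x ^ (2 * k) * cos (t * x))" for t
  have int: "integrable M (\<lambda>x. x ^ (2 * k) * cos (t * x))" for t
    by (rule Bochner_Integration.integrable_bound[OF mom]) (auto simp: abs_mult mult_left_le)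
  have le: "v t \<le> v 0" for t
    unfolding v_def using mom by (intro integral_mono int) (auto intro!: mult_left_le)
  \<comment> \<open>The cosine transform of a nonnegative weight is maximal at 0, so its derivative
    vanishes there.\<close>
  have "v1 0 = 0"
    using DERIV_local_max[of v "v1 0" 0 \<eta>] d1[of 0] \<open>0 < \<eta>\<close> le by (auto simp: v_def[abs_def])
  then have "((\<lambda>h. v1 h / h) \<longlongrightarrow> v2) (at 0)"
    using d2 by (simp add: DERIV_def)
  hence "\<forall>\<^sub>F h in at 0. \<bar>v1 h / h - v2\<bar> < 1"
    by (auto dest: tendstoD[of _ _ _ 1] simp: dist_real_def)
  then obtain \<eta>' where \<eta>': "0 < \<eta>'" "\<And>h. h \<noteq> 0 \<Longrightarrow> \<bar>h\<bar> < \<eta>' \<Longrightarrow> \<bar>v1 h / h - v2\<bar> < 1"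
    unfolding eventually_at by (auto simp: dist_real_def)
  define C where "C = \<bar>v2\<bar> + 1"
  have v1: "\<bar>v1 h\<bar> \<le> C * \<bar>h\<bar>" if "\<bar>h\<bar> < \<eta>'" for h
  proof (cases "h = 0")
    case False
    hence "\<bar>v1 h / h\<bar> \<le> C" using \<eta>'(2)[OF False that] by (simp add: C_def)
    thus ?thesis using False by (simp add: abs_divide field_simps)
  qed (use \<open>v1 0 = 0\<close> in simp)
  have quad: "v 0 - v h \<le> C * h\<^sup>2" if h: "0 < h" "h < \<eta>" "h < \<eta>'" for h
  proof -
    have "\<exists>z. 0 < z \<and> z < h \<and> v h - v 0 = (h - 0) * v1 z"
      using h d1 by (intro MVT2) (auto simp: v_def[abs_def])
    then obtain z where z: "0 < z" "z < h" "v h - v 0 = h * v1 z" by auto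
    have "v 0 - v h = h * (- v1 z)" using z(3) by (simp add: algebra_simps)
    also have "\<dots> \<le> h * \<bar>v1 z\<bar>" using h by (intro mult_left_mono) auto
    also have "\<dots> \<le> h * (C * \<bar>z\<bar>)" using v1[of z] z h by (intro mult_left_mono) auto
    also have "\<dots> \<le> h * (C * h)" using z h by (intro mult_left_mono) (auto simp: C_def)
    finally show ?thesis by (simp add: power2_eq_square mult_ac)
  qed
  define u where "u n x = ennreal (indicator {x. \<bar>x\<bar> \<le> real n} x * x ^ (2 * Suc k))" for n x
  \<comment> \<open>The cutoff \<open>n\<close> is paired with the frequency \<open>1 / n\<close>,
    so that \<open>\<bar>h * x\<bar> \<le> 1\<close> on the truncated range and
    \<open>1 - cos (h * x)\<close> controls \<open>(h * x)\<^sup>2\<close>; the factor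
    \<open>h\<^sup>2\<close> then cancels against the quadratic bound.\<close>
  have bound: "(\<integral>\<^sup>+x. u n x \<partial>M) \<le> ennreal (4 * C)" if n: "1 / real n < \<eta>" "1 / real n < \<eta>'" "0 < n" for n
  proof -
    define h where "h = 1 / real n"
    have h: "0 < h" "h < \<eta>" "h < \<eta>'" using n by (auto simp: h_def)
    have pw: "indicator {x. \<bar>x\<bar> \<le> real n} x * x ^ (2 * Suc k) \<le> 4 / h\<^sup>2 * (x ^ (2 * k) - x ^ (2 * k) * cos (h * x))" for x
    proof (cases "\<bar>x\<bar> \<le> real n")
      case True
      hence "\<bar>h * x\<bar> \<le> 1" using n by (simp add: h_def abs_mult)
      from one_minus_cos_ge[OF this] have "x\<^sup>2 \<le> 4 / h\<^sup>2 * (1 - cos (h * x))"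
        using h by (simp add: field_simps power_mult_distrib)
      hence "x ^ (2 * k) * x\<^sup>2 \<le> x ^ (2 * k) * (4 / h\<^sup>2 * (1 - cos (h * x)))" by (intro mult_left_mono) auto
      moreover have "x ^ (2 * Suc k) = x ^ (2 * k) * x\<^sup>2"
        by (simp only: power_add[symmetric]) simp
      moreover have "x ^ (2 * k) * (4 / h\<^sup>2 * (1 - cos (h * x))) = 4 / h\<^sup>2 * (x ^ (2 * k) - x ^ (2 * k) * cos (h * x))"
      proof -
        have "a * (c * (1 - d)) = c * (a - a * d)" for a c d :: real by (simp add: algebra_simps)
        thus ?thesis .
      qed
      moreover have "indicator {x. \<bar>x\<bar> \<le> real n} x = (1 :: real)" using True by simp
      ultimately show ?thesis by (simp only: mult_1)
    next
      case False
      have "x ^ (2 * k) * cos (h * x) \<le> x ^ (2 * k)" by (intro mult_left_le) auto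
      thus ?thesis using False by simp
    qed
    have i: "integrable M (\<lambda>x. 4 / h\<^sup>2 * (x ^ (2 * k) - x ^ (2 * k) * cos (h * x)))"
      using mom int by simp
    have "(\<integral>\<^sup>+x. u n x \<partial>M) \<le> (\<integral>\<^sup>+x. ennreal (4 / h\<^sup>2 * (x ^ (2 * k) - x ^ (2 * k) * cos (h * x))) \<partial>M)"
      unfolding u_def by (intro nn_integral_mono ennreal_leI pw)
    also have "\<dots> = ennreal (LINT x|M. 4 / h\<^sup>2 * (x ^ (2 * k) - x ^ (2 * k) * cos (h * x)))"
    proof (rule nn_integral_eq_integral[OF i], rule AE_I2)
      fix x
      have "x ^ (2 * k) * cos (h * x) \<le> x ^ (2 * k)" by (intro mult_left_le) auto
      thus "0 \<le> 4 / h\<^sup>2 * (x ^ (2 * k) - x ^ (2 * k) * cos (h * x))" by (intro mult_nonneg_nonneg) auto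
    qed
    also have "(LINT x|M. 4 / h\<^sup>2 * (x ^ (2 * k) - x ^ (2 * k) * cos (h * x))) = 4 / h\<^sup>2 * (v 0 - v h)"
      using mom int by (simp add: v_def)
    also have "\<dots> \<le> 4 / h\<^sup>2 * (C * h\<^sup>2)" using quad[OF h] by (intro mult_left_mono) auto
    also have "\<dots> = 4 * C" using h by simp
    finally show ?thesis by (simp add: ennreal_leI)
  qed
  have [measurable]: "u n \<in> borel_measurable M" for n unfolding u_def by measurable
  have lim: "liminf (\<lambda>n. u n x) = ennreal (x ^ (2 * Suc k))" for x
  proof (rule lim_imp_Liminf)
    obtain N where N: "\<bar>x\<bar> \<le> real N" using real_arch_simple by blast
    show "(\<lambda>n. u n x) \<longlonglongrightarrow> ennreal (x ^ (2 * Suc k))"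
    proof (rule tendsto_eventually, rule eventually_sequentiallyI[of N])
      fix n assume "N \<le> n"
      hence "\<bar>x\<bar> \<le> real n" using N by linarith
      thus "u n x = ennreal (x ^ (2 * Suc k))" by (simp add: u_def)
    qed
  qed simp
  \<comment> \<open>Fatou's lemma removes the truncation.\<close>
  have "(\<integral>\<^sup>+x. ennreal (x ^ (2 * Suc k)) \<partial>M) \<le> liminf (\<lambda>n. \<integral>\<^sup>+x. u n x \<partial>M)"
    unfolding lim[symmetric] by (rule nn_integral_liminf) measurable
  also have "\<dots> \<le> ennreal (4 * C)"
  proof (rule Liminf_le)
    have "(\<lambda>n. 1 / real n) \<longlonglongrightarrow> 0" by (rule lim_1_over_n)
    hence "\<forall>\<^sub>F n in sequentially. 1 / real n < min \<eta> \<eta>'"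
      using \<open>0 < \<eta>\<close> \<eta>'(1) by (intro order_tendstoD(2)) auto
    thus "\<forall>\<^sub>F n in sequentially. (\<integral>\<^sup>+x. u n x \<partial>M) \<le> ennreal (4 * C)"
      using eventually_gt_at_top[of 0] by eventually_elim (auto intro: bound)
  qed simp
  finally have fin: "(\<integral>\<^sup>+x. ennreal (x ^ (2 * Suc k)) \<partial>M) < \<infinity>"
    by (rule le_less_trans) simp
  have "0 \<le> x ^ (2 * Suc k)" for x :: real by (rule zero_le_even_power) simp
  thus ?thesis by (intro integrableI_nonneg[OF _ AE_I2 fin]) measurable
qed

text \<open>Once the moment of order \<open>2 * k\<close> is finite, \<open>\<phi> (2 * k)\<close>
  equals \<open>(- 1) ^ k\<close> times the transform of \<open>x ^ (2 * k)\<close>, and the next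
  two members of the chain supply the derivatives that the passage to order \<open>2 * Suc k\<close>
  requires.\<close>

lemma (in real_distribution) even_moment_of_char_chain:
  assumes "0 < \<eta>" and base: "\<And>t. \<bar>t\<bar> < \<eta> \<Longrightarrow> \<phi> 0 t = char M t"
    and chain: "\<And>j t. j < 2 * p \<Longrightarrow> \<bar>t\<bar> < \<eta> \<Longrightarrow> (\<phi> j has_vector_derivative \<phi> (Suc j) t) (at t)"
  shows "k \<le> p \<Longrightarrow> integrable M (\<lambda>x. x ^ (2 * k))"
proof (induction k)
  case (Suc k)
  hence mom: "integrable M (\<lambda>x. x ^ (2 * k))" by simp
  have "integrable M (\<lambda>x. 2 ^ (2 * k) * (1 + \<bar>x\<bar> ^ (2 * k)))" using mom by (simp add: power_even_abs)
  hence "integrable M (\<lambda>x. (1 + \<bar>x\<bar>) ^ (2 * k))"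
    by (rule Bochner_Integration.integrable_bound) (use one_plus_abs_power_le in \<open>auto intro!: AE_I2 simp: abs_of_nonneg\<close>)
  then interpret weighted_measure M "\<lambda>_. 1" "2 * k" by (rule weighted_measure_moment)
  have eq: "\<phi> j t = \<i> ^ j * weighted_ft M (\<lambda>_. 1) j t" if "j \<le> 2 * k" "\<bar>t\<bar> < \<eta>" for j t
    using that
  proof (induction j arbitrary: t)
    case 0
    thus ?case using base by (simp add: char_def weighted_ft_def)
  next
    case (Suc j)
    have "(\<phi> j has_vector_derivative \<i> ^ j * (\<i> * weighted_ft M (\<lambda>_. 1) (Suc j) t)) (at t)"
    proof (rule has_vector_derivative_transform_within_open)
      show "((\<lambda>t. \<i> ^ j * weighted_ft M (\<lambda>_. 1) j t) has_vector_derivative \<i> ^ j * (\<i> * weighted_ft M (\<lambda>_. 1) (Suc j) t)) (at t)"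
        using Suc.prems by (intro has_vector_derivative_mult_right weighted_ft_has_vector_derivative) auto
      show "open {-\<eta><..<\<eta>}" "t \<in> {-\<eta><..<\<eta>}" using Suc.prems by auto
      show "\<i> ^ j * weighted_ft M (\<lambda>_. 1) j s = \<phi> j s" if "s \<in> {-\<eta><..<\<eta>}" for s
        using Suc.IH[of s] Suc.prems that by auto
    qed
    with chain[of j t] Suc.prems \<open>Suc k \<le> p\<close> show ?case
      using vector_derivative_unique_at[of "\<phi> j" "\<phi> (Suc j) t" t] by (auto simp: mult_ac)
  qed
  have ii: "\<i> ^ (2 * k) = (- 1) ^ k" by (simp add: power_mult)
  have v: "(LINT x|M. x ^ (2 * k) * cos (t * x)) = Re ((- 1) ^ k * \<phi> (2 * k) t)" if "\<bar>t\<bar> < \<eta>" for t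
  proof -
    have "(- 1) ^ k * \<phi> (2 * k) t = weighted_ft M (\<lambda>_. 1) (2 * k) t"
      using eq[OF order.refl that] unfolding ii by (simp add: mult.assoc[symmetric] power_mult_distrib[symmetric])
    also have "Re \<dots> = (LINT x|M. Re (of_real (1 * x ^ (2 * k)) * iexp (t * x)))"
      unfolding weighted_ft_def by (rule integral_Re[OF integrable_weighted_exp[OF order.refl], symmetric])
    finally show ?thesis by (simp add: Re_exp)
  qed
  have Re: "((\<lambda>t. Re ((- 1) ^ k * \<phi> j t)) has_real_derivative Re ((- 1) ^ k * \<phi> (Suc j) t)) (at t)"
    if "j < 2 * p" "\<bar>t\<bar> < \<eta>" for j t
    unfolding has_real_derivative_iff_has_vector_derivative
    by (rule bounded_linear.has_vector_derivative[OF bounded_linear_Re])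
       (intro has_vector_derivative_mult_right chain that)
  show ?case
  proof (rule next_even_moment[OF mom assms(1)])
    show "((\<lambda>t. Re ((- 1) ^ k * \<phi> (Suc (2 * k)) t)) has_real_derivative Re ((- 1) ^ k * \<phi> (Suc (Suc (2 * k))) 0)) (at 0)"
      using Suc.prems assms(1) by (intro Re) auto
    fix t assume t: "\<bar>t\<bar> < \<eta>"
    show "((\<lambda>t. LINT x|M. x ^ (2 * k) * cos (t * x)) has_real_derivative Re ((- 1) ^ k * \<phi> (Suc (2 * k)) t)) (at t)"
    proof (rule has_field_derivative_transform_within_open)
      show "((\<lambda>t. Re ((- 1) ^ k * \<phi> (2 * k) t)) has_real_derivative Re ((- 1) ^ k * \<phi> (Suc (2 * k)) t)) (at t)"
        using Suc.prems t by (intro Re) auto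
      show "open {-\<eta><..<\<eta>}" "t \<in> {-\<eta><..<\<eta>}" using t by auto
      show "Re ((- 1) ^ k * \<phi> (2 * k) s) = (LINT x|M. x ^ (2 * k) * cos (s * x))" if "s \<in> {-\<eta><..<\<eta>}" for s
        using v[of s] that by auto
    qed
  qed
qed simp

section \<open>The standardized law and the logarithm of its characteristic function\<close>

locale standardized_sequence = prob_space M for M :: "'a measure" +
  fixes S :: "nat \<Rightarrow> 'a \<Rightarrow> real" and m :: nat
  assumes m_ge_3: "3 \<le> m"
    and S_measurable [measurable]: "\<And>n. S n \<in> borel_measurable M"
    and S_square_integrable: "\<And>n. integrable M (\<lambda>\<omega>. (S n \<omega>)\<^sup>2)"
    and S_centered: "\<And>n. (LINT \<omega>|M. S n \<omega>) = 0"
    and growth: "growth_condition m M S"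
begin

definition sd :: "nat \<Rightarrow> real" where "sd n = L2_norm M (S n)"

definition law :: "nat \<Rightarrow> real measure" where "law n = distr M borel (\<lambda>\<omega>. S n \<omega> / sd n)"

definition log_defect :: "nat \<Rightarrow> real \<Rightarrow> complex" where "log_defect n = log_char_defect M (S n)"

abbreviation deriv_log :: "nat \<Rightarrow> nat \<Rightarrow> real \<Rightarrow> complex" where
  "deriv_log j n \<equiv> nth_vderiv j (log_defect n)"

lemma sd_nonneg: "0 \<le> sd n"
  by (simp add: sd_def L2_norm_def)

lemma real_distribution_law: "real_distribution (law n)"
  unfolding law_def by (intro real_distribution_distr) measurable

sublocale law: real_distribution "law n" for n
  by (rule real_distribution_law)

lemma normalized_char_eq: "normalized_char M (S n) = char (law n)"
  by (simp add: normalized_char_def law_def sd_def)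

lemma continuous_char: "continuous_on A (char (law n))"
  using law.isCont_char by (simp add: continuous_at_imp_continuous_on)

lemma char_uminus: "char (law n) (- t) = cnj (char (law n) t)"
proof -
  have int: "integrable (law n) (\<lambda>x. iexp (t * x))" by (intro law.integrable_const_bound[where B = 1]) auto
  have "char (law n) (- t) = (LINT x|law n. cnj (iexp (t * x)))"
    unfolding char_def by (intro Bochner_Integration.integral_cong refl) (simp add: exp_cnj)
  thus ?thesis unfolding char_def by (simp add: int)
qed

text \<open>The condition offers a constant and a radius for each order; the least radius and the
  sum of the constants serve all orders.\<close>

lemma growth_constants:
  obtains \<epsilon> C :: real where "0 < \<epsilon>" "0 < C"
    "\<And>n t. \<bar>t\<bar> \<le> \<epsilon> * sd n \<Longrightarrow> char (law n) t \<noteq> 0"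
    "\<And>n. times_differentiable_on (m + 1) (log_defect n) {- (\<epsilon> * sd n)..\<epsilon> * sd n}"
    "\<And>n j t. j \<in> {3..m + 1} \<Longrightarrow> \<bar>t\<bar> \<le> \<epsilon> * sd n \<Longrightarrow> cmod (deriv_log j n t) \<le> C / sd n ^ (j - 2)"
proof -
  have "\<forall>j\<in>{3..m + 1}. \<exists>C \<epsilon>. 0 < C \<and> 0 < \<epsilon> \<and> (\<forall>n. (\<forall>t\<in>{- \<epsilon> * sd n..\<epsilon> * sd n}. char (law n) t \<noteq> 0) \<and>
     times_differentiable_on j (log_defect n) {- \<epsilon> * sd n..\<epsilon> * sd n} \<and>
     (\<forall>t\<in>{- \<epsilon> * sd n..\<epsilon> * sd n}. cmod (deriv_log j n t) \<le> C / sd n ^ (j - 2)))"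
    using growth unfolding growth_condition_def Let_def normalized_char_eq sd_def[symmetric] log_defect_def[symmetric]
    by blast
  then obtain C \<epsilon> where C: "\<forall>j\<in>{3..m + 1}. 0 < C j \<and> 0 < \<epsilon> j \<and> (\<forall>n. (\<forall>t\<in>{- \<epsilon> j * sd n..\<epsilon> j * sd n}. char (law n) t \<noteq> 0) \<and>
     times_differentiable_on j (log_defect n) {- \<epsilon> j * sd n..\<epsilon> j * sd n} \<and>
     (\<forall>t\<in>{- \<epsilon> j * sd n..\<epsilon> j * sd n}. cmod (deriv_log j n t) \<le> C j / sd n ^ (j - 2)))"
    by metis
  define e where "e = Min (\<epsilon> ` {3..m + 1})"
  define K where "K = (\<Sum>j\<in>{3..m + 1}. C j)"
  have m1: "m + 1 \<in> {3..m + 1}" using m_ge_3 by auto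
  have e_le: "e \<le> \<epsilon> j" if "j \<in> {3..m + 1}" for j
    unfolding e_def using that by (intro Min_le) auto
  have K_ge: "C j \<le> K" if "j \<in> {3..m + 1}" for j
    unfolding K_def using that C by (intro member_le_sum) (auto intro: less_imp_le)
  have in_I: "t \<in> {- \<epsilon> j * sd n..\<epsilon> j * sd n}" if "\<bar>t\<bar> \<le> e * sd n" "j \<in> {3..m + 1}" for t j n
    using that(1) mult_right_mono[OF e_le[OF that(2)] sd_nonneg[of n]] by (auto simp: abs_le_iff)
  show ?thesis
  proof (rule that[of e K])
    have "e \<in> \<epsilon> ` {3..m + 1}" unfolding e_def using m1 by (intro Min_in) auto
    thus "0 < e" using C by auto
    show "0 < K" using K_ge[OF m1] C m1 by (metis less_le_trans)
    show "char (law n) t \<noteq> 0" if "\<bar>t\<bar> \<le> e * sd n" for n t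
      using in_I[OF that m1] C m1 by blast
    show "times_differentiable_on (m + 1) (log_defect n) {- (e * sd n)..e * sd n}" for n
    proof -
      have "{- (e * sd n)..e * sd n} \<subseteq> {- \<epsilon> (m + 1) * sd n..\<epsilon> (m + 1) * sd n}"
        using in_I[OF _ m1] by (auto simp: abs_le_iff)
      moreover have "times_differentiable_on (m + 1) (log_defect n) {- \<epsilon> (m + 1) * sd n..\<epsilon> (m + 1) * sd n}"
        using C m1 by blast
      ultimately show ?thesis unfolding times_differentiable_on_def by blast
    qed
    show "cmod (deriv_log j n t) \<le> K / sd n ^ (j - 2)" if "j \<in> {3..m + 1}" "\<bar>t\<bar> \<le> e * sd n" for n j t
    proof -
      have "cmod (deriv_log j n t) \<le> C j / sd n ^ (j - 2)" using in_I[OF that(2,1)] C that(1) by blast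
      also have "\<dots> \<le> K / sd n ^ (j - 2)" using sd_nonneg[of n] by (intro divide_right_mono K_ge that) auto
      finally show ?thesis .
    qed
  qed
qed

definition radius :: real where
  "radius = (SOME \<epsilon>. 0 < \<epsilon> \<and> (\<exists>C>0.
    (\<forall>n t. \<bar>t\<bar> \<le> \<epsilon> * sd n \<longrightarrow> char (law n) t \<noteq> 0) \<and>
    (\<forall>n. times_differentiable_on (m + 1) (log_defect n) {- (\<epsilon> * sd n)..\<epsilon> * sd n}) \<and>
    (\<forall>n j t. j \<in> {3..m + 1} \<longrightarrow> \<bar>t\<bar> \<le> \<epsilon> * sd n \<longrightarrow> cmod (deriv_log j n t) \<le> C / sd n ^ (j - 2))))"

lemma radius:
  shows radius_pos: "0 < radius"
    and char_nonzero: "\<bar>t\<bar> \<le> radius * sd n \<Longrightarrow> char (law n) t \<noteq> 0"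
    and log_defect_differentiable: "times_differentiable_on (m + 1) (log_defect n) {- (radius * sd n)..radius * sd n}"
    and deriv_log_bound: "\<exists>C>0. \<forall>n j t. j \<in> {3..m + 1} \<longrightarrow> \<bar>t\<bar> \<le> radius * sd n \<longrightarrow> cmod (deriv_log j n t) \<le> C / sd n ^ (j - 2)"
proof -
  have "\<exists>\<epsilon>. 0 < \<epsilon> \<and> (\<exists>C>0.
    (\<forall>n t. \<bar>t\<bar> \<le> \<epsilon> * sd n \<longrightarrow> char (law n) t \<noteq> 0) \<and>
    (\<forall>n. times_differentiable_on (m + 1) (log_defect n) {- (\<epsilon> * sd n)..\<epsilon> * sd n}) \<and>
    (\<forall>n j t. j \<in> {3..m + 1} \<longrightarrow> \<bar>t\<bar> \<le> \<epsilon> * sd n \<longrightarrow> cmod (deriv_log j n t) \<le> C / sd n ^ (j - 2)))"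
    using growth_constants by metis
  from someI_ex[OF this, folded radius_def]
  have *: "0 < radius \<and> (\<exists>C>0.
    (\<forall>n t. \<bar>t\<bar> \<le> radius * sd n \<longrightarrow> char (law n) t \<noteq> 0) \<and>
    (\<forall>n. times_differentiable_on (m + 1) (log_defect n) {- (radius * sd n)..radius * sd n}) \<and>
    (\<forall>n j t. j \<in> {3..m + 1} \<longrightarrow> \<bar>t\<bar> \<le> radius * sd n \<longrightarrow> cmod (deriv_log j n t) \<le> C / sd n ^ (j - 2)))" .
  show "0 < radius" using * by blast
  show "char (law n) t \<noteq> 0" if "\<bar>t\<bar> \<le> radius * sd n" using * that by blast
  show "times_differentiable_on (m + 1) (log_defect n) {- (radius * sd n)..radius * sd n}" using * by blast
  show "\<exists>C>0. \<forall>n j t. j \<in> {3..m + 1} \<longrightarrow> \<bar>t\<bar> \<le> radius * sd n \<longrightarrow> cmod (deriv_log j n t) \<le> C / sd n ^ (j - 2)"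
    using * by blast
qed

lemma deriv_log_has_vector_derivative:
  assumes "j \<le> m" "\<bar>t\<bar> \<le> radius * sd n"
  shows "(deriv_log j n has_vector_derivative deriv_log (Suc j) n t) (at t)"
  using assms by (intro nth_vderiv_has_vector_derivative[OF log_defect_differentiable]) (auto simp: abs_le_iff)

lemma
  shows exp_log_defect: "\<bar>t\<bar> \<le> radius * sd n \<Longrightarrow> char (law n) t = exp (log_defect n t - of_real (t\<^sup>2 / 2))"
    and log_defect_0: "log_defect n 0 = 0"
proof -
  have d: "0 \<le> radius * sd n" using radius_pos sd_nonneg[of n] by simp
  note cl = continuous_log_exists[OF continuous_char, of "radius * sd n" n]
  have nz: "char (law n) s \<noteq> 0" if "s \<in> {- (radius * sd n)..radius * sd n}" for s
    using that by (intro char_nonzero) (auto simp: abs_le_iff)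
  have *: "exp (continuous_log (char (law n)) s) = char (law n) s" if "s \<in> {- (radius * sd n)..radius * sd n}" for s
    using cl(3)[OF nz _ d that] law.char_zero by simp
  show "char (law n) t = exp (log_defect n t - of_real (t\<^sup>2 / 2))" if "\<bar>t\<bar> \<le> radius * sd n"
    using *[of t] that by (simp add: log_defect_def log_char_defect_def normalized_char_eq abs_le_iff)
  show "log_defect n 0 = 0"
    using cl(2)[OF nz _ d] law.char_zero by (simp add: log_defect_def log_char_defect_def normalized_char_eq)
qed

lemma cumulant_real:
  assumes "k \<in> {3..m}"
  shows "deriv_log k n 0 * of_real (sd n ^ (k - 2)) * (- \<i>) ^ k \<in> \<real>"
proof (cases "sd n = 0")
  case True
  have "0 < k - 2" using assms by auto
  thus ?thesis using True by (simp add: power_0_left)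
next
  case False
  hence d: "0 < radius * sd n" using radius_pos sd_nonneg[of n] by (simp add: less_le)
  have cnj: "log_defect n (- t) = cnj (log_defect n t)" if "t \<in> {- (radius * sd n)<..<radius * sd n}" for t
  proof -
    have "continuous_log (char (law n)) (- t) = cnj (continuous_log (char (law n)) t)"
      using that d law.char_zero[of n]
      by (intro continuous_log_cnj[where \<delta> = "radius * sd n"] continuous_char char_nonzero char_uminus)
         (auto simp: abs_le_iff)
    thus ?thesis by (simp add: log_defect_def log_char_defect_def normalized_char_eq)
  qed
  have diff: "times_differentiable_on (m + 1) (log_defect n) {- (radius * sd n)<..<radius * sd n}"
    using log_defect_differentiable[of n] by (auto simp: times_differentiable_on_def)
  have "deriv_log k n 0 * (- \<i>) ^ k \<in> \<real>"
    using assms by (intro nth_vderiv_at_0_real[OF diff cnj _ d]) auto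
  hence "deriv_log k n 0 * (- \<i>) ^ k * of_real (sd n ^ (k - 2)) \<in> \<real>" by (rule Reals_mult[OF _ Reals_of_real])
  thus ?thesis by (simp only: mult_ac)
qed

lemma law_integrable_iff:
  "h \<in> borel_measurable borel \<Longrightarrow> integrable (law n) h \<longleftrightarrow> integrable M (\<lambda>\<omega>. h (S n \<omega> / sd n))"
  for h :: "real \<Rightarrow> real"
  unfolding law_def by (intro integrable_distr_eq) measurable

lemma law_integral:
  "h \<in> borel_measurable borel \<Longrightarrow> (LINT x|law n. h x) = (LINT \<omega>|M. h (S n \<omega> / sd n))"
  for h :: "real \<Rightarrow> real"
  unfolding law_def by (intro integral_distr) measurable

lemma law_moments:
  assumes "0 < sd n"
  shows "integrable (law n) (\<lambda>x. x\<^sup>2)" "(LINT x|law n. x) = 0" "(LINT x|law n. x\<^sup>2) = 1"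
proof -
  show "integrable (law n) (\<lambda>x. x\<^sup>2)"
    using S_square_integrable[of n] by (subst law_integrable_iff) (auto simp: power_divide)
  show "(LINT x|law n. x) = 0" using S_centered[of n] by (subst law_integral) auto
  have "sd n ^ 2 = (LINT \<omega>|M. (S n \<omega>)\<^sup>2)"
    unfolding sd_def L2_norm_def by (intro real_sqrt_pow2 integral_nonneg_AE) auto
  thus "(LINT x|law n. x\<^sup>2) = 1" using assms by (subst law_integral) (auto simp: power_divide)
qed

text \<open>The first two derivatives of \<open>exp (log_defect n t - t\<^sup>2 / 2)\<close> at 0
  are compared with the mean 0 and the second moment 1. The term \<open>t\<^sup>2 / 2\<close>
  accounts for the variance, so the logarithm starts at order 3. The weighted setting is entered
  with exponent 2, since the higher moments come later.\<close>

lemma deriv_log_0: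
  assumes "0 < sd n" "j < 3"
  shows "deriv_log j n 0 = 0"
proof -
  define d where "d = radius * sd n"
  have d: "0 < d" using radius_pos assms by (simp add: d_def)
  have "integrable (law n) (\<lambda>x. 4 * (1 + x\<^sup>2))" using law_moments[OF assms(1)] by simp
  hence "integrable (law n) (\<lambda>x. (1 + \<bar>x\<bar>) ^ 2)"
    by (rule Bochner_Integration.integrable_bound) (use one_plus_abs_power_le[of _ 2] in \<open>auto intro!: AE_I2 simp: abs_of_nonneg\<close>)
  then interpret wm: weighted_measure "law n" "\<lambda>_. 1" 2 by (rule law.weighted_measure_moment)
  let ?U = "weighted_ft (law n) (\<lambda>_. 1)"
  let ?f = "\<lambda>t. exp (log_defect n t - of_real (t\<^sup>2 / 2))"
  have U0: "?U 0 t = char (law n) t" for t by (simp add: weighted_ft_def char_def)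
  have sq: "((\<lambda>t. complex_of_real (t\<^sup>2 / 2)) has_vector_derivative of_real t) (at t)" for t
    by (intro has_vector_derivative_of_real) (auto intro!: derivative_eq_intros simp: has_real_derivative_iff_has_vector_derivative[symmetric])
  have fd: "(?f has_vector_derivative ?f t * (deriv_log 1 n t - of_real t)) (at t)" if "\<bar>t\<bar> < d" for t
  proof -
    have "(deriv_log 0 n has_vector_derivative deriv_log (Suc 0) n t) (at t)"
      using that m_ge_3 by (intro deriv_log_has_vector_derivative) (auto simp: d_def)
    hence "((\<lambda>t. log_defect n t - of_real (t\<^sup>2 / 2)) has_vector_derivative deriv_log 1 n t - of_real t) (at t)"
      by (intro has_vector_derivative_diff sq) simp
    from exp_remainder_has_vector_derivative(2)[OF this] show ?thesis by (simp add: exp_remainder_def)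
  qed
  have op: "open {-d<..<d}" by simp
  have U1: "?f t * (deriv_log 1 n t - of_real t) = \<i> * ?U 1 t" if "\<bar>t\<bar> < d" for t
  proof (rule vector_derivative_unique_at)
    show "(?f has_vector_derivative ?f t * (deriv_log 1 n t - of_real t)) (at t)" by (rule fd[OF that])
    show "(?f has_vector_derivative \<i> * ?U 1 t) (at t)"
    proof (rule has_vector_derivative_transform_within_open[OF _ op])
      show "(?U 0 has_vector_derivative \<i> * ?U 1 t) (at t)"
        using wm.weighted_ft_has_vector_derivative[of 0 t] by simp
      show "?U 0 s = ?f s" if "s \<in> {-d<..<d}" for s
        unfolding U0 using that by (intro exp_log_defect) (auto simp: d_def)
    qed (use that in auto)
  qed
  have z1: "?U 1 0 = 0" using law_moments(2)[OF assms(1)] by (simp add: weighted_ft_def)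
  have z2: "?U 2 0 = 1"
    using law_moments(3)[OF assms(1)] by (simp add: weighted_ft_def flip: of_real_power)
  have D1: "deriv_log 1 n 0 = 0"
    using U1[of 0] d z1 log_defect_0[of n] by simp
  have D2: "?f 0 * (deriv_log 2 n 0 - 1) + (?f 0 * (deriv_log 1 n 0 - of_real 0)) * (deriv_log 1 n 0 - of_real 0) = \<i> * (\<i> * ?U 2 0)"
  proof (rule vector_derivative_unique_at)
    show "((\<lambda>t. ?f t * (deriv_log 1 n t - of_real t)) has_vector_derivative
       ?f 0 * (deriv_log 2 n 0 - 1) + (?f 0 * (deriv_log 1 n 0 - of_real 0)) * (deriv_log 1 n 0 - of_real 0)) (at 0)"
    proof (rule has_vector_derivative_mult)
      show "(?f has_vector_derivative ?f 0 * (deriv_log 1 n 0 - of_real 0)) (at 0)" by (rule fd) (use d in auto)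
      have "(deriv_log 1 n has_vector_derivative deriv_log (Suc 1) n 0) (at 0)"
        using m_ge_3 d by (intro deriv_log_has_vector_derivative) (auto simp: d_def)
      thus "((\<lambda>t. deriv_log 1 n t - of_real t) has_vector_derivative deriv_log 2 n 0 - 1) (at 0)"
        by (intro has_vector_derivative_diff)
           (auto simp: numeral_2_eq_2 intro!: derivative_eq_intros has_vector_derivative_of_real)
    qed
    show "((\<lambda>t. ?f t * (deriv_log 1 n t - of_real t)) has_vector_derivative \<i> * (\<i> * ?U 2 0)) (at 0)"
    proof (rule has_vector_derivative_transform_within_open[OF _ op])
      show "((\<lambda>t. \<i> * ?U 1 t) has_vector_derivative \<i> * (\<i> * ?U 2 0)) (at 0)"
        using wm.weighted_ft_has_vector_derivative[of 1 0] by (intro has_vector_derivative_mult_right) (simp add: numeral_2_eq_2)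
      show "\<i> * ?U 1 s = ?f s * (deriv_log 1 n s - of_real s)" if "s \<in> {-d<..<d}" for s
        using U1[of s] that by auto
    qed (use d in auto)
  qed
  hence "deriv_log 2 n 0 = 0"
    using D1 z2 log_defect_0[of n] by simp
  moreover have "j = 0 \<or> j = 1 \<or> j = 2" using assms(2) by auto
  ultimately show ?thesis using D1 log_defect_0[of n] by auto
qed

text \<open>Near 0 the characteristic function is a Gaussian factor times the exponential of a
  function with \<open>m + 1\<close> derivatives, so it has \<open>m + 1\<close> derivatives itself.
  Even moments follow in steps of two, and \<open>2 * ((m + 1) div 2)\<close> is at least
  \<open>m\<close> whatever the parity; for odd \<open>m\<close> the derivative of order
  \<open>m + 1\<close> is essential here.\<close>

lemma moment_law:
  assumes "0 < sd n"
  shows "integrable (law n) (\<lambda>x. (1 + \<bar>x\<bar>) ^ m)"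
proof -
  define d where "d = radius * sd n"
  have d: "0 < d" using radius_pos assms by (simp add: d_def)
  \<comment> \<open>The growth calculus is reused for a single \<open>n\<close> with constant scale
    1, to obtain differentiability. Halving \<open>d\<close> gives a compact interval on which the
    derivatives up to order \<open>m\<close> are continuous, hence bounded.\<close>
  interpret F: scaled_family "\<lambda>_. 1" "\<lambda>_. {- (d / 2)<..<d / 2}"
    by unfold_locales (auto simp: closed_segment_eq_real_ivl split: if_splits)
  have bdd: "\<exists>K. \<forall>t\<in>{- (d / 2)..d / 2}. cmod (u t) \<le> K" if "continuous_on {- (d / 2)..d / 2} u" for u :: "real \<Rightarrow> complex"
  proof -
    have "bounded (u ` {- (d / 2)..d / 2})"
      by (intro compact_imp_bounded compact_continuous_image that compact_Icc)
    then obtain K where "\<forall>y\<in>u ` {- (d / 2)..d / 2}. norm y \<le> K" unfolding bounded_iff by blast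
    thus ?thesis by blast
  qed
  have g: "F.growth 0 1 (\<lambda>_. deriv_log j n)" if "j \<le> m + 1" for j
  proof -
    have "\<exists>K. \<forall>t\<in>{- (d / 2)..d / 2}. cmod (deriv_log j n t) \<le> K"
    proof (cases "j \<le> m")
      case True
      have "continuous_on {- (d / 2)..d / 2} (deriv_log j n)"
        using True d by (intro continuous_on_vector_derivative[where f' = "deriv_log (Suc j) n"]
          has_vector_derivative_at_within[OF deriv_log_has_vector_derivative]) (auto simp: d_def abs_le_iff)
      thus ?thesis by (rule bdd)
    next
      case False
      hence "j = m + 1" using that by simp
      hence j: "j \<in> {3..m + 1}" using m_ge_3 by auto
      obtain C where C: "\<forall>n j t. j \<in> {3..m + 1} \<longrightarrow> \<bar>t\<bar> \<le> radius * sd n \<longrightarrow> cmod (deriv_log j n t) \<le> C / sd n ^ (j - 2)"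
        using deriv_log_bound by blast
      show ?thesis
      proof (intro exI ballI)
        fix t assume "t \<in> {- (d / 2)..d / 2}"
        hence "\<bar>t\<bar> \<le> radius * sd n" using d by (auto simp: d_def)
        thus "cmod (deriv_log j n t) \<le> C / sd n ^ (j - 2)" using C j by blast
      qed
    qed
    then obtain K where "\<forall>t\<in>{- (d / 2)..d / 2}. cmod (deriv_log j n t) \<le> K" by blast
    thus ?thesis by (intro F.growthI[where K = K and N = 0]) auto
  qed
  have "F.derivs_growth (m + 1) 0 1 ((\<lambda>j _. deriv_log j n) 0)"
  proof (rule F.derivs_growth_of_chain)
    fix j and t :: real assume "j < m + 1" "t \<in> {- (d / 2)<..<d / 2}"
    thus "(deriv_log j n has_vector_derivative deriv_log (Suc j) n t) (at t)"
      using d by (intro deriv_log_has_vector_derivative) (auto simp: d_def)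
  qed (rule g)
  hence L: "F.derivs_growth (m + 1) 0 1 (\<lambda>_. log_defect n)" by simp
  have "continuous_on {- (d / 2)..d / 2} (deriv_log 0 n)"
    using d by (intro continuous_on_vector_derivative[where f' = "deriv_log (Suc 0) n"]
      has_vector_derivative_at_within[OF deriv_log_has_vector_derivative]) (auto simp: d_def abs_le_iff)
  from bdd[OF this] obtain K where K: "\<forall>t\<in>{- (d / 2)..d / 2}. cmod (log_defect n t) \<le> K"
    by auto
  have E: "F.derivs_growth (m + 1) 0 0 (\<lambda>_ t. exp_remainder 0 (log_defect n t))"
    using K by (intro F.derivs_growth_exp_remainder[OF L, where K = K]) auto
  have "F.derivs_growth (m + 1) 0 0 (\<lambda>_ t. exp (\<i> * of_real (0 * t) - of_real (1 * t\<^sup>2 / 2)))"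
    by (rule F.derivs_growth_exp_quadratic[where K = 1]) auto
  from F.derivs_growth_mult[OF this E]
  have f: "F.derivs_growth (m + 1) 0 0 (\<lambda>_. char (law n))"
  proof (subst (asm) F.derivs_growth_cong)
    fix t assume "t \<in> {- (d / 2)<..<d / 2}"
    hence "char (law n) t = exp (log_defect n t - of_real (t\<^sup>2 / 2))"
      using d by (intro exp_log_defect) (auto simp: d_def)
    thus "exp (\<i> * of_real (0 * t) - of_real (1 * t\<^sup>2 / 2)) * exp_remainder 0 (log_defect n t) = char (law n) t"
      by (simp add: exp_remainder_def mult_exp_exp)
  qed simp
  \<comment> \<open>Unfolds the nested existence statements into one sequence of derivatives. The
    derivative may formally depend on the dummy index; uniqueness allows index 0 throughout.\<close>
  have chain: "\<exists>U. U 0 = u \<and> (\<forall>j<J. \<forall>t\<in>{- (d / 2)<..<d / 2}. (U j has_vector_derivative U (Suc j) t) (at t))"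
    if "F.derivs_growth J 0 0 (\<lambda>_. u)" for J u
    using that
  proof (induction J arbitrary: u)
    case 0
    show ?case by (intro exI[of _ "\<lambda>_. u"]) auto
  next
    case (Suc J)
    then obtain u' where u': "\<forall>n. \<forall>t\<in>{- (d / 2)<..<d / 2}. (u has_vector_derivative u' n t) (at t)" "F.derivs_growth J 0 0 u'"
      by auto
    have "F.derivs_growth J 0 0 (\<lambda>_. u' 0)"
    proof (subst F.derivs_growth_cong[of _ u'])
      fix k t assume "t \<in> {- (d / 2)<..<d / 2}"
      thus "u' 0 t = u' k t" using u'(1) vector_derivative_unique_at by blast
    qed (rule u'(2))
    then obtain U where U: "U 0 = u' 0" "\<forall>j<J. \<forall>t\<in>{- (d / 2)<..<d / 2}. (U j has_vector_derivative U (Suc j) t) (at t)"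
      using Suc.IH by blast
    show ?case
    proof (intro exI[of _ "case_nat u U"] conjI allI impI ballI)
      fix j t assume "j < Suc J" "t \<in> {- (d / 2)<..<d / 2}"
      thus "(case_nat u U j has_vector_derivative case_nat u U (Suc j) t) (at t)"
        using U u'(1) by (cases j) auto
    qed simp
  qed
  obtain \<phi> where \<phi>: "\<phi> 0 = char (law n)" "\<forall>j<m + 1. \<forall>t\<in>{- (d / 2)<..<d / 2}. (\<phi> j has_vector_derivative \<phi> (Suc j) t) (at t)"
    using chain[OF f] by blast
  define p where "p = (m + 1) div 2"
  have p: "2 * p \<le> m + 1" "m \<le> 2 * p" by (auto simp: p_def)
  have "integrable (law n) (\<lambda>x. x ^ (2 * p))"
  proof (rule law.even_moment_of_char_chain[OF _ _ _ order.refl])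
    show "0 < d / 2" using d by simp
    show "\<phi> 0 t = char (law n) t" for t using \<phi> by simp
    show "(\<phi> j has_vector_derivative \<phi> (Suc j) t) (at t)" if "j < 2 * p" "\<bar>t\<bar> < d / 2" for j t
    proof -
      have "t \<in> {- (d / 2)<..<d / 2}" "j < m + 1" using that p by (auto simp: abs_less_iff)
      thus ?thesis using \<phi>(2) by blast
    qed
  qed
  hence "integrable (law n) (\<lambda>x. 2 ^ (2 * p) * (1 + \<bar>x\<bar> ^ (2 * p)))" by (simp add: power_even_abs)
  thus ?thesis
  proof (rule Bochner_Integration.integrable_bound)
    show "AE x in law n. norm ((1 + \<bar>x\<bar>) ^ m) \<le> norm (2 ^ (2 * p) * (1 + \<bar>x\<bar> ^ (2 * p)))"
    proof (rule AE_I2)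
      fix x :: real
      have "(1 + \<bar>x\<bar>) ^ m \<le> (1 + \<bar>x\<bar>) ^ (2 * p)" using p by (intro power_increasing) auto
      also have "\<dots> \<le> 2 ^ (2 * p) * (1 + \<bar>x\<bar> ^ (2 * p))" by (rule one_plus_abs_power_le)
      finally show "norm ((1 + \<bar>x\<bar>) ^ m) \<le> norm (2 ^ (2 * p) * (1 + \<bar>x\<bar> ^ (2 * p)))" by (simp add: abs_of_nonneg)
    qed
  qed measurable
qed

lemma moment_integrable: "integrable M (\<lambda>\<omega>. \<bar>S n \<omega>\<bar> ^ m)"
proof (cases "sd n = 0")
  \<comment> \<open>For \<open>sd n = 0\<close> the law of \<open>S n \<omega> / sd n\<close> is a
    point mass by default division and says nothing about \<open>S n\<close>, which however vanishes
    almost everywhere.\<close>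
  case True
  hence "(LINT \<omega>|M. (S n \<omega>)\<^sup>2) = 0"
    unfolding sd_def L2_norm_def by simp
  hence "AE \<omega> in M. (S n \<omega>)\<^sup>2 = 0"
    using integral_nonneg_eq_0_iff_AE[OF S_square_integrable] by simp
  hence "AE \<omega> in M. \<bar>S n \<omega>\<bar> ^ m = 0" using m_ge_3 by (auto simp: power_0_left)
  thus ?thesis by (subst integrable_cong_AE[where g = "\<lambda>_. 0"]) auto
next
  case False
  hence sd: "0 < sd n" using sd_nonneg[of n] by simp
  have "integrable M (\<lambda>\<omega>. sd n ^ m * (1 + \<bar>S n \<omega> / sd n\<bar>) ^ m)"
    using moment_law[OF sd] by (subst (asm) law_integrable_iff) auto
  thus ?thesis
  proof (rule Bochner_Integration.integrable_bound)
    show "AE \<omega> in M. norm (\<bar>S n \<omega>\<bar> ^ m) \<le> norm (sd n ^ m * (1 + \<bar>S n \<omega> / sd n\<bar>) ^ m)"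
    proof (rule AE_I2)
      fix \<omega>
      have "\<bar>S n \<omega>\<bar> ^ m = sd n ^ m * \<bar>S n \<omega> / sd n\<bar> ^ m"
        using sd by (simp add: power_mult_distrib[symmetric])
      also have "\<dots> \<le> sd n ^ m * (1 + \<bar>S n \<omega> / sd n\<bar>) ^ m"
        using sd by (intro mult_left_mono power_mono) auto
      finally show "norm (\<bar>S n \<omega>\<bar> ^ m) \<le> norm (sd n ^ m * (1 + \<bar>S n \<omega> / sd n\<bar>) ^ m)" by simp
    qed
  qed measurable
qed

end

section \<open>Growth of polynomial families and of differences of powers\<close>

context scaled_family
begin

lemma derivs_growth_monomial:
  assumes "\<And>n t. t \<in> I n \<Longrightarrow> cmod (c n) \<le> K / \<sigma> n ^ k"
  shows "derivs_growth J 0 k (\<lambda>n t. c n * of_real t ^ i)"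
  using derivs_growth_mult[OF derivs_growth_const[where J = J and c = c, OF assms]
      derivs_growth_power[OF derivs_growth_ident[of J], of i]]
  by simp

lemma derivs_growth_scaled_poly:
  assumes deg: "\<And>n. degree (p n) \<le> N" and coeff: "\<And>n i. cmod (coeff (p n) i) \<le> K"
    and "\<And>n t. t \<in> I n \<Longrightarrow> \<bar>\<rho> n\<bar> \<le> 2" and "\<And>n t. t \<in> I n \<Longrightarrow> \<bar>z n\<bar> \<le> 2 / \<sigma> n" and "k \<le> j"
  shows "derivs_growth J 0 k (\<lambda>n t. poly (p n) (\<i> * of_real (t * \<rho> n)) * of_real (z n) ^ j)"
proof -
  have K: "0 \<le> K" using order_trans[OF norm_ge_zero coeff] by blast
  have eq: "poly (p n) (\<i> * of_real (t * \<rho> n)) * of_real (z n) ^ j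
    = (\<Sum>i\<le>N. (coeff (p n) i * \<i> ^ i * of_real (\<rho> n) ^ i * of_real (z n) ^ j) * of_real t ^ i)" for n t
  proof -
    have "poly (p n) (\<i> * of_real (t * \<rho> n)) = (\<Sum>i\<le>N. coeff (p n) i * (\<i> * of_real (t * \<rho> n)) ^ i)"
      unfolding poly_altdef using deg[of n] by (intro sum.mono_neutral_left) (auto simp: coeff_eq_0)
    thus ?thesis unfolding sum_distrib_right
      by (simp only: sum_distrib_right) (intro sum.cong refl, simp add: power_mult_distrib mult_ac)
  qed
  show ?thesis
    unfolding eq
  proof (intro derivs_growth_sum derivs_growth_monomial)
    fix i n t assume i: "i \<in> {..N}" and t: "t \<in> I n"
    have \<sigma>: "1 \<le> \<sigma> n" by (rule scale_ge_1[OF t])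
    have "cmod (coeff (p n) i * \<i> ^ i * of_real (\<rho> n) ^ i * of_real (z n) ^ j) = cmod (coeff (p n) i) * \<bar>\<rho> n\<bar> ^ i * \<bar>z n\<bar> ^ j"
      by (simp add: norm_mult norm_power)
    also have "\<dots> \<le> K * 2 ^ N * (2 / \<sigma> n) ^ j"
    proof (intro mult_mono coeff power_mono assms(4)[OF t])
      have "\<bar>\<rho> n\<bar> ^ i \<le> 2 ^ i" using assms(3)[OF t] by (intro power_mono) auto
      also have "\<dots> \<le> 2 ^ N" using i by (intro power_increasing) auto
      finally show "\<bar>\<rho> n\<bar> ^ i \<le> 2 ^ N" .
    qed (use K in auto)
    also have "\<dots> = K * 2 ^ N * 2 ^ j / \<sigma> n ^ j" by (simp add: power_divide)
    also have "\<dots> \<le> K * 2 ^ N * 2 ^ j / \<sigma> n ^ k"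
      using \<sigma> K \<open>k \<le> j\<close> by (intro divide_left_mono power_increasing mult_pos_pos) auto
    finally show "cmod (coeff (p n) i * \<i> ^ i * of_real (\<rho> n) ^ i * of_real (z n) ^ j) \<le> K * 2 ^ N * 2 ^ j / \<sigma> n ^ k" .
  qed simp
qed

lemma derivs_growth_power_diff:
  assumes "derivs_growth J 0 0 M" "derivs_growth J 0 0 M'" "derivs_growth J 0 k (\<lambda>n t. M n t - M' n t)"
  shows "derivs_growth J 0 k (\<lambda>n t. M n t ^ l - M' n t ^ l)"
proof (induction l)
  case 0
  show ?case using derivs_growth_zero by simp
next
  case (Suc l)
  have "derivs_growth J 0 k (\<lambda>n t. M n t * (M n t ^ l - M' n t ^ l))"
    using derivs_growth_mult[OF assms(1) Suc] by simp
  moreover have "derivs_growth J 0 k (\<lambda>n t. (M n t - M' n t) * M' n t ^ l)"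
    using derivs_growth_mult[OF assms(3) derivs_growth_power[OF assms(2), of l]] by simp
  ultimately have "derivs_growth J 0 k (\<lambda>n t. M n t * (M n t ^ l - M' n t ^ l) + (M n t - M' n t) * M' n t ^ l)"
    by (rule derivs_growth_add)
  thus ?case by (simp add: algebra_simps)
qed

end

section \<open>The characteristic function near the origin\<close>

locale edgeworth_setting = standardized_sequence M S m
  for M :: "'a measure" and S :: "nat \<Rightarrow> 'a \<Rightarrow> real" and m :: nat +
  fixes A B :: "nat \<Rightarrow> real" and a b :: real
  assumes A_bound: "\<And>n. \<bar>A n\<bar> \<le> a" and B_bound: "\<And>n. \<bar>B n - sd n\<bar> \<le> b"
begin

lemma a_b_nonneg: "0 \<le> a" "0 \<le> b"
  using A_bound[of 0] B_bound[of 0] by auto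

text \<open>With \<open>32 * b \<le> sd n\<close> the ratio \<open>B n / sd n\<close> is within 1 /
  32 of 1, so its square lies in \<open>{3 / 4..9 / 8}\<close>. The numbers serve the balance of
  exponents: \<open>prefactor\<close> decays at rate 3 / 8, the exponent grows at most at rate 1 /
  8, and 1 / 4 remains.\<close>

definition large :: "nat \<Rightarrow> bool" where "large n \<longleftrightarrow> 32 * b + 1 \<le> sd n"

lemma large_bounds:
  assumes "large n"
  shows "1 \<le> sd n" "0 < B n" "\<bar>B n / sd n - 1\<bar> \<le> 1 / 32" "\<bar>B n / sd n\<bar> \<le> 2" "\<bar>1 / B n\<bar> \<le> 2 / sd n"
    "3 / 4 \<le> (B n)\<^sup>2 / (sd n)\<^sup>2" "(B n)\<^sup>2 / (sd n)\<^sup>2 \<le> 9 / 8" "\<bar>(B n)\<^sup>2 / (sd n)\<^sup>2 - 1\<bar> \<le> 3 * b / sd n"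
proof -
  show sd: "1 \<le> sd n" using assms a_b_nonneg by (simp add: large_def)
  have "32 * b \<le> sd n" using assms by (simp add: large_def)
  hence b: "b \<le> sd n / 32" by simp
  hence B: "31 / 32 * sd n \<le> B n" "B n \<le> 33 / 32 * sd n" using B_bound[of n] by (auto simp: abs_le_iff)
  show Bpos: "0 < B n" using B(1) sd by linarith
  define r where "r = B n / sd n"
  have r: "31 / 32 \<le> r" "r \<le> 33 / 32" using B sd by (auto simp: r_def field_simps)
  show "\<bar>B n / sd n - 1\<bar> \<le> 1 / 32" "\<bar>B n / sd n\<bar> \<le> 2" using r unfolding r_def[symmetric] abs_le_iff by linarith+
  have "sd n \<le> 2 * B n" using B(1) sd by linarith
  thus "\<bar>1 / B n\<bar> \<le> 2 / sd n" using Bpos sd by (simp add: field_simps)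
  have sq: "(B n)\<^sup>2 / (sd n)\<^sup>2 = r * r" by (simp add: r_def power2_eq_square)
  have "31 / 32 * (31 / 32) \<le> r * r" "r * r \<le> 33 / 32 * (33 / 32)" using r by (intro mult_mono; simp)+
  thus "3 / 4 \<le> (B n)\<^sup>2 / (sd n)\<^sup>2" "(B n)\<^sup>2 / (sd n)\<^sup>2 \<le> 9 / 8" unfolding sq by linarith+
  have "r - 1 = (B n - sd n) / sd n" using sd by (simp add: r_def field_simps)
  hence "\<bar>r - 1\<bar> = \<bar>B n - sd n\<bar> / sd n" using sd by simp
  hence "\<bar>r - 1\<bar> \<le> b / sd n" using B_bound[of n] sd by (simp add: divide_right_mono)
  moreover have "\<bar>r + 1\<bar> \<le> 3" using r by simp
  ultimately have "\<bar>r - 1\<bar> * \<bar>r + 1\<bar> \<le> b / sd n * 3" by (intro mult_mono) auto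
  moreover have "\<bar>r * r - 1\<bar> = \<bar>r - 1\<bar> * \<bar>r + 1\<bar>" by (simp add: abs_mult[symmetric] algebra_simps)
  ultimately show "\<bar>(B n)\<^sup>2 / (sd n)\<^sup>2 - 1\<bar> \<le> 3 * b / sd n" unfolding sq by (simp add: mult.commute[of b])
qed

definition log_bound :: real where
  "log_bound = (SOME C. 0 < C \<and> (\<forall>n j t. j \<in> {3..m + 1} \<longrightarrow> \<bar>t\<bar> \<le> radius * sd n \<longrightarrow> cmod (deriv_log j n t) \<le> C / sd n ^ (j - 2)))"

lemma log_bound:
  shows log_bound_pos: "0 < log_bound"
    and deriv_log_le: "j \<in> {3..m + 1} \<Longrightarrow> \<bar>t\<bar> \<le> radius * sd n \<Longrightarrow> cmod (deriv_log j n t) \<le> log_bound / sd n ^ (j - 2)"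
proof -
  have "\<exists>C. 0 < C \<and> (\<forall>n j t. j \<in> {3..m + 1} \<longrightarrow> \<bar>t\<bar> \<le> radius * sd n \<longrightarrow> cmod (deriv_log j n t) \<le> C / sd n ^ (j - 2))"
    using deriv_log_bound by blast
  from someI_ex[OF this, folded log_bound_def]
  have *: "0 < log_bound \<and> (\<forall>n j t. j \<in> {3..m + 1} \<longrightarrow> \<bar>t\<bar> \<le> radius * sd n \<longrightarrow> cmod (deriv_log j n t) \<le> log_bound / sd n ^ (j - 2))" .
  show "0 < log_bound" using * by blast
  show "j \<in> {3..m + 1} \<Longrightarrow> \<bar>t\<bar> \<le> radius * sd n \<Longrightarrow> cmod (deriv_log j n t) \<le> log_bound / sd n ^ (j - 2)"
    using * by blast
qed

text \<open>The second entry forces \<open>log_bound / sd n * \<bar>t\<bar> ^ 3\<close> below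
  \<open>t\<^sup>2 / 16\<close>, half of the growth rate allowed in the exponent.\<close>

definition near_radius :: real where "near_radius = min radius (1 / (16 * log_bound))"

lemma near_radius: "0 < near_radius" "near_radius \<le> radius" "log_bound * near_radius \<le> 1 / 16"
proof -
  show "0 < near_radius" "near_radius \<le> radius" using radius_pos log_bound_pos by (auto simp: near_radius_def)
  have "log_bound * near_radius \<le> log_bound * (1 / (16 * log_bound))"
    using log_bound_pos by (intro mult_left_mono) (auto simp: near_radius_def)
  thus "log_bound * near_radius \<le> 1 / 16" using log_bound_pos by simp
qed

text \<open>The law is controlled only for frequencies of order \<open>sd n\<close>, the density
  side at all frequencies; hence two families of sets, both empty unless
  \<open>large n\<close>.\<close>

definition near :: "nat \<Rightarrow> real set" where
  "near n = (if large n then {- (near_radius * sd n)<..<near_radius * sd n} else {})"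

definition everywhere :: "nat \<Rightarrow> real set" where
  "everywhere n = (if large n then UNIV else {})"

sublocale near: scaled_family sd near
proof
  show "open (near n)" for n by (simp add: near_def)
  show "1 \<le> sd n" if "t \<in> near n" for t n using that large_bounds(1) by (auto simp: near_def split: if_splits)
  show "closed_segment 0 t \<subseteq> near n" if "t \<in> near n" for t n
    using that by (auto simp: near_def closed_segment_eq_real_ivl split: if_splits)
qed

sublocale everywhere: scaled_family sd everywhere
proof
  show "open (everywhere n)" for n by (simp add: everywhere_def)
  show "1 \<le> sd n" if "t \<in> everywhere n" for t n using that large_bounds(1) by (auto simp: everywhere_def split: if_splits)
  show "closed_segment 0 t \<subseteq> everywhere n" if "t \<in> everywhere n" for t n
    using that by (auto simp: everywhere_def split: if_splits)
qed

lemma nearD: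
  assumes "t \<in> near n"
  shows "large n" "\<bar>t\<bar> < near_radius * sd n" "\<bar>t\<bar> \<le> radius * sd n"
proof -
  show *: "large n" "\<bar>t\<bar> < near_radius * sd n" using assms by (auto simp: near_def split: if_splits)
  have "near_radius * sd n \<le> radius * sd n" using near_radius sd_nonneg[of n] by (intro mult_right_mono)
  thus "\<bar>t\<bar> \<le> radius * sd n" using * by simp
qed

text \<open>The derivative of order \<open>j\<close> of the Taylor remainder of degree
  \<open>m\<close>. At \<open>j = m + 1\<close> the sum is empty and the growth condition bounds
  what is left.\<close>

definition taylor_remainder :: "nat \<Rightarrow> nat \<Rightarrow> real \<Rightarrow> complex" where
  "taylor_remainder j n t = deriv_log j n t - (\<Sum>k\<in>{j..m}. deriv_log k n 0 * of_real t ^ (k - j) / fact (k - j))"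

lemma taylor_remainder_has_vector_derivative:
  assumes "j \<le> m" "\<bar>t\<bar> \<le> radius * sd n"
  shows "(taylor_remainder j n has_vector_derivative taylor_remainder (Suc j) n t) (at t)"
proof -
  have "((\<lambda>t. deriv_log k n 0 * of_real t ^ (k - j) / fact (k - j)) has_vector_derivative
     (if k = j then 0 else deriv_log k n 0 * of_real t ^ (k - Suc j) / fact (k - Suc j))) (at t)" if "k \<in> {j..m}" for k
  proof (cases "k = j")
    case True
    have "(\<lambda>t :: real. deriv_log k n 0 * of_real t ^ (k - j) / fact (k - j)) = (\<lambda>t. deriv_log k n 0)" using True by simp
    thus ?thesis using True by simp
  next
    case False
    define i where "i = k - Suc j"
    have i: "k - j = Suc i" "k - Suc j = i" using that False by (auto simp: i_def)
    have "((\<lambda>z. z ^ Suc i) has_field_derivative of_nat (Suc i) * of_real t ^ i) (at (complex_of_real t))"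
      using DERIV_power[OF DERIV_ident, of "Suc i" "complex_of_real t" UNIV] by (simp del: of_nat_Suc)
    from DERIV_cdivide[OF DERIV_cmult[OF this, of "deriv_log k n 0"], of "fact (Suc i)"]
    have "((\<lambda>z. deriv_log k n 0 * z ^ Suc i / fact (Suc i)) has_field_derivative
        deriv_log k n 0 * (of_nat (Suc i) * of_real t ^ i) / fact (Suc i)) (at (complex_of_real t))" .
    moreover have "c * (of_nat (Suc i) * x) / fact (Suc i) = c * x / fact i" for c x :: complex
      unfolding fact_Suc by (simp del: of_nat_Suc)
    ultimately have "((\<lambda>z. deriv_log k n 0 * z ^ Suc i / fact (Suc i)) has_field_derivative
        deriv_log k n 0 * of_real t ^ i / fact i) (at (complex_of_real t))" by (simp only:)
    from has_vector_derivative_real_field[OF this] show ?thesis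
      using False unfolding i by (simp only: if_False o_def)
  qed
  hence "((\<lambda>t. \<Sum>k\<in>{j..m}. deriv_log k n 0 * of_real t ^ (k - j) / fact (k - j)) has_vector_derivative
     (\<Sum>k\<in>{j..m}. if k = j then 0 else deriv_log k n 0 * of_real t ^ (k - Suc j) / fact (k - Suc j))) (at t)"
    by (rule has_vector_derivative_sum)
  also have "(\<Sum>k\<in>{j..m}. if k = j then 0 else deriv_log k n 0 * of_real t ^ (k - Suc j) / fact (k - Suc j))
     = (\<Sum>k\<in>{Suc j..m}. deriv_log k n 0 * of_real t ^ (k - Suc j) / fact (k - Suc j))"
  proof (rule sum.mono_neutral_cong_right)
    show "\<forall>k\<in>{j..m} - {Suc j..m}. (if k = j then 0 else deriv_log k n 0 * of_real t ^ (k - Suc j) / fact (k - Suc j)) = 0"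
      by auto
  qed (auto simp del: fact_Suc)
  finally show ?thesis
    unfolding taylor_remainder_def by (intro has_vector_derivative_diff deriv_log_has_vector_derivative assms)
qed

text \<open>Induction from the top: the derivative of order \<open>m + 1\<close> has order
  \<open>m - 1\<close> in \<open>1 / sd n\<close>, and each lower one vanishes at 0 and is obtained
  by integration, which preserves the order.\<close>

lemma taylor_remainder_growth:
  "i \<le> m + 1 \<Longrightarrow> near.derivs_growth i 0 (m - 1) (taylor_remainder (m + 1 - i))"
proof (induction i)
  case 0
  have "near.growth 0 (m - 1) (taylor_remainder (m + 1))"
  proof (rule near.growthI[where K = log_bound and N = 0])
    fix n t assume t: "t \<in> near n"
    have "cmod (deriv_log (m + 1) n t) \<le> log_bound / sd n ^ (m + 1 - 2)"
      using nearD[OF t] m_ge_3 by (intro deriv_log_le) auto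
    thus "cmod (taylor_remainder (m + 1) n t) \<le> log_bound / sd n ^ (m - 1) * (1 + \<bar>t\<bar>) ^ 0 * exp (0 * t\<^sup>2)"
      by (simp add: taylor_remainder_def)
  qed
  thus ?case by simp
next
  case (Suc i)
  define j where "j = m - i"
  have j: "m + 1 - Suc i = j" "m + 1 - i = Suc j" "j \<le> m" using Suc.prems by (auto simp: j_def)
  show ?case
    unfolding j(1)
  proof (rule near.derivs_growth_integrate[where v = "taylor_remainder (Suc j)"])
    fix n t assume t: "t \<in> near n"
    have "(\<Sum>k\<in>{j..m}. deriv_log k n 0 * of_real 0 ^ (k - j) / fact (k - j)) = (\<Sum>k\<in>{j..m}. if k = j then deriv_log j n 0 else 0)"
      by (intro sum.cong) auto
    thus "taylor_remainder j n 0 = 0" using j(3) by (simp add: taylor_remainder_def)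
    show "(taylor_remainder j n has_vector_derivative taylor_remainder (Suc j) n t) (at t)"
      using nearD[OF t] j by (intro taylor_remainder_has_vector_derivative) auto
  next
    show "near.derivs_growth i 0 (m - 1) (taylor_remainder (Suc j))" using Suc j by simp
  qed
qed

lemma taylor_remainder_0:
  assumes "large n"
  shows "taylor_remainder 0 n t = log_defect n t - (\<Sum>k\<in>{3..m}. deriv_log k n 0 * of_real t ^ k / fact k)"
proof -
  have "(\<Sum>k\<in>{0..m}. deriv_log k n 0 * of_real t ^ k / fact k) = (\<Sum>k\<in>{3..m}. deriv_log k n 0 * of_real t ^ k / fact k)"
    using deriv_log_0[of n] large_bounds(1)[OF assms] by (intro sum.mono_neutral_right) auto
  thus ?thesis by (simp add: taylor_remainder_def)
qed

text \<open>Three integrations from 0, starting with the third derivative; the first three Taylor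
  coefficients vanish by \<open>deriv_log_0\<close>. The factor 1 / 6 is given away.\<close>

lemma log_defect_le:
  assumes "large n" "\<bar>t\<bar> \<le> radius * sd n"
  shows "cmod (log_defect n t) \<le> log_bound / sd n * \<bar>t\<bar> ^ 3"
proof -
  have sd: "1 \<le> sd n" by (rule large_bounds(1)[OF assms(1)])
  have step: "cmod (deriv_log j n t) \<le> log_bound / sd n * \<bar>t\<bar> ^ Suc p"
    if "j < 3" "\<And>s. \<bar>s\<bar> \<le> radius * sd n \<Longrightarrow> cmod (deriv_log (Suc j) n s) \<le> log_bound / sd n * \<bar>s\<bar> ^ p" "\<bar>t\<bar> \<le> radius * sd n" for j p t
  proof -
    have "norm (deriv_log j n t - deriv_log j n 0) \<le> (log_bound / sd n * \<bar>t\<bar> ^ p) * norm (t - 0)"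
    proof (rule differentiable_bound[where S = "closed_segment 0 t"])
      fix s assume "s \<in> closed_segment 0 t"
      hence s: "\<bar>s\<bar> \<le> \<bar>t\<bar>" by (auto simp: closed_segment_eq_real_ivl split: if_splits)
      hence s': "\<bar>s\<bar> \<le> radius * sd n" using that(3) by simp
      have "(deriv_log j n has_vector_derivative deriv_log (Suc j) n s) (at s within closed_segment 0 t)"
        using that(1) m_ge_3 s' by (intro has_vector_derivative_at_within[OF deriv_log_has_vector_derivative]) auto
      thus "(deriv_log j n has_derivative (\<lambda>h. h *\<^sub>R deriv_log (Suc j) n s)) (at s within closed_segment 0 t)"
        by (simp add: has_vector_derivative_def)
      have "cmod (deriv_log (Suc j) n s) \<le> log_bound / sd n * \<bar>s\<bar> ^ p" by (rule that(2)[OF s'])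
      also have "\<dots> \<le> log_bound / sd n * \<bar>t\<bar> ^ p" using s sd log_bound_pos by (intro mult_left_mono power_mono) auto
      finally show "onorm (\<lambda>h. h *\<^sub>R deriv_log (Suc j) n s) \<le> log_bound / sd n * \<bar>t\<bar> ^ p"
        by (subst onorm_scaleR_left) (auto simp: bounded_linear_ident onorm_id)
    qed auto
    thus ?thesis using deriv_log_0[of n j] that(1) sd by (simp add: mult_ac)
  qed
  have 3: "cmod (deriv_log (Suc 2) n s) \<le> log_bound / sd n * \<bar>s\<bar> ^ 0" if "\<bar>s\<bar> \<le> radius * sd n" for s
    using deriv_log_le[of 3 s n] that m_ge_3 by (simp add: numeral_3_eq_3)
  have 2: "cmod (deriv_log (Suc 1) n s) \<le> log_bound / sd n * \<bar>s\<bar> ^ Suc 0" if "\<bar>s\<bar> \<le> radius * sd n" for s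
    using step[of 2 0 s, OF _ 3 that] by (simp add: numeral_2_eq_2)
  have 1: "cmod (deriv_log (Suc 0) n s) \<le> log_bound / sd n * \<bar>s\<bar> ^ Suc (Suc 0)" if "\<bar>s\<bar> \<le> radius * sd n" for s
    using step[of 1 "Suc 0" s, OF _ 2 that] by simp
  show ?thesis using step[of 0 "Suc (Suc 0)" t, OF _ 1 assms(2)] by (simp add: numeral_3_eq_3)
qed

definition params :: "nat \<Rightarrow> parameter \<Rightarrow> complex" where
  "params n = parameter_value M (S n) (A n) (B n)"

lemma params_simps:
  "params n Shift = of_real (A n)" "params n Scale = of_real (B n - sd n)"
  "params n (Cumulant k) = deriv_log k n 0 * of_real (sd n ^ (k - 2))"
  by (simp_all add: params_def sd_def log_defect_def)

lemma real_parameters_params: "real_parameters m (params n)"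
  unfolding real_parameters_def params_simps using cumulant_real by auto

lemma params_bounded:
  assumes "i \<in> parameters m"
  shows "bounded (range (\<lambda>n. params n i))"
proof -
  consider "i = Shift" | "i = Scale" | k where "i = Cumulant k" "k \<in> {3..m + 1}"
    using assms by (auto simp: parameters_def)
  thus ?thesis
  proof cases
    case 1
    thus ?thesis using A_bound by (auto simp: bounded_iff params_simps)
  next
    case 2
    have "cmod (params n Scale) \<le> b" for n
      using B_bound[of n] unfolding params_simps norm_of_real .
    thus ?thesis using 2 by (auto simp: bounded_iff)
  next
    case (3 k)
    have "cmod (params n (Cumulant k)) \<le> log_bound" for n
    proof -
      have "cmod (params n (Cumulant k)) = cmod (deriv_log k n 0) * sd n ^ (k - 2)"
        using sd_nonneg[of n] by (simp add: params_simps norm_mult norm_power)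
      also have "\<dots> \<le> log_bound / sd n ^ (k - 2) * sd n ^ (k - 2)"
        using 3 radius_pos sd_nonneg[of n] by (intro mult_right_mono deriv_log_le) auto
      also have "\<dots> \<le> log_bound" using log_bound_pos by simp
      finally show ?thesis .
    qed
    thus ?thesis using 3 by (auto simp: bounded_iff)
  qed
qed

definition symbol_coeff :: "nat \<Rightarrow> nat \<Rightarrow> complex poly" where
  "symbol_coeff j n = coeff (exp_phase m (params n)) j"

lemma symbol_coeff_bounded:
  obtains N K where "\<And>n. degree (exp_phase m (params n)) \<le> N" "\<And>n j. degree (symbol_coeff j n) \<le> N"
    "\<And>n j i. cmod (coeff (symbol_coeff j n) i) \<le> K"
proof -
  obtain N where N: "\<And>v. degree (exp_phase m v) \<le> N" "\<And>v j. degree (coeff (exp_phase m v) j) \<le> N"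
    using real_poly_family_exp_phase[of m] unfolding real_poly_family_def by blast
  have "bounded (range (\<lambda>n. coeff (symbol_coeff j n) i))" for j i
    unfolding symbol_coeff_def
    using real_poly_family_exp_phase[of m] params_bounded
    by (intro polynomial_fun_bounded[of "parameters m" "\<lambda>v. coeff (coeff (exp_phase m v) j) i"]) (auto simp: real_poly_family_def)
  hence "\<forall>j i. \<exists>K. \<forall>n. cmod (coeff (symbol_coeff j n) i) \<le> K" unfolding bounded_iff by blast
  then obtain K where K: "\<And>j i n. cmod (coeff (symbol_coeff j n) i) \<le> K j i" by metis
  have K0: "0 \<le> K j i" for j i using order_trans[OF norm_ge_zero K] .
  show ?thesis
  proof (rule that[of N "\<Sum>j\<le>N. \<Sum>i\<le>N. K j i"])
    show "degree (exp_phase m (params n)) \<le> N" for n by (rule N)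
    show dN: "degree (symbol_coeff j n) \<le> N" for n j unfolding symbol_coeff_def by (rule N)
    show "cmod (coeff (symbol_coeff j n) i) \<le> (\<Sum>j\<le>N. \<Sum>i\<le>N. K j i)" for n j i
    proof (cases "j \<le> N \<and> i \<le> N")
      case True
      have "cmod (coeff (symbol_coeff j n) i) \<le> K j i" by (rule K)
      also have "\<dots> \<le> (\<Sum>i\<le>N. K j i)" using True K0 by (intro member_le_sum) auto
      also have "\<dots> \<le> (\<Sum>j\<le>N. \<Sum>i\<le>N. K j i)"
        using True K0 by (intro member_le_sum[of j "{..N}" "\<lambda>j. \<Sum>i\<le>N. K j i"]) (auto intro: sum_nonneg)
      finally show ?thesis .
    next
      case False
      have "coeff (symbol_coeff j n) i = 0"
      proof (cases "j \<le> N")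
        case True
        thus ?thesis using False dN[of j n] by (intro coeff_eq_0) auto
      next
        case False
        hence "symbol_coeff j n = 0" unfolding symbol_coeff_def using N(1)[of "params n"] by (intro coeff_eq_0) auto
        thus ?thesis by simp
      qed
      thus ?thesis using K0 by (simp add: sum_nonneg)
    qed
  qed
qed

definition phase_value :: "nat \<Rightarrow> real \<Rightarrow> complex" where
  "phase_value n t = eval2 (phase m (params n)) (1 / of_real (B n)) (\<i> * of_real (t * B n / sd n))"

definition exponent :: "nat \<Rightarrow> real \<Rightarrow> complex" where
  "exponent n t = phase_value n t + taylor_remainder 0 n t"

text \<open>The transform of a normal law with mean \<open>A n / sd n\<close> and standard deviation
  \<open>B n / sd n\<close>. Dividing it out leaves an exponent of order \<open>1 / sd n\<close>,
  since shift and change of scale reappear inside \<open>phase_value\<close> as corrections.\<close>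

definition prefactor :: "nat \<Rightarrow> real \<Rightarrow> complex" where
  "prefactor n t = exp (\<i> * of_real (A n / sd n * t) - of_real ((B n)\<^sup>2 / (sd n)\<^sup>2 * t\<^sup>2 / 2))"

definition truncated_symbol :: "nat \<Rightarrow> real \<Rightarrow> complex" where
  "truncated_symbol n t = (\<Sum>j<m - 1. poly (symbol_coeff j n) (\<i> * of_real (t * (B n / sd n))) * of_real (1 / B n) ^ j)"

lemma phase_value_eq:
  assumes "large n"
  shows "phase_value n t = - (\<i> * of_real (t * A n / sd n)) + of_real (t\<^sup>2 / 2 * ((B n)\<^sup>2 / (sd n)\<^sup>2 - 1))
     + (\<Sum>k\<in>{3..m}. deriv_log k n 0 * of_real t ^ k / fact k)"
  unfolding phase_value_def
  using large_bounds(1,2)[OF assms] by (intro eval2_phase params_simps) auto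

lemma char_eq_exponent:
  assumes "t \<in> near n"
  shows "char (law n) t = prefactor n t * exp (exponent n t)"
proof -
  \<comment> \<open>The shift and scale terms of the phase undo those of \<open>prefactor\<close>,
    and its Taylor polynomial undoes the one subtracted in the remainder.\<close>
  have *: "p - q + (- p' + r + S + (L - S)) = L - s" if "p = p'" "r = q - s" for p q p' r S L s :: complex
    using that by simp
  have "char (law n) t = exp (log_defect n t - of_real (t\<^sup>2 / 2))"
    by (rule exp_log_defect[OF nearD(3)[OF assms]])
  also have "log_defect n t - of_real (t\<^sup>2 / 2) =
     (\<i> * of_real (A n / sd n * t) - of_real ((B n)\<^sup>2 / (sd n)\<^sup>2 * t\<^sup>2 / 2)) + exponent n t"
    unfolding exponent_def phase_value_eq[OF nearD(1)[OF assms]] taylor_remainder_0[OF nearD(1)[OF assms]]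
  proof (rule *[symmetric])
    show "\<i> * complex_of_real (A n / sd n * t) = \<i> * complex_of_real (t * A n / sd n)" by simp
    have "t\<^sup>2 / 2 * ((B n)\<^sup>2 / (sd n)\<^sup>2 - 1) = (B n)\<^sup>2 / (sd n)\<^sup>2 * t\<^sup>2 / 2 - t\<^sup>2 / 2"
      by (simp add: algebra_simps)
    thus "complex_of_real (t\<^sup>2 / 2 * ((B n)\<^sup>2 / (sd n)\<^sup>2 - 1)) = complex_of_real ((B n)\<^sup>2 / (sd n)\<^sup>2 * t\<^sup>2 / 2) - complex_of_real (t\<^sup>2 / 2)"
      by (metis of_real_diff)
  qed
  finally show ?thesis by (simp only: exp_add prefactor_def)
qed

text \<open>The rate 1 / 8 is the sum of 1 / 16 from the mismatch of \<open>B n\<close> and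
  \<open>sd n\<close> and 1 / 16 from \<open>log_defect\<close>; the shift contributes only a
  constant because \<open>\<bar>t\<bar> / sd n\<close> is bounded by
  \<open>near_radius\<close>.\<close>

lemma exponent_bound:
  assumes "t \<in> near n"
  shows "cmod (exponent n t) \<le> a * near_radius + 1 / 8 * t\<^sup>2"
proof -
  note large = nearD(1)[OF assms]
  have sd: "1 \<le> sd n" by (rule large_bounds(1)[OF large])
  have "exponent n t = - (\<i> * of_real (t * A n / sd n)) + of_real (t\<^sup>2 / 2 * ((B n)\<^sup>2 / (sd n)\<^sup>2 - 1)) + log_defect n t"
    unfolding exponent_def phase_value_eq[OF large] taylor_remainder_0[OF large] by simp
  also have "cmod \<dots> \<le> \<bar>t * A n / sd n\<bar> + \<bar>t\<^sup>2 / 2 * ((B n)\<^sup>2 / (sd n)\<^sup>2 - 1)\<bar> + cmod (log_defect n t)"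
  proof (intro order_trans[OF norm_triangle_ineq] add_mono order.refl)
    show "cmod (- (\<i> * complex_of_real (t * A n / sd n))) \<le> \<bar>t * A n / sd n\<bar>"
      unfolding norm_minus_cancel norm_mult norm_of_real by simp
    show "cmod (complex_of_real (t\<^sup>2 / 2 * ((B n)\<^sup>2 / (sd n)\<^sup>2 - 1))) \<le> \<bar>t\<^sup>2 / 2 * ((B n)\<^sup>2 / (sd n)\<^sup>2 - 1)\<bar>"
      unfolding norm_of_real by simp
  qed
  also have "\<bar>t * A n / sd n\<bar> \<le> a * near_radius"
  proof -
    have "\<bar>t\<bar> / sd n \<le> near_radius" using nearD(2)[OF assms] sd by (simp add: field_simps)
    hence "\<bar>A n\<bar> * (\<bar>t\<bar> / sd n) \<le> a * near_radius" using A_bound[of n] sd a_b_nonneg by (intro mult_mono) auto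
    thus ?thesis using sd by (simp add: abs_mult mult.commute)
  qed
  also have "\<bar>t\<^sup>2 / 2 * ((B n)\<^sup>2 / (sd n)\<^sup>2 - 1)\<bar> \<le> t\<^sup>2 / 2 * (1 / 8)"
  proof -
    have "31 / 32 * (31 / 32) \<le> (7 / 8 :: real) + 1 / 8" by simp
    have r: "\<bar>(B n)\<^sup>2 / (sd n)\<^sup>2 - 1\<bar> \<le> 1 / 8"
    proof -
      have "32 * b \<le> sd n" using large by (simp add: large_def)
      hence "3 * b / sd n \<le> 1 / 8" using sd a_b_nonneg by (simp add: field_simps)
      thus ?thesis using large_bounds(8)[OF large] by linarith
    qed
    have "\<bar>t\<^sup>2 / 2 * ((B n)\<^sup>2 / (sd n)\<^sup>2 - 1)\<bar> = t\<^sup>2 / 2 * \<bar>(B n)\<^sup>2 / (sd n)\<^sup>2 - 1\<bar>" by (simp add: abs_mult)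
    also have "\<dots> \<le> t\<^sup>2 / 2 * (1 / 8)" by (intro mult_left_mono r) auto
    finally show ?thesis .
  qed
  also have "cmod (log_defect n t) \<le> 1 / 16 * t\<^sup>2"
  proof -
    have "cmod (log_defect n t) \<le> log_bound / sd n * \<bar>t\<bar> ^ 3"
      by (rule log_defect_le[OF large nearD(3)[OF assms]])
    also have "\<dots> = log_bound * (\<bar>t\<bar> / sd n) * t\<^sup>2" by (simp add: power3_eq_cube power2_eq_square)
    also have "\<dots> \<le> log_bound * near_radius * t\<^sup>2"
      using nearD(2)[OF assms] sd log_bound_pos by (intro mult_right_mono mult_left_mono) (auto simp: field_simps)
    also have "\<dots> \<le> 1 / 16 * t\<^sup>2" using near_radius by (intro mult_right_mono) auto
    finally show ?thesis .
  qed
  finally show ?thesis by simp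
qed

text \<open>Each piece has order at least 1: the shift because \<open>A\<close> is bounded, the
  change of scale because \<open>B n - sd n\<close> is bounded, and the Taylor terms because
  \<open>1 \<le> k - 2\<close>.\<close>

lemma phase_value_growth: "near.derivs_growth J 0 1 phase_value"
proof -
  define u where "u n t = - (\<i> * of_real (A n / sd n)) * of_real t ^ 1 + of_real (((B n)\<^sup>2 / (sd n)\<^sup>2 - 1) / 2) * of_real t ^ 2
     + (\<Sum>k\<in>{3..m}. deriv_log k n 0 / fact k * of_real t ^ k)" for n t
  have "near.derivs_growth J 0 1 u"
    unfolding u_def
  proof (intro near.derivs_growth_add near.derivs_growth_sum near.derivs_growth_monomial)
    fix n t assume t: "t \<in> near n"
    have sd: "1 \<le> sd n" by (rule near.scale_ge_1[OF t])
    have "\<bar>A n\<bar> / sd n \<le> a / sd n" using A_bound[of n] sd by (intro divide_right_mono) auto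
    thus "cmod (- (\<i> * complex_of_real (A n / sd n))) \<le> a / sd n ^ 1"
      using sd by (simp add: norm_mult norm_divide)
    have "cmod (complex_of_real (((B n)\<^sup>2 / (sd n)\<^sup>2 - 1) / 2)) = \<bar>(B n)\<^sup>2 / (sd n)\<^sup>2 - 1\<bar> / 2"
      unfolding norm_of_real by simp
    thus "cmod (complex_of_real (((B n)\<^sup>2 / (sd n)\<^sup>2 - 1) / 2)) \<le> (3 * b) / sd n ^ 1"
      using large_bounds(8)[OF nearD(1)[OF t]] by simp
  next
    fix k n t assume k: "k \<in> {3..m}" and t: "t \<in> near n"
    have sd: "1 \<le> sd n" by (rule near.scale_ge_1[OF t])
    have "cmod (deriv_log k n 0 / fact k) \<le> cmod (deriv_log k n 0) / 1"
      unfolding norm_divide by (intro divide_left_mono) (auto simp: norm_fact fact_ge_1)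
    also have "cmod (deriv_log k n 0) \<le> log_bound / sd n ^ (k - 2)"
      using k radius_pos sd by (intro deriv_log_le) auto
    also have "\<dots> \<le> log_bound / sd n ^ 1"
      using k sd log_bound_pos by (intro divide_left_mono power_increasing) auto
    finally show "cmod (deriv_log k n 0 / fact k) \<le> log_bound / sd n ^ 1" by simp
  qed simp
  also have "near.derivs_growth J 0 1 u \<longleftrightarrow> near.derivs_growth J 0 1 phase_value"
  proof (rule near.derivs_growth_cong)
    fix n t assume t: "t \<in> near n"
    show "u n t = phase_value n t"
      unfolding u_def phase_value_eq[OF nearD(1)[OF t]]
    proof (intro arg_cong2[of _ _ _ _ "(+)"] sum.cong refl)
      show "- (\<i> * complex_of_real (A n / sd n)) * complex_of_real t ^ 1 = - (\<i> * complex_of_real (t * A n / sd n))" by simp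
      show "complex_of_real (((B n)\<^sup>2 / (sd n)\<^sup>2 - 1) / 2) * complex_of_real t ^ 2 = complex_of_real (t\<^sup>2 / 2 * ((B n)\<^sup>2 / (sd n)\<^sup>2 - 1))"
        by (simp only: of_real_power[symmetric] of_real_mult[symmetric]) simp
    qed simp
  qed
  finally show ?thesis .
qed

lemma exponent_growth: "near.derivs_growth (m + 1) 0 1 exponent"
proof -
  have "near.derivs_growth (m + 1) 0 (m - 1) (taylor_remainder 0)"
    using taylor_remainder_growth[OF order.refl] by (simp only: diff_self_eq_0)
  hence "near.derivs_growth (m + 1) 0 1 (taylor_remainder 0)"
    by (rule near.derivs_growth_mono) (use m_ge_3 in auto)
  from near.derivs_growth_add[OF phase_value_growth this] show ?thesis
    unfolding exponent_def[abs_def] .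
qed

lemma prefactor_growth_aux:
  "large n \<Longrightarrow> \<bar>A n / sd n\<bar> \<le> a + 2" "large n \<Longrightarrow> \<bar>(B n)\<^sup>2 / (sd n)\<^sup>2\<bar> \<le> a + 2" "large n \<Longrightarrow> - ((B n)\<^sup>2 / (sd n)\<^sup>2) / 2 \<le> - 3 / 8"
proof -
  assume large: "large n"
  have sd: "1 \<le> sd n" by (rule large_bounds(1)[OF large])
  have "\<bar>A n\<bar> / sd n \<le> a / 1" using A_bound[of n] sd a_b_nonneg by (intro frac_le) auto
  thus "\<bar>A n / sd n\<bar> \<le> a + 2" using sd by simp
  show "\<bar>(B n)\<^sup>2 / (sd n)\<^sup>2\<bar> \<le> a + 2" using large_bounds(6,7)[OF large] a_b_nonneg by (simp only: abs_le_iff) linarith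
  show "- ((B n)\<^sup>2 / (sd n)\<^sup>2) / 2 \<le> - 3 / 8"
  proof -
    have "- x / 2 \<le> - 3 / 8" if "3 / 4 \<le> x" for x :: real using that by simp
    from this[OF large_bounds(6)[OF large]] show ?thesis .
  qed
qed

lemma prefactor_growth:
  "near.derivs_growth J (- 3 / 8) 0 prefactor" "everywhere.derivs_growth J (- 3 / 8) 0 prefactor"
proof -
  show "near.derivs_growth J (- 3 / 8) 0 prefactor"
    unfolding prefactor_def[abs_def]
    by (rule near.derivs_growth_exp_quadratic[where K = "a + 2"]) (intro prefactor_growth_aux, erule nearD(1))+
  have large: "t \<in> everywhere n \<Longrightarrow> large n" for t n by (auto simp: everywhere_def split: if_splits)
  show "everywhere.derivs_growth J (- 3 / 8) 0 prefactor"
    unfolding prefactor_def[abs_def]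
    by (rule everywhere.derivs_growth_exp_quadratic[where K = "a + 2"]) (intro prefactor_growth_aux, erule large)+
qed

lemma truncated_symbol_growth: "everywhere.derivs_growth J 0 0 truncated_symbol"
proof -
  have large: "t \<in> everywhere n \<Longrightarrow> large n" for t n by (auto simp: everywhere_def split: if_splits)
  obtain N K where NK: "\<And>n j. degree (symbol_coeff j n) \<le> N" "\<And>n j i. cmod (coeff (symbol_coeff j n) i) \<le> K"
    using symbol_coeff_bounded by metis
  show ?thesis
    unfolding truncated_symbol_def[abs_def]
    by (intro everywhere.derivs_growth_sum everywhere.derivs_growth_scaled_poly[OF NK] large_bounds large) auto
qed

text \<open>Three errors of order \<open>m - 1\<close> are added: the remainder of the exponential,
  the replacement of the exponent by the phase inside the truncated exponential, and the powers of
  \<open>1 / B n\<close> from \<open>m - 1\<close> on. The rate is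
  \<open>- 3 / 8 + 1 / 8\<close>.\<close>

theorem char_approximation:
  "near.derivs_growth (m + 1) (- 1 / 4) (m - 1) (\<lambda>n t. char (law n) t - prefactor n t * truncated_symbol n t)"
proof -
  obtain N K where NK: "\<And>n. degree (exp_phase m (params n)) \<le> N" "\<And>n j. degree (symbol_coeff j n) \<le> N"
    "\<And>n j i. cmod (coeff (symbol_coeff j n) i) \<le> K"
    using symbol_coeff_bounded by metis
  \<comment> \<open>The upper limit \<open>N + m\<close> is beyond the degree and lets the indices
    split at \<open>m - 1\<close> whatever \<open>N\<close> is.\<close>
  define tail where "tail n t = (\<Sum>j\<in>{m - 1..N + m}. poly (symbol_coeff j n) (\<i> * of_real (t * (B n / sd n))) * of_real (1 / B n) ^ j)" for n t
  have tail: "near.derivs_growth (m + 1) 0 (m - 1) tail"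
    unfolding tail_def[abs_def]
    by (intro near.derivs_growth_sum near.derivs_growth_scaled_poly[OF NK(2,3)] large_bounds nearD(1)) auto
  define diff where "diff n t = (\<Sum>l<m - 1. 1 / fact l * (exponent n t ^ l - phase_value n t ^ l))" for n t
  have diff: "near.derivs_growth (m + 1) 0 (m - 1) diff"
    unfolding diff_def[abs_def]
  proof (rule near.derivs_growth_sum)
    fix l
    have "near.derivs_growth (m + 1) 0 (m - 1) (\<lambda>n t. exponent n t - phase_value n t)"
      using taylor_remainder_growth[of "m + 1"] by (simp add: exponent_def)
    hence "near.derivs_growth (m + 1) 0 (m - 1) (\<lambda>n t. exponent n t ^ l - phase_value n t ^ l)"
      using near.derivs_growth_mono[OF exponent_growth, of 0 0] near.derivs_growth_mono[OF phase_value_growth, of 0 0]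
      by (intro near.derivs_growth_power_diff) auto
    moreover have const: "near.derivs_growth (m + 1) 0 0 (\<lambda>n t. 1 / fact l)"
      by (rule near.derivs_growth_const[where K = 1]) (auto simp: norm_divide norm_fact fact_ge_1)
    ultimately show "near.derivs_growth (m + 1) 0 (m - 1) (\<lambda>n t. 1 / fact l * (exponent n t ^ l - phase_value n t ^ l))"
      using near.derivs_growth_mult[OF const, of 0 "m - 1"] by (simp only: add_0)
  qed simp
  have rem: "near.derivs_growth (m + 1) (1 / 8) (m - 1) (\<lambda>n t. exp_remainder (m - 1) (exponent n t))"
    by (rule near.derivs_growth_exp_remainder[OF exponent_growth exponent_bound])
  have "near.derivs_growth (m + 1) (1 / 8) (m - 1) (\<lambda>n t. exp_remainder (m - 1) (exponent n t) + (diff n t + tail n t))"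
    by (intro near.derivs_growth_add rem near.derivs_growth_mono[OF diff] near.derivs_growth_mono[OF tail]) auto
  from near.derivs_growth_mult[OF prefactor_growth(1) this]
  have "near.derivs_growth (m + 1) (- 3 / 8 + 1 / 8) (0 + (m - 1)) (\<lambda>n t. prefactor n t * (exp_remainder (m - 1) (exponent n t) + (diff n t + tail n t)))" .
  moreover have "near.derivs_growth (m + 1) (- 1 / 4) (m - 1) (\<lambda>n t. prefactor n t * (exp_remainder (m - 1) (exponent n t) + (diff n t + tail n t)))
     \<longleftrightarrow> near.derivs_growth (m + 1) (- 1 / 4) (m - 1) (\<lambda>n t. char (law n) t - prefactor n t * truncated_symbol n t)"
  proof (rule near.derivs_growth_cong)
    fix n t assume t: "t \<in> near n"
    let ?z = "1 / complex_of_real (B n)" and ?s = "\<i> * complex_of_real (t * B n / sd n)"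
    have "(\<Sum>l<m - 1. phase_value n t ^ l / fact l) = eval2 (exp_phase m (params n)) ?z ?s"
      unfolding exp_phase_def phase_value_def eval2_sum eval2_simps by (intro sum.cong refl) simp
    also have "\<dots> = (\<Sum>j\<le>N + m. poly (symbol_coeff j n) ?s * ?z ^ j)"
      unfolding eval2_altdef symbol_coeff_def using NK(1)[of n]
      by (intro sum.mono_neutral_left) (auto simp: coeff_eq_0)
    also have "{..N + m} = {..<m - 1} \<union> {m - 1..N + m}" using m_ge_3 by auto
    also have "(\<Sum>j\<in>{..<m - 1} \<union> {m - 1..N + m}. poly (symbol_coeff j n) ?s * ?z ^ j) = truncated_symbol n t + tail n t"
      unfolding truncated_symbol_def tail_def by (subst sum.union_disjoint) auto
    finally have e: "(\<Sum>l<m - 1. phase_value n t ^ l / fact l) = truncated_symbol n t + tail n t" .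
    have d: "diff n t = (\<Sum>l<m - 1. exponent n t ^ l / fact l) - (\<Sum>l<m - 1. phase_value n t ^ l / fact l)"
      unfolding diff_def by (simp add: sum_subtractf[symmetric] diff_divide_distrib)
    have "exp_remainder (m - 1) (exponent n t) + (diff n t + tail n t) = exp (exponent n t) - truncated_symbol n t"
      unfolding d e exp_remainder_def by simp
    thus "prefactor n t * (exp_remainder (m - 1) (exponent n t) + (diff n t + tail n t)) = char (law n) t - prefactor n t * truncated_symbol n t"
      unfolding char_eq_exponent[OF t] by (simp add: right_diff_distrib)
  qed
  ultimately show ?thesis by simp
qed

end

section \<open>The expansion as a signed density\<close>

definition gaussian_ft :: "real poly \<Rightarrow> real \<Rightarrow> complex" where
  "gaussian_ft p t = (LINT x|lborel. of_real (std_normal_density x * poly p x) * iexp (t * x))"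

lemma gaussian_ft_add: "gaussian_ft (p + q) t = gaussian_ft p t + gaussian_ft q t"
proof -
  have "of_real (std_normal_density x * poly (p + q) x) * iexp (t * x)
     = of_real (std_normal_density x * poly p x) * iexp (t * x) + of_real (std_normal_density x * poly q x) * iexp (t * x)" for x
    by (simp add: algebra_simps)
  thus ?thesis unfolding gaussian_ft_def
    by (simp only: Bochner_Integration.integral_add[OF integrable_gaussian_poly_exp integrable_gaussian_poly_exp])
qed

lemma gaussian_ft_smult: "gaussian_ft (smult c p) t = of_real c * gaussian_ft p t"
proof -
  have "of_real (std_normal_density x * poly (smult c p) x) * iexp (t * x)
     = of_real c * (of_real (std_normal_density x * poly p x) * iexp (t * x))" for x
    by simp
  thus ?thesis unfolding gaussian_ft_def by (simp only: integral_mult_right_zero)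
qed

lemma gaussian_ft_sum: "gaussian_ft (\<Sum>a\<in>A. p a) t = (\<Sum>a\<in>A. gaussian_ft (p a) t)"
proof (induction A rule: infinite_finite_induct)
  case (insert x F)
  thus ?case by (simp add: gaussian_ft_add)
qed (auto simp: gaussian_ft_def)

lemma gaussian_ft_hermite: "gaussian_ft (hermite k) t = (\<i> * of_real t) ^ k * of_real (exp (- t\<^sup>2 / 2))"
  unfolding gaussian_ft_def by (rule fourier_hermite)

lemma hermite_combination_bound:
  fixes c :: "nat \<Rightarrow> real"
  assumes "\<And>k. \<bar>c k\<bar> \<le> K"
  shows "\<bar>coeff (\<Sum>k<N. smult (c k) (hermite (f k))) i\<bar> \<le> K * (\<Sum>k<N. \<Sum>i\<le>f k. \<bar>coeff (hermite (f k)) i\<bar>)"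
proof -
  have K: "0 \<le> K" using assms[of 0] by linarith
  have h: "\<bar>coeff (hermite k) i\<bar> \<le> (\<Sum>i\<le>k. \<bar>coeff (hermite k) i\<bar>)" for k
  proof (cases "i \<le> k")
    case True
    thus ?thesis by (intro member_le_sum) auto
  next
    case False
    hence "coeff (hermite k) i = 0" using degree_hermite[of k] by (intro coeff_eq_0) auto
    thus ?thesis by (simp add: sum_nonneg)
  qed
  have "\<bar>coeff (\<Sum>k<N. smult (c k) (hermite (f k))) i\<bar> \<le> (\<Sum>k<N. \<bar>c k * coeff (hermite (f k)) i\<bar>)"
    unfolding coeff_sum coeff_smult by (rule sum_abs)
  also have "\<dots> \<le> (\<Sum>k<N. K * (\<Sum>i\<le>f k. \<bar>coeff (hermite (f k)) i\<bar>))"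
    unfolding abs_mult using K by (intro sum_mono mult_mono assms h) auto
  finally show ?thesis by (simp add: sum_distrib_left)
qed

section \<open>The polynomials of the expansion and the transported density\<close>

context edgeworth_setting
begin

definition symbol_degree :: nat where
  "symbol_degree = (SOME N. \<forall>v j. degree (coeff (exp_phase m v) j) \<le> N)"

lemma symbol_degree: "degree (coeff (exp_phase m v) j) \<le> symbol_degree"
proof -
  have "\<exists>N. \<forall>v j. degree (coeff (exp_phase m v) j) \<le> N"
    using real_poly_family_exp_phase[of m] unfolding real_poly_family_def by blast
  from someI_ex[OF this, folded symbol_degree_def] show ?thesis by blast
qed

text \<open>The monomial \<open>(\<i> t)\<^bsup>k + 1\<^esup>\<close> of the symbol contributes \<open>\<phi> hermite (k + 1) = - (\<phi> hermite k)\<^sup>\<prime>\<close> to the density,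
  hence \<open>- \<phi> hermite k\<close> to the distribution function.\<close>

definition edgeworth_poly :: "nat \<Rightarrow> nat \<Rightarrow> real poly" where
  "edgeworth_poly j n = - (\<Sum>k<symbol_degree. smult (Re (coeff (symbol_coeff j n) (Suc k))) (hermite k))"

definition density_poly :: "nat \<Rightarrow> real poly" where
  "density_poly n = edgeworth_density_poly (m - 2) (B n) (\<lambda>j. edgeworth_poly j n)"

lemma symbol_coeff_real: "of_real (Re (coeff (symbol_coeff j n) i)) = coeff (symbol_coeff j n) i"
  using real_poly_family_exp_phase[of m] real_parameters_params[of n]
  unfolding real_poly_family_def symbol_coeff_def by (auto intro: of_real_Re)

lemma density_poly_eq:
  "density_poly n = 1 + (\<Sum>j = 1..m - 2. smult (1 / B n ^ j)
     (\<Sum>k<symbol_degree. smult (Re (coeff (symbol_coeff j n) (Suc k))) (hermite (Suc k))))"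
proof -
  \<comment> \<open>\<open>std_normal_density x * poly (L p) x\<close> is the derivative of
    \<open>std_normal_density x * poly p x\<close>. So \<open>L\<close> maps
    \<open>hermite k\<close> to \<open>- hermite (Suc k)\<close>, and the minus sign in
    \<open>edgeworth_poly\<close> disappears.\<close>
  define L :: "real poly \<Rightarrow> real poly" where "L p = pderiv p - [:0, 1:] * p" for p
  have L_add: "L (p + q) = L p + L q" for p q by (simp add: L_def pderiv_add algebra_simps)
  have L_smult: "L (smult c p) = smult c (L p)" for c p by (simp add: L_def pderiv_smult algebra_simps smult_diff_right)
  have L_0: "L 0 = 0" by (simp add: L_def)
  have L_sum: "L (\<Sum>a\<in>A. p a) = (\<Sum>a\<in>A. L (p a))" for p and A :: "nat set"
    by (induction A rule: infinite_finite_induct) (auto simp: L_0 L_add)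
  have L_minus: "L (- p) = - L p" for p by (simp add: L_def pderiv_minus)
  have L_hermite: "L (hermite k) = - hermite (Suc k)" for k by (simp add: L_def)
  have "density_poly n = 1 + L (\<Sum>j = 1..m - 2. smult (1 / B n ^ j) (edgeworth_poly j n))"
    by (simp add: density_poly_def edgeworth_density_poly_def edgeworth_correction_def L_def)
  thus ?thesis
    unfolding edgeworth_poly_def L_sum L_smult L_minus L_hermite by (simp add: sum_negf del: hermite.simps)
qed

text \<open>Each \<open>hermite (Suc k)\<close> has transform \<open>(\<i> * t) ^ Suc k\<close>
  times the Gaussian, so the symbol is recovered term by term. Its constant coefficient, absent from
  the sum, is 0 for \<open>1 \<le> j\<close>, and the summand 1 accounts for
  \<open>j = 0\<close>.\<close>

lemma gaussian_ft_density_poly: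
  "gaussian_ft (density_poly n) t
     = of_real (exp (- t\<^sup>2 / 2)) * (\<Sum>j<m - 1. poly (symbol_coeff j n) (\<i> * of_real t) * of_real (1 / B n) ^ j)"
proof -
  let ?s = "\<i> * complex_of_real t" and ?e = "complex_of_real (exp (- t\<^sup>2 / 2))"
  have summand: "gaussian_ft (smult (1 / B n ^ j) (\<Sum>k<symbol_degree. smult (Re (coeff (symbol_coeff j n) (Suc k))) (hermite (Suc k)))) t
     = ?e * (poly (symbol_coeff j n) ?s * of_real (1 / B n) ^ j)" if "1 \<le> j" for j
  proof -
    have c0: "coeff (symbol_coeff j n) 0 = 0"
      unfolding symbol_coeff_def using that by (intro exp_phase_coeff_coeff_0) auto
    have "poly (symbol_coeff j n) ?s = (\<Sum>i<Suc symbol_degree. coeff (symbol_coeff j n) i * ?s ^ i)"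
      unfolding poly_altdef using symbol_degree[of "params n" j]
      by (intro sum.mono_neutral_left) (auto simp: coeff_eq_0 symbol_coeff_def)
    also have "\<dots> = (\<Sum>k<symbol_degree. coeff (symbol_coeff j n) (Suc k) * ?s ^ Suc k)"
      unfolding sum.lessThan_Suc_shift by (simp add: c0)
    finally have p: "poly (symbol_coeff j n) ?s = (\<Sum>k<symbol_degree. coeff (symbol_coeff j n) (Suc k) * ?s ^ Suc k)" .
    have "gaussian_ft (smult (1 / B n ^ j) (\<Sum>k<symbol_degree. smult (Re (coeff (symbol_coeff j n) (Suc k))) (hermite (Suc k)))) t
      = of_real (1 / B n ^ j) * (\<Sum>k<symbol_degree. coeff (symbol_coeff j n) (Suc k) * (?s ^ Suc k * ?e))"
      unfolding gaussian_ft_smult gaussian_ft_sum gaussian_ft_hermite symbol_coeff_real ..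
    also have "\<dots> = ?e * (poly (symbol_coeff j n) ?s * of_real (1 / B n) ^ j)"
    proof -
      have "(\<Sum>k<symbol_degree. coeff (symbol_coeff j n) (Suc k) * (?s ^ Suc k * ?e)) = poly (symbol_coeff j n) ?s * ?e"
        unfolding p sum_distrib_right by (simp only: mult.assoc)
      moreover have "complex_of_real (1 / B n ^ j) = of_real (1 / B n) ^ j" by (simp add: power_divide)
      ultimately show ?thesis by (simp only: mult_ac)
    qed
    finally show ?thesis .
  qed
  have zero: "gaussian_ft 1 t = ?e * (poly (symbol_coeff 0 n) ?s * of_real (1 / B n) ^ 0)"
  proof -
    have "symbol_coeff 0 n = 1" unfolding symbol_coeff_def using m_ge_3 by (intro exp_phase_coeff_0) auto
    thus ?thesis using gaussian_ft_hermite[of 0 t] by simp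
  qed
  have "gaussian_ft (density_poly n) t = ?e * (poly (symbol_coeff 0 n) ?s * of_real (1 / B n) ^ 0)
     + (\<Sum>j = 1..m - 2. ?e * (poly (symbol_coeff j n) ?s * of_real (1 / B n) ^ j))"
    unfolding density_poly_eq gaussian_ft_add gaussian_ft_sum zero using summand by simp
  also have "\<dots> = (\<Sum>j\<in>insert 0 {1..m - 2}. ?e * (poly (symbol_coeff j n) ?s * of_real (1 / B n) ^ j))"
    by simp
  also have "insert 0 {1..m - 2} = {..<m - 1}" using m_ge_3 by auto
  finally show ?thesis by (simp add: sum_distrib_left)
qed

text \<open>The expansion approximates the law of \<open>W\<close>, whereas \<open>law n\<close> is
  that of \<open>S n / sd n\<close>, its image under
  \<open>x \<mapsto> A n / sd n + B n / sd n * x\<close>. The density is pushed forward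
  accordingly.\<close>

definition pdf :: "nat \<Rightarrow> real \<Rightarrow> real" where
  "pdf n y = sd n / B n * (std_normal_density ((sd n * y - A n) / B n) * poly (density_poly n) ((sd n * y - A n) / B n))"

lemma pdf_measurable [measurable]: "pdf n \<in> borel_measurable borel"
  unfolding pdf_def by measurable

lemma pdf_affine:
  assumes "large n"
  shows "B n / sd n * pdf n (A n / sd n + B n / sd n * x) = std_normal_density x * poly (density_poly n) x"
proof -
  have "sd n \<noteq> 0" "B n \<noteq> 0" using large_bounds(1,2)[OF assms] by auto
  moreover from this have "(sd n * (A n / sd n + B n / sd n * x) - A n) / B n = x" by (simp add: field_simps)
  ultimately show ?thesis unfolding pdf_def by simp
qed

lemma pdf_substitution:
  fixes h :: "real \<Rightarrow> 'b :: {banach, second_countable_topology}"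
  assumes "large n"
  shows "(LINT y|lborel. pdf n y *\<^sub>R h y)
     = (LINT x|lborel. (std_normal_density x * poly (density_poly n) x) *\<^sub>R h (A n / sd n + B n / sd n * x))"
proof -
  have pos: "0 < B n / sd n" using large_bounds(1,2)[OF assms] by simp
  have "(LINT y|lborel. pdf n y *\<^sub>R h y)
    = \<bar>B n / sd n\<bar> *\<^sub>R (LINT x|lborel. pdf n (A n / sd n + B n / sd n * x) *\<^sub>R h (A n / sd n + B n / sd n * x))"
    by (rule lborel_integral_real_affine) (use pos in linarith)
  also have "\<dots> = (LINT x|lborel. (B n / sd n) *\<^sub>R (pdf n (A n / sd n + B n / sd n * x) *\<^sub>R h (A n / sd n + B n / sd n * x)))"
    unfolding abs_of_pos[OF pos] by (rule integral_scaleR_right[symmetric])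
  also have "\<dots> = (LINT x|lborel. (std_normal_density x * poly (density_poly n) x) *\<^sub>R h (A n / sd n + B n / sd n * x))"
    unfolding scaleR_scaleR pdf_affine[OF assms] ..
  finally show ?thesis .
qed

text \<open>Under the affine change the shift becomes a phase and the scale acts on the frequency;
  together with the Gaussian they form exactly \<open>prefactor\<close>.\<close>

lemma weighted_ft_pdf:
  assumes "large n"
  shows "weighted_ft lborel (pdf n) 0 t = prefactor n t * truncated_symbol n t"
proof -
  let ?\<rho> = "B n / sd n"
  have "weighted_ft lborel (pdf n) 0 t = (LINT y|lborel. pdf n y *\<^sub>R iexp (t * y))"
    unfolding weighted_ft_def by (simp add: scaleR_conv_of_real)
  also have "\<dots> = (LINT x|lborel. (std_normal_density x * poly (density_poly n) x) *\<^sub>R iexp (t * (A n / sd n + ?\<rho> * x)))"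
    by (rule pdf_substitution[OF assms])
  also have "\<dots> = (LINT x|lborel. iexp (A n / sd n * t) * (of_real (std_normal_density x * poly (density_poly n) x) * iexp (?\<rho> * t * x)))"
  proof (intro Bochner_Integration.integral_cong refl)
    fix x
    have "iexp (t * (A n / sd n + ?\<rho> * x)) = iexp (A n / sd n * t) * iexp (?\<rho> * t * x)"
      unfolding exp_add[symmetric] distrib_left[symmetric] of_real_add[symmetric]
      by (simp add: algebra_simps)
    thus "(std_normal_density x * poly (density_poly n) x) *\<^sub>R iexp (t * (A n / sd n + ?\<rho> * x))
       = iexp (A n / sd n * t) * (of_real (std_normal_density x * poly (density_poly n) x) * iexp (?\<rho> * t * x))"
      by (simp only: scaleR_conv_of_real mult_ac)
  qed
  also have "\<dots> = iexp (A n / sd n * t) * gaussian_ft (density_poly n) (?\<rho> * t)"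
    unfolding gaussian_ft_def by (rule integral_mult_right_zero)
  also have "\<dots> = (iexp (A n / sd n * t) * of_real (exp (- (?\<rho> * t)\<^sup>2 / 2))) * truncated_symbol n t"
    unfolding gaussian_ft_density_poly truncated_symbol_def by (simp only: mult.assoc mult.commute[of t])
  also have "iexp (A n / sd n * t) * of_real (exp (- (?\<rho> * t)\<^sup>2 / 2)) = prefactor n t"
  proof -
    have "- (?\<rho> * t)\<^sup>2 / 2 = - ((B n)\<^sup>2 / (sd n)\<^sup>2 * t\<^sup>2 / 2)" by (simp add: power_mult_distrib power_divide)
    thus ?thesis unfolding prefactor_def
      by (simp only: exp_of_real[symmetric] exp_add[symmetric] of_real_minus diff_conv_add_uminus)
  qed
  finally show ?thesis .
qed

lemma truncated_symbol_0: "truncated_symbol n 0 = 1"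
proof -
  have "poly (symbol_coeff j n) 0 = (if j = 0 then 1 else 0)" for j
  proof (cases "j = 0")
    case True
    have "symbol_coeff 0 n = 1" unfolding symbol_coeff_def using m_ge_3 by (intro exp_phase_coeff_0) auto
    thus ?thesis using True by simp
  next
    case False
    hence "coeff (symbol_coeff j n) 0 = 0" unfolding symbol_coeff_def by (intro exp_phase_coeff_coeff_0) auto
    thus ?thesis using False by (simp add: poly_0_coeff_0)
  qed
  hence "truncated_symbol n 0 = (\<Sum>j<m - 1. if j = 0 then 1 else 0)"
    unfolding truncated_symbol_def by (intro sum.cong) auto
  also have "\<dots> = 1" using m_ge_3 by simp
  finally show ?thesis .
qed

lemma density_poly_bounded:
  obtains N K where "\<And>n. degree (density_poly n) \<le> N" "\<And>n i. large n \<Longrightarrow> \<bar>coeff (density_poly n) i\<bar> \<le> K"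
proof -
  have "\<exists>K. \<forall>n j i. cmod (coeff (symbol_coeff j n) i) \<le> K"
    by (rule symbol_coeff_bounded) blast
  then obtain K where NK: "\<And>n j i. cmod (coeff (symbol_coeff j n) i) \<le> K"
    by blast
  define Z where "Z = K * (\<Sum>k<symbol_degree. \<Sum>i\<le>Suc k. \<bar>coeff (hermite (Suc k)) i\<bar>)"
  have Re: "\<bar>Re (coeff (symbol_coeff j n) i)\<bar> \<le> K" for j n i
    by (rule order_trans[OF abs_Re_le_cmod NK])
  show ?thesis
  proof (rule that[of symbol_degree "1 + (\<Sum>j = 1..m - 2. 2 ^ j * Z)"])
    show "degree (density_poly n) \<le> symbol_degree" for n
      unfolding density_poly_eq
    proof (rule degree_add_le[OF _ degree_sum_le])
      fix j
      have "degree (\<Sum>k<symbol_degree. smult (Re (coeff (symbol_coeff j n) (Suc k))) (hermite (Suc k))) \<le> symbol_degree"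
      proof (rule degree_sum_le)
        fix k assume "k \<in> {..<symbol_degree}"
        thus "degree (smult (Re (coeff (symbol_coeff j n) (Suc k))) (hermite (Suc k))) \<le> symbol_degree"
          by (intro order_trans[OF degree_smult_le order_trans[OF degree_hermite]]) simp
      qed simp
      thus "degree (smult (1 / B n ^ j) (\<Sum>k<symbol_degree. smult (Re (coeff (symbol_coeff j n) (Suc k))) (hermite (Suc k)))) \<le> symbol_degree"
        by (rule order_trans[OF degree_smult_le])
    qed auto
    fix n i assume large: "large n"
    have "2 / sd n \<le> 2 / 1" using large_bounds(1)[OF large] by (intro divide_left_mono) auto
    hence z: "\<bar>1 / B n\<bar> \<le> 2" using large_bounds(5)[OF large] by linarith
    define T where "T j = 1 / B n ^ j * coeff (\<Sum>k<symbol_degree. smult (Re (coeff (symbol_coeff j n) (Suc k))) (hermite (Suc k))) i" for j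
    have T: "\<bar>T j\<bar> \<le> 2 ^ j * Z" for j
    proof -
      have "\<bar>1 / B n ^ j\<bar> = \<bar>1 / B n\<bar> ^ j" by (simp only: power_abs[symmetric] power_divide power_one)
      also have "\<dots> \<le> 2 ^ j" using z by (intro power_mono) auto
      finally have "\<bar>1 / B n ^ j\<bar> \<le> 2 ^ j" .
      moreover have "\<bar>coeff (\<Sum>k<symbol_degree. smult (Re (coeff (symbol_coeff j n) (Suc k))) (hermite (Suc k))) i\<bar> \<le> Z"
        unfolding Z_def by (rule hermite_combination_bound[where c = "\<lambda>k. Re (coeff (symbol_coeff j n) (Suc k))" and f = Suc]) (rule Re)
      ultimately show ?thesis unfolding T_def abs_mult by (rule mult_mono) simp_all
    qed
    have "coeff (density_poly n) i = coeff 1 i + (\<Sum>j = 1..m - 2. T j)"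
      unfolding density_poly_eq coeff_add T_def by (subst coeff_sum) (simp only: coeff_smult)
    moreover have "\<bar>\<Sum>j = 1..m - 2. T j\<bar> \<le> (\<Sum>j = 1..m - 2. 2 ^ j * Z)"
      by (rule order_trans[OF sum_abs sum_mono]) (rule T)
    moreover have "\<bar>coeff (1 :: real poly) i\<bar> \<le> 1" by (cases i) simp_all
    ultimately show "\<bar>coeff (density_poly n) i\<bar> \<le> 1 + (\<Sum>j = 1..m - 2. 2 ^ j * Z)" by linarith
  qed
qed

text \<open>The weights before and after the affine map are comparable with constants free of
  \<open>n\<close>, so weighted bounds transfer both ways.\<close>

lemma affine_weight_le:
  assumes "large n"
  shows "1 + \<bar>A n / sd n + B n / sd n * x\<bar> \<le> (2 + a) * (1 + \<bar>x\<bar>)"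
    and "1 + \<bar>x\<bar> \<le> (2 + 2 * a) * (1 + \<bar>A n / sd n + B n / sd n * x\<bar>)"
proof -
  have sd: "1 \<le> sd n" and B: "0 < B n" using large_bounds[OF assms] by auto
  have An: "\<bar>A n / sd n\<bar> \<le> a"
  proof -
    have "\<bar>A n\<bar> / sd n \<le> a / 1" using A_bound[of n] sd a_b_nonneg by (intro frac_le) auto
    thus ?thesis using sd by simp
  qed
  have r: "31 / 32 \<le> B n / sd n" "B n / sd n \<le> 2"
    using large_bounds(3,4)[OF assms] by (simp_all only: abs_le_iff) linarith+
  define \<rho> where "\<rho> = B n / sd n"
  define \<alpha> where "\<alpha> = A n / sd n"
  note folds = \<rho>_def[symmetric] \<alpha>_def[symmetric]
  have r: "31 / 32 \<le> \<rho>" "\<rho> \<le> 2" "\<bar>\<alpha>\<bar> \<le> a" using r An by (auto simp: folds)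
  have "\<bar>\<rho> * x\<bar> \<le> 2 * \<bar>x\<bar>" using r by (simp add: abs_mult mult_right_mono)
  hence "1 + \<bar>\<alpha> + \<rho> * x\<bar> \<le> 1 + a + 2 * \<bar>x\<bar>" using r by linarith
  also have "\<dots> \<le> (2 + a) * (1 + \<bar>x\<bar>)" using a_b_nonneg by (simp add: algebra_simps)
  finally show "1 + \<bar>A n / sd n + B n / sd n * x\<bar> \<le> (2 + a) * (1 + \<bar>x\<bar>)" by (simp only: folds)
  define y where "y = \<alpha> + \<rho> * x"
  have "31 / 32 * \<bar>x\<bar> \<le> \<rho> * \<bar>x\<bar>" using r by (intro mult_right_mono) auto
  also have "\<dots> = \<bar>y - \<alpha>\<bar>" using r by (simp add: y_def abs_mult)
  also have "\<dots> \<le> \<bar>y\<bar> + a" using r by linarith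
  finally have "31 / 32 * \<bar>x\<bar> \<le> \<bar>y\<bar> + a" .
  have "1 + \<bar>x\<bar> \<le> 1 + 2 * (\<bar>y\<bar> + a)"
  proof -
    have "1 + X \<le> 1 + 2 * (Y + c)" if "31 / 32 * X \<le> Y + c" "0 \<le> X" "0 \<le> Y" "0 \<le> c" for X Y c :: real
    proof -
      have "X \<le> 2 * (31 / 32 * X)" using that(2) by simp
      also have "\<dots> \<le> 2 * (Y + c)" by (rule mult_left_mono[OF that(1)]) simp
      finally show ?thesis by simp
    qed
    from this[OF \<open>31 / 32 * \<bar>x\<bar> \<le> \<bar>y\<bar> + a\<close> abs_ge_zero abs_ge_zero a_b_nonneg(1)] show ?thesis .
  qed
  also have "\<dots> \<le> (2 + 2 * a) * (1 + \<bar>y\<bar>)" using a_b_nonneg by (simp add: algebra_simps)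
  finally show "1 + \<bar>x\<bar> \<le> (2 + 2 * a) * (1 + \<bar>A n / sd n + B n / sd n * x\<bar>)" by (simp only: y_def folds)
qed

lemma cdf_approximation_law:
  obtains L where "0 < L" "\<And>n. large n \<Longrightarrow> cdf_approximation (law n) (pdf n) m L"
proof -
  obtain N K where NK: "\<And>n. degree (density_poly n) \<le> N" "\<And>n i. large n \<Longrightarrow> \<bar>coeff (density_poly n) i\<bar> \<le> K"
    using density_poly_bounded by metis
  \<comment> \<open>Two powers beyond \<open>m\<close> make the density times
    \<open>(1 + \<bar>x\<bar>) ^ m\<close> integrable.\<close>
  obtain L where L: "0 < L" and L_bound: "\<forall>p. degree p \<le> N \<longrightarrow> (\<forall>i. \<bar>coeff p i\<bar> \<le> K) \<longrightarrow>
     (\<forall>x. \<bar>std_normal_density x * poly p x\<bar> * (1 + \<bar>x\<bar>) ^ (m + 2) \<le> L)"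
    using gaussian_poly_bounded[of N K "m + 2"] by blast
  define L' where "L' = 2 * (2 + a) ^ (m + 2) * L"
  have decay: "\<bar>pdf n y\<bar> * (1 + \<bar>y\<bar>) ^ (m + 2) \<le> L'" if large: "large n" for n y
  proof -
    define x where "x = (sd n * y - A n) / B n"
    have sd: "1 \<le> sd n" and B: "0 < B n" using large_bounds[OF large] by auto
    have y: "y = A n / sd n + B n / sd n * x" using sd B by (simp add: x_def field_simps)
    have "\<bar>sd n / B n\<bar> \<le> 2"
    proof -
      have "\<bar>1 / B n\<bar> * sd n \<le> 2 / sd n * sd n" using large_bounds(5)[OF large] sd by (intro mult_right_mono) auto
      thus ?thesis using sd B by simp
    qed
    hence "\<bar>pdf n y\<bar> \<le> 2 * \<bar>std_normal_density x * poly (density_poly n) x\<bar>"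
      unfolding pdf_def x_def[symmetric] by (subst abs_mult) (intro mult_right_mono, auto)
    moreover have "(1 + \<bar>y\<bar>) ^ (m + 2) \<le> ((2 + a) * (1 + \<bar>x\<bar>)) ^ (m + 2)"
      unfolding y using affine_weight_le(1)[OF large] by (intro power_mono) auto
    ultimately have "\<bar>pdf n y\<bar> * (1 + \<bar>y\<bar>) ^ (m + 2)
       \<le> (2 * \<bar>std_normal_density x * poly (density_poly n) x\<bar>) * ((2 + a) * (1 + \<bar>x\<bar>)) ^ (m + 2)"
      by (intro mult_mono) auto
    also have "\<dots> = 2 * (2 + a) ^ (m + 2) * (\<bar>std_normal_density x * poly (density_poly n) x\<bar> * (1 + \<bar>x\<bar>) ^ (m + 2))"
      by (simp only: power_mult_distrib mult_ac)
    also have "\<dots> \<le> L'"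
    proof -
      have "\<bar>std_normal_density x * poly (density_poly n) x\<bar> * (1 + \<bar>x\<bar>) ^ (m + 2) \<le> L"
        using L_bound NK(1)[of n] NK(2)[OF large] by blast
      thus ?thesis unfolding L'_def using a_b_nonneg by (intro mult_left_mono) auto
    qed
    finally show ?thesis .
  qed
  have L'pos: "0 < L'" using L a_b_nonneg by (simp add: L'_def)
  show ?thesis
  proof (rule that[OF L'pos])
    fix n assume large: "large n"
    have sd: "0 < sd n" using large_bounds(1)[OF large] by simp
    interpret w: weighted_measure "law n" "\<lambda>_. 1" m
      by (rule law.weighted_measure_moment[OF moment_law[OF sd]])
    have int: "integrable lborel (\<lambda>x. pdf n x * (1 + \<bar>x\<bar>) ^ m)"
    proof (rule integrable_of_quadratic_decay[where L = L'])
      fix x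
      have "norm (pdf n x * (1 + \<bar>x\<bar>) ^ m) * (1 + \<bar>x\<bar>)\<^sup>2 = \<bar>pdf n x\<bar> * ((1 + \<bar>x\<bar>) ^ m * (1 + \<bar>x\<bar>)\<^sup>2)"
        by (simp add: abs_mult)
      also have "\<dots> = \<bar>pdf n x\<bar> * (1 + \<bar>x\<bar>) ^ (m + 2)" by (simp only: power_add)
      also have "\<dots> \<le> L'" by (rule decay[OF large])
      finally show "norm (pdf n x * (1 + \<bar>x\<bar>) ^ m) * (1 + \<bar>x\<bar>)\<^sup>2 \<le> L'" .
    qed measurable
    interpret d: weighted_measure lborel "pdf n" m
      by unfold_locales (use int in auto)
    show "cdf_approximation (law n) (pdf n) m L'"
    proof unfold_locales
      show "1 \<le> m" using m_ge_3 by simp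
      show "\<bar>pdf n x\<bar> * (1 + \<bar>x\<bar>) ^ m \<le> L'" for x
      proof -
        have "\<bar>pdf n x\<bar> * (1 + \<bar>x\<bar>) ^ m \<le> \<bar>pdf n x\<bar> * (1 + \<bar>x\<bar>) ^ (m + 2)"
          by (intro mult_left_mono power_increasing) auto
        thus ?thesis using decay[OF large, of x] by linarith
      qed
      \<comment> \<open>The total mass is the transform at frequency 0, where prefactor and symbol
        are both 1.\<close>
      have "of_real (LINT x|lborel. pdf n x) = weighted_ft lborel (pdf n) 0 0"
        by (simp add: weighted_ft_def)
      also have "\<dots> = 1" unfolding weighted_ft_pdf[OF large] truncated_symbol_0 by (simp add: prefactor_def)
      finally show "(LINT x|lborel. pdf n x) = 1" using of_real_eq_1_iff by blast
    qed
  qed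
qed

lemma discrepancy_eq:
  assumes "large n"
  shows "cdf_approximation.discrepancy (law n) (pdf n) (A n / sd n + B n / sd n * x)
     = measure M {\<omega> \<in> space M. (S n \<omega> - A n) / B n \<le> x} - edgeworth (m - 2) (B n) (\<lambda>j. edgeworth_poly j n) x"
proof -
  obtain L where "cdf_approximation (law n) (pdf n) m L" using cdf_approximation_law assms by metis
  then interpret cdf_approximation "law n" "pdf n" m L .
  have sd: "1 \<le> sd n" and B: "0 < B n" using large_bounds[OF assms] by auto
  have "measure (law n) {..A n / sd n + B n / sd n * x} = measure M ((\<lambda>\<omega>. S n \<omega> / sd n) -` {..A n / sd n + B n / sd n * x} \<inter> space M)"
    unfolding law_def by (subst measure_distr) auto
  also have "(\<lambda>\<omega>. S n \<omega> / sd n) -` {..A n / sd n + B n / sd n * x} \<inter> space M = {\<omega> \<in> space M. (S n \<omega> - A n) / B n \<le> x}"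
  proof -
    have "S n \<omega> / sd n \<le> A n / sd n + B n / sd n * x \<longleftrightarrow> (S n \<omega> - A n) / B n \<le> x" for \<omega>
      using sd B by (auto simp: field_simps)
    thus ?thesis by auto
  qed
  finally have F: "measure (law n) {..A n / sd n + B n / sd n * x} = measure M {\<omega> \<in> space M. (S n \<omega> - A n) / B n \<le> x}" .
  have "(LBINT t:{..A n / sd n + B n / sd n * x}. pdf n t)
      = (LINT t|lborel. pdf n t *\<^sub>R (indicator {..A n / sd n + B n / sd n * x} t :: real))"
    unfolding set_lebesgue_integral_def by (simp only: real_scaleR_def mult.commute)
  also have "\<dots> = (LINT u|lborel. (std_normal_density u * poly (density_poly n) u) *\<^sub>R indicator {..A n / sd n + B n / sd n * x} (A n / sd n + B n / sd n * u))"
    by (rule pdf_substitution[OF assms])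
  also have "\<dots> = (LBINT u:{..x}. std_normal_density u * poly (density_poly n) u)"
  proof -
    have "indicator {..A n / sd n + B n / sd n * x} (A n / sd n + B n / sd n * u) = (indicator {..x} u :: real)" for u
    proof -
      have "B n / sd n * u \<le> B n / sd n * x \<longleftrightarrow> u \<le> x" using sd B by (intro mult_le_cancel_left_pos) simp
      thus ?thesis by (simp add: indicator_def)
    qed
    thus ?thesis unfolding set_lebesgue_integral_def by (simp only: real_scaleR_def mult.commute)
  qed
  also have "\<dots> = edgeworth (m - 2) (B n) (\<lambda>j. edgeworth_poly j n) x"
    unfolding density_poly_def by (rule edgeworth_eq_integral[symmetric])
  finally show ?thesis unfolding discrepancy_def F by simp
qed

end

section \<open>Smoothing at the scale of the expansion\<close>

lemma derivative_chain_factor: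
  assumes "\<And>j. j < J \<Longrightarrow> (U j has_vector_derivative \<i> * U (Suc j) t) (at t)" "j < J"
  shows "((\<lambda>t. \<i> ^ j * U j t) has_vector_derivative \<i> ^ Suc j * U (Suc j) t) (at t)"
  using has_vector_derivative_mult_right[OF assms(1)[OF assms(2)], of "\<i> ^ j"] by (simp add: mult_ac)

lemma (in weighted_measure) nth_vderiv_weighted_ft:
  "k \<le> m \<Longrightarrow> nth_vderiv k (weighted_ft N w 0) t = \<i> ^ k * weighted_ft N w k t"
proof (induction k arbitrary: t)
  case (Suc k)
  have "nth_vderiv k (weighted_ft N w 0) = (\<lambda>t. \<i> ^ k * weighted_ft N w k t)" using Suc by auto
  hence "nth_vderiv (Suc k) (weighted_ft N w 0) t = vector_derivative (\<lambda>t. \<i> ^ k * weighted_ft N w k t) (at t)"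
    by (simp add: nth_vderiv_def)
  also have "\<dots> = \<i> ^ Suc k * weighted_ft N w (Suc k) t"
    using Suc.prems by (intro vector_derivative_at derivative_chain_factor[where J = m] weighted_ft_has_vector_derivative) auto
  finally show ?case .
qed simp

lemma integral_inverse_square_le:
  fixes a T :: real
  assumes "0 < a" "a \<le> T"
  shows "set_integrable lborel {a..T} (\<lambda>t. 1 / t\<^sup>2)" "(LBINT t:{a..T}. 1 / t\<^sup>2) \<le> 1 / a"
proof -
  have c: "continuous_on {a..T} (\<lambda>t. 1 / t\<^sup>2)" using assms by (auto intro!: continuous_intros)
  show "set_integrable lborel {a..T} (\<lambda>t. 1 / t\<^sup>2)" by (rule borel_integrable_atLeastAtMost'[OF c])
  have "(LINT t|lborel. indicator {a..T} t *\<^sub>R (1 / t\<^sup>2)) = - (1 / T) - - (1 / a)"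
  proof (rule integral_FTC_atLeastAtMost[OF assms(2) _ c])
    fix t assume "a \<le> t" "t \<le> T"
    thus "((\<lambda>t. - (1 / t)) has_vector_derivative 1 / t\<^sup>2) (at t within {a..T})"
      unfolding has_real_derivative_iff_has_vector_derivative[symmetric]
      using assms by (auto intro!: derivative_eq_intros simp: power2_eq_square)
  qed
  thus "(LBINT t:{a..T}. 1 / t\<^sup>2) \<le> 1 / a" using assms by (simp add: set_lebesgue_integral_def)
qed

context edgeworth_setting
begin

abbreviation "U n \<equiv> cdf_approximation.ft_difference (law n) (pdf n)"

lemma cdf_approximation_law_ex: "large n \<Longrightarrow> \<exists>L. cdf_approximation (law n) (pdf n) m L"
  using cdf_approximation_law by metis

lemma U_def: "large n \<Longrightarrow> U n k t = weighted_ft (law n) (\<lambda>_. 1) k t - weighted_ft lborel (pdf n) k t"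
proof -
  assume "large n"
  then obtain L where "cdf_approximation (law n) (pdf n) m L" using cdf_approximation_law_ex by blast
  then interpret cdf_approximation "law n" "pdf n" m L .
  show ?thesis by (rule ft_difference_def)
qed

lemma U_has_vector_derivative:
  assumes "large n" "k < m"
  shows "(U n k has_vector_derivative \<i> * U n (Suc k) t) (at t)"
proof -
  obtain L where "cdf_approximation (law n) (pdf n) m L" using cdf_approximation_law_ex[OF assms(1)] by blast
  then interpret cdf_approximation "law n" "pdf n" m L .
  show ?thesis by (rule ft_difference_has_vector_derivative[OF assms(2)])
qed

lemma weighted_ft_pdf_has_vector_derivative:
  assumes "large n" "k < m"
  shows "(weighted_ft lborel (pdf n) k has_vector_derivative \<i> * weighted_ft lborel (pdf n) (Suc k) t) (at t)"
proof -
  obtain L where "cdf_approximation (law n) (pdf n) m L" using cdf_approximation_law_ex[OF assms(1)] by blast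
  then interpret cdf_approximation "law n" "pdf n" m L .
  show ?thesis using assms(2) by (intro dens.weighted_ft_has_vector_derivative) auto
qed

lemma weighted_ft_law_0: "weighted_ft (law n) (\<lambda>_. 1) 0 = char (law n)"
  by (simp add: weighted_ft_def char_def fun_eq_iff)

lemma U_derivs_growth:
  assumes "k \<le> m"
  shows "near.derivs_growth (m + 1 - k) (- 1 / 4) (m - 1) (\<lambda>n t. \<i> ^ k * U n k t)"
proof -
  have "near.derivs_growth (k + (m + 1 - k)) (- 1 / 4) (m - 1) (\<lambda>n t. char (law n) t - prefactor n t * truncated_symbol n t)"
    using char_approximation assms by simp
  thus ?thesis
  proof (rule near.derivs_growth_chain[where U = "\<lambda>k n t. \<i> ^ k * U n k t"])
    fix n t assume "t \<in> near n"
    hence large: "large n" by (rule nearD(1))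
    show "char (law n) t - prefactor n t * truncated_symbol n t = \<i> ^ 0 * U n 0 t"
      by (simp add: U_def[OF large] weighted_ft_law_0 weighted_ft_pdf[OF large])
    fix j assume "j < k"
    thus "((\<lambda>t. \<i> ^ j * U n j t) has_vector_derivative \<i> ^ Suc j * U n (Suc j) t) (at t)"
      using assms by (intro derivative_chain_factor[where J = m] U_has_vector_derivative large) auto
  qed
qed

text \<open>Gaussian decay beats the untracked powers of \<open>1 + \<bar>t\<bar>\<close>. The two
  powers retained later give the integrable decay \<open>1 / t\<^sup>2\<close>.\<close>

lemma U_bound:
  obtains K where "0 < K" "\<And>n t k. t \<in> near n \<Longrightarrow> k \<le> m \<Longrightarrow> cmod (U n k t) * (1 + \<bar>t\<bar>)\<^sup>2 \<le> K / sd n ^ (m - 1)"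
proof -
  have "\<exists>K. \<forall>n. \<forall>t\<in>near n. cmod (U n k t) * (1 + \<bar>t\<bar>)\<^sup>2 \<le> K / sd n ^ (m - 1)" if "k \<le> m" for k
  proof -
    have "near.growth (- 1 / 4) (m - 1) (\<lambda>n t. \<i> ^ k * U n k t)"
      by (rule near.derivs_growth_0[OF U_derivs_growth[OF that]])
    then obtain K N where K: "0 \<le> K" and le [rule_format]: "\<forall>n. \<forall>t\<in>near n. cmod (\<i> ^ k * U n k t) \<le> K / sd n ^ (m - 1) * (1 + \<bar>t\<bar>) ^ N * exp ((- 1 / 4) * t\<^sup>2)"
      unfolding near.growth_def by blast
    obtain C where C: "0 < C" "\<forall>t :: real. (1 + \<bar>t\<bar>) ^ (N + 2) * exp (- (1 / 4) * t\<^sup>2) \<le> C"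
      using power_exp_quadratic_bounded[of "1 / 4" "N + 2"] by auto
    show ?thesis
    proof (intro exI allI ballI)
      fix n t assume t: "t \<in> near n"
      have sd: "1 \<le> sd n" by (rule near.scale_ge_1[OF t])
      have "cmod (U n k t) \<le> K / sd n ^ (m - 1) * (1 + \<bar>t\<bar>) ^ N * exp ((- 1 / 4) * t\<^sup>2)"
        using le[OF t] by (simp add: norm_mult norm_power)
      hence "cmod (U n k t) * (1 + \<bar>t\<bar>)\<^sup>2 \<le> K / sd n ^ (m - 1) * (1 + \<bar>t\<bar>) ^ N * exp ((- 1 / 4) * t\<^sup>2) * (1 + \<bar>t\<bar>)\<^sup>2"
        by (intro mult_right_mono) auto
      also have "\<dots> = K / sd n ^ (m - 1) * ((1 + \<bar>t\<bar>) ^ (N + 2) * exp (- (1 / 4) * t\<^sup>2))"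
        by (simp only: power_add mult_ac minus_divide_left)
      also have "\<dots> \<le> K / sd n ^ (m - 1) * C"
        using C(2) K sd by (intro mult_left_mono) auto
      finally show "cmod (U n k t) * (1 + \<bar>t\<bar>)\<^sup>2 \<le> (K * C) / sd n ^ (m - 1)" by simp
    qed
  qed
  then obtain K where K: "\<And>k n t. k \<le> m \<Longrightarrow> t \<in> near n \<Longrightarrow> cmod (U n k t) * (1 + \<bar>t\<bar>)\<^sup>2 \<le> K k / sd n ^ (m - 1)"
    by metis
  show ?thesis
  proof (rule that[of "1 + (\<Sum>k\<le>m. \<bar>K k\<bar>)"])
    show "0 < 1 + (\<Sum>k\<le>m. \<bar>K k\<bar>)" by (simp add: add_pos_nonneg sum_nonneg)
    fix n t k assume t: "t \<in> near n" and k: "k \<le> m"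
    have sd: "1 \<le> sd n" by (rule near.scale_ge_1[OF t])
    have "\<bar>K k\<bar> \<le> (\<Sum>k\<le>m. \<bar>K k\<bar>)" using k by (intro member_le_sum) auto
    hence "K k / sd n ^ (m - 1) \<le> (1 + (\<Sum>k\<le>m. \<bar>K k\<bar>)) / sd n ^ (m - 1)"
      using sd by (intro divide_right_mono) auto
    thus "cmod (U n k t) * (1 + \<bar>t\<bar>)\<^sup>2 \<le> (1 + (\<Sum>k\<le>m. \<bar>K k\<bar>)) / sd n ^ (m - 1)" using K[OF k t] by linarith
  qed
qed

text \<open>The derivative beyond order \<open>m\<close> is not obtained from a moment; it exists
  because the approximation of the characteristic function near the origin has \<open>m + 1\<close>
  derivatives. It is bounded where the division by \<open>t\<close> is delicate.\<close>

lemma U_top_derivative: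
  obtains V K where "0 < K" "\<And>n t. t \<in> near n \<Longrightarrow> (U n m has_vector_derivative V n t) (at t)"
    "\<And>n t. t \<in> near n \<Longrightarrow> \<bar>t\<bar> \<le> 1 \<Longrightarrow> cmod (V n t) \<le> K / sd n ^ (m - 1)"
proof -
  have "near.derivs_growth (Suc 0) (- 1 / 4) (m - 1) (\<lambda>n t. \<i> ^ m * U n m t)"
    using U_derivs_growth[OF order.refl] by simp
  then obtain u' where u': "\<And>n t. t \<in> near n \<Longrightarrow> ((\<lambda>t. \<i> ^ m * U n m t) has_vector_derivative u' n t) (at t)"
    "near.growth (- 1 / 4) (m - 1) u'"
    by auto
  obtain K N where K: "0 \<le> K" and le [rule_format]: "\<forall>n. \<forall>t\<in>near n. cmod (u' n t) \<le> K / sd n ^ (m - 1) * (1 + \<bar>t\<bar>) ^ N * exp ((- 1 / 4) * t\<^sup>2)"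
    using u'(2) unfolding near.growth_def by blast
  show ?thesis
  proof (rule that[of "K * 2 ^ N + 1" "\<lambda>n t. (- \<i>) ^ m * u' n t"])
    show "0 < K * 2 ^ N + 1" using K by (simp add: add_nonneg_pos)
    fix n t assume t: "t \<in> near n"
    have e: "(- \<i>) ^ m * (\<i> ^ m * x) = x" for x :: complex
      by (simp add: mult.assoc[symmetric] power_mult_distrib[symmetric])
    show "(U n m has_vector_derivative (- \<i>) ^ m * u' n t) (at t)"
      using has_vector_derivative_mult_right[OF u'(1)[OF t], of "(- \<i>) ^ m"] unfolding e .
    assume t1: "\<bar>t\<bar> \<le> 1"
    have sd: "1 \<le> sd n" by (rule near.scale_ge_1[OF t])
    have "cmod ((- \<i>) ^ m * u' n t) \<le> K / sd n ^ (m - 1) * (1 + \<bar>t\<bar>) ^ N * exp ((- 1 / 4) * t\<^sup>2)"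
      using le[OF t] by (simp add: norm_mult norm_power)
    also have "\<dots> \<le> K / sd n ^ (m - 1) * 2 ^ N * 1"
      using t1 K sd by (intro mult_mono power_mono mult_nonneg_nonneg divide_nonneg_nonneg) auto
    also have "\<dots> \<le> (K * 2 ^ N + 1) / sd n ^ (m - 1)" using sd by (simp add: divide_right_mono)
    finally show "cmod ((- \<i>) ^ m * u' n t) \<le> (K * 2 ^ N + 1) / sd n ^ (m - 1)" .
  qed
qed

text \<open>The transform of the density has Gaussian decay at all frequencies. The power
  \<open>m\<close> is enough to make its contribution above \<open>c * sd n\<close> of order
  \<open>m - 1\<close>.\<close>

lemma weighted_ft_pdf_bound:
  obtains K where "0 < K" "\<And>n t k. large n \<Longrightarrow> k \<le> m \<Longrightarrow> cmod (weighted_ft lborel (pdf n) k t) * (1 + \<bar>t\<bar>) ^ m \<le> K"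
proof -
  have "\<exists>K. \<forall>n t. large n \<longrightarrow> cmod (weighted_ft lborel (pdf n) k t) * (1 + \<bar>t\<bar>) ^ m \<le> K" if "k \<le> m" for k
  proof -
    have "everywhere.derivs_growth (k + 0) (- 3 / 8) 0 (\<lambda>n t. prefactor n t * truncated_symbol n t)"
      using everywhere.derivs_growth_mult[OF prefactor_growth(2) truncated_symbol_growth] by simp
    hence "everywhere.derivs_growth 0 (- 3 / 8) 0 (\<lambda>n t. \<i> ^ k * weighted_ft lborel (pdf n) k t)"
    proof (rule everywhere.derivs_growth_chain[where U = "\<lambda>k n t. \<i> ^ k * weighted_ft lborel (pdf n) k t"])
      fix n t assume "t \<in> everywhere n"
      hence large: "large n" by (simp add: everywhere_def split: if_splits)
      show "prefactor n t * truncated_symbol n t = \<i> ^ 0 * weighted_ft lborel (pdf n) 0 t"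
        by (simp add: weighted_ft_pdf[OF large])
      fix j assume "j < k"
      thus "((\<lambda>t. \<i> ^ j * weighted_ft lborel (pdf n) j t) has_vector_derivative \<i> ^ Suc j * weighted_ft lborel (pdf n) (Suc j) t) (at t)"
        using that by (intro derivative_chain_factor[where J = m] weighted_ft_pdf_has_vector_derivative large) auto
    qed
    then obtain K N where K: "0 \<le> K" and le [rule_format]: "\<forall>n. \<forall>t\<in>everywhere n. cmod (\<i> ^ k * weighted_ft lborel (pdf n) k t) \<le> K / sd n ^ 0 * (1 + \<bar>t\<bar>) ^ N * exp ((- 3 / 8) * t\<^sup>2)"
      unfolding everywhere.derivs_growth.simps everywhere.growth_def by blast
    obtain C where C: "0 < C" "\<forall>t :: real. (1 + \<bar>t\<bar>) ^ (N + m) * exp (- (3 / 8) * t\<^sup>2) \<le> C"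
      using power_exp_quadratic_bounded[of "3 / 8" "N + m"] by auto
    show ?thesis
    proof (intro exI allI impI)
      fix n and t :: real assume "large n"
      hence t: "t \<in> everywhere n" by (simp add: everywhere_def)
      have "cmod (weighted_ft lborel (pdf n) k t) \<le> K * (1 + \<bar>t\<bar>) ^ N * exp ((- 3 / 8) * t\<^sup>2)"
        using le[OF t] by (simp add: norm_mult norm_power)
      hence "cmod (weighted_ft lborel (pdf n) k t) * (1 + \<bar>t\<bar>) ^ m \<le> K * (1 + \<bar>t\<bar>) ^ N * exp ((- 3 / 8) * t\<^sup>2) * (1 + \<bar>t\<bar>) ^ m"
        by (intro mult_right_mono) auto
      also have "\<dots> = K * ((1 + \<bar>t\<bar>) ^ (N + m) * exp (- (3 / 8) * t\<^sup>2))"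
        by (simp only: power_add mult_ac minus_divide_left)
      also have "\<dots> \<le> K * C" using C(2) K by (intro mult_left_mono) auto
      finally show "cmod (weighted_ft lborel (pdf n) k t) * (1 + \<bar>t\<bar>) ^ m \<le> K * C" .
    qed
  qed
  then obtain K where K: "\<And>k n t. k \<le> m \<Longrightarrow> large n \<Longrightarrow> cmod (weighted_ft lborel (pdf n) k t) * (1 + \<bar>t\<bar>) ^ m \<le> K k"
    by metis
  show ?thesis
  proof (rule that[of "1 + (\<Sum>k\<le>m. \<bar>K k\<bar>)"])
    show "0 < 1 + (\<Sum>k\<le>m. \<bar>K k\<bar>)" by (simp add: add_pos_nonneg sum_nonneg)
    fix n t k assume large: "large n" and k: "k \<le> m"
    have "\<bar>K k\<bar> \<le> (\<Sum>k\<le>m. \<bar>K k\<bar>)" using k by (intro member_le_sum) auto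
    thus "cmod (weighted_ft lborel (pdf n) k t) * (1 + \<bar>t\<bar>) ^ m \<le> 1 + (\<Sum>k\<le>m. \<bar>K k\<bar>)" using K[OF k large, of t] by linarith
  qed
qed

definition high_frequency :: "nat \<Rightarrow> nat \<Rightarrow> real \<Rightarrow> real \<Rightarrow> real" where
  "high_frequency k n c T = (LBINT t:{c * sd n..T}. cmod (weighted_ft (law n) (\<lambda>_. 1) k t) / t)"

text \<open>The frequencies are cut at \<open>c * sd n\<close>. Below, the growth bounds give order
  \<open>m - 1\<close> even after division by \<open>t\<close>; above, the transform of the density
  is negligible and only that of the law remains. Hardy's inequality accounts for the factor 2 and
  for a boundary term at the cut, again of order \<open>m - 1\<close>.\<close>

lemma discrepancy_le_high_frequency:
  assumes c: "0 < c" "c < near_radius"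
  obtains K C where "0 < C" "0 < K"
    "\<And>n T y. large n \<Longrightarrow> 1 \<le> c * sd n \<Longrightarrow> c * sd n \<le> T \<Longrightarrow> C \<le> T \<Longrightarrow>
      (1 + \<bar>y\<bar>) ^ m * \<bar>cdf_approximation.discrepancy (law n) (pdf n) y\<bar>
        \<le> K / sd n ^ (m - 1) + C * (high_frequency 0 n c T + 2 * high_frequency m n c T) + C / T"
proof -
  obtain C where C: "0 < C" and smoothing: "\<And>\<mu> \<gamma> L T x. cdf_approximation \<mu> \<gamma> m L \<Longrightarrow> C \<le> T \<Longrightarrow>
      set_integrable lborel {0..T} (quotient_deriv (cdf_approximation.ft_difference \<mu> \<gamma>) m) \<Longrightarrow>
      (1 + \<bar>x\<bar>) ^ m * \<bar>cdf_approximation.discrepancy \<mu> \<gamma> x\<bar> \<le>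
        C * ((LBINT t:{0..T}. cmod (quotient_deriv (cdf_approximation.ft_difference \<mu> \<gamma>) 0 t))
           + (LBINT t:{0..T}. cmod (quotient_deriv (cdf_approximation.ft_difference \<mu> \<gamma>) m t)) + L / T)"
    using nonuniform_smoothing[of m] by metis
  obtain L where L: "0 < L" "\<And>n. large n \<Longrightarrow> cdf_approximation (law n) (pdf n) m L"
    using cdf_approximation_law by metis
  obtain K1 where K1: "0 < K1" "\<And>n t k. t \<in> near n \<Longrightarrow> k \<le> m \<Longrightarrow> cmod (U n k t) * (1 + \<bar>t\<bar>)\<^sup>2 \<le> K1 / sd n ^ (m - 1)"
    using U_bound by metis
  obtain V K2 where V: "0 < K2" "\<And>n t. t \<in> near n \<Longrightarrow> (U n m has_vector_derivative V n t) (at t)"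
    "\<And>n t. t \<in> near n \<Longrightarrow> \<bar>t\<bar> \<le> 1 \<Longrightarrow> cmod (V n t) \<le> K2 / sd n ^ (m - 1)"
    using U_top_derivative by metis
  obtain K3 where K3: "0 < K3" "\<And>n t k. large n \<Longrightarrow> k \<le> m \<Longrightarrow> cmod (weighted_ft lborel (pdf n) k t) * (1 + \<bar>t\<bar>) ^ m \<le> K3"
    using weighted_ft_pdf_bound by metis
  define K4 where "K4 = K1 + K2"
  define K where "K = C * (2 * K4 + (1 + fact (Suc m)) * K4 + fact m * K4 + 3 * (K3 / c ^ (m - 1)))"
  define C' where "C' = max C (C * L)"
  have K4: "0 < K4" using K1 V by (simp add: K4_def)
  show ?thesis
  proof (rule that[of C' K])
    show "0 < C'" using C by (simp add: C'_def)
    show "0 < K" unfolding K_def using C K4 K3 c by (intro mult_pos_pos add_pos_pos) auto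
    fix n T y
    assume large: "large n" and a1: "1 \<le> c * sd n" and aT: "c * sd n \<le> T" and T: "C' \<le> T"
    interpret cdf_approximation "law n" "pdf n" m L by (rule L(2)[OF large])
    define a' where "a' = c * sd n"
    have sd: "1 \<le> sd n" by (rule large_bounds(1)[OF large])
    have a': "1 \<le> a'" "a' \<le> T" "0 < a'" using a1 aT by (auto simp: a'_def)
    \<comment> \<open>The strict inequality \<open>c < near_radius\<close> puts the closed interval
      inside the open set \<open>near n\<close>.\<close>
    have near: "t \<in> near n" if "t \<in> {0..a'}" for t
    proof -
      have "c * sd n < near_radius * sd n" using c sd by (intro mult_strict_right_mono) auto
      thus ?thesis using that a' large by (auto simp: near_def a'_def)
    qed
    define q where "q = K4 / sd n ^ (m - 1)"
    have q: "0 \<le> q" using K4 sd by (simp add: q_def)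
    have Uq: "cmod (U n k t) * (1 + \<bar>t\<bar>)\<^sup>2 \<le> q" if "k \<le> m" "t \<in> {0..a'}" for k t
    proof -
      have "K1 / sd n ^ (m - 1) \<le> q" unfolding q_def K4_def using sd V by (intro divide_right_mono) auto
      thus ?thesis using K1(2)[OF near[OF that(2)] that(1)] by linarith
    qed
    have Ule: "cmod (U n k t) \<le> q" if "k \<le> m" "t \<in> {0..a'}" for k t
    proof -
      have "cmod (U n k t) * 1 \<le> cmod (U n k t) * (1 + \<bar>t\<bar>)\<^sup>2" by (intro mult_left_mono) (auto simp: one_le_power)
      thus ?thesis using Uq[OF that] by linarith
    qed
    have decay: "cmod (U n k t) \<le> q / t\<^sup>2" if "k \<le> m" "t \<in> {1..a'}" for k t
    proof -
      have "cmod (U n k t) * t\<^sup>2 \<le> cmod (U n k t) * (1 + \<bar>t\<bar>)\<^sup>2" using that by (intro mult_left_mono power_mono) auto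
      also have "\<dots> \<le> q" using that by (intro Uq) auto
      finally show ?thesis using that by (simp add: field_simps)
    qed
    have zero: "U n 0 0 = 0"
      by (simp add: U_def[OF large] weighted_ft_law_0 law.char_zero weighted_ft_pdf[OF large] truncated_symbol_0 prefactor_def)
    have Vq: "cmod (V n s) \<le> q" if "s \<in> {0..1}" for s
    proof -
      have "K2 / sd n ^ (m - 1) \<le> q" unfolding q_def K4_def using sd K1 by (intro divide_right_mono) auto
      moreover have "cmod (V n s) \<le> K2 / sd n ^ (m - 1)" using that a' by (intro V(3) near) auto
      ultimately show ?thesis by linarith
    qed
    have contU: "continuous_on X (U n k)" if "k \<le> m" for k X by (rule continuous_ft_difference[OF that])
    have high: "(LBINT t:{a'..T}. cmod (U n k t) / t) \<le> high_frequency k n c T + K3 / c ^ (m - 1) / sd n ^ (m - 1)" if k: "k \<le> m" for k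
    proof -
      have i1: "set_integrable lborel {a'..T} (\<lambda>t. cmod (weighted_ft (law n) (\<lambda>_. 1) k t) / t)"
        using a' continuous_on_subset[OF law.continuous_weighted_ft[OF k], of "{a'..T}"]
        by (intro borel_integrable_atLeastAtMost') (auto intro!: continuous_intros)
      have i2: "set_integrable lborel {a'..T} (\<lambda>t. K3 / a' ^ (m - 1) * (1 / t\<^sup>2))"
        using integral_inverse_square_le(1)[OF a'(3,2)] by (intro set_integrable_mult_right)
      have i0: "set_integrable lborel {a'..T} (\<lambda>t. cmod (U n k t) / t)"
        using a' contU[OF k] by (intro borel_integrable_atLeastAtMost') (auto intro!: continuous_intros)
      have pw: "cmod (U n k t) / t \<le> cmod (weighted_ft (law n) (\<lambda>_. 1) k t) / t + K3 / a' ^ (m - 1) * (1 / t\<^sup>2)" if "t \<in> {a'..T}" for t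
      proof -
        have t: "0 < t" "a' \<le> t" "1 \<le> t" using that a' by auto
        have tm: "t ^ m = t ^ (m - 1) * t" using m_ge_3 by (cases m) auto
        have "cmod (weighted_ft lborel (pdf n) k t) * t ^ m \<le> cmod (weighted_ft lborel (pdf n) k t) * (1 + \<bar>t\<bar>) ^ m"
          using t by (intro mult_left_mono power_mono) auto
        also have "\<dots> \<le> K3" by (rule K3(2)[OF large k])
        finally have "cmod (weighted_ft lborel (pdf n) k t) \<le> K3 / t ^ m" using t by (simp add: pos_le_divide_eq)
        hence "cmod (weighted_ft lborel (pdf n) k t) / t \<le> K3 / t ^ m / t" using t by (intro divide_right_mono) auto
        \<comment> \<open>Of the \<open>m + 1\<close> powers two are kept for integrability; the
          other \<open>m - 1\<close> are evaluated at the cut and give the order in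
          \<open>sd n\<close>.\<close>
        also have "\<dots> = K3 / t ^ (m - 1) * (1 / t\<^sup>2)" unfolding tm by (simp add: power2_eq_square)
        also have "\<dots> \<le> K3 / a' ^ (m - 1) * (1 / t\<^sup>2)"
          using t a' K3 by (intro mult_right_mono divide_left_mono power_mono mult_pos_pos) auto
        finally have g: "cmod (weighted_ft lborel (pdf n) k t) / t \<le> K3 / a' ^ (m - 1) * (1 / t\<^sup>2)" .
        have "cmod (U n k t) / t \<le> (cmod (weighted_ft (law n) (\<lambda>_. 1) k t) + cmod (weighted_ft lborel (pdf n) k t)) / t"
          unfolding U_def[OF large] using t by (intro divide_right_mono norm_triangle_ineq4) auto
        thus ?thesis using g by (simp add: add_divide_distrib)
      qed
      have "(LBINT t:{a'..T}. cmod (U n k t) / t) \<le> (LBINT t:{a'..T}. cmod (weighted_ft (law n) (\<lambda>_. 1) k t) / t + K3 / a' ^ (m - 1) * (1 / t\<^sup>2))"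
        by (intro set_integral_mono i0 set_integral_add(1)[OF i1 i2] pw)
      also have "\<dots> = high_frequency k n c T + K3 / a' ^ (m - 1) * (LBINT t:{a'..T}. 1 / t\<^sup>2)"
        unfolding set_integral_add(2)[OF i1 i2] high_frequency_def a'_def[symmetric] by (simp only: set_integral_mult_right)
      also have "\<dots> \<le> high_frequency k n c T + K3 / a' ^ (m - 1) * 1"
      proof (intro add_left_mono mult_left_mono)
        have "1 / a' \<le> 1" using a' by simp
        thus "(LBINT t:{a'..T}. 1 / t\<^sup>2) \<le> 1" using integral_inverse_square_le(2)[OF a'(3,2)] by linarith
      qed (use K3 a' in auto)
      also have "K3 / a' ^ (m - 1) * 1 = K3 / c ^ (m - 1) / sd n ^ (m - 1)" by (simp add: a'_def power_mult_distrib)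
      finally show ?thesis .
    qed
    have I0: "(LBINT t:{0..T}. cmod (quotient_deriv (U n) 0 t)) \<le> 2 * q + (high_frequency 0 n c T + K3 / c ^ (m - 1) / sd n ^ (m - 1))"
    proof -
      have d: "(U n 0 has_vector_derivative \<i> * U n 1 s) (at s)" for s
        using U_has_vector_derivative[OF large, of 0 s] m_ge_3 by simp
      have b: "cmod (\<i> * U n 1 s) \<le> q" if "s \<in> {0..1}" for s
        using Ule[of 1 s] that a' m_ge_3 by (simp add: norm_mult)
      have "(LBINT t:{0..T}. cmod (quotient_deriv (U n) 0 t)) \<le> (1 + fact (Suc 0)) * q + (LBINT t:{a'..T}. cmod (quotient_deriv (U n) 0 t))"
      proof (rule integral_quotient_deriv_from_zero_le(2)[where V = "\<lambda>s. \<i> * U n 1 s"])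
        show "cmod (U n j t) \<le> q / t\<^sup>2" if "j \<le> 0" "t \<in> {1..a'}" for j t
          using that by (intro decay) auto
        show "continuous_on UNIV (U n j)" if "j \<le> 0" for j using that by (intro contU) auto
      qed (use d b zero a' in simp_all)
      also have "(LBINT t:{a'..T}. cmod (quotient_deriv (U n) 0 t)) = (LBINT t:{a'..T}. cmod (U n 0 t) / t)"
        using a' by (intro set_lebesgue_integral_cong) (auto simp: norm_mult norm_divide)
      also have "\<dots> \<le> high_frequency 0 n c T + K3 / c ^ (m - 1) / sd n ^ (m - 1)" by (rule high) simp
      finally show ?thesis by simp
    qed
    have m': "Suc (m - 1) = m" using m_ge_3 by simp
    have top: "set_integrable lborel {0..T} (quotient_deriv (U n) m) \<and> (LBINT t:{0..T}. cmod (quotient_deriv (U n) m t)) \<le> (1 + fact (Suc m)) * q + (LBINT t:{a'..T}. cmod (quotient_deriv (U n) m t))"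
    proof (intro conjI)
      note F = integral_quotient_deriv_from_zero_le[where U = "U n" and k = m and V = "V n" and M = q and a = a' and T = T]
      have p: "\<And>j s. j < m \<Longrightarrow> (U n j has_vector_derivative \<i> * U n (Suc j) s) (at s)"
        by (rule U_has_vector_derivative[OF large])
      have d: "\<And>s. s \<in> {0..1} \<Longrightarrow> (U n m has_vector_derivative V n s) (at s)"
        by (rule V(2)[OF near]) (use a' in auto)
      show "set_integrable lborel {0..T} (quotient_deriv (U n) m)"
        by (rule F(1)[OF p d Vq zero contU a'(1,2) decay])
      show "(LBINT t:{0..T}. cmod (quotient_deriv (U n) m t)) \<le> (1 + fact (Suc m)) * q + (LBINT t:{a'..T}. cmod (quotient_deriv (U n) m t))"
        by (rule F(2)[OF p d Vq zero contU a'(1,2) decay])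
    qed
    have hardy: "(LBINT t:{a'..T}. cmod (quotient_deriv (U n) m t)) \<le> 2 * (high_frequency m n c T + K3 / c ^ (m - 1) / sd n ^ (m - 1)) + fact m * q"
    proof -
      have gen: "X \<le> 2 * H + W" if "X \<le> 2 * Y + Z" "Z \<le> W" "Y \<le> H" for X Y Z W H :: real
        using that by linarith
      have 1: "(LBINT t:{a'..T}. cmod (quotient_deriv (U n) (Suc (m - 1)) t)) \<le> 2 * (LBINT t:{a'..T}. cmod (U n (Suc (m - 1)) t) / t) + cmod (quotient_deriv (U n) (m - 1) a')"
        using m_ge_3 by (intro integral_quotient_deriv_le U_has_vector_derivative[OF large] contU a') auto
      have 2: "cmod (quotient_deriv (U n) (m - 1) a') \<le> fact (Suc (m - 1)) * q"
        using a' by (intro quotient_deriv_le Ule) auto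
      show ?thesis using 1 2 high[OF order.refl] unfolding m' by (rule gen)
    qed
    have "(1 + \<bar>y\<bar>) ^ m * \<bar>discrepancy y\<bar> \<le> C * ((LBINT t:{0..T}. cmod (quotient_deriv (U n) 0 t)) + (LBINT t:{0..T}. cmod (quotient_deriv (U n) m t)) + L / T)"
      using T by (intro smoothing[OF L(2)[OF large]] conjunct1[OF top]) (simp add: C'_def)
    also have "\<dots> \<le> C * ((2 * q + (high_frequency 0 n c T + K3 / c ^ (m - 1) / sd n ^ (m - 1)))
        + ((1 + fact (Suc m)) * q + (2 * (high_frequency m n c T + K3 / c ^ (m - 1) / sd n ^ (m - 1)) + fact m * q)) + L / T)"
    proof (intro mult_left_mono add_mono order.refl I0)
      show "(LBINT t:{0..T}. cmod (quotient_deriv (U n) m t)) \<le> (1 + fact (Suc m)) * q + (2 * (high_frequency m n c T + K3 / c ^ (m - 1) / sd n ^ (m - 1)) + fact m * q)"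
        by (rule order_trans[OF conjunct2[OF top] add_left_mono[OF hardy]])
    qed (use C in auto)
    also have "\<dots> = K / sd n ^ (m - 1) + C * (high_frequency 0 n c T + 2 * high_frequency m n c T) + C * L / T"
    proof -
      have gen: "C * ((2 * (k * r) + (h0 + g * r)) + ((1 + f1) * (k * r) + (2 * (hm + g * r) + f2 * (k * r))) + l)
         = C * (2 * k + (1 + f1) * k + f2 * k + 3 * g) * r + C * (h0 + 2 * hm) + C * l" for k r h0 hm g f1 f2 l :: real
        by (simp add: algebra_simps)
      have e: "x / sd n ^ (m - 1) = x * (1 / sd n ^ (m - 1))" for x by simp
      show ?thesis unfolding q_def K_def e[of K4] e[of "K3 / c ^ (m - 1)"] gen e[of "C * _"] by simp
    qed
    also have "\<dots> \<le> K / sd n ^ (m - 1) + C' * (high_frequency 0 n c T + 2 * high_frequency m n c T) + C' / T"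
    proof (intro add_mono order.refl mult_right_mono divide_right_mono)
      have nn: "0 \<le> high_frequency k n c T" for k
        unfolding high_frequency_def set_lebesgue_integral_def
        by (intro integral_nonneg_AE AE_I2) (use a' in \<open>auto simp: indicator_def a'_def[symmetric]\<close>)
      show "0 \<le> high_frequency 0 n c T + 2 * high_frequency m n c T" using nn[of 0] nn[of m] by simp
    qed (use a' in \<open>auto simp: C'_def\<close>)
    finally show "(1 + \<bar>y\<bar>) ^ m * \<bar>discrepancy y\<bar>
        \<le> K / sd n ^ (m - 1) + C' * (high_frequency 0 n c T + 2 * high_frequency m n c T) + C' / T" .
  qed
qed

end

section \<open>Expectations of test functions\<close>

text \<open>As the argument of the expansion tends to infinity, the Gaussian times a polynomial
  vanishes and the normal distribution function tends to 1.\<close>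

lemma integral_edgeworth_density:
  "(LINT x|lborel. std_normal_density x * poly (edgeworth_density_poly r b H) x) = 1"
proof -
  let ?f = "\<lambda>x. std_normal_density x * poly (edgeworth_density_poly r b H) x"
  have int: "integrable lborel ?f" using integrable_gaussian_poly_power[of _ 0] by simp
  have 1: "((\<lambda>y. LINT x|lborel. indicator {..y} x *\<^sub>R ?f x) \<longlongrightarrow> (LINT x|lborel. ?f x)) at_top"
    by (rule tendsto_integral_at_top[OF _ int]) simp
  have "((\<lambda>y. LINT x|lborel. indicator {..y} x *\<^sub>R std_normal_density x) \<longlongrightarrow> (LINT x|lborel. std_normal_density x)) at_top"
    by (rule tendsto_integral_at_top) auto
  hence 2: "((\<lambda>y. (LINT x|lborel. indicator {..y} x *\<^sub>R std_normal_density x) + std_normal_density y * poly (edgeworth_correction r b H) y) \<longlongrightarrow> 1 + 0) at_top"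
    by (intro tendsto_add gaussian_poly_tendsto_0(1)) simp
  have eq: "(LINT x|lborel. indicator {..y} x *\<^sub>R ?f x) =
      (LINT x|lborel. indicator {..y} x *\<^sub>R std_normal_density x) + std_normal_density y * poly (edgeworth_correction r b H) y" for y
    using edgeworth_eq_integral[of r b H y] unfolding edgeworth_eq std_normal_cdf_def set_lebesgue_integral_def by simp
  have "(LINT x|lborel. ?f x) = 1 + 0"
    using 1 2 unfolding eq by (rule tendsto_unique[OF trivial_limit_at_top_linorder])
  thus ?thesis by simp
qed

text \<open>Applied to the law of \<open>W\<close> itself, without the affine change. The constant
  \<open>L\<close> may depend on \<open>n\<close> here, since this instance serves integration by
  parts and finiteness, while the uniform bound comes from the transported instance.\<close>

lemma (in real_distribution) cdf_approximation_edgeworth: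
  assumes moment: "integrable M (\<lambda>x. (1 + \<bar>x\<bar>) ^ k)" and k: "1 \<le> k"
  shows "\<exists>L. cdf_approximation M (\<lambda>x. std_normal_density x * poly (edgeworth_density_poly r b H) x) k L"
proof -
  let ?f = "\<lambda>x. std_normal_density x * poly (edgeworth_density_poly r b H) x"
  obtain L where L: "\<And>x. \<bar>?f x\<bar> * (1 + \<bar>x\<bar>) ^ k \<le> L" using gaussian_poly_decay by metis
  interpret w: weighted_measure M "\<lambda>_. 1" k by (rule weighted_measure_moment[OF moment])
  have meas: "?f \<in> borel_measurable borel" by (intro borel_measurable_times poly_measurable) auto
  interpret d: weighted_measure lborel ?f k
    by unfold_locales (use meas integrable_gaussian_poly_power in auto)
  have "cdf_approximation M ?f k L"
    by unfold_locales (use L k in \<open>auto simp: integral_edgeworth_density\<close>)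
  thus ?thesis ..
qed

lemma discrepancy_edgeworth:
  "cdf_approximation.discrepancy \<mu> (\<lambda>x. std_normal_density x * poly (edgeworth_density_poly r b H) x) x
     = measure \<mu> {..x} - edgeworth r b H x"
  if "cdf_approximation \<mu> (\<lambda>x. std_normal_density x * poly (edgeworth_density_poly r b H) x) k L"
  using cdf_approximation.discrepancy_def[OF that] by (simp add: edgeworth_eq_integral)

lemma (in real_distribution) edgeworth_error_bounded:
  assumes "integrable M (\<lambda>x. (1 + \<bar>x\<bar>) ^ k)" "1 \<le> k"
  shows "\<exists>c. \<forall>x. (1 + \<bar>x\<bar>) ^ k * \<bar>measure M {..x} - edgeworth r b H x\<bar> \<le> c"
proof -
  obtain L where L: "cdf_approximation M (\<lambda>x. std_normal_density x * poly (edgeworth_density_poly r b H) x) k L"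
    using cdf_approximation_edgeworth[OF assms] by blast
  show ?thesis using cdf_approximation.discrepancy_bounded[OF L] unfolding discrepancy_edgeworth[OF L] .
qed

text \<open>Integration by parts sets the error of the distribution functions against
  \<open>g\<close>, and its weighted bound leaves the weighted integral of \<open>g\<close>.
  \<open>g\<close> is tied to \<open>h\<close> only through the fundamental theorem, which also
  admits \<open>\<bar>x\<bar> ^ q\<close>.\<close>

lemma (in real_distribution) expectation_edgeworth:
  fixes h g :: "real \<Rightarrow> real"
  assumes moment: "integrable M (\<lambda>x. (1 + \<bar>x\<bar>) ^ k)" "1 \<le> k"
    and bound: "\<And>x. \<bar>measure M {..x} - edgeworth r b H x\<bar> \<le> D / (1 + \<bar>x\<bar>) ^ k"
    and g [measurable]: "g \<in> borel_measurable borel"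
    and FTC: "\<And>u v. u \<le> v \<Longrightarrow> set_integrable lborel {u..v} g \<and> h v - h u = (LINT x:{u..v}|lborel. g x)"
    and int: "integrable lborel (\<lambda>x. \<bar>g x\<bar> / (1 + \<bar>x\<bar>) ^ k)"
  shows "integrable M h" "integrable_wrt (edgeworth r b H) h"
    "\<bar>(LINT x|M. h x) - integral_wrt (edgeworth r b H) h\<bar> \<le> D * (LINT x|lborel. \<bar>g x\<bar> / (1 + \<bar>x\<bar>) ^ k)"
proof -
  obtain L where L: "cdf_approximation M (\<lambda>x. std_normal_density x * poly (edgeworth_density_poly r b H) x) k L"
    using cdf_approximation_edgeworth[OF moment] by blast
  interpret a: cdf_approximation M "\<lambda>x. std_normal_density x * poly (edgeworth_density_poly r b H) x" k L by (rule L)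
  have size: "(\<exists>C. \<forall>y. norm (g y) \<le> C * (1 + \<bar>y\<bar>) ^ (k - 1)) \<or> integrable lborel (\<lambda>y. norm (g y) / (1 + \<bar>y\<bar>) ^ k)"
    using int by simp
  note E = a.expectation_difference[OF g FTC size]
  show "integrable M h" by (rule E(1))
  show "integrable_wrt (edgeworth r b H) h"
    using E(2) unfolding integrable_wrt_def deriv_edgeworth by (simp add: mult.commute)
  have "(LINT x|M. h x) - integral_wrt (edgeworth r b H) h = - (LINT y|lborel. a.discrepancy y *\<^sub>R g y)"
    using E(4) unfolding integral_wrt_def deriv_edgeworth by (simp add: mult.commute)
  hence "\<bar>(LINT x|M. h x) - integral_wrt (edgeworth r b H) h\<bar> = norm (LINT y|lborel. a.discrepancy y *\<^sub>R g y)" by simp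
  also have "\<dots> \<le> (LINT y|lborel. norm (a.discrepancy y *\<^sub>R g y))" by (rule integral_norm_bound)
  also have "\<dots> \<le> (LINT y|lborel. D * (\<bar>g y\<bar> / (1 + \<bar>y\<bar>) ^ k))"
  proof (intro integral_mono integrable_norm E(3) integrable_mult_right int)
    fix y
    have "\<bar>a.discrepancy y\<bar> * \<bar>g y\<bar> \<le> D / (1 + \<bar>y\<bar>) ^ k * \<bar>g y\<bar>"
      using bound[of y] unfolding discrepancy_edgeworth[OF L] by (intro mult_right_mono) auto
    thus "norm (a.discrepancy y *\<^sub>R g y) \<le> D * (\<bar>g y\<bar> / (1 + \<bar>y\<bar>) ^ k)" by (simp add: abs_mult)
  qed
  finally show "\<bar>(LINT x|M. h x) - integral_wrt (edgeworth r b H) h\<bar> \<le> D * (LINT x|lborel. \<bar>g x\<bar> / (1 + \<bar>x\<bar>) ^ k)"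
    by (simp only: integral_mult_right_zero)
qed

section \<open>Derivatives of admissible functions and of powers\<close>

lemma admissible_deriv_measurable:
  assumes "admissible_test_function m h"
  shows "deriv h \<in> borel_measurable borel"
proof (rule borel_measurable_LIMSEQ_real)
  \<comment> \<open>Integrability on bounded intervals makes each truncation measurable, and
    \<open>deriv h\<close> is their pointwise limit.\<close>
  fix k :: nat
  have "set_integrable lborel {- real k..real k} (deriv h)"
    using assms unfolding admissible_test_function_def by auto
  hence "(\<lambda>x. indicator {- real k..real k} x *\<^sub>R deriv h x) \<in> borel_measurable lborel"
    unfolding set_integrable_def by (rule borel_measurable_integrable)
  thus "(\<lambda>x. indicator {- real k..real k} x * deriv h x) \<in> borel_measurable borel" by simp
next
  fix x :: real
  have "eventually (\<lambda>k. indicator {- real k..real k} x * deriv h x = deriv h x) sequentially"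
    using eventually_ge_at_top[of "nat \<lceil>\<bar>x\<bar>\<rceil>"]
  proof eventually_elim
    case (elim k)
    hence "\<bar>x\<bar> \<le> real k" by linarith
    thus ?case by (simp add: indicator_def abs_le_iff)
  qed
  thus "(\<lambda>k. indicator {- real k..real k} x * deriv h x) \<longlonglongrightarrow> deriv h x" by (rule tendsto_eventually)
qed

text \<open>An exceptional point is allowed because \<open>\<bar>x\<bar>\<close> has no derivative
  at 0.\<close>

lemma FTC_off_zero:
  fixes h g :: "real \<Rightarrow> real"
  assumes h: "continuous_on UNIV h" and d: "\<And>x. x \<noteq> 0 \<Longrightarrow> (h has_real_derivative g x) (at x)"
    and g [measurable]: "g \<in> borel_measurable borel" and le: "\<And>x. \<bar>g x\<bar> \<le> c * (1 + \<bar>x\<bar>) ^ k" and c: "0 \<le> c"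
    and uv: "u \<le> v"
  shows "set_integrable lborel {u..v} g \<and> h v - h u = (LINT x:{u..v}|lborel. g x)"
proof -
  have "set_integrable lborel {u..v} g"
    unfolding set_integrable_def
  proof (rule integrableI_bounded_set_indicator[where B = "c * (1 + \<bar>u\<bar> + \<bar>v\<bar>) ^ k"])
    show "AE x in lborel. x \<in> {u..v} \<longrightarrow> norm (g x) \<le> c * (1 + \<bar>u\<bar> + \<bar>v\<bar>) ^ k"
    proof (intro AE_I2 impI)
      fix x assume "x \<in> {u..v}"
      hence "c * (1 + \<bar>x\<bar>) ^ k \<le> c * (1 + \<bar>u\<bar> + \<bar>v\<bar>) ^ k" using c by (intro mult_left_mono power_mono) auto
      thus "norm (g x) \<le> c * (1 + \<bar>u\<bar> + \<bar>v\<bar>) ^ k" using le[of x] by simp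
    qed
  qed (use uv in auto)
  moreover have "(g has_integral (h v - h u)) {u..v}"
  proof (rule fundamental_theorem_of_calculus_interior_strong[of "{0}"])
    show "continuous_on {u..v} h" by (rule continuous_on_subset[OF h]) simp
    show "(h has_vector_derivative g x) (at x)" if "x \<in> {u<..<v} - {0}" for x
      using d[of x] that by (simp add: has_real_derivative_iff_has_vector_derivative)
  qed (use uv in auto)
  ultimately show ?thesis by (simp add: set_borel_integral_eq_integral(2) integral_unique)
qed

lemma has_real_derivative_abs_power:
  fixes x :: real
  assumes "x \<noteq> 0"
  shows "((\<lambda>x. \<bar>x\<bar> ^ q) has_real_derivative real q * \<bar>x\<bar> ^ (q - 1) * sgn x) (at x)"
proof (cases "0 < x")
  case True
  have "((\<lambda>x. x ^ q) has_real_derivative real q * \<bar>x\<bar> ^ (q - 1) * sgn x) (at x)"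
    using True by (auto intro!: derivative_eq_intros)
  thus ?thesis
    by (rule has_field_derivative_transform_within_open[where S = "{0<..}"]) (use True in auto)
next
  case False
  have "((\<lambda>x. (- x) ^ q) has_real_derivative real q * \<bar>x\<bar> ^ (q - 1) * sgn x) (at x)"
    using False assms by (auto intro!: derivative_eq_intros)
  thus ?thesis
    by (rule has_field_derivative_transform_within_open[where S = "{..<0}"]) (use False assms in auto)
qed

text \<open>A derivative of size \<open>q * \<bar>x\<bar> ^ (q - 1)\<close> with
  \<open>q < m\<close> leaves two powers of the weight to spare, so the weighted variation of every
  admissible power is below this constant.\<close>

definition moment_constant :: "nat \<Rightarrow> real" where
  "moment_constant m = real m * (LINT x|lborel. 1 / (1 + \<bar>x :: real\<bar>)\<^sup>2)"

lemma moment_weight: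
  fixes g :: "real \<Rightarrow> real"
  assumes q: "q < m" and [measurable]: "g \<in> borel_measurable borel"
    and g: "\<And>x. \<bar>g x\<bar> \<le> real q * \<bar>x\<bar> ^ (q - 1)"
  shows "integrable lborel (\<lambda>x. \<bar>g x\<bar> / (1 + \<bar>x\<bar>) ^ m)"
    "(LINT x|lborel. \<bar>g x\<bar> / (1 + \<bar>x\<bar>) ^ m) \<le> moment_constant m"
proof -
  have int: "integrable lborel (\<lambda>x :: real. 1 / (1 + \<bar>x\<bar>)\<^sup>2)"
    by (rule integrable_of_quadratic_decay[where L = 1]) auto
  have le: "\<bar>g x\<bar> / (1 + \<bar>x\<bar>) ^ m \<le> real m * (1 / (1 + \<bar>x\<bar>)\<^sup>2)" for x
  \<comment> \<open>For \<open>q = 0\<close> truncated subtraction would spoil the exponent count,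
    but then \<open>g\<close> vanishes.\<close>
  proof (cases "q = 0")
    case True thus ?thesis using g[of x] by simp
  next
    case False
    have "\<bar>g x\<bar> * (1 + \<bar>x\<bar>)\<^sup>2 \<le> (real m * (1 + \<bar>x\<bar>) ^ (q - 1)) * (1 + \<bar>x\<bar>)\<^sup>2"
    proof (intro mult_right_mono)
      have "real q * \<bar>x\<bar> ^ (q - 1) \<le> real m * (1 + \<bar>x\<bar>) ^ (q - 1)" using q by (intro mult_mono power_mono) auto
      thus "\<bar>g x\<bar> \<le> real m * (1 + \<bar>x\<bar>) ^ (q - 1)" using g[of x] by linarith
    qed auto
    also have "\<dots> = real m * (1 + \<bar>x\<bar>) ^ (q - 1 + 2)" by (simp only: power_add mult.assoc)
    also have "\<dots> \<le> real m * (1 + \<bar>x\<bar>) ^ m" using q False by (intro mult_left_mono power_increasing) auto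
    finally show ?thesis by (simp add: pos_divide_le_eq pos_le_divide_eq add_pos_nonneg)
  qed
  show i: "integrable lborel (\<lambda>x. \<bar>g x\<bar> / (1 + \<bar>x\<bar>) ^ m)"
    by (rule Bochner_Integration.integrable_bound[OF integrable_mult_right[OF int, of "real m"]])
       (use le in \<open>auto intro!: AE_I2\<close>)
  have "(LINT x|lborel. \<bar>g x\<bar> / (1 + \<bar>x\<bar>) ^ m) \<le> (LINT x|lborel. real m * (1 / (1 + \<bar>x\<bar>)\<^sup>2))"
    by (intro integral_mono i integrable_mult_right int le)
  thus "(LINT x|lborel. \<bar>g x\<bar> / (1 + \<bar>x\<bar>) ^ m) \<le> moment_constant m"
    unfolding moment_constant_def by (simp only: integral_mult_right_zero)
qed

lemma (in real_distribution) moment_edgeworth: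
  assumes moment: "integrable M (\<lambda>x. (1 + \<bar>x\<bar>) ^ k)" "1 \<le> k" and q: "q < k"
    and bound: "\<And>x. \<bar>measure M {..x} - edgeworth r b H x\<bar> \<le> D / (1 + \<bar>x\<bar>) ^ k" and D: "0 \<le> D"
    and h: "h = (\<lambda>x. x ^ q) \<or> h = (\<lambda>x. \<bar>x\<bar> ^ q)"
  shows "integrable M h" "integrable_wrt (edgeworth r b H) h"
    "\<bar>(LINT x|M. h x) - integral_wrt (edgeworth r b H) h\<bar> \<le> D * moment_constant k"
proof -
  have "\<exists>g. g \<in> borel_measurable borel \<and> (\<forall>x. \<bar>g x\<bar> \<le> real q * \<bar>x\<bar> ^ (q - 1))
     \<and> (\<forall>x. x \<noteq> 0 \<longrightarrow> (h has_real_derivative g x) (at x))"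
    using h
  proof
    assume h: "h = (\<lambda>x. x ^ q)"
    show ?thesis unfolding h
      by (intro exI[of _ "\<lambda>x. real q * x ^ (q - 1)"]) (auto intro!: derivative_eq_intros simp: abs_mult power_abs)
  next
    assume h: "h = (\<lambda>x. \<bar>x\<bar> ^ q)"
    show ?thesis unfolding h
      by (intro exI[of _ "\<lambda>x. real q * \<bar>x\<bar> ^ (q - 1) * sgn x"])
        (use has_real_derivative_abs_power in \<open>auto simp: abs_mult abs_sgn_eq\<close>)
  qed
  then obtain g where g [measurable]: "g \<in> borel_measurable borel" and le: "\<And>x. \<bar>g x\<bar> \<le> real q * \<bar>x\<bar> ^ (q - 1)"
    and d: "\<And>x. x \<noteq> 0 \<Longrightarrow> (h has_real_derivative g x) (at x)" by metis
  have le': "\<bar>g x\<bar> \<le> real q * (1 + \<bar>x\<bar>) ^ (q - 1)" for x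
  proof -
    have "real q * \<bar>x\<bar> ^ (q - 1) \<le> real q * (1 + \<bar>x\<bar>) ^ (q - 1)" by (intro mult_left_mono power_mono) auto
    thus ?thesis using le[of x] by linarith
  qed
  have cont: "continuous_on UNIV h" using h by (auto intro!: continuous_intros)
  note FTC = FTC_off_zero[OF cont d g le' of_nat_0_le_iff]
  note W = moment_weight[OF q g le]
  note E = expectation_edgeworth[OF moment bound g FTC W(1)]
  show "integrable M h" by (rule E(1))
  show "integrable_wrt (edgeworth r b H) h" by (rule E(2))
  have "D * (LINT x|lborel. \<bar>g x\<bar> / (1 + \<bar>x\<bar>) ^ k) \<le> D * moment_constant k" by (intro mult_left_mono W(2) D)
  thus "\<bar>(LINT x|M. h x) - integral_wrt (edgeworth r b H) h\<bar> \<le> D * moment_constant k" using E(3) by linarith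
qed

context edgeworth_setting
begin

section \<open>Size of the error\<close>

lemma weighted_measure_law: "0 < sd n \<Longrightarrow> weighted_measure (law n) (\<lambda>_. 1) m"
  by (rule law.weighted_measure_moment[OF moment_law])

text \<open>The integral in the condition runs over both signs of \<open>t\<close>; restricting a
  nonnegative integrand to positive \<open>t\<close> only decreases it.\<close>

lemma high_frequency_le:
  assumes sd: "0 < sd n" and c: "0 < c" and k: "k \<le> m"
  shows "high_frequency k n c T \<le>
    (LINT t:{t. c * L2_norm M (S n) \<le> \<bar>t\<bar> \<and> \<bar>t\<bar> \<le> T}|lborel.
       cmod (nth_vderiv k (normalized_char M (S n)) t / of_real t))"
proof -
  interpret w: weighted_measure "law n" "\<lambda>_. 1" m by (rule weighted_measure_law[OF sd])
  define f where "f t = cmod (weighted_ft (law n) (\<lambda>_. 1) k t / of_real t)" for t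
  define X where "X = {t. c * sd n \<le> \<bar>t\<bar> \<and> \<bar>t\<bar> \<le> T}"
  have f: "cmod (nth_vderiv k (normalized_char M (S n)) t / of_real t) = f t" for t
    unfolding f_def normalized_char_eq weighted_ft_law_0[symmetric] w.nth_vderiv_weighted_ft[OF k]
    by (simp add: norm_divide norm_mult norm_power)
  have csd: "0 < c * sd n" using sd c by simp
  have X0: "t \<noteq> 0" if "t \<in> X" for t using that csd by (auto simp: X_def)
  have "bounded X" unfolding bounded_iff X_def by (intro exI[of _ T]) auto
  moreover have "closed X" unfolding X_def by (intro closed_Collect_conj closed_Collect_le continuous_intros)
  ultimately have X: "compact X" by (simp add: compact_eq_bounded_closed)
  have "continuous_on X f"
    unfolding f_def using X0 by (intro continuous_intros continuous_on_subset[OF w.continuous_weighted_ft[OF k]]) auto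
  hence i1: "integrable lborel (\<lambda>t. indicator X t *\<^sub>R f t)" by (rule borel_integrable_compact[OF X])
  have e: "indicator {c * sd n..T} t *\<^sub>R (cmod (weighted_ft (law n) (\<lambda>_. 1) k t) / t) = indicator ({0..} \<inter> X) t *\<^sub>R f t" for t
    using csd by (auto simp: indicator_def X_def f_def norm_divide)
  have i2: "integrable lborel (\<lambda>t. indicator ({0..} \<inter> X) t *\<^sub>R f t)"
  proof (rule Bochner_Integration.integrable_bound[OF i1])
    have m: "(\<lambda>t. indicator {0..} t *\<^sub>R (indicator X t *\<^sub>R f t)) \<in> borel_measurable lborel"
      by (rule borel_measurable_scaleR[OF _ borel_measurable_integrable[OF i1]]) simp
    have e: "indicator {0..} t *\<^sub>R (indicator X t *\<^sub>R f t) = indicator ({0..} \<inter> X) t *\<^sub>R f t" for t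
      by (simp add: indicator_def)
    show "(\<lambda>t. indicator ({0..} \<inter> X) t *\<^sub>R f t) \<in> borel_measurable lborel" using m unfolding e .
  qed (auto simp: indicator_def)
  have "high_frequency k n c T = (LINT t|lborel. indicator ({0..} \<inter> X) t *\<^sub>R f t)"
    unfolding high_frequency_def set_lebesgue_integral_def e ..
  also have "\<dots> \<le> (LINT t|lborel. indicator X t *\<^sub>R f t)"
    by (intro integral_mono i1 i2) (auto simp: indicator_def f_def)
  finally show ?thesis unfolding f set_lebesgue_integral_def X_def sd_def .
qed

lemma high_frequency_small:
  assumes ic: "integrability_condition k m M S" and k: "k \<le> m" and sd: "filterlim sd at_top sequentially"
  shows "\<exists>c\<^sub>0>0. \<exists>b\<^sub>0>0. \<forall>c d \<eta>. 0 < c \<longrightarrow> c < c\<^sub>0 \<longrightarrow> b\<^sub>0 < d \<longrightarrow> 0 < \<eta> \<longrightarrow>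
    (\<forall>\<^sub>F n in sequentially. high_frequency k n c (d * sd n ^ (m - 2)) \<le> \<eta> / sd n ^ (m - 2))"
proof -
  obtain c0 b0 where cb: "0 < c0" "0 < b0" and small: "\<forall>c b. 0 < c \<and> c < c0 \<and> b0 < b \<longrightarrow>
       (\<lambda>n. LINT t:{t. c * L2_norm M (S n) \<le> \<bar>t\<bar> \<and> \<bar>t\<bar> \<le> b * L2_norm M (S n) ^ (m - 2)}|lborel.
              cmod (nth_vderiv k (normalized_char M (S n)) t / of_real t)) \<in> o(\<lambda>n. 1 / L2_norm M (S n) ^ (m - 2))"
    using ic unfolding integrability_condition_def by blast
  have "\<forall>\<^sub>F n in sequentially. high_frequency k n c (d * sd n ^ (m - 2)) \<le> \<eta> / sd n ^ (m - 2)"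
    if "0 < c" "c < c0" "b0 < d" "0 < \<eta>" for c d \<eta>
    using landau_o.smallD[OF small[rule_format, OF conjI[OF that(1) conjI[OF that(2,3)]]] that(4)] filterlim_at_top_dense[THEN iffD1, OF sd, rule_format, of 0]
  proof eventually_elim
    case (elim n)
    have "high_frequency k n c (d * sd n ^ (m - 2)) \<le> \<eta> * norm (1 / L2_norm M (S n) ^ (m - 2))"
      using order_trans[OF high_frequency_le[OF elim(2) that(1) k]
          order_trans[OF order_trans[OF abs_ge_self eq_refl[OF real_norm_def[symmetric]]] elim(1)]]
      unfolding sd_def by simp
    thus ?case using elim(2) by (simp add: sd_def)
  qed
  thus ?thesis by (intro exI[of _ c0] exI[of _ b0] conjI cb allI impI)
qed

lemma edgeworth_poly_bounded:
  obtains K where "\<And>j n. degree (edgeworth_poly j n) \<le> symbol_degree" "\<And>j n i. \<bar>coeff (edgeworth_poly j n) i\<bar> \<le> K"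
proof -
  have "\<exists>K. \<forall>n j i. cmod (coeff (symbol_coeff j n) i) \<le> K"
    by (rule symbol_coeff_bounded) blast
  then obtain K where NK: "\<And>n j i. cmod (coeff (symbol_coeff j n) i) \<le> K"
    by blast
  show ?thesis
  proof (rule that)
    fix j n i
    show "degree (edgeworth_poly j n) \<le> symbol_degree"
      unfolding edgeworth_poly_def degree_minus
      by (intro degree_sum_le order_trans[OF degree_smult_le order_trans[OF degree_hermite]]) auto
    have "\<bar>Re (coeff (symbol_coeff j n) (Suc k))\<bar> \<le> K" for k
      by (rule order_trans[OF abs_Re_le_cmod NK])
    thus "\<bar>coeff (edgeworth_poly j n) i\<bar> \<le> K * (\<Sum>k<symbol_degree. \<Sum>i\<le>k. \<bar>coeff (hermite k) i\<bar>)"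
      unfolding edgeworth_poly_def coeff_minus abs_minus_cancel
      by (intro hermite_combination_bound[where c = "\<lambda>k. Re (coeff (symbol_coeff j n) (Suc k))" and f = "\<lambda>k. k"])
  qed
qed

definition error :: "nat \<Rightarrow> nat \<Rightarrow> real \<Rightarrow> real" where
  "error r n x = \<bar>measure M {\<omega> \<in> space M. (S n \<omega> - A n) / B n \<le> x} - edgeworth r (B n) (\<lambda>j. edgeworth_poly j n) x\<bar>"

lemma top_error_small:
  assumes ic: "integrability_condition m m M S" "integrability_condition 0 m M S"
    and sd: "filterlim sd at_top sequentially" and \<eta>: "0 < \<eta>"
  shows "\<forall>\<^sub>F n in sequentially. \<forall>x. (1 + \<bar>x\<bar>) ^ m * error (m - 2) n x \<le> \<eta> / sd n ^ (m - 2)"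
proof -
  \<comment> \<open>\<open>w\<close> converts the weight at the transported point into the weight at
    \<open>x\<close>; each of the three terms of the bound then receives a share
    \<open>\<theta>\<close>.\<close>
  define w where "w = (2 + 2 * a) ^ m"
  have w: "0 < w" using a_b_nonneg by (simp add: w_def)
  define \<theta> where "\<theta> = \<eta> / (3 * w)"
  have \<theta>: "0 < \<theta>" using \<eta> w by (simp add: \<theta>_def)
  obtain c1 b1 where h1: "0 < c1" "0 < b1" "\<And>c d \<eta>. 0 < c \<Longrightarrow> c < c1 \<Longrightarrow> b1 < d \<Longrightarrow> 0 < \<eta> \<Longrightarrow>
     (\<forall>\<^sub>F n in sequentially. high_frequency m n c (d * sd n ^ (m - 2)) \<le> \<eta> / sd n ^ (m - 2))"
    using high_frequency_small[OF ic(1) _ sd] by auto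
  obtain c2 b2 where h2: "0 < c2" "0 < b2" "\<And>c d \<eta>. 0 < c \<Longrightarrow> c < c2 \<Longrightarrow> b2 < d \<Longrightarrow> 0 < \<eta> \<Longrightarrow>
     (\<forall>\<^sub>F n in sequentially. high_frequency 0 n c (d * sd n ^ (m - 2)) \<le> \<eta> / sd n ^ (m - 2))"
    using high_frequency_small[OF ic(2) _ sd] by auto
  define c where "c = min near_radius (min c1 c2) / 2"
  have c: "0 < c" "c < near_radius" "c < c1" "c < c2" using near_radius(1) h1(1) h2(1) by (auto simp: c_def)
  obtain K C where KC: "0 < C" "0 < K" and main: "\<And>n T y. large n \<Longrightarrow> 1 \<le> c * sd n \<Longrightarrow> c * sd n \<le> T \<Longrightarrow> C \<le> T \<Longrightarrow>
      (1 + \<bar>y\<bar>) ^ m * \<bar>cdf_approximation.discrepancy (law n) (pdf n) y\<bar>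
        \<le> K / sd n ^ (m - 1) + C * (high_frequency 0 n c T + 2 * high_frequency m n c T) + C / T"
    using discrepancy_le_high_frequency[OF c(1,2)] by metis
  \<comment> \<open>A sum of all lower bounds: \<open>b1\<close> and \<open>b2\<close> are the
    thresholds of the integrability conditions, \<open>c\<close> and \<open>C\<close> make
    \<open>T\<close> admissible, and \<open>C / \<theta>\<close> makes \<open>C / T\<close>
    small.\<close>
  define d where "d = 1 + b1 + b2 + c + C + C / \<theta>"
  have C\<theta>: "0 < C / \<theta>" using KC \<theta> by simp
  have d: "b1 < d" "b2 < d" "c \<le> d" "C \<le> d" "0 < d" "C / \<theta> \<le> d"
    unfolding d_def using C\<theta> h1 h2 c KC by linarith+
  \<comment> \<open>Three high-frequency integrals, counted with multiplicity, share
    \<open>\<theta>\<close> after multiplication by \<open>C\<close>.\<close>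
  define e where "e = \<theta> / (3 * C)"
  have e: "0 < e" using \<theta> KC by (simp add: e_def)
  show ?thesis
    using h1(3)[OF c(1,3) d(1) e] h2(3)[OF c(1,4) d(2) e]
      filterlim_at_top[THEN iffD1, OF sd, rule_format, of "32 * b + 1 + 1 / c + K / \<theta>"]
  proof eventually_elim
    case (elim n)
    have p: "0 \<le> 1 / c" "0 \<le> K / \<theta>" using c KC \<theta> by auto
    have large: "large n" using elim(3) p unfolding large_def by linarith
    have sd1: "1 \<le> sd n" by (rule large_bounds(1)[OF large])
    have "1 / c \<le> sd n" using elim(3) p a_b_nonneg by linarith
    hence 1: "1 \<le> c * sd n" using c by (simp add: pos_divide_le_eq mult.commute)
    have "K / \<theta> \<le> sd n" using elim(3) p a_b_nonneg by linarith
    hence K: "K \<le> \<theta> * sd n" using \<theta> by (simp add: pos_divide_le_eq mult.commute)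
    define q where "q = sd n ^ (m - 2)"
    have "sd n ^ 1 \<le> q" unfolding q_def using sd1 m_ge_3 by (intro power_increasing) auto
    hence q: "sd n \<le> q" "1 \<le> q" using sd1 by auto
    define T where "T = d * q"
    have T1: "c * sd n \<le> T" unfolding T_def using d c q sd1 by (intro mult_mono) auto
    have "d * 1 \<le> T" unfolding T_def using d q by (intro mult_left_mono) auto
    hence T2: "C \<le> T" using d(4) by linarith
    have s: "sd n ^ (m - 1) = q * sd n" unfolding q_def power_Suc2[symmetric] using m_ge_3 by (intro arg_cong[where f = "power (sd n)"]) auto
    \<comment> \<open>One power of \<open>sd n\<close> more than needed absorbs the constant
      \<open>K\<close>.\<close>
    have "K / sd n ^ (m - 1) \<le> \<theta> * sd n / (q * sd n)" unfolding s using K q sd1 by (intro divide_right_mono) auto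
    hence b1: "K / sd n ^ (m - 1) \<le> \<theta> / q" using sd1 by simp
    have "high_frequency 0 n c T + 2 * high_frequency m n c T \<le> 3 * (e / q)"
      using elim(1,2) unfolding T_def q_def by linarith
    hence "C * (high_frequency 0 n c T + 2 * high_frequency m n c T) \<le> C * (3 * (e / q))" using KC by (intro mult_left_mono) auto
    hence b2: "C * (high_frequency 0 n c T + 2 * high_frequency m n c T) \<le> \<theta> / q" using KC by (simp add: e_def)
    have "C \<le> \<theta> * d" using d(6) \<theta> by (simp add: pos_divide_le_eq mult.commute)
    hence "C / T \<le> \<theta> * d / (d * q)" unfolding T_def using d q by (intro divide_right_mono) auto
    hence b3: "C / T \<le> \<theta> / q" using d by simp
    show ?case
    proof
      fix x
      define y where "y = A n / sd n + B n / sd n * x"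
      have disc: "\<bar>cdf_approximation.discrepancy (law n) (pdf n) y\<bar> = error (m - 2) n x"
        unfolding y_def discrepancy_eq[OF large] error_def ..
      have "(1 + \<bar>y\<bar>) ^ m * error (m - 2) n x \<le> 3 * (\<theta> / q)"
        using main[OF large 1 T1 T2, of y] b1 b2 b3 unfolding disc by linarith
      hence z: "w * ((1 + \<bar>y\<bar>) ^ m * error (m - 2) n x) \<le> w * (3 * (\<theta> / q))" using w by (intro mult_left_mono) auto
      have "(1 + \<bar>x\<bar>) ^ m \<le> ((2 + 2 * a) * (1 + \<bar>y\<bar>)) ^ m"
        unfolding y_def using affine_weight_le(2)[OF large] by (intro power_mono) auto
      hence "(1 + \<bar>x\<bar>) ^ m * error (m - 2) n x \<le> (w * (1 + \<bar>y\<bar>) ^ m) * error (m - 2) n x"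
        unfolding w_def power_mult_distrib by (intro mult_right_mono) (auto simp: error_def)
      also have "\<dots> \<le> w * (3 * (\<theta> / q))" using z by (simp only: mult.assoc)
      also have "\<dots> = \<eta> / q" using w by (simp add: \<theta>_def)
      finally show "(1 + \<bar>x\<bar>) ^ m * error (m - 2) n x \<le> \<eta> / sd n ^ (m - 2)" unfolding q_def .
    qed
  qed
qed

text \<open>Dropping the terms from \<open>Suc r\<close> to \<open>m - 2\<close> costs no more than
  the first dropped power, so the longest expansion implies all shorter ones.\<close>

lemma error_le_top_error:
  obtains K where "0 < K" "\<And>n r x. 1 \<le> B n \<Longrightarrow> r \<le> m - 2 \<Longrightarrow>
    (1 + \<bar>x\<bar>) ^ m * error r n x \<le> (1 + \<bar>x\<bar>) ^ m * error (m - 2) n x + K / B n ^ Suc r"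
proof -
  obtain K where K: "\<And>j n. degree (edgeworth_poly j n) \<le> symbol_degree" "\<And>j n i. \<bar>coeff (edgeworth_poly j n) i\<bar> \<le> K"
    using edgeworth_poly_bounded by metis
  obtain L where L: "0 < L" and L_bound: "\<forall>p. degree p \<le> symbol_degree \<longrightarrow> (\<forall>i. \<bar>coeff p i\<bar> \<le> K) \<longrightarrow>
     (\<forall>x. \<bar>std_normal_density x * poly p x\<bar> * (1 + \<bar>x\<bar>) ^ m \<le> L)"
    using gaussian_poly_bounded[of symbol_degree K m] by blast
  show ?thesis
  proof (rule that[of "real m * L"])
    show "0 < real m * L" using L m_ge_3 by simp
    fix n r x
    assume B: "1 \<le> B n" and r: "r \<le> m - 2"
    define p where "p j = std_normal_density x * poly (edgeworth_poly j n) x" for j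
    have p: "\<bar>p j\<bar> * (1 + \<bar>x\<bar>) ^ m \<le> L" for j
      unfolding p_def using L_bound K by blast
    have "edgeworth (m - 2) (B n) (\<lambda>j. edgeworth_poly j n) x - edgeworth r (B n) (\<lambda>j. edgeworth_poly j n) x
        = (\<Sum>j = 1..m - 2. p j / B n ^ j) - (\<Sum>j = 1..r. p j / B n ^ j)"
      unfolding edgeworth_def p_def by (simp add: sum_distrib_left)
    also have "(\<Sum>j = 1..m - 2. p j / B n ^ j) = (\<Sum>j = 1..r. p j / B n ^ j) + (\<Sum>j = Suc r..m - 2. p j / B n ^ j)"
      using sum.ub_add_nat[of 1 r "\<lambda>j. p j / B n ^ j" "m - 2 - r", unfolded le_add_diff_inverse[OF r]] by simp
    finally have diff: "edgeworth (m - 2) (B n) (\<lambda>j. edgeworth_poly j n) x - edgeworth r (B n) (\<lambda>j. edgeworth_poly j n) x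
        = (\<Sum>j = Suc r..m - 2. p j / B n ^ j)" by simp
    have "(1 + \<bar>x\<bar>) ^ m * \<bar>\<Sum>j = Suc r..m - 2. p j / B n ^ j\<bar> \<le> (1 + \<bar>x\<bar>) ^ m * (\<Sum>j = Suc r..m - 2. \<bar>p j / B n ^ j\<bar>)"
      by (intro mult_left_mono sum_abs) auto
    also have "\<dots> = (\<Sum>j = Suc r..m - 2. (\<bar>p j\<bar> * (1 + \<bar>x\<bar>) ^ m) / B n ^ j)"
      using B by (simp add: sum_distrib_left mult.commute)
    also have "\<dots> \<le> (\<Sum>j = Suc r..m - 2. L / B n ^ Suc r)"
    proof (intro sum_mono frac_le p)
      fix j assume "j \<in> {Suc r..m - 2}"
      thus "B n ^ Suc r \<le> B n ^ j" using B by (intro power_increasing) auto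
    qed (use L B in auto)
    also have "\<dots> = real (m - 2 - r) * (L / B n ^ Suc r)" by simp
    also have "\<dots> \<le> real m * (L / B n ^ Suc r)" using L B by (intro mult_right_mono) auto
    finally have rest: "(1 + \<bar>x\<bar>) ^ m * \<bar>\<Sum>j = Suc r..m - 2. p j / B n ^ j\<bar> \<le> real m * L / B n ^ Suc r" by simp
    have "error r n x \<le> error (m - 2) n x + \<bar>\<Sum>j = Suc r..m - 2. p j / B n ^ j\<bar>"
      unfolding error_def diff[symmetric] by linarith
    hence "(1 + \<bar>x\<bar>) ^ m * error r n x \<le> (1 + \<bar>x\<bar>) ^ m * (error (m - 2) n x + \<bar>\<Sum>j = Suc r..m - 2. p j / B n ^ j\<bar>)"
      by (intro mult_left_mono) auto
    also have "\<dots> \<le> (1 + \<bar>x\<bar>) ^ m * error (m - 2) n x + real m * L / B n ^ Suc r"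
      using rest by (simp only: distrib_left add_left_mono)
    finally show "(1 + \<bar>x\<bar>) ^ m * error r n x \<le> (1 + \<bar>x\<bar>) ^ m * error (m - 2) n x + real m * L / B n ^ Suc r" .
  qed
qed

lemma error_small:
  assumes ic: "integrability_condition m m M S" "integrability_condition 0 m M S"
    and sd: "filterlim sd at_top sequentially" and \<eta>: "0 < \<eta>" and r: "r \<le> m - 2"
  shows "\<forall>\<^sub>F n in sequentially. \<forall>x. (1 + \<bar>x\<bar>) ^ m * error r n x * B n ^ r \<le> \<eta>"
proof -
  obtain K where K: "0 < K" and le: "\<And>n r x. 1 \<le> B n \<Longrightarrow> r \<le> m - 2 \<Longrightarrow>
    (1 + \<bar>x\<bar>) ^ m * error r n x \<le> (1 + \<bar>x\<bar>) ^ m * error (m - 2) n x + K / B n ^ Suc r"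
    using error_le_top_error by metis
  \<comment> \<open>Half of \<open>\<eta>\<close> is for the top error, with
    \<open>2 ^ (m - 2)\<close> from \<open>B n \<le> 2 * sd n\<close>; the other half is for
    \<open>K / B n\<close>.\<close>
  define \<theta> where "\<theta> = \<eta> / 2 / 2 ^ (m - 2)"
  have \<theta>: "0 < \<theta>" using \<eta> by (simp add: \<theta>_def)
  show ?thesis
    using top_error_small[OF ic sd \<theta>]
      filterlim_at_top[THEN iffD1, OF sd, rule_format, of "32 * b + 1 + b + 1 + 2 * K / \<eta>"]
  proof eventually_elim
    case (elim n)
    have p: "0 \<le> 2 * K / \<eta>" using K \<eta> by simp
    have large: "large n" using elim(2) p a_b_nonneg unfolding large_def by linarith
    have sd1: "1 \<le> sd n" by (rule large_bounds(1)[OF large])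
    have B: "1 \<le> B n" "2 * K / \<eta> \<le> B n" using elim(2) p a_b_nonneg B_bound[of n] by linarith+
    have B2: "B n \<le> 2 * sd n" using large_bounds(4)[OF large] sd1 B(1) by (simp add: pos_divide_le_eq)
    have "B n ^ r \<le> B n ^ (m - 2)" using B r by (intro power_increasing) auto
    also have "\<dots> \<le> (2 * sd n) ^ (m - 2)" using B B2 by (intro power_mono) auto
    finally have Br: "B n ^ r \<le> 2 ^ (m - 2) * sd n ^ (m - 2)" by (simp only: power_mult_distrib)
    show ?case
    proof
      fix x
      have "(1 + \<bar>x\<bar>) ^ m * error r n x \<le> \<theta> / sd n ^ (m - 2) + K / B n ^ Suc r"
        using le[OF B(1) r, of x] elim(1)[rule_format, of x] by linarith
      hence "(1 + \<bar>x\<bar>) ^ m * error r n x * B n ^ r \<le> (\<theta> / sd n ^ (m - 2) + K / B n ^ Suc r) * B n ^ r"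
        using B by (intro mult_right_mono) auto
      also have "\<dots> = \<theta> / sd n ^ (m - 2) * B n ^ r + K / B n" using B by (simp add: distrib_right)
      also have "\<dots> \<le> \<theta> / sd n ^ (m - 2) * (2 ^ (m - 2) * sd n ^ (m - 2)) + \<eta> / 2"
      proof (intro add_mono mult_left_mono Br)
        show "K / B n \<le> \<eta> / 2" using B \<eta> by (simp add: field_simps)
      qed (use \<theta> sd1 in auto)
      also have "\<dots> = \<eta>" using sd1 by (simp add: \<theta>_def)
      finally show "(1 + \<bar>x\<bar>) ^ m * error r n x * B n ^ r \<le> \<eta>" .
    qed
  qed
qed

section \<open>Error constants for every index and the resulting estimates\<close>

definition normalized_law :: "nat \<Rightarrow> real measure" where
  "normalized_law n = distr M borel (\<lambda>\<omega>. (S n \<omega> - A n) / B n)"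

lemma real_distribution_normalized_law: "real_distribution (normalized_law n)"
  unfolding normalized_law_def by (intro real_distribution_distr) measurable

lemma normalized_law_cdf: "measure (normalized_law n) {..x} = measure M {\<omega> \<in> space M. (S n \<omega> - A n) / B n \<le> x}"
  unfolding normalized_law_def by (subst measure_distr) (auto simp: vimage_def Int_def conj_commute)

lemma moment_normalized_law:
  assumes "0 < B n"
  shows "integrable (normalized_law n) (\<lambda>x. (1 + \<bar>x\<bar>) ^ m)"
proof -
  define c where "c = 1 + (a + 1) / B n"
  have c: "1 \<le> c" using assms a_b_nonneg by (simp add: c_def)
  have "integrable M (\<lambda>\<omega>. (1 + \<bar>(S n \<omega> - A n) / B n\<bar>) ^ m)"
  proof (rule Bochner_Integration.integrable_bound)
    show "integrable M (\<lambda>\<omega>. (2 * c) ^ m * (1 + \<bar>S n \<omega>\<bar> ^ m))"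
      by (intro integrable_mult_right Bochner_Integration.integrable_add moment_integrable) simp
    show "AE \<omega> in M. norm ((1 + \<bar>(S n \<omega> - A n) / B n\<bar>) ^ m) \<le> norm ((2 * c) ^ m * (1 + \<bar>S n \<omega>\<bar> ^ m))"
    proof (rule AE_I2)
      fix \<omega>
      have "\<bar>(S n \<omega> - A n) / B n\<bar> \<le> (\<bar>S n \<omega>\<bar> + a) / B n"
        unfolding abs_divide using assms A_bound[of n] by (intro frac_le) auto
      also have "\<dots> \<le> ((a + 1) * (1 + \<bar>S n \<omega>\<bar>)) / B n"
        using assms a_b_nonneg by (intro divide_right_mono) (auto simp: distrib_left distrib_right)
      finally have "1 + \<bar>(S n \<omega> - A n) / B n\<bar> \<le> c * (1 + \<bar>S n \<omega>\<bar>)"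
        by (simp add: c_def distrib_left distrib_right add_divide_distrib)
      also have "\<dots> \<le> c * (2 * max 1 \<bar>S n \<omega>\<bar>)" using c by (intro mult_left_mono) auto
      finally have "(1 + \<bar>(S n \<omega> - A n) / B n\<bar>) ^ m \<le> (2 * c * max 1 \<bar>S n \<omega>\<bar>) ^ m"
        by (intro power_mono) auto
      also have "\<dots> = (2 * c) ^ m * max 1 \<bar>S n \<omega>\<bar> ^ m" by (simp only: power_mult_distrib)
      also have "\<dots> \<le> (2 * c) ^ m * (1 + \<bar>S n \<omega>\<bar> ^ m)" using c by (intro mult_left_mono) (auto simp: max_def)
      finally show "norm ((1 + \<bar>(S n \<omega> - A n) / B n\<bar>) ^ m) \<le> norm ((2 * c) ^ m * (1 + \<bar>S n \<omega>\<bar> ^ m))"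
        using c by simp
    qed
  qed measurable
  thus ?thesis unfolding normalized_law_def by (subst integrable_distr_eq) auto
qed

text \<open>A supremum instead of an eventual bound yields inequalities for every \<open>n\<close>
  with \<open>0 < B n\<close>.\<close>

definition error_sup :: "nat \<Rightarrow> nat \<Rightarrow> real" where
  "error_sup r n = (SUP x. (1 + \<bar>x\<bar>) ^ m * error r n x * B n ^ r)"

text \<open>The sum over \<open>r\<close> is a single sequence valid for all lengths of the
  expansion. Where \<open>B n\<close> is not positive the value 0 is a default, as no estimate is
  claimed there.\<close>

definition error_const :: "nat \<Rightarrow> real" where
  "error_const n = (if 0 < B n then \<Sum>r = 1..m - 2. error_sup r n else 0)"

lemma error_nonneg: "0 \<le> error r n x"
  by (simp add: error_def)

lemma error_le_sup:
  assumes B: "0 < B n"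
  shows "(1 + \<bar>x\<bar>) ^ m * error r n x * B n ^ r \<le> error_sup r n"
  unfolding error_sup_def
proof (rule cSUP_upper)
  interpret l: real_distribution "normalized_law n" by (rule real_distribution_normalized_law)
  \<comment> \<open>For fixed \<open>n\<close> finiteness comes from Markov's inequality with the
    moment of order \<open>m\<close>.\<close>
  obtain c where c: "\<And>x. (1 + \<bar>x\<bar>) ^ m * error r n x \<le> c"
    using l.edgeworth_error_bounded[OF moment_normalized_law[OF B], of r "B n" "\<lambda>j. edgeworth_poly j n"] m_ge_3
    unfolding normalized_law_cdf error_def by auto
  show "bdd_above (range (\<lambda>x. (1 + \<bar>x\<bar>) ^ m * error r n x * B n ^ r))"
    using B c by (intro bdd_aboveI[where M = "c * B n ^ r"]) (auto intro!: mult_right_mono)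
qed simp

lemma error_sup_nonneg: "0 < B n \<Longrightarrow> 0 \<le> error_sup r n"
  by (rule order_trans[OF _ error_le_sup[where x = 0]]) (auto intro!: mult_nonneg_nonneg error_nonneg)

lemma error_const_nonneg: "0 \<le> error_const n"
  by (simp add: error_const_def sum_nonneg error_sup_nonneg)

lemma error_le:
  assumes B: "0 < B n" and r: "r \<in> {1..m - 2}"
  shows "error r n x \<le> error_const n / B n ^ r / (1 + \<bar>x\<bar>) ^ m"
proof -
  have "error_sup r n \<le> error_const n"
    unfolding error_const_def using B r error_sup_nonneg by (auto intro!: member_le_sum)
  hence "(1 + \<bar>x\<bar>) ^ m * error r n x * B n ^ r \<le> error_const n" using error_le_sup[OF B, of x r] by linarith
  thus ?thesis using B by (simp add: pos_le_divide_eq mult_ac add_pos_nonneg)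
qed

lemma error_const_tendsto_0:
  assumes ic: "integrability_condition m m M S" "integrability_condition 0 m M S"
    and sd: "filterlim sd at_top sequentially"
  shows "error_const \<longlonglongrightarrow> 0"
proof -
  have B: "\<forall>\<^sub>F n in sequentially. 0 < B n"
    using filterlim_at_top[THEN iffD1, OF sd, rule_format, of "32 * b + 1"]
    by eventually_elim (auto simp: large_def intro: large_bounds(2))
  have "error_sup r \<longlonglongrightarrow> 0" if r: "r \<in> {1..m - 2}" for r
  proof (rule tendstoI)
    fix e :: real assume e: "0 < e"
    have r': "r \<le> m - 2" using r by simp
    show "\<forall>\<^sub>F n in sequentially. dist (error_sup r n) 0 < e"
      using error_small[OF ic sd half_gt_zero[OF e] r'] B
    proof eventually_elim
      case (elim n)
      have "error_sup r n \<le> e / 2" unfolding error_sup_def using elim(1) by (intro cSUP_least) auto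
      thus ?case using error_sup_nonneg[OF elim(2), of r] e by (simp add: dist_real_def)
    qed
  qed
  hence "(\<lambda>n. \<Sum>r = 1..m - 2. error_sup r n) \<longlonglongrightarrow> (\<Sum>r = 1..m - 2. 0)" by (intro tendsto_sum)
  moreover have "\<forall>\<^sub>F n in sequentially. (\<Sum>r = 1..m - 2. error_sup r n) = error_const n"
    using B by eventually_elim (simp add: error_const_def)
  ultimately show ?thesis by (simp add: tendsto_cong)
qed

text \<open>The coefficients of \<open>edgeworth_poly\<close> as functions of free parameters. The
  sign is written as a factor to fit the closure rules of \<open>polynomial_fun\<close>.\<close>

definition coeff_fun :: "nat \<Rightarrow> nat \<Rightarrow> (parameter \<Rightarrow> complex) \<Rightarrow> complex" where
  "coeff_fun j i v = - 1 * (\<Sum>k<symbol_degree. coeff (coeff (exp_phase m v) j) (Suc k) * of_real (coeff (hermite k) i))"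

lemma polynomial_fun_coeff: "polynomial_fun (parameters m) (coeff_fun j i)"
proof -
  have "polynomial_fun (parameters m) (\<lambda>v. - 1 * (\<Sum>k<symbol_degree. coeff (coeff (exp_phase m v) j) (Suc k) * of_real (coeff (hermite k) i)))"
    using real_poly_family_exp_phase[of m] unfolding real_poly_family_def
    by (intro polynomial_fun.mult polynomial_fun.const polynomial_fun_sum) auto
  thus ?thesis unfolding coeff_fun_def[abs_def] .
qed

lemma coeff_edgeworth_poly: "of_real (coeff (edgeworth_poly j n) i) = coeff_fun j i (params n)"
proof -
  have "complex_of_real (coeff (edgeworth_poly j n) i)
      = - (\<Sum>k<symbol_degree. of_real (Re (coeff (symbol_coeff j n) (Suc k))) * of_real (coeff (hermite k) i))"
    unfolding edgeworth_poly_def coeff_minus coeff_sum coeff_smult by simp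
  thus ?thesis unfolding symbol_coeff_real unfolding coeff_fun_def symbol_coeff_def by simp
qed

lemma expectation_admissible:
  assumes B: "0 < B n" and r: "r \<in> {1..m - 2}" and h: "admissible_test_function m h"
  shows "integrable M (\<lambda>\<omega>. h ((S n \<omega> - A n) / B n))"
    "integrable_wrt (edgeworth r (B n) (\<lambda>j. edgeworth_poly j n)) h"
    "\<bar>(LINT \<omega>|M. h ((S n \<omega> - A n) / B n)) - integral_wrt (edgeworth r (B n) (\<lambda>j. edgeworth_poly j n)) h\<bar>
       \<le> error_const n * weighted_variation m h / B n ^ r"
proof -
  interpret l: real_distribution "normalized_law n" by (rule real_distribution_normalized_law)
  have bound: "\<bar>measure (normalized_law n) {..x} - edgeworth r (B n) (\<lambda>j. edgeworth_poly j n) x\<bar> \<le> error_const n / B n ^ r / (1 + \<bar>x\<bar>) ^ m" for x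
    using error_le[OF B r] unfolding normalized_law_cdf error_def .
  have FTC: "set_integrable lborel {u..v} (deriv h) \<and> h v - h u = (LINT x:{u..v}|lborel. deriv h x)" if "u \<le> v" for u v
    using h that unfolding admissible_test_function_def by blast
  have int: "integrable lborel (\<lambda>x. \<bar>deriv h x\<bar> / (1 + \<bar>x\<bar>) ^ m)" using h unfolding admissible_test_function_def by blast
  have m1: "1 \<le> m" using m_ge_3 by simp
  note E = l.expectation_edgeworth[OF moment_normalized_law[OF B] m1 bound admissible_deriv_measurable[OF h] FTC int]
  have int_law: "integrable (normalized_law n) h" by (rule E(1))
  have [measurable]: "h \<in> borel_measurable borel"
    using borel_measurable_integrable[OF int_law] by (simp add: normalized_law_def)
  show "integrable M (\<lambda>\<omega>. h ((S n \<omega> - A n) / B n))"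
    using int_law unfolding normalized_law_def by (subst (asm) integrable_distr_eq) auto
  show "integrable_wrt (edgeworth r (B n) (\<lambda>j. edgeworth_poly j n)) h" by (rule E(2))
  have "(LINT x|normalized_law n. h x) = (LINT \<omega>|M. h ((S n \<omega> - A n) / B n))"
    unfolding normalized_law_def by (subst integral_distr) auto
  thus "\<bar>(LINT \<omega>|M. h ((S n \<omega> - A n) / B n)) - integral_wrt (edgeworth r (B n) (\<lambda>j. edgeworth_poly j n)) h\<bar>
       \<le> error_const n * weighted_variation m h / B n ^ r"
    using E(3) unfolding weighted_variation_def by simp
qed

lemma expectation_moment:
  assumes B: "0 < B n" and r: "r \<in> {1..m - 2}" and q: "q < m" and h: "h = (\<lambda>x. x ^ q) \<or> h = (\<lambda>x. \<bar>x\<bar> ^ q)"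
  shows "integrable M (\<lambda>\<omega>. h ((S n \<omega> - A n) / B n))"
    "integrable_wrt (edgeworth r (B n) (\<lambda>j. edgeworth_poly j n)) h"
    "\<bar>(LINT \<omega>|M. h ((S n \<omega> - A n) / B n)) - integral_wrt (edgeworth r (B n) (\<lambda>j. edgeworth_poly j n)) h\<bar>
       \<le> moment_constant m * error_const n / B n ^ r"
proof -
  interpret l: real_distribution "normalized_law n" by (rule real_distribution_normalized_law)
  have bound: "\<bar>measure (normalized_law n) {..x} - edgeworth r (B n) (\<lambda>j. edgeworth_poly j n) x\<bar> \<le> error_const n / B n ^ r / (1 + \<bar>x\<bar>) ^ m" for x
    using error_le[OF B r] unfolding normalized_law_cdf error_def .
  have m1: "1 \<le> m" using m_ge_3 by simp
  have D: "0 \<le> error_const n / B n ^ r" using error_const_nonneg B by simp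
  have [measurable]: "h \<in> borel_measurable borel" using h by auto
  note E = l.moment_edgeworth[OF moment_normalized_law[OF B] m1 q bound D h]
  show "integrable M (\<lambda>\<omega>. h ((S n \<omega> - A n) / B n))"
    using E(1) unfolding normalized_law_def by (subst (asm) integrable_distr_eq) auto
  show "integrable_wrt (edgeworth r (B n) (\<lambda>j. edgeworth_poly j n)) h" by (rule E(2))
  have "(LINT x|normalized_law n. h x) = (LINT \<omega>|M. h ((S n \<omega> - A n) / B n))"
    unfolding normalized_law_def by (subst integral_distr) auto
  thus "\<bar>(LINT \<omega>|M. h ((S n \<omega> - A n) / B n)) - integral_wrt (edgeworth r (B n) (\<lambda>j. edgeworth_poly j n)) h\<bar>
       \<le> moment_constant m * error_const n / B n ^ r"
    using E(3) by (simp add: mult.commute)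
qed

end

theorem corollary11:
  fixes m :: nat
  assumes "3 \<le> m"
  shows "\<exists>R :: real. \<forall>(M :: 'a measure) (S :: nat \<Rightarrow> 'a \<Rightarrow> real) (A :: nat \<Rightarrow> real) (B :: nat \<Rightarrow> real).
    prob_space M \<and>
    (\<forall>n. S n \<in> borel_measurable M) \<and>
    (\<forall>n. integrable M (\<lambda>\<omega>. (S n \<omega>)\<^sup>2)) \<and>
    (\<forall>n. (LINT \<omega>|M. S n \<omega>) = 0) \<and>
    filterlim (\<lambda>n. L2_norm M (S n)) at_top sequentially \<and>
    bounded (range A) \<and>
    (\<lambda>n. B n - L2_norm M (S n)) \<in> O(\<lambda>_. 1) \<and>
    growth_condition m M S \<and>
    integrability_condition m m M S \<and>
    integrability_condition 0 m M S
    \<longrightarrow>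
    (\<exists>(H :: nat \<Rightarrow> nat \<Rightarrow> real poly) (d :: nat \<Rightarrow> nat)
      (P :: nat \<Rightarrow> nat \<Rightarrow> (parameter \<Rightarrow> complex) \<Rightarrow> complex) (C :: nat \<Rightarrow> real).
      (\<forall>j\<in>{1..m - 2}.
        (\<forall>n. degree (H j n) \<le> d j) \<and>
        (\<forall>i. bounded (range (\<lambda>n. coeff (H j n) i))) \<and>
        (\<forall>i. polynomial_fun (parameters m) (P j i)) \<and>
        (\<forall>i n. complex_of_real (coeff (H j n) i) =
               P j i (parameter_value M (S n) (A n) (B n)))) \<and>
      C \<longlonglongrightarrow> 0 \<and>
      (\<forall>r\<in>{1..m - 2}. \<forall>n. 0 < B n \<longrightarrow>
        (let W = (\<lambda>\<omega>. (S n \<omega> - A n) / B n);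
             F = (\<lambda>x. measure M {\<omega> \<in> space M. W \<omega> \<le> x});
             \<Psi> = edgeworth r (B n) (\<lambda>j. H j n)
         in (\<forall>x. \<bar>F x - \<Psi> x\<bar> \<le> C n / B n ^ r / (1 + \<bar>x\<bar>) ^ m) \<and>
            (\<forall>h. admissible_test_function m h \<longrightarrow>
               integrable M (\<lambda>\<omega>. h (W \<omega>)) \<and> integrable_wrt \<Psi> h \<and>
               \<bar>(LINT \<omega>|M. h (W \<omega>)) - integral_wrt \<Psi> h\<bar>
                 \<le> C n * weighted_variation m h / B n ^ r) \<and>
            (\<forall>q<m.
               integrable M (\<lambda>\<omega>. W \<omega> ^ q) \<and> integrable_wrt \<Psi> (\<lambda>x. x ^ q) \<and>
               \<bar>(LINT \<omega>|M. W \<omega> ^ q) - integral_wrt \<Psi> (\<lambda>x. x ^ q)\<bar> \<le> R * C n / B n ^ r) \<and>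
            (\<forall>q<m.
               integrable M (\<lambda>\<omega>. \<bar>W \<omega>\<bar> ^ q) \<and> integrable_wrt \<Psi> (\<lambda>x. \<bar>x\<bar> ^ q) \<and>
               \<bar>(LINT \<omega>|M. \<bar>W \<omega>\<bar> ^ q) - integral_wrt \<Psi> (\<lambda>x. \<bar>x\<bar> ^ q)\<bar> \<le> R * C n / B n ^ r))))"
proof (intro exI[of _ "moment_constant m"] allI impI)
  fix M :: "'a measure" and S :: "nat \<Rightarrow> 'a \<Rightarrow> real" and A B :: "nat \<Rightarrow> real"
  assume asm: "prob_space M \<and>
    (\<forall>n. S n \<in> borel_measurable M) \<and>
    (\<forall>n. integrable M (\<lambda>\<omega>. (S n \<omega>)\<^sup>2)) \<and>
    (\<forall>n. (LINT \<omega>|M. S n \<omega>) = 0) \<and>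
    filterlim (\<lambda>n. L2_norm M (S n)) at_top sequentially \<and>
    bounded (range A) \<and>
    (\<lambda>n. B n - L2_norm M (S n)) \<in> O(\<lambda>_. 1) \<and>
    growth_condition m M S \<and>
    integrability_condition m m M S \<and>
    integrability_condition 0 m M S"
  interpret prob_space M using asm by blast
  interpret s: standardized_sequence M S m
    by unfold_locales (use assms asm in auto)
  obtain a where a: "\<And>n. \<bar>A n\<bar> \<le> a" using asm by (auto simp: bounded_iff)
  \<comment> \<open>The Landau bound holds only eventually, but an eventually bounded sequence is
    bounded, which yields one \<open>b\<close> for all \<open>n\<close>.\<close>
  have "(\<lambda>n. B n - L2_norm M (S n)) \<in> O(\<lambda>_. 1)" using asm by blast
  then obtain c where "\<forall>\<^sub>F n in sequentially. norm (B n - L2_norm M (S n)) \<le> c"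
    by (auto elim!: landau_o.bigE)
  hence "Bseq (\<lambda>n. B n - L2_norm M (S n))" by (rule BfunI)
  then obtain b where "\<forall>n. norm (B n - L2_norm M (S n)) \<le> b" using BseqD by blast
  hence b: "\<bar>B n - L2_norm M (S n)\<bar> \<le> b" for n by simp
  interpret e: edgeworth_setting M S m A B a b
    by unfold_locales (use a b in \<open>simp_all add: s.sd_def\<close>)
  have sd: "filterlim s.sd at_top sequentially" using asm unfolding s.sd_def[abs_def] by blast
  obtain K where K: "\<And>j n. degree (e.edgeworth_poly j n) \<le> e.symbol_degree" "\<And>j n i. \<bar>coeff (e.edgeworth_poly j n) i\<bar> \<le> K"
    using e.edgeworth_poly_bounded by metis
  show "\<exists>(H :: nat \<Rightarrow> nat \<Rightarrow> real poly) (d :: nat \<Rightarrow> nat)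
      (P :: nat \<Rightarrow> nat \<Rightarrow> (parameter \<Rightarrow> complex) \<Rightarrow> complex) (C :: nat \<Rightarrow> real).
      (\<forall>j\<in>{1..m - 2}.
        (\<forall>n. degree (H j n) \<le> d j) \<and>
        (\<forall>i. bounded (range (\<lambda>n. coeff (H j n) i))) \<and>
        (\<forall>i. polynomial_fun (parameters m) (P j i)) \<and>
        (\<forall>i n. complex_of_real (coeff (H j n) i) =
               P j i (parameter_value M (S n) (A n) (B n)))) \<and>
      C \<longlonglongrightarrow> 0 \<and>
      (\<forall>r\<in>{1..m - 2}. \<forall>n. 0 < B n \<longrightarrow>
        (let W = (\<lambda>\<omega>. (S n \<omega> - A n) / B n);
             F = (\<lambda>x. measure M {\<omega> \<in> space M. W \<omega> \<le> x});
             \<Psi> = edgeworth r (B n) (\<lambda>j. H j n)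
         in (\<forall>x. \<bar>F x - \<Psi> x\<bar> \<le> C n / B n ^ r / (1 + \<bar>x\<bar>) ^ m) \<and>
            (\<forall>h. admissible_test_function m h \<longrightarrow>
               integrable M (\<lambda>\<omega>. h (W \<omega>)) \<and> integrable_wrt \<Psi> h \<and>
               \<bar>(LINT \<omega>|M. h (W \<omega>)) - integral_wrt \<Psi> h\<bar>
                 \<le> C n * weighted_variation m h / B n ^ r) \<and>
            (\<forall>q<m.
               integrable M (\<lambda>\<omega>. W \<omega> ^ q) \<and> integrable_wrt \<Psi> (\<lambda>x. x ^ q) \<and>
               \<bar>(LINT \<omega>|M. W \<omega> ^ q) - integral_wrt \<Psi> (\<lambda>x. x ^ q)\<bar> \<le> moment_constant m * C n / B n ^ r) \<and>
            (\<forall>q<m.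
               integrable M (\<lambda>\<omega>. \<bar>W \<omega>\<bar> ^ q) \<and> integrable_wrt \<Psi> (\<lambda>x. \<bar>x\<bar> ^ q) \<and>
               \<bar>(LINT \<omega>|M. \<bar>W \<omega>\<bar> ^ q) - integral_wrt \<Psi> (\<lambda>x. \<bar>x\<bar> ^ q)\<bar> \<le> moment_constant m * C n / B n ^ r)))"
    unfolding Let_def
  \<comment> \<open>One degree bound serves all \<open>j\<close>, and one error sequence serves all
    \<open>r\<close>, all test functions and all powers.\<close>
  proof (rule exI[of _ e.edgeworth_poly], rule exI[of _ "\<lambda>_. e.symbol_degree"], rule exI[of _ e.coeff_fun],
      rule exI[of _ e.error_const], intro conjI ballI allI impI)
    show "e.error_const \<longlonglongrightarrow> 0" using asm sd by (intro e.error_const_tendsto_0) auto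
    fix j n i
    show "degree (e.edgeworth_poly j n) \<le> e.symbol_degree" by (rule K(1))
    show "bounded (range (\<lambda>n. coeff (e.edgeworth_poly j n) i))" using K(2) by (auto simp: bounded_iff)
    show "polynomial_fun (parameters m) (e.coeff_fun j i)" by (rule e.polynomial_fun_coeff)
    show "complex_of_real (coeff (e.edgeworth_poly j n) i) = e.coeff_fun j i (parameter_value M (S n) (A n) (B n))"
      using e.coeff_edgeworth_poly unfolding e.params_def .
  next
    fix r n x
    assume r: "r \<in> {1..m - 2}" and B: "0 < B n"
    show "\<bar>measure M {\<omega> \<in> space M. (S n \<omega> - A n) / B n \<le> x} - edgeworth r (B n) (\<lambda>j. e.edgeworth_poly j n) x\<bar>
        \<le> e.error_const n / B n ^ r / (1 + \<bar>x\<bar>) ^ m"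
      using e.error_le[OF B r] unfolding e.error_def .
    fix h assume "admissible_test_function m h"
    note E = e.expectation_admissible[OF B r this]
    show "integrable M (\<lambda>\<omega>. h ((S n \<omega> - A n) / B n))"
      "integrable_wrt (edgeworth r (B n) (\<lambda>j. e.edgeworth_poly j n)) h"
      "\<bar>(LINT \<omega>|M. h ((S n \<omega> - A n) / B n)) - integral_wrt (edgeworth r (B n) (\<lambda>j. e.edgeworth_poly j n)) h\<bar>
         \<le> e.error_const n * weighted_variation m h / B n ^ r"
      by (fact E)+
  next
    fix r n q
    assume r: "r \<in> {1..m - 2}" and B: "0 < B n" and q: "q < m"
    note E = e.expectation_moment[OF B r q disjI1[OF refl]]
    note E' = e.expectation_moment[OF B r q disjI2[OF refl]]
    show "integrable M (\<lambda>\<omega>. ((S n \<omega> - A n) / B n) ^ q)"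
      "integrable_wrt (edgeworth r (B n) (\<lambda>j. e.edgeworth_poly j n)) (\<lambda>x. x ^ q)"
      "\<bar>(LINT \<omega>|M. ((S n \<omega> - A n) / B n) ^ q) - integral_wrt (edgeworth r (B n) (\<lambda>j. e.edgeworth_poly j n)) (\<lambda>x. x ^ q)\<bar>
         \<le> moment_constant m * e.error_const n / B n ^ r"
      by (fact E)+
    show "integrable M (\<lambda>\<omega>. \<bar>(S n \<omega> - A n) / B n\<bar> ^ q)"
      "integrable_wrt (edgeworth r (B n) (\<lambda>j. e.edgeworth_poly j n)) (\<lambda>x. \<bar>x\<bar> ^ q)"
      "\<bar>(LINT \<omega>|M. \<bar>(S n \<omega> - A n) / B n\<bar> ^ q) - integral_wrt (edgeworth r (B n) (\<lambda>j. e.edgeworth_poly j n)) (\<lambda>x. \<bar>x\<bar> ^ q)\<bar>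
         \<le> moment_constant m * e.error_const n / B n ^ r"
      by (fact E')+
  qed
qed

end
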